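(* Let $k$ be a perfect field. Any infinite-dimensional chain coalgebra over $k$ is isomorphic to a cotensor coalgebra $\mathcal{DC}(D,\alpha)$, where $D$ is a finite-dimensional division algebra over $k$ and $\alpha\in\mathrm{Aut}_k(D)$.
   Context: Coalgebras are coassociative and counital over $k$. A chain coalgebra is a coalgebra whose right coideals (right subcomodules of itself) are linearly ordered by inclusion (equivalently, whose left coideals are). $\mathrm{Aut}_k(D)$ is the group of $k$-linear algebra automorphisms of $D$. For $\alpha\in\mathrm{Aut}_k(D)$, $D_\alpha$ is the $D$-bimodule with underlying space $D$ and actions $a\rhd x=ax$, $x\lhd b=x\alpha(b)$. $D^*=\mathrm{Hom}_k(D,k)$ is the dual coalgebra of $D$, and $(D_\alpha)^*$ is a $D^*$-bicomodule by dualizing the two actions. Then $\mathcal{DC}(D,\alpha):=T_{D^*}((D_\alpha)^* )$, where for a coalgebra $C$ and a $C$-bicomodule $N$ with left coaction $\rho^l$ and right coaction $\rho^r$, the cotensor product $N\Box_C N$ is the kernel of $\rho^r\otimes \mathrm{id}-\mathrm{id}\otimes\rho^l: N\otimes N\to N\otimes C\otimes N$ (similarly for iterated ones), and the cotensor coalgebra is $T_C(N)=\bigoplus_{n\ge 0}N^{\Box_C n}$ with $N^{\Box_C 0}=C$, $N^{\Box_C 1}=N$, and $N^{\Box_C n}$ the $n$-fold cotensor product. Its comultiplication is $\Delta_C$ on $C$, $\Delta(m)=\rho^l(m)+\rho^r(m)$ for $m\in N$, and for $n\ge2$ $$\Delta(m_1\Box\cdots\Box m_n)=\sum (m_1)_{-1}\otimes((m_1)_0\Box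 m_2\Box\cdots\Box m_n)+\sum_{i=1}^{n-1}(m_1\Box\cdots\Box m_i)\otimes(m_{i+1}\Box\cdots\Box m_n)+\sum(m_1\Box\cdots\Box m_{n-1}\Box(m_n)_0)\otimes(m_n)_1,$$ where $\rho^l(m_1)=\sum (m_1)_{-1}\otimes(m_1)_0$ and $\rho^r(m_n)=\sum(m_n)_0\otimes(m_n)_1$; its counit is $\varepsilon_C$ on $C$ and $0$ on $N^{\Box_C n}$ for $n\ge1$. *)

theory Defs
  imports
    "HOL-Computational_Algebra.Polynomial_Factorial"
    "HOL-Library.Function_Algebras"
    "HOL-Library.Product_Plus"
begin

section \<open>Fields and vector spaces\<close>

text \<open>A field is perfect if every irreducible polynomial over it is separable.\<close>

definition perfect_field :: "'k::field itself \<Rightarrow> bool" where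
  "perfect_field _ \<longleftrightarrow> (\<forall>p :: 'k poly. irreducible p \<longrightarrow> coprime p (pderiv p))"

text \<open>
  A vector space over the field \<open>'k\<close> is a subspace \<open>vecs V\<close> of an additive group type \<open>'v\<close> that
  carries a scalar multiplication \<open>scal V\<close>.  Explicit carriers are needed because the dimension
  of the algebra \<open>D\<close> is existentially quantified and because the cotensor powers are kernels.
  Maps out of a vector space are only meaningful on its carrier.
\<close>

record ('k, 'v) vspace =
  scal :: "'k \<Rightarrow> 'v \<Rightarrow> 'v"
  vecs :: "'v set"

definition is_vspace :: "('k::field, 'v::ab_group_add, 'm) vspace_scheme \<Rightarrow> bool" where
  "is_vspace V \<longleftrightarrow> vector_space (scal V) \<and> module.subspace (scal V) (vecs V)"

definition finite_dim :: "('k::field, 'v::ab_group_add, 'm) vspace_scheme \<Rightarrow> bool" where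
  "finite_dim V \<longleftrightarrow> (\<exists>B. finite B \<and> module.span (scal V) B = vecs V)"

definition linear_map ::
  "('k::field, 'v::ab_group_add, 'm) vspace_scheme \<Rightarrow> ('k, 'w::ab_group_add, 'n) vspace_scheme
    \<Rightarrow> ('v \<Rightarrow> 'w) \<Rightarrow> bool" where
  "linear_map V W f \<longleftrightarrow>
     (\<forall>x\<in>vecs V. f x \<in> vecs W) \<and>
     (\<forall>x\<in>vecs V. \<forall>y\<in>vecs V. f (x + y) = f x + f y) \<and>
     (\<forall>a. \<forall>x\<in>vecs V. f (scal V a x) = scal W a (f x))"

definition bilinear_map ::
  "('k::field, 'v::ab_group_add, 'm) vspace_scheme \<Rightarrow> ('k, 'w::ab_group_add, 'n) vspace_scheme
    \<Rightarrow> ('k, 'u::ab_group_add, 'o) vspace_scheme \<Rightarrow> ('v \<Rightarrow> 'w \<Rightarrow> 'u) \<Rightarrow> bool" where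
  "bilinear_map V W U f \<longleftrightarrow>
     (\<forall>x\<in>vecs V. linear_map W U (f x)) \<and> (\<forall>y\<in>vecs W. linear_map V U (\<lambda>x. f x y))"

definition ground :: "('k::field, 'k) vspace" where
  "ground = \<lparr>scal = (*), vecs = UNIV\<rparr>"

definition pscale :: "'k::field \<Rightarrow> ('x \<Rightarrow> 'k) \<Rightarrow> ('x \<Rightarrow> 'k)" where
  "pscale a f = (\<lambda>x. a * f x)"

text \<open>
  Functionals on \<open>V\<close> are normalised to vanish outside the carrier of \<open>V\<close>, so that equality of
  functions is equality of functionals.
\<close>

definition dual :: "('k::field, 'v::ab_group_add, 'm) vspace_scheme \<Rightarrow> ('k, 'v \<Rightarrow> 'k) vspace" where
  "dual V = \<lparr>scal = pscale, vecs = {f. linear_map V ground f \<and> (\<forall>x. x \<notin> vecs V \<longrightarrow> f x = 0)}\<rparr>"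


section \<open>Tensor products\<close>

text \<open>
  \<open>V \<otimes> W\<close> is realised as the space of functionals on bilinear forms \<open>V \<times> W \<rightarrow> k\<close> spanned by the
  pure tensors, where \<open>v \<otimes> w\<close> is evaluation at \<open>(v, w)\<close> (and functionals are extended by \<open>0\<close> to
  functions that are not bilinear forms).  Over a field this is a tensor product: see the
  universal property \<open>tensor_universal\<close>, \<open>tensor_universal_unique\<close> below.
\<close>

definition tens ::
  "('k::field, 'v::ab_group_add, 'm) vspace_scheme \<Rightarrow> ('k, 'w::ab_group_add, 'n) vspace_scheme
    \<Rightarrow> 'v \<Rightarrow> 'w \<Rightarrow> ('v \<Rightarrow> 'w \<Rightarrow> 'k) \<Rightarrow> 'k" where
  "tens V W v w = (\<lambda>B. if bilinear_map V W ground B then B v w else 0)"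

definition tensor_span ::
  "('k::field, 'v::ab_group_add, 'm) vspace_scheme \<Rightarrow> ('k, 'w::ab_group_add, 'n) vspace_scheme
    \<Rightarrow> 'v set \<Rightarrow> 'w set \<Rightarrow> (('v \<Rightarrow> 'w \<Rightarrow> 'k) \<Rightarrow> 'k) set" where
  "tensor_span V W S T = module.span pscale {tens V W v w | v w. v \<in> S \<and> w \<in> T}"

definition tensor ::
  "('k::field, 'v::ab_group_add, 'm) vspace_scheme \<Rightarrow> ('k, 'w::ab_group_add, 'n) vspace_scheme
    \<Rightarrow> ('k, ('v \<Rightarrow> 'w \<Rightarrow> 'k) \<Rightarrow> 'k) vspace" where
  "tensor V W = \<lparr>scal = pscale, vecs = tensor_span V W (vecs V) (vecs W)\<rparr>"

text \<open>
  If \<open>h\<close> is a bilinear map on \<open>V \<times> W\<close> with values in another tensor product (so that \<open>h v w\<close> is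
  itself a functional on forms), then \<open>tlift h\<close> is the linear map on \<open>V \<otimes> W\<close> with
  \<open>tlift h (v \<otimes> w) = h v w\<close>.
\<close>

definition tlift ::
  "('v \<Rightarrow> 'w \<Rightarrow> ('b \<Rightarrow> 'k)) \<Rightarrow> (('v \<Rightarrow> 'w \<Rightarrow> 'k) \<Rightarrow> 'k) \<Rightarrow> ('b \<Rightarrow> 'k)" where
  "tlift h t = (\<lambda>B. t (\<lambda>v w. h v w B))"

text \<open>The map \<open>f \<otimes> g\<close> into \<open>V' \<otimes> W'\<close>; the arguments \<open>V'\<close>, \<open>W'\<close> are the codomains of \<open>f\<close>, \<open>g\<close>.\<close>

definition tmap ::
  "('k::field, 'v'::ab_group_add, 'm) vspace_scheme \<Rightarrow> ('k, 'w'::ab_group_add, 'n) vspace_scheme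
    \<Rightarrow> ('v \<Rightarrow> 'v') \<Rightarrow> ('w \<Rightarrow> 'w') \<Rightarrow> (('v \<Rightarrow> 'w \<Rightarrow> 'k) \<Rightarrow> 'k) \<Rightarrow> (('v' \<Rightarrow> 'w' \<Rightarrow> 'k) \<Rightarrow> 'k)" where
  "tmap V' W' f g = tlift (\<lambda>v w. tens V' W' (f v) (g w))"

text \<open>The associator \<open>(V \<otimes> W) \<otimes> U \<rightarrow> V \<otimes> (W \<otimes> U)\<close>.\<close>

definition tassoc ::
  "('k::field, 'v::ab_group_add, 'm) vspace_scheme \<Rightarrow> ('k, 'w::ab_group_add, 'n) vspace_scheme
    \<Rightarrow> ('k, 'u::ab_group_add, 'o) vspace_scheme
    \<Rightarrow> (((('v \<Rightarrow> 'w \<Rightarrow> 'k) \<Rightarrow> 'k) \<Rightarrow> 'u \<Rightarrow> 'k) \<Rightarrow> 'k)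
    \<Rightarrow> (('v \<Rightarrow> (('w \<Rightarrow> 'u \<Rightarrow> 'k) \<Rightarrow> 'k) \<Rightarrow> 'k) \<Rightarrow> 'k)" where
  "tassoc V W U = tlift (\<lambda>s u. tlift (\<lambda>v w. tens V (tensor W U) v (tens W U w u)) s)"

text \<open>
  Tensor powers \<open>N\<^sup>\<otimes>\<^sup>n\<close>, realised in the same way by functionals on \<open>n\<close>-linear forms.  Forms take
  lists of length \<open>n\<close> as arguments, so that all tensor powers of \<open>N\<close> have the same type.
\<close>

definition multilinear_form ::
  "('k::field, 'v::ab_group_add, 'm) vspace_scheme \<Rightarrow> nat \<Rightarrow> ('v list \<Rightarrow> 'k) \<Rightarrow> bool" where
  "multilinear_form N n F \<longleftrightarrow>
     (\<forall>ms i. length ms = n \<and> set ms \<subseteq> vecs N \<and> i < n \<longrightarrow> linear_map N ground (\<lambda>x. F (ms[i := x])))"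

definition word ::
  "('k::field, 'v::ab_group_add, 'm) vspace_scheme \<Rightarrow> nat \<Rightarrow> 'v list \<Rightarrow> ('v list \<Rightarrow> 'k) \<Rightarrow> 'k" where
  "word N n ms = (\<lambda>F. if multilinear_form N n F then F ms else 0)"

definition tpow ::
  "('k::field, 'v::ab_group_add, 'm) vspace_scheme \<Rightarrow> nat \<Rightarrow> ('k, ('v list \<Rightarrow> 'k) \<Rightarrow> 'k) vspace" where
  "tpow N n = \<lparr>scal = pscale,
               vecs = module.span pscale {word N n ms | ms. length ms = n \<and> set ms \<subseteq> vecs N}\<rparr>"

definition wlift :: "('v list \<Rightarrow> ('b \<Rightarrow> 'k)) \<Rightarrow> (('v list \<Rightarrow> 'k) \<Rightarrow> 'k) \<Rightarrow> ('b \<Rightarrow> 'k)" where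
  "wlift h t = (\<lambda>B. t (\<lambda>ms. h ms B))"

subsection \<open>The universal property\<close>

lemma vector_space_pscale: "vector_space (pscale :: 'k::field \<Rightarrow> ('x \<Rightarrow> 'k) \<Rightarrow> _)"
  by unfold_locales (auto simp: pscale_def fun_eq_iff algebra_simps)

lemma vector_space_mult: "vector_space ((*) :: 'k::field \<Rightarrow> 'k \<Rightarrow> 'k)"
  by unfold_locales (auto simp: algebra_simps)

lemma is_vspace_tensor: "is_vspace (tensor V W)"
proof -
  interpret P: vector_space "pscale :: 'a \<Rightarrow> (('b \<Rightarrow> 'c \<Rightarrow> 'a) \<Rightarrow> 'a) \<Rightarrow> _"
    by (rule vector_space_pscale)
  show ?thesis
    by (simp add: is_vspace_def tensor_def tensor_span_def P.vector_space_axioms P.subspace_span)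
qed

lemma bilinear_map_tens: "bilinear_map V W (tensor V W) (tens V W)"
proof -
  interpret P: vector_space "pscale :: 'a \<Rightarrow> (('b \<Rightarrow> 'd \<Rightarrow> 'a) \<Rightarrow> 'a) \<Rightarrow> _"
    by (rule vector_space_pscale)
  have "tens V W v w \<in> vecs (tensor V W)" if "v \<in> vecs V" "w \<in> vecs W" for v w
    using that by (auto simp: tensor_def tensor_span_def intro!: P.span_base)
  then show ?thesis
    by (auto simp: bilinear_map_def linear_map_def tens_def tensor_def pscale_def ground_def
        fun_eq_iff)
qed

lemma evaluation_lift:
  fixes ev :: "'x \<Rightarrow> ('f \<Rightarrow> 'k::field)" and U :: "('k, 'u::ab_group_add, 'm) vspace_scheme"
  assumes U: "is_vspace U" and h: "\<And>x. x \<in> X \<Longrightarrow> h x \<in> vecs U"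
    and ev: "\<And>\<phi> :: 'u \<Rightarrow> 'k. Vector_Spaces.linear (scal U) (*) \<phi> \<Longrightarrow> \<exists>F. \<forall>x\<in>X. ev x F = \<phi> (h x)"
  shows "\<exists>g. linear_map \<lparr>scal = pscale, vecs = module.span pscale (ev ` X)\<rparr> U g \<and>
             (\<forall>x\<in>X. g (ev x) = h x)"
proof -
  interpret P: vector_space "pscale :: 'k \<Rightarrow> ('f \<Rightarrow> 'k) \<Rightarrow> _" by (rule vector_space_pscale)
  interpret U: vector_space "scal U" using U by (simp add: is_vspace_def)
  interpret K: vector_space "(*) :: 'k \<Rightarrow> _" by (rule vector_space_mult)
  interpret PU: vector_space_pair "pscale :: 'k \<Rightarrow> ('f \<Rightarrow> 'k) \<Rightarrow> _" "scal U" by unfold_locales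
  interpret UK: vector_space_pair "scal U" "(*) :: 'k \<Rightarrow> _" by unfold_locales
  have sub: "U.subspace (vecs U)" using U by (simp add: is_vspace_def)
  obtain B where B: "B \<subseteq> ev ` X" "P.independent B" "ev ` X \<subseteq> P.span B"
    by (rule P.basis_exists[of "ev ` X"])
  define r where "r b = (SOME x. x \<in> X \<and> ev x = b)" for b
  have r: "r b \<in> X \<and> ev (r b) = b" if "b \<in> B" for b
    unfolding r_def by (rule someI_ex) (use that B(1) in auto)
  define g where "g = PU.construct B (\<lambda>b. h (r b))"
  have lg: "Vector_Spaces.linear pscale (scal U) g"
    unfolding g_def by (rule PU.linear_construct[OF B(2)])
  interpret g: Vector_Spaces.linear pscale "scal U" g by (rule lg)
  have gB: "g b = h (r b)" if "b \<in> B" for b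
    unfolding g_def by (rule PU.construct_basis[OF B(2) that])
  have span: "P.span (ev ` X) = P.span B"
    using P.span_mono[OF B(1)] P.span_minimal[OF B(3) P.subspace_span] by (rule order_antisym[rotated])
  have key: "g (ev x) = h x" if x: "x \<in> X" for x
  proof (rule ccontr)
    define u where "u = g (ev x) - h x"
    assume "g (ev x) \<noteq> h x"
    then have "u \<noteq> 0" by (simp add: u_def)
    then have ind: "U.independent {u}" by simp
    define \<phi> where "\<phi> = UK.construct {u} (\<lambda>_. 1)"
    have l\<phi>: "Vector_Spaces.linear (scal U) (*) \<phi>"
      unfolding \<phi>_def by (rule UK.linear_construct[OF ind])
    interpret \<phi>: Vector_Spaces.linear "scal U" "(*)" \<phi> by (rule l\<phi>)
    have "\<phi> u = 1" unfolding \<phi>_def by (rule UK.construct_basis[OF ind]) simp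
    obtain F where F: "\<And>x. x \<in> X \<Longrightarrow> ev x F = \<phi> (h x)" using ev[OF l\<phi>] by blast
    have "\<phi> (g t) = t F" if "t \<in> P.span B" for t
      using that
    proof (induction rule: P.span_induct_alt)
      case base
      show ?case using g.zero \<phi>.zero by (simp add: zero_fun_def)
    next
      case (step c b t)
      have "\<phi> (g (pscale c b + t)) = c * \<phi> (g b) + \<phi> (g t)"
        by (simp add: g.add g.scale \<phi>.add \<phi>.scale)
      also have "\<phi> (g b) = b F"
        using F[of "r b"] r[of b] step(1) by (simp add: gB)
      finally show ?case using step(2) by (simp add: pscale_def)
    qed
    then have "\<phi> (g (ev x)) = \<phi> (h x)" using F[OF x] B(3) x by auto
    with \<open>\<phi> u = 1\<close> show False by (simp add: u_def \<phi>.diff)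
  qed
  have "g t \<in> vecs U" if "t \<in> P.span (ev ` X)" for t
    using that
  proof (induction rule: P.span_induct_alt)
    case base
    show ?case using g.zero U.subspace_0[OF sub] by (simp add: zero_fun_def)
  next
    case (step c b t)
    have "g (pscale c b + t) = scal U c (g b) + g t" by (simp only: g.add g.scale)
    moreover have "g b \<in> vecs U" using step(1) key h by auto
    ultimately show ?case
      using step(2) sub by (simp only: U.subspace_add U.subspace_scale)
  qed
  then have "linear_map \<lparr>scal = pscale, vecs = P.span (ev ` X)\<rparr> U g"
    by (simp add: linear_map_def g.add g.scale)
  with key show ?thesis by blast
qed

theorem tensor_universal:
  fixes V :: "('k::field, 'v::ab_group_add, 'm) vspace_scheme"
    and W :: "('k, 'w::ab_group_add, 'n) vspace_scheme"
    and U :: "('k, 'u::ab_group_add, 'o) vspace_scheme"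
  assumes U: "is_vspace U" and h: "bilinear_map V W U h"
  shows "\<exists>g. linear_map (tensor V W) U g \<and> (\<forall>v\<in>vecs V. \<forall>w\<in>vecs W. g (tens V W v w) = h v w)"
proof -
  let ?ev = "\<lambda>(v, w). tens V W v w"
  have "\<exists>F. \<forall>x\<in>vecs V \<times> vecs W. ?ev x F = \<phi> (case x of (v, w) \<Rightarrow> h v w)"
    if "Vector_Spaces.linear (scal U) (*) \<phi>" for \<phi> :: "'u \<Rightarrow> 'k"
  proof -
    interpret \<phi>: Vector_Spaces.linear "scal U" "(*)" \<phi> by (rule that)
    have "bilinear_map V W ground (\<lambda>v w. \<phi> (h v w))"
      using h by (auto simp: bilinear_map_def linear_map_def ground_def \<phi>.add \<phi>.scale)
    then show ?thesis by (intro exI[of _ "\<lambda>v w. \<phi> (h v w)"]) (auto simp: tens_def)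
  qed
  moreover have "(case x of (v, w) \<Rightarrow> h v w) \<in> vecs U" if "x \<in> vecs V \<times> vecs W" for x
    using that h by (auto simp: bilinear_map_def linear_map_def)
  ultimately have "\<exists>g. linear_map \<lparr>scal = pscale,
        vecs = module.span pscale (?ev ` (vecs V \<times> vecs W))\<rparr> U g \<and>
      (\<forall>x\<in>vecs V \<times> vecs W. g (?ev x) = (case x of (v, w) \<Rightarrow> h v w))"
    by (intro evaluation_lift[OF U]) auto
  moreover have "?ev ` (vecs V \<times> vecs W) = {tens V W v w |v w. v \<in> vecs V \<and> w \<in> vecs W}"
    by force
  ultimately show ?thesis by (auto simp: tensor_def tensor_span_def)
qed

theorem tensor_universal_unique:
  fixes V :: "('k::field, 'v::ab_group_add, 'm) vspace_scheme"
    and W :: "('k, 'w::ab_group_add, 'n) vspace_scheme"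
    and U :: "('k, 'u::ab_group_add, 'o) vspace_scheme"
  assumes g: "linear_map (tensor V W) U g" and g': "linear_map (tensor V W) U g'"
    and eq: "\<And>v w. v \<in> vecs V \<Longrightarrow> w \<in> vecs W \<Longrightarrow> g (tens V W v w) = g' (tens V W v w)"
    and t: "t \<in> vecs (tensor V W)"
  shows "g t = g' t"
proof -
  interpret P: vector_space "pscale :: 'k \<Rightarrow> (('v \<Rightarrow> 'w \<Rightarrow> 'k) \<Rightarrow> 'k) \<Rightarrow> _"
    by (rule vector_space_pscale)
  let ?G = "{tens V W v w | v w. v \<in> vecs V \<and> w \<in> vecs W}"
  have lin: "(\<forall>x\<in>P.span ?G. \<forall>y\<in>P.span ?G. f (x + y) = f x + f y) \<and>
             (\<forall>a. \<forall>x\<in>P.span ?G. f (pscale a x) = scal U a (f x))"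
    if "linear_map (tensor V W) U f" for f
    using that by (simp only: linear_map_def tensor_def tensor_span_def vspace.simps) simp
  have zero: "f 0 = 0" if "linear_map (tensor V W) U f" for f
  proof -
    have "f (0 + 0) = f 0 + f 0" using lin[OF that] P.span_zero by blast
    then show ?thesis by (simp only: add_0 add_cancel_right_right)
  qed
  have comb: "f (pscale c b + x) = scal U c (f b) + f x"
    if f: "linear_map (tensor V W) U f" and b: "b \<in> P.span ?G" and x: "x \<in> P.span ?G" for f c b x
  proof -
    have "f (pscale c b + x) = f (pscale c b) + f x"
      using lin[OF f] P.span_scale[OF b] x by blast
    also have "f (pscale c b) = scal U c (f b)"
      using lin[OF f] b by blast
    finally show ?thesis .
  qed
  have "t \<in> P.span ?G" using t by (simp add: tensor_def tensor_span_def)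
  then have "t \<in> P.span ?G \<and> g t = g' t"
  proof (induction rule: P.span_induct_alt)
    case base
    show ?case using zero[OF g] zero[OF g'] P.span_zero by (simp only: simp_thms)
  next
    case (step c b t)
    have b: "b \<in> P.span ?G" using step(1) by (rule P.span_base)
    have gb: "g b = g' b" using step(1) eq by blast
    have t: "t \<in> P.span ?G" "g t = g' t" using step(2) by simp_all
    show ?case
      using comb[OF g b t(1)] comb[OF g' b t(1)] gb t(2) P.span_add[OF P.span_scale[OF b] t(1)]
      by (simp only: simp_thms)
  qed
  then show ?thesis by (rule conjunct2)
qed


section \<open>Coalgebras\<close>

record ('k, 'c) coalgebra = "('k, 'c) vspace" +
  comult :: "'c \<Rightarrow> (('c \<Rightarrow> 'c \<Rightarrow> 'k) \<Rightarrow> 'k)"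
  counit :: "'c \<Rightarrow> 'k"

text \<open>The counit laws are stated through the canonical identifications \<open>k \<otimes> C \<cong> C \<cong> C \<otimes> k\<close>.\<close>

definition is_coalgebra :: "('k::field, 'c::ab_group_add, 'm) coalgebra_scheme \<Rightarrow> bool" where
  "is_coalgebra C \<longleftrightarrow>
     is_vspace C \<and> linear_map C (tensor C C) (comult C) \<and> linear_map C ground (counit C) \<and>
     (\<forall>c\<in>vecs C. tassoc C C C (tmap (tensor C C) C (comult C) id (comult C c)) =
                 tmap C (tensor C C) id (comult C) (comult C c)) \<and>
     (\<forall>c\<in>vecs C. tmap ground C (counit C) id (comult C c) = tens ground C 1 c) \<and>
     (\<forall>c\<in>vecs C. tmap C ground id (counit C) (comult C c) = tens C ground c 1)"

definition right_coideal :: "('k::field, 'c::ab_group_add, 'm) coalgebra_scheme \<Rightarrow> 'c set \<Rightarrow> bool" where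
  "right_coideal C I \<longleftrightarrow>
     module.subspace (scal C) I \<and> I \<subseteq> vecs C \<and>
     (\<forall>c\<in>I. comult C c \<in> tensor_span C C I (vecs C))"

definition chain_coalgebra :: "('k::field, 'c::ab_group_add, 'm) coalgebra_scheme \<Rightarrow> bool" where
  "chain_coalgebra C \<longleftrightarrow>
     is_coalgebra C \<and>
     (\<forall>I J. right_coideal C I \<and> right_coideal C J \<longrightarrow> I \<subseteq> J \<or> J \<subseteq> I)"

definition coalgebra_iso ::
  "('k::field, 'c::ab_group_add, 'm) coalgebra_scheme \<Rightarrow> ('k, 'e::ab_group_add, 'n) coalgebra_scheme
    \<Rightarrow> ('c \<Rightarrow> 'e) \<Rightarrow> bool" where
  "coalgebra_iso C E f \<longleftrightarrow>
     linear_map C E f \<and> bij_betw f (vecs C) (vecs E) \<and>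
     (\<forall>c\<in>vecs C. comult E (f c) = tmap E E f f (comult C c)) \<and>
     (\<forall>c\<in>vecs C. counit E (f c) = counit C c)"

definition coalgebra_isomorphic ::
  "('k::field, 'c::ab_group_add, 'm) coalgebra_scheme \<Rightarrow> ('k, 'e::ab_group_add, 'n) coalgebra_scheme
    \<Rightarrow> bool" where
  "coalgebra_isomorphic C E \<longleftrightarrow> (\<exists>f. coalgebra_iso C E f)"


section \<open>Bicomodules and the cotensor coalgebra\<close>

record ('k, 'c, 'n) bicomodule = "('k, 'n) vspace" +
  lcoact :: "'n \<Rightarrow> (('c \<Rightarrow> 'n \<Rightarrow> 'k) \<Rightarrow> 'k)"
  rcoact :: "'n \<Rightarrow> (('n \<Rightarrow> 'c \<Rightarrow> 'k) \<Rightarrow> 'k)"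

text \<open>
  The left coaction \<open>N\<^sup>\<otimes>\<^sup>n \<rightarrow> C \<otimes> N\<^sup>\<otimes>\<^sup>n\<close> through the first factor, the right coaction
  \<open>N\<^sup>\<otimes>\<^sup>n \<rightarrow> N\<^sup>\<otimes>\<^sup>n \<otimes> C\<close> through the last factor (both for \<open>n \<ge> 1\<close>), and the identification
  \<open>N\<^sup>\<otimes>\<^sup>n \<rightarrow> N\<^sup>\<otimes>\<^sup>i \<otimes> N\<^sup>\<otimes>\<^sup>n\<^sup>-\<^sup>i\<close>.
\<close>

definition lcoact_pow ::
  "('k::field, 'c::ab_group_add, 'l) coalgebra_scheme \<Rightarrow> ('k, 'c, 'n::ab_group_add, 'm) bicomodule_scheme
    \<Rightarrow> nat \<Rightarrow> (('n list \<Rightarrow> 'k) \<Rightarrow> 'k) \<Rightarrow> (('c \<Rightarrow> (('n list \<Rightarrow> 'k) \<Rightarrow> 'k) \<Rightarrow> 'k) \<Rightarrow> 'k)" where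
  "lcoact_pow C N n = wlift (\<lambda>ms.
     tlift (\<lambda>c x. tens C (tpow N n) c (word N n (x # tl ms))) (lcoact N (hd ms)))"

definition rcoact_pow ::
  "('k::field, 'c::ab_group_add, 'l) coalgebra_scheme \<Rightarrow> ('k, 'c, 'n::ab_group_add, 'm) bicomodule_scheme
    \<Rightarrow> nat \<Rightarrow> (('n list \<Rightarrow> 'k) \<Rightarrow> 'k) \<Rightarrow> (((('n list \<Rightarrow> 'k) \<Rightarrow> 'k) \<Rightarrow> 'c \<Rightarrow> 'k) \<Rightarrow> 'k)" where
  "rcoact_pow C N n = wlift (\<lambda>ms.
     tlift (\<lambda>x c. tens (tpow N n) C (word N n (butlast ms @ [x])) c) (rcoact N (last ms)))"

definition tsplit ::
  "('k::field, 'n::ab_group_add, 'm) vspace_scheme \<Rightarrow> nat \<Rightarrow> nat \<Rightarrow> (('n list \<Rightarrow> 'k) \<Rightarrow> 'k)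
    \<Rightarrow> (((('n list \<Rightarrow> 'k) \<Rightarrow> 'k) \<Rightarrow> (('n list \<Rightarrow> 'k) \<Rightarrow> 'k) \<Rightarrow> 'k) \<Rightarrow> 'k)" where
  "tsplit N n i = wlift (\<lambda>ms.
     tens (tpow N i) (tpow N (n - i)) (word N i (take i ms)) (word N (n - i) (drop i ms)))"

text \<open>
  The cotensor power \<open>N \<box> \<dots> \<box> N\<close> with \<open>n \<ge> 1\<close> factors: the common kernel of the maps
  \<open>id \<otimes> (\<rho>\<^sup>r \<otimes> id - id \<otimes> \<rho>\<^sup>l) \<otimes> id\<close> from \<open>N\<^sup>\<otimes>\<^sup>n\<close> to \<open>N\<^sup>\<otimes>\<^sup>i \<otimes> C \<otimes> N\<^sup>\<otimes>\<^sup>n\<^sup>-\<^sup>i\<close>, for \<open>0 < i < n\<close>.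
\<close>

definition cotensor_pow ::
  "('k::field, 'c::ab_group_add, 'l) coalgebra_scheme \<Rightarrow> ('k, 'c, 'n::ab_group_add, 'm) bicomodule_scheme
    \<Rightarrow> nat \<Rightarrow> ('k, ('n list \<Rightarrow> 'k) \<Rightarrow> 'k) vspace" where
  "cotensor_pow C N n = \<lparr>scal = pscale,
     vecs = {t \<in> vecs (tpow N n). \<forall>i. 0 < i \<and> i < n \<longrightarrow>
       tassoc (tpow N i) C (tpow N (n - i))
         (tmap (tensor (tpow N i) C) (tpow N (n - i)) (rcoact_pow C N i) id (tsplit N n i t)) =
       tmap (tpow N i) (tensor C (tpow N (n - i))) id (lcoact_pow C N (n - i)) (tsplit N n i t)}\<rparr>"

text \<open>
  The direct sum of \<open>C\<close> (in degree \<open>0\<close>) and of \<open>P n\<close> over \<open>n \<ge> 1\<close>.  An element is a pair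
  \<open>(c, t)\<close> with \<open>c\<close> its component of degree \<open>0\<close> and \<open>t n\<close> its component of degree \<open>n \<ge> 1\<close>;
  the unused value \<open>t 0\<close> is \<open>0\<close>.
\<close>

definition graded_sum ::
  "('k::field, 'c::ab_group_add, 'l) vspace_scheme \<Rightarrow> (nat \<Rightarrow> ('k, 'p::ab_group_add) vspace)
    \<Rightarrow> ('k, 'c \<times> (nat \<Rightarrow> 'p)) vspace" where
  "graded_sum C P = \<lparr>scal = (\<lambda>a (c, t). (scal C a c, \<lambda>n. scal (P n) a (t n))),
     vecs = {(c, t). c \<in> vecs C \<and> t 0 = 0 \<and> (\<forall>n\<ge>1. t n \<in> vecs (P n)) \<and> finite {n. t n \<noteq> 0}}\<rparr>"

definition in_deg0 :: "'c \<Rightarrow> 'c \<times> (nat \<Rightarrow> 'p::zero)" where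
  "in_deg0 c = (c, \<lambda>_. 0)"

definition in_deg :: "nat \<Rightarrow> 'p \<Rightarrow> 'c::zero \<times> (nat \<Rightarrow> 'p::zero)" where
  "in_deg n u = (0, (\<lambda>_. 0)(n := u))"

text \<open>
  The formula for the comultiplication makes sense on all of \<open>T' = C \<oplus> \<Oplus>\<^sub>n\<^sub>\<ge>\<^sub>1 N\<^sup>\<otimes>\<^sup>n\<close>, with values in
  \<open>T' \<otimes> T'\<close>.
\<close>

definition tensor_sum ::
  "('k::field, 'c::ab_group_add, 'l) coalgebra_scheme \<Rightarrow> ('k, 'c, 'n::ab_group_add, 'm) bicomodule_scheme
    \<Rightarrow> ('k, 'c \<times> (nat \<Rightarrow> (('n list \<Rightarrow> 'k) \<Rightarrow> 'k))) vspace" where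
  "tensor_sum C N = graded_sum C (tpow N)"

definition cotensor_sum ::
  "('k::field, 'c::ab_group_add, 'l) coalgebra_scheme \<Rightarrow> ('k, 'c, 'n::ab_group_add, 'm) bicomodule_scheme
    \<Rightarrow> ('k, 'c \<times> (nat \<Rightarrow> (('n list \<Rightarrow> 'k) \<Rightarrow> 'k))) vspace" where
  "cotensor_sum C N = graded_sum C (cotensor_pow C N)"

definition ambient_comult ::
  "('k::field, 'c::ab_group_add, 'l) coalgebra_scheme \<Rightarrow> ('k, 'c, 'n::ab_group_add, 'm) bicomodule_scheme
    \<Rightarrow> 'c \<times> (nat \<Rightarrow> (('n list \<Rightarrow> 'k) \<Rightarrow> 'k))
    \<Rightarrow> ('c \<times> (nat \<Rightarrow> (('n list \<Rightarrow> 'k) \<Rightarrow> 'k)) \<Rightarrow> 'c \<times> (nat \<Rightarrow> (('n list \<Rightarrow> 'k) \<Rightarrow> 'k)) \<Rightarrow> 'k) \<Rightarrow> 'k" where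
  "ambient_comult C N = (\<lambda>(c, t).
     tmap (tensor_sum C N) (tensor_sum C N) in_deg0 in_deg0 (comult C c) +
     (\<Sum>n\<in>{n. t n \<noteq> 0}.
        tmap (tensor_sum C N) (tensor_sum C N) in_deg0 (in_deg n) (lcoact_pow C N n (t n)) +
        (\<Sum>i\<in>{1..<n}.
           tmap (tensor_sum C N) (tensor_sum C N) (in_deg i) (in_deg (n - i)) (tsplit N n i (t n))) +
        tmap (tensor_sum C N) (tensor_sum C N) (in_deg n) in_deg0 (rcoact_pow C N n (t n))))"

text \<open>
  On the cotensor coalgebra \<open>T\<close>, the formula takes values in \<open>T \<otimes> T\<close>, seen inside \<open>T' \<otimes> T'\<close> through
  the (injective) map induced by the inclusion of \<open>T\<close> in \<open>T'\<close>.
\<close>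

definition cotensor_coalgebra ::
  "('k::field, 'c::ab_group_add, 'l) coalgebra_scheme \<Rightarrow> ('k, 'c, 'n::ab_group_add, 'm) bicomodule_scheme
    \<Rightarrow> ('k, 'c \<times> (nat \<Rightarrow> (('n list \<Rightarrow> 'k) \<Rightarrow> 'k))) coalgebra" where
  "cotensor_coalgebra C N =
     \<lparr>scal = scal (cotensor_sum C N), vecs = vecs (cotensor_sum C N),
      comult = (\<lambda>x. THE u. u \<in> vecs (tensor (cotensor_sum C N) (cotensor_sum C N)) \<and>
                      tmap (tensor_sum C N) (tensor_sum C N) id id u = ambient_comult C N x),
      counit = (\<lambda>(c, t). counit C c)\<rparr>"


section \<open>Algebras, bimodules and their duals\<close>

record ('k, 'd) algebra = "('k, 'd) vspace" +
  amult :: "'d \<Rightarrow> 'd \<Rightarrow> 'd"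
  aone :: "'d"

definition is_algebra :: "('k::field, 'd::ab_group_add, 'm) algebra_scheme \<Rightarrow> bool" where
  "is_algebra D \<longleftrightarrow>
     is_vspace D \<and> bilinear_map D D D (amult D) \<and> aone D \<in> vecs D \<and>
     (\<forall>a\<in>vecs D. \<forall>b\<in>vecs D. \<forall>c\<in>vecs D. amult D (amult D a b) c = amult D a (amult D b c)) \<and>
     (\<forall>a\<in>vecs D. amult D (aone D) a = a \<and> amult D a (aone D) = a)"

definition division_algebra :: "('k::field, 'd::ab_group_add, 'm) algebra_scheme \<Rightarrow> bool" where
  "division_algebra D \<longleftrightarrow>
     is_algebra D \<and> aone D \<noteq> 0 \<and>
     (\<forall>a\<in>vecs D. a \<noteq> 0 \<longrightarrow> (\<exists>b\<in>vecs D. amult D a b = aone D \<and> amult D b a = aone D))"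

definition algebra_aut :: "('k::field, 'd::ab_group_add, 'm) algebra_scheme \<Rightarrow> ('d \<Rightarrow> 'd) set" where
  "algebra_aut D = {\<alpha>. linear_map D D \<alpha> \<and> bij_betw \<alpha> (vecs D) (vecs D) \<and> \<alpha> (aone D) = aone D \<and>
     (\<forall>a\<in>vecs D. \<forall>b\<in>vecs D. \<alpha> (amult D a b) = amult D (\<alpha> a) (\<alpha> b))}"

record ('k, 'd, 'x) bimodule = "('k, 'x) vspace" +
  lact :: "'d \<Rightarrow> 'x \<Rightarrow> 'x"
  ract :: "'x \<Rightarrow> 'd \<Rightarrow> 'x"

definition twisted_bimodule ::
  "('k::field, 'd::ab_group_add, 'm) algebra_scheme \<Rightarrow> ('d \<Rightarrow> 'd) \<Rightarrow> ('k, 'd, 'd) bimodule" where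
  "twisted_bimodule D \<alpha> = \<lparr>scal = scal D, vecs = vecs D,
     lact = (\<lambda>a x. amult D a x), ract = (\<lambda>x b. amult D x (\<alpha> b))\<rparr>"

text \<open>
  For finite-dimensional \<open>V\<close> and \<open>W\<close>, the dual \<open>M\<^sup>* \<rightarrow> V\<^sup>* \<otimes> W\<^sup>*\<close> of the linear map \<open>V \<otimes> W \<rightarrow> M\<close>
  given by the bilinear map \<open>m\<close>: it sends \<open>f\<close> to \<open>\<Sum> g\<^sub>i \<otimes> h\<^sub>i\<close> with \<open>f (m v w) = \<Sum> g\<^sub>i v * h\<^sub>i w\<close>.
\<close>

definition dual_map ::
  "('k::field, 'v::ab_group_add, 'm) vspace_scheme \<Rightarrow> ('k, 'w::ab_group_add, 'n) vspace_scheme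
    \<Rightarrow> ('v \<Rightarrow> 'w \<Rightarrow> 'u) \<Rightarrow> ('u \<Rightarrow> 'k) \<Rightarrow> ((('v \<Rightarrow> 'k) \<Rightarrow> ('w \<Rightarrow> 'k) \<Rightarrow> 'k) \<Rightarrow> 'k)" where
  "dual_map V W m f = (THE t. t \<in> vecs (tensor (dual V) (dual W)) \<and>
     (\<forall>v\<in>vecs V. \<forall>w\<in>vecs W. t (\<lambda>g h. g v * h w) = f (m v w)))"

definition dual_coalgebra ::
  "('k::field, 'd::ab_group_add, 'm) algebra_scheme \<Rightarrow> ('k, 'd \<Rightarrow> 'k) coalgebra" where
  "dual_coalgebra D = \<lparr>scal = scal (dual D), vecs = vecs (dual D),
     comult = dual_map D D (amult D), counit = (\<lambda>f. f (aone D))\<rparr>"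

definition dual_bicomodule ::
  "('k::field, 'd::ab_group_add, 'l) algebra_scheme \<Rightarrow> ('k, 'd, 'x::ab_group_add, 'm) bimodule_scheme
    \<Rightarrow> ('k, 'd \<Rightarrow> 'k, 'x \<Rightarrow> 'k) bicomodule" where
  "dual_bicomodule D M = \<lparr>scal = scal (dual M), vecs = vecs (dual M),
     lcoact = dual_map D M (lact M), rcoact = dual_map M D (ract M)\<rparr>"

text \<open>The coalgebra \<open>\<D>\<C>(D, \<alpha>)\<close>.\<close>

definition DC ::
  "('k::field, 'd::ab_group_add, 'm) algebra_scheme \<Rightarrow> ('d \<Rightarrow> 'd)
    \<Rightarrow> ('k, ('d \<Rightarrow> 'k) \<times> (nat \<Rightarrow> ((('d \<Rightarrow> 'k) list \<Rightarrow> 'k) \<Rightarrow> 'k))) coalgebra" where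
  "DC D \<alpha> = cotensor_coalgebra (dual_coalgebra D) (dual_bicomodule D (twisted_bimodule D \<alpha>))"

end

theory Submission
  imports Defs
begin

text \<open>
  Let \<open>A = C\<^sup>*\<close>.  The right coideals of \<open>C\<close> are the \<open>A\<close>-submodules, and proper ones are
  finite-dimensional because they form a chain.  A functional \<open>x\<close> that vanishes on the least nonzero
  coideal \<open>M\<close> but not on the next one acts on \<open>C\<close> surjectively with kernel \<open>M\<close>; hence \<open>A\<close> is a
  complete local ring with maximal ideal \<open>x \<star> A\<close> and with residue algebra a finite-dimensional
  division algebra \<open>D = M\<^sup>*\<close>.  As \<open>k\<close> is perfect, \<open>D\<close> is separable, and a Casimir element of \<open>D\<close>
  serves twice: it lifts \<open>D\<close> to a subalgebra of \<open>A\<close> (by successive approximation, as in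
  Wedderburn's principal theorem), and, by averaging, it turns \<open>x\<close> into a uniformizer with
  \<open>x \<star> d = \<alpha> d \<star> x\<close> for \<open>d \<in> D\<close>.  So \<open>A\<close> is the skew power series ring \<open>D[[x; \<alpha>]]\<close>.  On the other side,
  \<open>N = (D\<^sub>\<alpha>)\<^sup>*\<close> satisfies \<open>N\<^sup>\<otimes>\<^sup>n = (D\<^sup>\<otimes>\<^sup>n)\<^sup>*\<close>, where the cotensor condition says that a form factors through
  \<open>(d\<^sub>1, \<dots>, d\<^sub>n) \<mapsto> d\<^sub>1 \<alpha>(d\<^sub>2) \<dots> \<alpha>\<^sup>n\<^sup>-\<^sup>1(d\<^sub>n)\<close>; so the cotensor coalgebra is the graded dual of \<open>D[x; \<alpha>]\<close>.
\<close>

section \<open>Subspaces and linear functionals\<close>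

text \<open>Dual bases u_i, v_i of a Frobenius form on D do not suffice for the Casimir element,
  since \<Sum> u_i v_i may vanish. Hence some z is inserted with \<Sum> u_i z v_i \<noteq> 0; this
  sum is central, so it can be divided out. Perfectness enters in the existence of z: elements of
  the centre K are roots of separable polynomials, so K \<otimes> K contains a separability
  idempotent, and D \<otimes>_K D acts faithfully on D by two-sided multiplication. The automorphism
  comes from the ideal x A being two-sided: a x = x \<sigma>(a) defines an endomorphism \<sigma> of
  A, and \<alpha> is the inverse of the map induced by \<sigma> on residues. The coalgebra must be
  recovered from its infinite-dimensional dual. What passes to the other side is therefore the
  pairing of C with the elements a x^i: those of large degree vanish at a given c, together they
  separate C, and every finitely supported family of functionals on D is attained.\<close>

lemma sum_fun_apply: "(\<Sum>i\<in>I. f i) x = (\<Sum>i\<in>I. f i x)"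
  by (induction I rule: infinite_finite_induct) simp_all

lemma linear_form_iff:
  "linear_map V ground f \<longleftrightarrow>
     (\<forall>x\<in>vecs V. \<forall>y\<in>vecs V. f (x + y) = f x + f y) \<and> (\<forall>a. \<forall>x\<in>vecs V. f (scal V a x) = a * f x)"
  by (simp add: linear_map_def ground_def)

lemma bilinear_form_iff:
  "bilinear_map V W ground B \<longleftrightarrow>
     (\<forall>v\<in>vecs V. linear_map W ground (B v)) \<and> (\<forall>w\<in>vecs W. linear_map V ground (\<lambda>v. B v w))"
  by (simp add: bilinear_map_def)

lemma vecs_closed:
  assumes "is_vspace V"
  shows "0 \<in> vecs V"
    and "\<And>x y. x \<in> vecs V \<Longrightarrow> y \<in> vecs V \<Longrightarrow> x + y \<in> vecs V"
    and "\<And>x y. x \<in> vecs V \<Longrightarrow> y \<in> vecs V \<Longrightarrow> x - y \<in> vecs V"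
    and "\<And>a x. x \<in> vecs V \<Longrightarrow> scal V a x \<in> vecs V"
    and "\<And>I g. (\<And>i. i \<in> I \<Longrightarrow> g i \<in> vecs V) \<Longrightarrow> sum g I \<in> vecs V"
proof -
  interpret vector_space "scal V" using assms by (simp add: is_vspace_def)
  have s: "subspace (vecs V)" using assms by (simp add: is_vspace_def)
  show "0 \<in> vecs V" using subspace_0[OF s] .
  show "\<And>x y. x \<in> vecs V \<Longrightarrow> y \<in> vecs V \<Longrightarrow> x + y \<in> vecs V" using subspace_add[OF s] .
  show "\<And>x y. x \<in> vecs V \<Longrightarrow> y \<in> vecs V \<Longrightarrow> x - y \<in> vecs V" using subspace_diff[OF s] .
  show "\<And>a x. x \<in> vecs V \<Longrightarrow> scal V a x \<in> vecs V" using subspace_scale[OF s] .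
  show "\<And>I g. (\<And>i. i \<in> I \<Longrightarrow> g i \<in> vecs V) \<Longrightarrow> sum g I \<in> vecs V" using subspace_sum[OF s] .
qed

lemma linear_map_basic:
  assumes V: "is_vspace V" and W: "is_vspace W" and f: "linear_map V W f"
  shows "f 0 = 0"
    and "\<And>x y. x \<in> vecs V \<Longrightarrow> y \<in> vecs V \<Longrightarrow> f (x - y) = f x - f y"
    and "\<And>I g. (\<And>i. i \<in> I \<Longrightarrow> g i \<in> vecs V) \<Longrightarrow> f (sum g I) = (\<Sum>i\<in>I. f (g i))"
proof -
  note c = vecs_closed[OF V]
  have add: "f (x + y) = f x + f y" if "x \<in> vecs V" "y \<in> vecs V" for x y
    using f that by (simp add: linear_map_def)
  show z: "f 0 = 0" using add[of 0 0] c(1) by simp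
  show "f (x - y) = f x - f y" if "x \<in> vecs V" "y \<in> vecs V" for x y
    using add[of "x - y" y] c(3)[OF that] that by simp
  show "f (sum g I) = (\<Sum>i\<in>I. f (g i))" if "\<And>i. i \<in> I \<Longrightarrow> g i \<in> vecs V" for I g
    using that
  proof (induction I rule: infinite_finite_induct)
    case (insert i I)
    then show ?case using c(5)[of I g] by (simp add: add)
  qed (simp_all add: z)
qed

lemma is_vspace_ground: "is_vspace ground"
  by (simp add: is_vspace_def ground_def vector_space_mult module.subspace_UNIV
      module_iff_vector_space[THEN iffD2])

lemma linear_form_basic:
  assumes "is_vspace V" and "linear_map V ground f"
  shows "f 0 = (0::'k::field)"
    and "\<And>x y. x \<in> vecs V \<Longrightarrow> y \<in> vecs V \<Longrightarrow> f (x + y) = f x + f y"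
    and "\<And>x y. x \<in> vecs V \<Longrightarrow> y \<in> vecs V \<Longrightarrow> f (x - y) = f x - f y"
    and "\<And>a x. x \<in> vecs V \<Longrightarrow> f (scal V a x) = a * f x"
    and "\<And>I g. (\<And>i. i \<in> I \<Longrightarrow> g i \<in> vecs V) \<Longrightarrow> f (sum g I) = (\<Sum>i\<in>I. f (g i))"
  subgoal by (rule linear_map_basic(1)[OF assms(1) is_vspace_ground assms(2)])
  subgoal using assms(2) by (simp add: linear_form_iff)
  subgoal by (rule linear_map_basic(2)[OF assms(1) is_vspace_ground assms(2)])
  subgoal using assms(2) by (simp add: linear_form_iff)
  subgoal by (rule linear_map_basic(3)[OF assms(1) is_vspace_ground assms(2)])
  done

text \<open>The predicate \<open>linear_map\<close> only speaks of the carrier. Extending from a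
  basis of the carrier to the whole type gives a map to which the facts on images of spans and of
  independent sets apply.\<close>

lemma linear_map_extend:
  assumes V: "is_vspace V" and W: "is_vspace W" and f: "linear_map V W f"
  obtains g where "Vector_Spaces.linear (scal V) (scal W) g" "\<And>x. x \<in> vecs V \<Longrightarrow> g x = f x"
proof -
  interpret V: vector_space "scal V" using V by (simp add: is_vspace_def)
  interpret W: vector_space "scal W" using W by (simp add: is_vspace_def)
  interpret VW: vector_space_pair "scal V" "scal W" by unfold_locales
  obtain B where B: "B \<subseteq> vecs V" "V.independent B" "vecs V \<subseteq> V.span B"
    by (rule V.basis_exists[of "vecs V"])
  define g where "g = VW.construct B f"
  have lg: "Vector_Spaces.linear (scal V) (scal W) g"
    unfolding g_def by (rule VW.linear_construct[OF B(2)])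
  interpret g: Vector_Spaces.linear "scal V" "scal W" g by (rule lg)
  have "x \<in> vecs V \<and> g x = f x" if "x \<in> V.span B" for x
    using that
  proof (induction rule: V.span_induct_alt)
    case base
    show ?case using vecs_closed(1)[OF V] linear_map_basic(1)[OF V W f] g.zero by simp
  next
    case (step c b y)
    have b: "b \<in> vecs V" using step(1) B by auto
    have "g b = f b" unfolding g_def by (rule VW.construct_basis[OF B(2) step(1)])
    then show ?case using step b f vecs_closed[OF V]
      by (simp add: g.add g.scale linear_map_def)
  qed
  then show thesis using that[OF lg] B(3) by blast
qed

lemma vecs_dual: "p \<in> vecs (dual V) \<longleftrightarrow> linear_map V ground p \<and> (\<forall>x. x \<notin> vecs V \<longrightarrow> p x = 0)"
  by (simp add: dual_def)

lemma scal_dual [simp]: "scal (dual V) = pscale"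
  by (simp add: dual_def)

lemma pscale_apply: "pscale a f x = a * f x"
  by (simp add: pscale_def)

lemma is_vspace_dual:
  assumes "is_vspace V" shows "is_vspace (dual V)"
proof -
  interpret P: vector_space "pscale :: 'a \<Rightarrow> ('b \<Rightarrow> 'a) \<Rightarrow> _" by (rule vector_space_pscale)
  show ?thesis
    by (auto simp: is_vspace_def P.vector_space_axioms dual_def linear_form_iff pscale_def
        algebra_simps intro!: P.subspaceI)
qed

lemma dual_prescribe:
  assumes V: "is_vspace V" and B: "module.independent (scal V) B" "B \<subseteq> vecs V"
  obtains p where "p \<in> vecs (dual V)" "\<And>b. b \<in> B \<Longrightarrow> p b = g b"
proof -
  interpret V: vector_space "scal V" using V by (simp add: is_vspace_def)
  interpret K: vector_space "(*) :: 'a \<Rightarrow> _" by (rule vector_space_mult)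
  interpret VK: vector_space_pair "scal V" "(*) :: 'a \<Rightarrow> _" by unfold_locales
  define q where "q = VK.construct B g"
  interpret q: Vector_Spaces.linear "scal V" "(*)" q
    unfolding q_def by (rule VK.linear_construct[OF B(1)])
  have "q b = g b" if "b \<in> B" for b
    unfolding q_def by (rule VK.construct_basis[OF B(1) that])
  then have "\<And>b. b \<in> B \<Longrightarrow> (if b \<in> vecs V then q b else 0) = g b" using B by auto
  moreover have "(\<lambda>x. if x \<in> vecs V then q x else 0) \<in> vecs (dual V)"
    using vecs_closed[OF V] by (auto simp: vecs_dual linear_form_iff q.add q.scale)
  ultimately show thesis using that by blast
qed

text \<open>\<open>v\<close> is independent of a basis of \<open>S\<close>, so the value 1 at
  \<open>v\<close> and the value 0 on that basis can be prescribed together.\<close>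

lemma dual_separate_subspace:
  assumes V: "is_vspace V" and S: "module.subspace (scal V) S" "S \<subseteq> vecs V"
    and v: "v \<in> vecs V" "v \<notin> S"
  obtains p where "p \<in> vecs (dual V)" "p v = 1" "\<And>x. x \<in> S \<Longrightarrow> p x = 0"
proof -
  interpret V: vector_space "scal V" using V by (simp add: is_vspace_def)
  obtain B where B: "B \<subseteq> S" "V.independent B" "S \<subseteq> V.span B"
    by (rule V.basis_exists[of S])
  have SB: "V.span B = S" using V.span_subspace[OF B(1) B(3) S(1)] .
  have ind: "V.independent (insert v B)" using B(2) v SB by (simp add: V.independent_insertI)
  have sub: "insert v B \<subseteq> vecs V" using B(1) S(2) v(1) by auto
  obtain p where p: "p \<in> vecs (dual V)" "\<And>b. b \<in> insert v B \<Longrightarrow> p b = (if b = v then 1 else 0)"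
    using dual_prescribe[OF V ind sub, of "\<lambda>b. if b = v then 1 else 0"] by metis
  have pB: "p b = 0" if "b \<in> B" for b using p(2)[of b] that B(1) v(2) by auto
  have l: "linear_map V ground p" using p(1) by (simp add: vecs_dual)
  have "x \<in> vecs V \<and> p x = 0" if "x \<in> V.span B" for x
    using that
  proof (induction rule: V.span_induct_alt)
    case base
    show ?case using vecs_closed(1)[OF V] linear_form_basic(1)[OF V l] by simp
  next
    case (step c b y)
    then have "b \<in> vecs V" using sub by auto
    then show ?case using step pB linear_form_basic[OF V l] vecs_closed[OF V] by simp
  qed
  then show thesis using that[OF p(1)] p(2)[of v] SB by auto
qed

lemma dual_separates:
  assumes V: "is_vspace V" and v: "v \<in> vecs V" and eq: "\<And>p. p \<in> vecs (dual V) \<Longrightarrow> p v = 0"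
  shows "v = 0"
proof (rule ccontr)
  assume "v \<noteq> 0"
  moreover have "module.subspace (scal V) {0}"
    using V by (simp add: is_vspace_def module.subspace_single_0 module_iff_vector_space[THEN iffD2])
  ultimately obtain p where "p \<in> vecs (dual V)" "p v = 1"
    using dual_separate_subspace[OF V, of "{0}" v] v vecs_closed(1)[OF V] by blast
  with eq show False by fastforce
qed

lemma dual_eqI:
  assumes V: "is_vspace V" and v: "v \<in> vecs V" "w \<in> vecs V"
    and eq: "\<And>p. p \<in> vecs (dual V) \<Longrightarrow> p v = p w"
  shows "v = w"
proof -
  have "p (v - w) = 0" if "p \<in> vecs (dual V)" for p
    using linear_form_basic(3)[OF V _ v, of p] eq[OF that] that by (simp add: vecs_dual)
  then have "v - w = 0" by (rule dual_separates[OF V vecs_closed(3)[OF V v]])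
  then show ?thesis by simp
qed

section \<open>Dimension counts in finitely spanned subspaces\<close>

context vector_space
begin

lemma dim_less:
  assumes S: "subspace S" and T: "subspace T" and ST: "S \<subset> T" and F: "finite F" "T \<subseteq> span F"
  shows "dim S < dim T"
proof -
  obtain B where B: "B \<subseteq> S" "independent B" "S \<subseteq> span B" "card B = dim S"
    by (rule basis_exists)
  obtain B' where B': "B \<subseteq> B'" "B' \<subseteq> T" "independent B'" "T \<subseteq> span B'"
    using maximal_independent_subset_extend[of B T] B ST by blast
  have fin: "finite B'" using independent_span_bound[OF F(1) B'(3)] B'(2) F(2) by blast
  have "B \<noteq> B'" using span_subspace[OF B(1) B(3) S] B'(4) ST by auto
  then show ?thesis
    using psubset_card_mono[OF fin, of B] B'(1) B(4) basis_card_eq_dim[OF B'(2) B'(4) B'(3)] by auto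
qed

lemma dim_mono_finite:
  assumes "subspace S" "subspace T" "S \<subseteq> T" "finite F" "T \<subseteq> span F"
  shows "dim S \<le> dim T"
  using dim_less[OF assms(1,2) _ assms(4,5)] assms(3)
  by (cases "S = T") (auto simp: psubset_eq)

lemma finite_span_subspace:
  assumes S: "subspace S" and F: "finite F" "S \<subseteq> span F"
  obtains B where "finite B" "independent B" "span B = S" "B \<subseteq> S" "card B = dim S"
proof -
  obtain B where B: "B \<subseteq> S" "independent B" "S \<subseteq> span B" "card B = dim S"
    by (rule basis_exists)
  have "finite B" using independent_span_bound[OF F(1) B(2)] B(1) F(2) by blast
  then show thesis using that[OF _ B(2) span_subspace[OF B(1) B(3) S] B(1,4)] by blast
qed

end

text \<open>An injective map sends a basis to an independent set of the same size, which by counting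
  is again a basis.\<close>

lemma finite_dim_inj_surj:
  assumes V: "is_vspace V" and fd: "finite_dim V" and f: "linear_map V V f"
    and inj: "\<And>x. x \<in> vecs V \<Longrightarrow> f x = 0 \<Longrightarrow> x = 0"
  shows "f ` vecs V = vecs V"
proof -
  interpret V: vector_space "scal V" using V by (simp add: is_vspace_def)
  have sub: "V.subspace (vecs V)" using V by (simp add: is_vspace_def)
  obtain F where F: "finite F" "V.span F = vecs V" using fd by (auto simp: finite_dim_def)
  obtain g where g: "Vector_Spaces.linear (scal V) (scal V) g" and gf: "\<And>x. x \<in> vecs V \<Longrightarrow> g x = f x"
    using linear_map_extend[OF V V f] by blast
  interpret g: Vector_Spaces.linear "scal V" "scal V" g by (rule g)
  obtain B where B: "finite B" "V.independent B" "V.span B = vecs V" "B \<subseteq> vecs V" "card B = V.dim (vecs V)"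
    using V.finite_span_subspace[OF sub F(1)] F(2) by auto
  have inj_on: "inj_on g (vecs V)"
    using inj gf vecs_closed(3)[OF V] by (intro inj_onI) (metis eq_iff_diff_eq_0 g.diff)
  have ind: "V.independent (g ` B)"
    using g.independent_injective_image[OF B(2)] inj_on B(3) by simp
  have gB: "g ` B \<subseteq> vecs V" using f gf B(4) by (auto simp: linear_map_def)
  obtain B' where B': "g ` B \<subseteq> B'" "B' \<subseteq> vecs V" "V.independent B'" "vecs V \<subseteq> V.span B'"
    using V.maximal_independent_subset_extend[OF gB ind] by blast
  have fin: "finite B'" using V.independent_span_bound[OF F(1) B'(3)] B'(2) F(2) by blast
  have "card B' = card (g ` B)"
    using V.basis_card_eq_dim[OF B'(2) B'(4) B'(3)] B(5) card_image[OF inj_on_subset[OF inj_on B(4)]] by simp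
  then have "B' = g ` B" using card_subset_eq[OF fin B'(1)] by simp
  then have "vecs V \<subseteq> g ` vecs V" using B'(4) g.span_image[of B] B(3) by simp
  moreover have "g ` vecs V = f ` vecs V" using gf by (auto simp: image_def)
  ultimately show ?thesis using f by (auto simp: linear_map_def)
qed

section \<open>Calculus of tensors\<close>

lemma scal_tensor [simp]: "scal (tensor V W) = pscale"
  by (simp add: tensor_def)

lemma tens_in_tensor: "v \<in> vecs V \<Longrightarrow> w \<in> vecs W \<Longrightarrow> tens V W v w \<in> vecs (tensor V W)"
  using bilinear_map_tens[of V W] by (auto simp: bilinear_map_def linear_map_def)

lemma tens_apply: "bilinear_map V W ground B \<Longrightarrow> tens V W v w B = B v w"
  by (simp add: tens_def)

lemma linear_tens_left: "w \<in> vecs W \<Longrightarrow> linear_map V (tensor V W) (\<lambda>v. tens V W v w)"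
  using bilinear_map_tens[of V W] by (simp add: bilinear_map_def)

lemma linear_tens_right: "v \<in> vecs V \<Longrightarrow> linear_map W (tensor V W) (\<lambda>w. tens V W v w)"
  using bilinear_map_tens[of V W] by (simp add: bilinear_map_def)

lemma tens_span_induct [consumes 1, case_names zero step]:
  fixes V :: "('k::field, 'v::ab_group_add, 'm) vspace_scheme"
    and W :: "('k, 'w::ab_group_add, 'n) vspace_scheme"
  assumes t: "t \<in> tensor_span V W S T"
    and z: "P 0"
    and st: "\<And>c v w t. v \<in> S \<Longrightarrow> w \<in> T \<Longrightarrow> t \<in> tensor_span V W S T \<Longrightarrow> P t \<Longrightarrow>
               P (pscale c (tens V W v w) + t)"
  shows "P t"
proof -
  interpret P: vector_space "pscale :: 'k \<Rightarrow> (('v \<Rightarrow> 'w \<Rightarrow> 'k) \<Rightarrow> 'k) \<Rightarrow> _"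
    by (rule vector_space_pscale)
  have "t \<in> P.span {tens V W v w |v w. v \<in> S \<and> w \<in> T}" using t by (simp add: tensor_span_def)
  then have "t \<in> tensor_span V W S T \<and> P t"
  proof (induction rule: P.span_induct_alt)
    case base
    show "0 \<in> tensor_span V W S T \<and> P 0" using z P.span_zero by (simp add: tensor_span_def)
  next
    case (step c x y)
    then show "pscale c x + y \<in> tensor_span V W S T \<and> P (pscale c x + y)" using st[of _ _ y c] P.span_add[OF P.span_scale[OF P.span_base]]
      by (auto simp: tensor_span_def)
  qed
  then show ?thesis ..
qed

lemma tensor_induct [consumes 1, case_names zero step]:
  assumes t: "t \<in> vecs (tensor V W)"
    and z: "P 0"
    and st: "\<And>c v w t. v \<in> vecs V \<Longrightarrow> w \<in> vecs W \<Longrightarrow> t \<in> vecs (tensor V W) \<Longrightarrow> P t \<Longrightarrow>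
               P (pscale c (tens V W v w) + t)"
  shows "P t"
  by (rule tens_span_induct[where P = P, OF t[unfolded tensor_def vspace.simps] z])
    (simp add: st tensor_def)

lemma bilinear_form_add:
  "bilinear_map V W ground B \<Longrightarrow> bilinear_map V W ground B' \<Longrightarrow>
   bilinear_map V W ground (\<lambda>v w. B v w + B' v w)"
  by (simp add: bilinear_form_iff linear_form_iff algebra_simps)

lemma bilinear_form_scale:
  "bilinear_map V W ground B \<Longrightarrow> bilinear_map V W ground (\<lambda>v w. a * B v w)"
  by (simp add: bilinear_form_iff linear_form_iff algebra_simps)

lemma bilinear_form_zero: "bilinear_map V W ground (\<lambda>v w. 0)"
  by (simp add: bilinear_form_iff linear_form_iff)

lemma bilinear_form_mult:
  "linear_map V ground p \<Longrightarrow> linear_map W ground q \<Longrightarrow> bilinear_map V W ground (\<lambda>v w. p v * q w)"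
  by (simp add: bilinear_form_iff linear_form_iff algebra_simps)

lemma bilinear_form_cong:
  assumes V: "is_vspace V" and W: "is_vspace W"
    and eq: "\<And>v w. v \<in> vecs V \<Longrightarrow> w \<in> vecs W \<Longrightarrow> B v w = B' v w"
  shows "bilinear_map V W ground B \<longleftrightarrow> bilinear_map V W ground B'"
  using eq vecs_closed[OF V] vecs_closed[OF W] by (simp add: bilinear_form_iff linear_form_iff)

text \<open>Elements of a tensor product are functions of \<open>B\<close> with the default value 0
  when \<open>B\<close> is not bilinear. Bilinearity only looks at the carriers, so \<open>B\<close>
  and \<open>B'\<close> are treated alike even if they differ elsewhere.\<close>

lemma tensor_cong:
  assumes V: "is_vspace V" and W: "is_vspace W" and t: "t \<in> vecs (tensor V W)"
    and eq: "\<And>v w. v \<in> vecs V \<Longrightarrow> w \<in> vecs W \<Longrightarrow> B v w = B' v w"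
  shows "t B = t B'"
  using t
proof (induction rule: tensor_induct)
  case (step c v w t)
  have "bilinear_map V W ground B = bilinear_map V W ground B'"
    by (rule bilinear_form_cong[OF V W eq])
  then show ?case using step eq by (simp add: tens_def pscale_def)
qed simp

lemma tensor_form_add:
  assumes "t \<in> vecs (tensor V W)" "bilinear_map V W ground B" "bilinear_map V W ground B'"
  shows "t (\<lambda>v w. B v w + B' v w) = t B + t B'"
  using assms(1)
  by (induction rule: tensor_induct)
    (simp_all add: tens_apply assms(2,3) bilinear_form_add pscale_def algebra_simps)

lemma tensor_form_scale:
  assumes "t \<in> vecs (tensor V W)" "bilinear_map V W ground B"
  shows "t (\<lambda>v w. a * B v w) = a * t B"
  using assms(1)
  by (induction rule: tensor_induct)
    (simp_all add: tens_apply assms(2) bilinear_form_scale pscale_def algebra_simps)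

lemma tensor_form_zero:
  assumes "t \<in> vecs (tensor V W)" shows "t (\<lambda>v w. 0) = 0"
  using assms
  by (induction rule: tensor_induct)
    (simp_all add: tens_apply bilinear_form_zero pscale_def)

lemma tlift_zero: "tlift h 0 = 0"
  by (simp add: tlift_def fun_eq_iff)

lemma tlift_add: "tlift h (t + t') = tlift h t + tlift h t'"
  by (simp add: tlift_def fun_eq_iff)

lemma tlift_pscale: "tlift h (pscale c t) = pscale c (tlift h t)"
  by (simp add: tlift_def pscale_def fun_eq_iff)

text \<open>Bilinearity is demanded for every \<open>B\<close>, including arguments that are not
  forms themselves; otherwise the pure tensor would return its default value 0 instead of
  \<open>h v w B\<close>.\<close>

lemma tlift_tens:
  "(\<And>B. bilinear_map V W ground (\<lambda>v w. h v w B)) \<Longrightarrow> tlift h (tens V W v w) = h v w"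
  by (simp add: tlift_def fun_eq_iff tens_apply)

lemma tlift_mem:
  fixes U :: "('k::field, 'b \<Rightarrow> 'k, 'm) vspace_scheme"
  assumes U: "is_vspace U" "scal U = pscale" and t: "t \<in> vecs (tensor V W)"
    and h: "\<And>B. bilinear_map V W ground (\<lambda>v w. h v w B)"
    and mem: "\<And>v w. v \<in> vecs V \<Longrightarrow> w \<in> vecs W \<Longrightarrow> h v w \<in> vecs U"
  shows "tlift h t \<in> vecs U"
  using t
proof (induction rule: tensor_induct)
  case zero
  show "tlift h 0 \<in> vecs U" using vecs_closed(1)[OF U(1)] by (simp add: tlift_zero)
next
  case (step c v w t)
  then show "tlift h (pscale c (tens V W v w) + t) \<in> vecs U" using vecs_closed[OF U(1)] mem U(2)
    by (simp add: tlift_add tlift_pscale tlift_tens[OF h])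
qed

lemma tens_bilinear_in:
  assumes f: "linear_map V V' f" and g: "linear_map W W' g"
  shows "bilinear_map V W ground (\<lambda>v w. tens V' W' (f v) (g w) B)"
proof (cases "bilinear_map V' W' ground B")
  case True
  have "linear_map W ground (\<lambda>w. B v (g w))" if "v \<in> vecs V'" for v
    using True that g by (simp add: bilinear_form_iff linear_form_iff linear_map_def)
  moreover have "linear_map V ground (\<lambda>v. B (f v) w)" if "w \<in> vecs W'" for w
    using True that f by (simp add: bilinear_form_iff linear_form_iff linear_map_def)
  ultimately show ?thesis
    using f g by (simp add: tens_apply[OF True] bilinear_form_iff linear_map_def)
next
  case False
  then show ?thesis by (simp add: tens_def bilinear_form_zero)
qed

lemma tmap_apply:
  "bilinear_map V' W' ground B \<Longrightarrow> tmap V' W' f g t B = t (\<lambda>v w. B (f v) (g w))"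
  by (simp add: tmap_def tlift_def tens_apply)

lemma tmap_mem:
  assumes f: "linear_map V V' f" and g: "linear_map W W' g" and t: "t \<in> vecs (tensor V W)"
  shows "tmap V' W' f g t \<in> vecs (tensor V' W')"
  unfolding tmap_def
  using f g
  by (intro tlift_mem[OF is_vspace_tensor _ t] tens_bilinear_in tens_in_tensor)
    (auto simp: linear_map_def)

lemma tassoc_apply:
  "bilinear_map V (tensor W U) ground B \<Longrightarrow>
   tassoc V W U t B = t (\<lambda>s u. s (\<lambda>v w. B v (tens W U w u)))"
  by (simp add: tassoc_def tlift_def tens_apply)

text \<open>This is the condition under which the outer \<open>tlift\<close> in
  \<open>tassoc\<close> has the prescribed values on pure tensors. For bilinear \<open>B\<close>
  linearity in \<open>u\<close> is shown by induction on \<open>s\<close>; for any other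
  \<open>B\<close> the form is 0.\<close>

lemma tassoc_inner_bilinear:
  assumes U: "is_vspace U"
  shows "bilinear_map (tensor V W) U ground (\<lambda>s u. s (\<lambda>v w. tens V (tensor W U) v (tens W U w u) B))"
proof (cases "bilinear_map V (tensor W U) ground B")
  case B: True
  have Bv: "linear_map (tensor W U) ground (B v)" if "v \<in> vecs V" for v
    using B that by (simp add: bilinear_form_iff)
  have bil: "bilinear_map V W ground (\<lambda>v w. B v (tens W U w u))" if u: "u \<in> vecs U" for u
  proof -
    have "linear_map W ground (\<lambda>w. B v (tens W U w u))" if "v \<in> vecs V" for v
      using Bv[OF that] linear_tens_left[OF u, of W]
      by (simp add: linear_form_iff) (simp add: linear_map_def)
    moreover have "linear_map V ground (\<lambda>v. B v (tens W U w u))" if "w \<in> vecs W" for w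
      using B tens_in_tensor[OF that u] by (simp add: bilinear_form_iff)
    ultimately show ?thesis by (simp add: bilinear_form_iff)
  qed
  have lin: "linear_map U ground (\<lambda>u. B v (tens W U w u))" if "v \<in> vecs V" "w \<in> vecs W" for v w
    using Bv[OF that(1)] linear_tens_right[OF that(2), of U]
    by (simp add: linear_form_iff) (simp add: linear_map_def)
  have add: "B v (tens W U w (u + u')) = B v (tens W U w u) + B v (tens W U w u')"
    if "v \<in> vecs V" "w \<in> vecs W" "u \<in> vecs U" "u' \<in> vecs U" for v w u u'
    using lin that by (simp add: linear_form_iff)
  have sc: "B v (tens W U w (scal U a u)) = a * B v (tens W U w u)"
    if "v \<in> vecs V" "w \<in> vecs W" "u \<in> vecs U" for v w u a
    using lin that by (simp add: linear_form_iff)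
  have "s (\<lambda>v w. B v (tens W U w (u + u'))) = s (\<lambda>v w. B v (tens W U w u)) + s (\<lambda>v w. B v (tens W U w u'))"
    if "s \<in> vecs (tensor V W)" "u \<in> vecs U" "u' \<in> vecs U" "u + u' \<in> vecs U" for s u u'
    using that(1)
    by (induction rule: tensor_induct)
      (simp_all add: tens_apply bil that add pscale_def distrib_left)
  moreover have "s (\<lambda>v w. B v (tens W U w (scal U a u))) = a * s (\<lambda>v w. B v (tens W U w u))"
    if "s \<in> vecs (tensor V W)" "u \<in> vecs U" "scal U a u \<in> vecs U" for s u a
    using that(1)
    by (induction rule: tensor_induct)
      (simp_all add: tens_apply bil that sc pscale_def algebra_simps)
  ultimately show ?thesis
    using vecs_closed[OF U]
    by (simp add: tens_apply[OF B] bilinear_form_iff linear_form_iff pscale_def)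
next
  case False
  have "bilinear_map (tensor V W) U ground (\<lambda>s u. s (\<lambda>v w. 0))"
    using tensor_form_zero[of _ V W] by (simp add: bilinear_form_iff linear_form_iff pscale_def)
  moreover have "(\<lambda>s u. s (\<lambda>v w. tens V (tensor W U) v (tens W U w u) B)) = (\<lambda>s u. s (\<lambda>v w. 0))"
    using False by (simp add: tens_def[of V])
  ultimately show ?thesis
    using arg_cong[of _ _ "bilinear_map (tensor V W) U ground"] by blast
qed

lemma tassoc_mem:
  assumes U: "is_vspace U" and t: "t \<in> vecs (tensor (tensor V W) U)"
  shows "tassoc V W U t \<in> vecs (tensor V (tensor W U))"
  unfolding tassoc_def
proof (rule tlift_mem[OF is_vspace_tensor _ t])
  show "bilinear_map (tensor V W) U ground
      (\<lambda>s u. tlift (\<lambda>v w. tens V (tensor W U) v (tens W U w u)) s B)" for B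
    using tassoc_inner_bilinear[OF U, of V W B] by (simp add: tlift_def)
  have "bilinear_map V W ground (\<lambda>v w. tens V (tensor W U) v (tens W U w u) B)"
    if "u \<in> vecs U" for u B
    by (rule tens_bilinear_in[where f = "\<lambda>x. x" and g = "\<lambda>w. tens W U w u"])
      (use bilinear_map_tens[of W U] that in \<open>auto simp: linear_map_def bilinear_map_def\<close>)
  then show "tlift (\<lambda>v w. tens V (tensor W U) v (tens W U w u)) s \<in> vecs (tensor V (tensor W U))"
    if "s \<in> vecs (tensor V W)" "u \<in> vecs U" for s u
    using that by (intro tlift_mem[OF is_vspace_tensor _ that(1)] tens_in_tensor) auto
qed simp

section \<open>Contraction, basis expansion and separation of tensors\<close>

lemma tensor_contract_left:
  fixes V :: "('k::field, 'v::ab_group_add, 'm) vspace_scheme"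
    and W :: "('k, 'w::ab_group_add, 'n) vspace_scheme"
  assumes V: "is_vspace V" and W: "is_vspace W" and p: "linear_map V ground p"
    and T: "module.subspace (scal W) T" "T \<subseteq> vecs W"
    and t: "t \<in> tensor_span V W (vecs V) T"
  obtains w where "w \<in> T" "\<And>q. linear_map W ground q \<Longrightarrow> q w = t (\<lambda>x y. p x * q y)"
proof -
  interpret W: vector_space "scal W" using W by (simp add: is_vspace_def)
  have "\<exists>w\<in>T. \<forall>q. linear_map W ground q \<longrightarrow> q w = t (\<lambda>x y. p x * q y)"
    using t
  proof (induction rule: tens_span_induct)
    case zero
    show ?case using W.subspace_0[OF T(1)] linear_form_basic(1)[OF W] by auto
  next
    case (step c v w t)
    then obtain w' where w': "w' \<in> T" "\<And>q. linear_map W ground q \<Longrightarrow> q w' = t (\<lambda>x y. p x * q y)"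
      by blast
    let ?w = "scal W (c * p v) w + w'"
    have mem: "?w \<in> T" using w'(1) step(2) T(1) by (simp add: W.subspace_add W.subspace_scale)
    have "q ?w = (pscale c (tens V W v w) + t) (\<lambda>x y. p x * q y)" if q: "linear_map W ground q" for q
    proof -
      have "w \<in> vecs W" "w' \<in> vecs W" "scal W (c * p v) w \<in> vecs W"
        using step(2) w'(1) T(2) vecs_closed(4)[OF W] by auto
      then show ?thesis
        using w'(2)[OF q] linear_form_basic[OF W q]
        by (simp add: pscale_def tens_apply[OF bilinear_form_mult[OF p q]])
    qed
    then show ?case using mem by blast
  qed
  then show thesis using that by blast
qed

lemma tensor_contract_right:
  fixes V :: "('k::field, 'v::ab_group_add, 'm) vspace_scheme"
    and W :: "('k, 'w::ab_group_add, 'n) vspace_scheme"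
  assumes V: "is_vspace V" and W: "is_vspace W" and q: "linear_map W ground q"
    and S: "module.subspace (scal V) S" "S \<subseteq> vecs V"
    and t: "t \<in> tensor_span V W S (vecs W)"
  obtains v where "v \<in> S" "\<And>p. linear_map V ground p \<Longrightarrow> p v = t (\<lambda>x y. p x * q y)"
proof -
  interpret V: vector_space "scal V" using V by (simp add: is_vspace_def)
  have "\<exists>v\<in>S. \<forall>p. linear_map V ground p \<longrightarrow> p v = t (\<lambda>x y. p x * q y)"
    using t
  proof (induction rule: tens_span_induct)
    case zero
    show ?case using V.subspace_0[OF S(1)] linear_form_basic(1)[OF V] by auto
  next
    case (step c v w t)
    then obtain v' where v': "v' \<in> S" "\<And>p. linear_map V ground p \<Longrightarrow> p v' = t (\<lambda>x y. p x * q y)"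
      by blast
    let ?v = "scal V (c * q w) v + v'"
    have mem: "?v \<in> S" using v'(1) step(1) S(1) by (simp add: V.subspace_add V.subspace_scale)
    have "p ?v = (pscale c (tens V W v w) + t) (\<lambda>x y. p x * q y)" if p: "linear_map V ground p" for p
    proof -
      have "v \<in> vecs V" "v' \<in> vecs V" "scal V (c * q w) v \<in> vecs V"
        using step(1) v'(1) S(2) vecs_closed(4)[OF V] by auto
      then show ?thesis
        using v'(2)[OF p] linear_form_basic[OF V p]
        by (simp add: pscale_def tens_apply[OF bilinear_form_mult[OF p q]])
    qed
    then show ?case using mem by blast
  qed
  then show thesis using that by blast
qed

text \<open>Pure tensors are expanded in their second factor, and the coefficients of equal basis
  vectors are collected on the left.\<close>

lemma tensor_basis_expansion:
  fixes V :: "('k::field, 'v::ab_group_add, 'm) vspace_scheme"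
    and W :: "('k, 'w::ab_group_add, 'n) vspace_scheme"
  assumes V: "is_vspace V" and W: "is_vspace W"
    and B: "module.span (scal W) B = vecs W" and t: "t \<in> vecs (tensor V W)"
  obtains F g where "finite F" "F \<subseteq> B" "\<And>b. g b \<in> vecs V" "t = (\<Sum>b\<in>F. tens V W (g b) b)"
proof -
  interpret W: vector_space "scal W" using W by (simp add: is_vspace_def)
  have BW: "b \<in> vecs W" if "b \<in> B" for b using that W.span_base B by blast
  have "\<exists>F g. finite F \<and> F \<subseteq> B \<and> (\<forall>b. g b \<in> vecs V) \<and> t = (\<Sum>b\<in>F. tens V W (g b) b)"
    using t
  proof (induction rule: tensor_induct)
    case zero
    show ?case using vecs_closed(1)[OF V] by (intro exI[of _ "{}"] exI[of _ "\<lambda>_. 0"]) simp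
  next
    case (step c v w t)
    then obtain F g where F: "finite F" "F \<subseteq> B" "\<And>b. g b \<in> vecs V" "t = (\<Sum>b\<in>F. tens V W (g b) b)"
      by blast
    obtain G r where G: "finite G" "G \<subseteq> B" "w = (\<Sum>b\<in>G. scal W (r b) b)"
      using step(2) B[symmetric] by (auto simp: W.span_explicit)
    \<comment> \<open>\<open>G\<close> supports the expansion of \<open>w\<close> and
      \<open>F\<close> that of the remaining sum; the two conditionals allow the supports to
      overlap.\<close>
    let ?g = "\<lambda>b. (if b \<in> G then scal V (c * r b) v else 0) + (if b \<in> F then g b else 0)"
    have mem: "?g b \<in> vecs V" for b using F(3) step(1) vecs_closed[OF V] by simp
    have z: "tens V W 0 b = 0" if "b \<in> B" for b
      using linear_map_basic(1)[OF V is_vspace_tensor linear_tens_left[OF BW[OF that]]] .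
    have sc: "tens V W (scal V a x) b = pscale a (tens V W x b)" if "b \<in> B" "x \<in> vecs V" for a x b
      using linear_tens_left[OF BW[OF that(1)], of V] that(2) by (simp add: linear_map_def)
    have ad: "tens V W (x + y) b = tens V W x b + tens V W y b" if "b \<in> B" "x \<in> vecs V" "y \<in> vecs V" for x y b
      using linear_tens_left[OF BW[OF that(1)], of V] that(2,3) by (simp add: linear_map_def)
    have "tens V W (?g b) b = (if b \<in> G then pscale (c * r b) (tens V W v b) else 0) + (if b \<in> F then tens V W (g b) b else 0)"
      if "b \<in> F \<union> G" for b
    proof -
      have b: "b \<in> B" using that F(2) G(2) by auto
      show ?thesis using F(3) step(1) vecs_closed[OF V] by (simp add: ad[OF b] sc[OF b] z[OF b])
    qed
    then have "(\<Sum>b\<in>F \<union> G. tens V W (?g b) b) =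
        (\<Sum>b\<in>F \<union> G. if b \<in> G then pscale (c * r b) (tens V W v b) else 0) + (\<Sum>b\<in>F \<union> G. if b \<in> F then tens V W (g b) b else 0)"
      by (simp add: sum.distrib)
    also have "\<dots> = (\<Sum>b\<in>G. pscale (c * r b) (tens V W v b)) + t"
      using F(1) G(1) F(4)
      by (simp flip: sum.inter_restrict add: Int_absorb1 Int_absorb2)
    also have "(\<Sum>b\<in>G. pscale (c * r b) (tens V W v b)) = pscale c (tens V W v w)"
    proof -
      have "tens V W v w = (\<Sum>b\<in>G. tens V W v (scal W (r b) b))"
        unfolding G(3) using BW G(2) vecs_closed(4)[OF W]
        by (simp add: linear_map_basic(3)[OF W is_vspace_tensor linear_tens_right[OF step(1)]] subset_iff)
      also have "\<dots> = (\<Sum>b\<in>G. pscale (r b) (tens V W v b))"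
        using linear_tens_right[OF step(1), of W] BW G(2)
        by (intro sum.cong) (auto simp: linear_map_def)
      finally show ?thesis 
        by (simp add: pscale_def fun_eq_iff sum_fun_apply sum_distrib_left mult.assoc)
    qed
    finally show ?case using F(1,2) G(1,2) mem
      by (intro exI[of _ "F \<union> G"] exI[of _ ?g]) auto
  qed
  then show thesis using that by blast
qed

text \<open>Write t = \<Sum> g_b \<otimes> b over a basis of \<open>W\<close>. For fixed
  \<open>p\<close> the vector \<Sum> p(g_b) b is killed by all of \<open>Q\<close>, hence is 0, and
  independence gives p(g_b) = 0. As \<open>p\<close> varies in \<open>P\<close>, every g_b vanishes.
  So arbitrary separating families suffice, not only full dual spaces.\<close>

lemma tensor_separated:
  fixes V :: "('k::field, 'v::ab_group_add, 'm) vspace_scheme"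
    and W :: "('k, 'w::ab_group_add, 'n) vspace_scheme"
  assumes V: "is_vspace V" and W: "is_vspace W"
    and P: "\<And>p. p \<in> P \<Longrightarrow> linear_map V ground p"
    and Q: "\<And>q. q \<in> Q \<Longrightarrow> linear_map W ground q"
    and sepP: "\<And>v. v \<in> vecs V \<Longrightarrow> (\<And>p. p \<in> P \<Longrightarrow> p v = 0) \<Longrightarrow> v = 0"
    and sepQ: "\<And>w. w \<in> vecs W \<Longrightarrow> (\<And>q. q \<in> Q \<Longrightarrow> q w = 0) \<Longrightarrow> w = 0"
    and t: "t \<in> vecs (tensor V W)"
    and eq: "\<And>p q. p \<in> P \<Longrightarrow> q \<in> Q \<Longrightarrow> t (\<lambda>v w. p v * q w) = 0"
  shows "t = 0"
proof -
  interpret W: vector_space "scal W" using W by (simp add: is_vspace_def)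
  obtain B where B: "B \<subseteq> vecs W" "W.independent B" "vecs W \<subseteq> W.span B"
    by (rule W.basis_exists[of "vecs W"])
  have span: "W.span B = vecs W"
    using W.span_subspace[OF B(1,3)] W by (simp add: is_vspace_def)
  obtain F g where F: "finite F" "F \<subseteq> B" "\<And>b. g b \<in> vecs V" "t = (\<Sum>b\<in>F. tens V W (g b) b)"
    by (rule tensor_basis_expansion[OF V W span t]) blast
  have BW: "b \<in> vecs W" if "b \<in> F" for b using that F(2) B(1) by auto
  have pg: "p (g b) = 0" if p: "p \<in> P" and b: "b \<in> F" for p b
  proof -
    let ?w = "\<Sum>b\<in>F. scal W (p (g b)) b"
    have "q ?w = 0" if q: "q \<in> Q" for q
    proof -
      have "q ?w = (\<Sum>b\<in>F. p (g b) * q b)"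
        by (simp add: linear_form_basic(4,5)[OF W Q[OF q]] BW vecs_closed(4)[OF W])
      also have "\<dots> = t (\<lambda>v w. p v * q w)"
        unfolding F(4) by (simp add: sum_fun_apply tens_apply[OF bilinear_form_mult[OF P[OF p] Q[OF q]]])
      finally show ?thesis using eq[OF p q] by simp
    qed
    then have "?w = 0" by (intro vecs_closed(5)[OF W] vecs_closed(4)[OF W] BW sepQ)
    then show ?thesis using W.independentD[OF B(2) F(1,2), of "\<lambda>b. p (g b)"] b by blast
  qed
  have "tens V W (g b) b = 0" if "b \<in> F" for b
  proof -
    have "g b = 0" using sepP[OF F(3)] pg that by blast
    then show ?thesis
      using linear_map_basic(1)[OF V is_vspace_tensor linear_tens_left[OF BW[OF that]]] by simp
  qed
  then show ?thesis using F(4) by simp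
qed

lemma tensor_eqI:
  fixes V :: "('k::field, 'v::ab_group_add, 'm) vspace_scheme"
    and W :: "('k, 'w::ab_group_add, 'n) vspace_scheme"
  assumes "is_vspace V" "is_vspace W"
    and "\<And>p. p \<in> P \<Longrightarrow> linear_map V ground p"
    and "\<And>q. q \<in> Q \<Longrightarrow> linear_map W ground q"
    and "\<And>v. v \<in> vecs V \<Longrightarrow> (\<And>p. p \<in> P \<Longrightarrow> p v = 0) \<Longrightarrow> v = 0"
    and "\<And>w. w \<in> vecs W \<Longrightarrow> (\<And>q. q \<in> Q \<Longrightarrow> q w = 0) \<Longrightarrow> w = 0"
    and t: "t \<in> vecs (tensor V W)" "t' \<in> vecs (tensor V W)"
    and eq: "\<And>p q. p \<in> P \<Longrightarrow> q \<in> Q \<Longrightarrow> t (\<lambda>v w. p v * q w) = t' (\<lambda>v w. p v * q w)"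
  shows "t = t'"
proof -
  have "(t - t') (\<lambda>v w. p v * q w) = 0" if "p \<in> P" "q \<in> Q" for p q
    using eq[OF that] by simp
  then have "t - t' = 0"
    using tensor_separated[OF assms(1-6) vecs_closed(3)[OF is_vspace_tensor t]] by blast
  then show ?thesis by simp
qed

section \<open>The dual algebra and its actions\<close>

text \<open>
  For \<open>p\<close> in the dual algebra \<open>A = C\<^sup>*\<close>, the operators \<open>R p\<close> and \<open>L p\<close> are \<open>(p \<otimes> id) \<circ> \<Delta>\<close> and
  \<open>(id \<otimes> p) \<circ> \<Delta>\<close>.  The right coideals of \<open>C\<close> are the subspaces that are stable under all \<open>L p\<close>, and
  the operators \<open>R p\<close> commute with the \<open>L q\<close>.
\<close>

locale coalg =
  fixes C :: "('k::field, 'c::ab_group_add) coalgebra"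
  assumes coalgebra: "is_coalgebra C"
begin

abbreviation A :: "('c \<Rightarrow> 'k) set" where "A \<equiv> vecs (dual C)"

text \<open>Members of \<open>A\<close> vanish off the carrier, so the counit has to be cut off
  there in order to be the unit of \<open>A\<close>.\<close>

definition eps :: "'c \<Rightarrow> 'k" where
  "eps = (\<lambda>c. if c \<in> vecs C then counit C c else 0)"

definition conv :: "('c \<Rightarrow> 'k) \<Rightarrow> ('c \<Rightarrow> 'k) \<Rightarrow> 'c \<Rightarrow> 'k" (infixl "\<star>" 70) where
  "p \<star> q = (\<lambda>c. if c \<in> vecs C then comult C c (\<lambda>x y. p x * q y) else 0)"

definition R :: "('c \<Rightarrow> 'k) \<Rightarrow> 'c \<Rightarrow> 'c" where
  "R p c = (SOME w. w \<in> vecs C \<and> (\<forall>q. linear_map C ground q \<longrightarrow> q w = comult C c (\<lambda>x y. p x * q y)))"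

definition L :: "('c \<Rightarrow> 'k) \<Rightarrow> 'c \<Rightarrow> 'c" where
  "L q c = (SOME w. w \<in> vecs C \<and> (\<forall>p. linear_map C ground p \<longrightarrow> p w = comult C c (\<lambda>x y. p x * q y)))"

lemma vspace: "is_vspace C"
  using coalgebra by (simp add: is_coalgebra_def)

sublocale VC: vector_space "scal C"
  using vspace by (simp add: is_vspace_def)

lemma subspace_vecs: "VC.subspace (vecs C)"
  using vspace by (simp add: is_vspace_def)

lemmas C_closed [simp] = vecs_closed[OF vspace]
lemmas A_closed = vecs_closed[OF is_vspace_dual[OF vspace]]

lemma A_add [simp]: "p \<in> A \<Longrightarrow> q \<in> A \<Longrightarrow> p + q \<in> A" by (rule A_closed)
lemma A_diff [simp]: "p \<in> A \<Longrightarrow> q \<in> A \<Longrightarrow> p - q \<in> A" by (rule A_closed)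
lemma A_zero [simp]: "0 \<in> A" by (rule A_closed)
lemma A_pscale [simp]: "p \<in> A \<Longrightarrow> pscale a p \<in> A" using A_closed(4)[of p a] by simp
lemma A_sum: "(\<And>i. i \<in> I \<Longrightarrow> f i \<in> A) \<Longrightarrow> sum f I \<in> A" by (rule A_closed)
lemma A_linear: "p \<in> A \<Longrightarrow> linear_map C ground p"
  by (simp add: vecs_dual)

lemma A_outside: "p \<in> A \<Longrightarrow> c \<notin> vecs C \<Longrightarrow> p c = 0"
  by (simp add: vecs_dual)

lemmas A_app = linear_form_basic[OF vspace A_linear]

lemma A_eqI: "p \<in> A \<Longrightarrow> q \<in> A \<Longrightarrow> (\<And>c. c \<in> vecs C \<Longrightarrow> p c = q c) \<Longrightarrow> p = q"
  by (rule ext) (metis A_outside)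

lemma C_eqI: "c \<in> vecs C \<Longrightarrow> d \<in> vecs C \<Longrightarrow> (\<And>p. p \<in> A \<Longrightarrow> p c = p d) \<Longrightarrow> c = d"
  by (rule dual_eqI[OF vspace])

lemma A_restrict: "linear_map C ground p \<Longrightarrow> (\<lambda>c. if c \<in> vecs C then p c else 0) \<in> A"
  by (simp add: vecs_dual linear_form_iff)

lemma comult_mem: "c \<in> vecs C \<Longrightarrow> comult C c \<in> vecs (tensor C C)"
  using coalgebra by (simp add: is_coalgebra_def linear_map_def)

lemma comult_linear: "linear_map C (tensor C C) (comult C)"
  using coalgebra by (simp add: is_coalgebra_def)

lemma comult_add: "c \<in> vecs C \<Longrightarrow> d \<in> vecs C \<Longrightarrow> comult C (c + d) B = comult C c B + comult C d B"
  using comult_linear by (simp add: linear_map_def)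

lemma comult_scale: "c \<in> vecs C \<Longrightarrow> comult C (scal C a c) B = a * comult C c B"
  using comult_linear by (simp add: linear_map_def pscale_def)

lemma A_mult_bilinear: "p \<in> A \<Longrightarrow> q \<in> A \<Longrightarrow> bilinear_map C C ground (\<lambda>x y. p x * q y)"
  by (simp add: bilinear_form_mult A_linear)

lemma conv_apply: "c \<in> vecs C \<Longrightarrow> (p \<star> q) c = comult C c (\<lambda>x y. p x * q y)"
  by (simp add: conv_def)

lemma conv_mem [simp]: "p \<star> q \<in> A"
  by (simp add: conv_def vecs_dual linear_form_iff comult_add comult_scale)

lemma eps_mem [simp]: "eps \<in> A"
  using coalgebra A_restrict[of "counit C"] by (simp add: eps_def is_coalgebra_def)

lemma conv_add_left: "p \<in> A \<Longrightarrow> p' \<in> A \<Longrightarrow> q \<in> A \<Longrightarrow> (p + p') \<star> q = p \<star> q + p' \<star> q"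
  by (rule A_eqI)
    (simp_all add: conv_apply distrib_right tensor_form_add[OF comult_mem] A_mult_bilinear)

lemma conv_add_right: "p \<in> A \<Longrightarrow> q \<in> A \<Longrightarrow> q' \<in> A \<Longrightarrow> p \<star> (q + q') = p \<star> q + p \<star> q'"
  by (rule A_eqI)
    (simp_all add: conv_apply distrib_left tensor_form_add[OF comult_mem] A_mult_bilinear)

lemma conv_pscale_left: "p \<in> A \<Longrightarrow> q \<in> A \<Longrightarrow> pscale a p \<star> q = pscale a (p \<star> q)"
  by (rule A_eqI)
    (simp_all add: conv_apply pscale_def mult.assoc tensor_form_scale[OF comult_mem] A_mult_bilinear
       A_pscale[unfolded pscale_def])

lemma conv_pscale_right: "p \<in> A \<Longrightarrow> q \<in> A \<Longrightarrow> p \<star> pscale a q = pscale a (p \<star> q)"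
  by (rule A_eqI)
    (simp_all add: conv_apply pscale_def mult.left_commute tensor_form_scale[OF comult_mem]
       A_mult_bilinear A_pscale[unfolded pscale_def])

lemma conv_diff_left: "p \<in> A \<Longrightarrow> p' \<in> A \<Longrightarrow> q \<in> A \<Longrightarrow> (p - p') \<star> q = p \<star> q - p' \<star> q"
  using conv_add_left[of "p - p'" p' q] by simp

lemma conv_diff_right: "p \<in> A \<Longrightarrow> q \<in> A \<Longrightarrow> q' \<in> A \<Longrightarrow> p \<star> (q - q') = p \<star> q - p \<star> q'"
  using conv_add_right[of p "q - q'" q'] by simp

lemma conv_zero_left: "q \<in> A \<Longrightarrow> 0 \<star> q = 0"
  using conv_add_left[of 0 0 q] by simp

lemma conv_zero_right: "q \<in> A \<Longrightarrow> q \<star> 0 = 0"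
  using conv_add_right[of q 0 0] by simp

lemma conv_eps_left: assumes p: "p \<in> A" shows "eps \<star> p = p"
proof (rule A_eqI)
  fix c assume c: "c \<in> vecs C"
  have B: "bilinear_map ground C ground (\<lambda>a y. a * p y)"
    using A_linear[OF p] by (simp add: bilinear_form_iff linear_form_iff algebra_simps)
      (simp add: ground_def algebra_simps)
  have "tmap ground C (counit C) id (comult C c) = tens ground C 1 c"
    using coalgebra c by (simp add: is_coalgebra_def)
  from fun_cong[OF this, of "\<lambda>a y. a * p y"]
  have "comult C c (\<lambda>x y. counit C x * p y) = p c"
    by (simp add: tmap_apply[OF B] tens_apply[OF B])
  then show "(eps \<star> p) c = p c"
    using tensor_cong[OF vspace vspace comult_mem[OF c], of "\<lambda>x y. eps x * p y" "\<lambda>x y. counit C x * p y"]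
    by (simp add: conv_apply[OF c] eps_def)
qed (simp_all add: p)

lemma conv_eps_right: assumes p: "p \<in> A" shows "p \<star> eps = p"
proof (rule A_eqI)
  fix c assume c: "c \<in> vecs C"
  have B: "bilinear_map C ground ground (\<lambda>y a. p y * a)"
    using A_linear[OF p] by (simp add: bilinear_form_iff linear_form_iff algebra_simps)
      (simp add: ground_def algebra_simps)
  have "tmap C ground id (counit C) (comult C c) = tens C ground c 1"
    using coalgebra c by (simp add: is_coalgebra_def)
  from fun_cong[OF this, of "\<lambda>y a. p y * a"]
  have "comult C c (\<lambda>x y. p x * counit C y) = p c"
    by (simp add: tmap_apply[OF B] tens_apply[OF B])
  then show "(p \<star> eps) c = p c"
    using tensor_cong[OF vspace vspace comult_mem[OF c], of "\<lambda>x y. p x * eps y" "\<lambda>x y. p x * counit C y"]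
    by (simp add: conv_apply[OF c] eps_def)
qed (simp_all add: p)

lemma conv_assoc: assumes p: "p \<in> A" and q: "q \<in> A" and r: "r \<in> A"
  shows "(p \<star> q) \<star> r = p \<star> (q \<star> r)"
proof (rule A_eqI)
  fix c assume c: "c \<in> vecs C"
  have qr: "bilinear_map C C ground (\<lambda>w u. q w * r u)" using q r by (rule A_mult_bilinear)
  have pq: "bilinear_map C C ground (\<lambda>v w. p v * q w)" using p q by (rule A_mult_bilinear)
  \<comment> \<open>Coassociativity will be tested on the form that applies \<open>p\<close> to the
    first leg and \<open>q\<close>, \<open>r\<close> to the other two; both bracketings of this form
    must be known to be bilinear.\<close>
  have B: "bilinear_map C (tensor C C) ground (\<lambda>v s. p v * s (\<lambda>w u. q w * r u))"
    by (rule bilinear_form_mult[OF A_linear[OF p]]) (simp add: linear_form_iff pscale_def)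
  have B': "bilinear_map (tensor C C) C ground (\<lambda>s u. s (\<lambda>v w. p v * q w) * r u)"
    by (rule bilinear_form_mult[OF _ A_linear[OF r]]) (simp add: linear_form_iff pscale_def)
  have in1: "s (\<lambda>v w. p v * tens C C w u (\<lambda>w u. q w * r u)) = s (\<lambda>v w. p v * q w) * r u"
    if "s \<in> vecs (tensor C C)" for s u
    using tensor_form_scale[OF that pq, of "r u"] by (simp add: tens_apply[OF qr] mult.assoc mult.commute mult.left_commute)
  have B'': "bilinear_map (tensor C C) C ground
      (\<lambda>s u. s (\<lambda>v w. p v * tens C C w u (\<lambda>w u. q w * r u)))"
    by (subst bilinear_form_cong[OF is_vspace_tensor vspace, of C C _ "\<lambda>s u. s (\<lambda>v w. p v * q w) * r u"])
      (simp_all add: in1 B')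
  have "tassoc C C C (tmap (tensor C C) C (comult C) id (comult C c)) =
        tmap C (tensor C C) id (comult C) (comult C c)"
    using coalgebra c by (simp add: is_coalgebra_def)
  from fun_cong[OF this, of "\<lambda>v s. p v * s (\<lambda>w u. q w * r u)"]
  have "comult C c (\<lambda>x y. comult C x (\<lambda>v w. p v * tens C C w y (\<lambda>w u. q w * r u))) =
        comult C c (\<lambda>x y. p x * comult C y (\<lambda>w u. q w * r u))"
    by (simp add: tmap_apply[OF B] tassoc_apply[OF B] tmap_apply[OF B''])
  moreover have "comult C c (\<lambda>x y. comult C x (\<lambda>v w. p v * tens C C w y (\<lambda>w u. q w * r u))) =
      comult C c (\<lambda>x y. (p \<star> q) x * r y)"
    by (rule tensor_cong[OF vspace vspace comult_mem[OF c]]) (simp add: in1 comult_mem conv_apply)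
  moreover have "comult C c (\<lambda>x y. p x * comult C y (\<lambda>w u. q w * r u)) = comult C c (\<lambda>x y. p x * (q \<star> r) y)"
    by (rule tensor_cong[OF vspace vspace comult_mem[OF c]]) (simp add: conv_apply)
  ultimately show "((p \<star> q) \<star> r) c = (p \<star> (q \<star> r)) c" by (simp add: conv_apply[OF c])
qed simp_all

section \<open>Contraction operators and right coideals\<close>

lemma R_spec:
  assumes p: "p \<in> A" and c: "c \<in> vecs C"
  shows "R p c \<in> vecs C \<and> (\<forall>q. linear_map C ground q \<longrightarrow> q (R p c) = comult C c (\<lambda>x y. p x * q y))"
proof -
  have "comult C c \<in> tensor_span C C (vecs C) (vecs C)"
    using comult_mem[OF c] by (simp add: tensor_def)
  then obtain w where "w \<in> vecs C" "\<And>q. linear_map C ground q \<Longrightarrow> q w = comult C c (\<lambda>x y. p x * q y)"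
    using tensor_contract_left[OF vspace vspace A_linear[OF p] subspace_vecs order_refl] by blast
  then have "\<exists>w. w \<in> vecs C \<and> (\<forall>q. linear_map C ground q \<longrightarrow> q w = comult C c (\<lambda>x y. p x * q y))"
    by blast
  then show ?thesis unfolding R_def by (rule someI_ex)
qed

lemma L_spec:
  assumes q: "q \<in> A" and c: "c \<in> vecs C"
  shows "L q c \<in> vecs C \<and> (\<forall>p. linear_map C ground p \<longrightarrow> p (L q c) = comult C c (\<lambda>x y. p x * q y))"
proof -
  have "comult C c \<in> tensor_span C C (vecs C) (vecs C)"
    using comult_mem[OF c] by (simp add: tensor_def)
  then obtain w where "w \<in> vecs C" "\<And>p. linear_map C ground p \<Longrightarrow> p w = comult C c (\<lambda>x y. p x * q y)"
    using tensor_contract_right[OF vspace vspace A_linear[OF q] subspace_vecs order_refl] by blast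
  then have "\<exists>w. w \<in> vecs C \<and> (\<forall>p. linear_map C ground p \<longrightarrow> p w = comult C c (\<lambda>x y. p x * q y))"
    by blast
  then show ?thesis unfolding L_def by (rule someI_ex)
qed

lemma R_mem [simp]: "p \<in> A \<Longrightarrow> c \<in> vecs C \<Longrightarrow> R p c \<in> vecs C" using R_spec by blast
lemma L_mem [simp]: "p \<in> A \<Longrightarrow> c \<in> vecs C \<Longrightarrow> L p c \<in> vecs C" using L_spec by blast

lemma R_eval: "p \<in> A \<Longrightarrow> q \<in> A \<Longrightarrow> c \<in> vecs C \<Longrightarrow> q (R p c) = (p \<star> q) c"
  using R_spec A_linear by (simp add: conv_apply)

lemma L_eval: "p \<in> A \<Longrightarrow> q \<in> A \<Longrightarrow> c \<in> vecs C \<Longrightarrow> p (L q c) = (p \<star> q) c"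
  using L_spec A_linear by (simp add: conv_apply)

lemma R_linear: assumes p: "p \<in> A" shows "linear_map C C (R p)"
  unfolding linear_map_def
proof (intro conjI ballI allI)
  show "R p (c + d) = R p c + R p d" if "c \<in> vecs C" "d \<in> vecs C" for c d
    using that p by (intro C_eqI) (simp_all add: R_eval A_app(2))
  show "R p (scal C a c) = scal C a (R p c)" if "c \<in> vecs C" for a c
    using that p by (intro C_eqI) (simp_all add: R_eval A_app(4))
qed (use p in simp)

lemma L_linear: assumes p: "p \<in> A" shows "linear_map C C (L p)"
  unfolding linear_map_def
proof (intro conjI ballI allI)
  show "L p (c + d) = L p c + L p d" if "c \<in> vecs C" "d \<in> vecs C" for c d
    using that p by (intro C_eqI) (simp_all add: L_eval A_app(2))
  show "L p (scal C a c) = scal C a (L p c)" if "c \<in> vecs C" for a c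
    using that p by (intro C_eqI) (simp_all add: L_eval A_app(4))
qed (use p in simp)

lemma R_zero: "p \<in> A \<Longrightarrow> R p 0 = 0"
  using linear_map_basic(1)[OF vspace vspace R_linear] .

lemma R_add: "p \<in> A \<Longrightarrow> c \<in> vecs C \<Longrightarrow> d \<in> vecs C \<Longrightarrow> R p (c + d) = R p c + R p d"
  using R_linear by (simp add: linear_map_def)

lemma R_scale: "p \<in> A \<Longrightarrow> c \<in> vecs C \<Longrightarrow> R p (scal C a c) = scal C a (R p c)"
  using R_linear by (simp add: linear_map_def)

lemma R_diff: "p \<in> A \<Longrightarrow> c \<in> vecs C \<Longrightarrow> d \<in> vecs C \<Longrightarrow> R p (c - d) = R p c - R p d"
  using linear_map_basic(2)[OF vspace vspace R_linear] .

text \<open>\<open>R\<close> reverses the order of a product, whereas \<open>L\<close> keeps it: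
  \<open>R\<close> makes \<open>C\<close> a right and \<open>L\<close> a left
  \<open>A\<close>-module.\<close>

lemma R_conv: "p \<in> A \<Longrightarrow> q \<in> A \<Longrightarrow> c \<in> vecs C \<Longrightarrow> R (p \<star> q) c = R q (R p c)"
  by (rule C_eqI) (simp_all add: R_eval conv_assoc)

lemma L_conv: "p \<in> A \<Longrightarrow> q \<in> A \<Longrightarrow> c \<in> vecs C \<Longrightarrow> L (p \<star> q) c = L p (L q c)"
  by (rule C_eqI) (simp_all add: L_eval conv_assoc)

lemma R_eps: "c \<in> vecs C \<Longrightarrow> R eps c = c"
  by (rule C_eqI) (simp_all add: R_eval conv_eps_left)

lemma L_eps: "c \<in> vecs C \<Longrightarrow> L eps c = c"
  by (rule C_eqI) (simp_all add: L_eval conv_eps_right)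

lemma R_L_commute: "p \<in> A \<Longrightarrow> q \<in> A \<Longrightarrow> c \<in> vecs C \<Longrightarrow> R p (L q c) = L q (R p c)"
  by (rule C_eqI) (simp_all add: R_eval L_eval conv_assoc)

lemma apply_via_eps: "p \<in> A \<Longrightarrow> c \<in> vecs C \<Longrightarrow> p c = eps (R p c)"
  by (simp add: R_eval conv_eps_right)

text \<open>Applying the coordinate functional of a basis vector \<open>b\<close> to the right leg
  of the comultiplication extracts the left coefficient of \<open>b\<close>. Stability under all
  \<open>L p\<close> therefore puts every left coefficient into \<open>I\<close>.\<close>

lemma right_coideal_iff:
  "right_coideal C I \<longleftrightarrow> VC.subspace I \<and> I \<subseteq> vecs C \<and> (\<forall>p\<in>A. \<forall>c\<in>I. L p c \<in> I)"
proof
  assume I: "right_coideal C I"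
  then have sub: "VC.subspace I" "I \<subseteq> vecs C" by (simp_all add: right_coideal_def)
  have "L p c \<in> I" if p: "p \<in> A" and c: "c \<in> I" for p c
  proof -
    have "comult C c \<in> tensor_span C C I (vecs C)" using I c by (simp add: right_coideal_def)
    then obtain v where v: "v \<in> I" "\<And>q. linear_map C ground q \<Longrightarrow> q v = comult C c (\<lambda>x y. q x * p y)"
      using tensor_contract_right[OF vspace vspace A_linear[OF p] sub] by blast
    have "L p c = v"
      using v sub(2) c p by (intro C_eqI) (auto simp: L_eval conv_apply A_linear)
    then show ?thesis using v(1) by simp
  qed
  with sub show "VC.subspace I \<and> I \<subseteq> vecs C \<and> (\<forall>p\<in>A. \<forall>c\<in>I. L p c \<in> I)" by blast
next
  assume *: "VC.subspace I \<and> I \<subseteq> vecs C \<and> (\<forall>p\<in>A. \<forall>c\<in>I. L p c \<in> I)"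
  interpret P: vector_space "pscale :: 'k \<Rightarrow> (('c \<Rightarrow> 'c \<Rightarrow> 'k) \<Rightarrow> 'k) \<Rightarrow> _" by (rule vector_space_pscale)
  have "comult C c \<in> tensor_span C C I (vecs C)" if c: "c \<in> I" for c
  proof -
    have cC: "c \<in> vecs C" using c * by blast
    obtain B where B: "B \<subseteq> vecs C" "VC.independent B" "vecs C \<subseteq> VC.span B"
      by (rule VC.basis_exists[of "vecs C"])
    have span: "VC.span B = vecs C" using VC.span_subspace[OF B(1,3) subspace_vecs] .
    obtain F g where F: "finite F" "F \<subseteq> B" "\<And>b. g b \<in> vecs C" "comult C c = (\<Sum>b\<in>F. tens C C (g b) b)"
      by (rule tensor_basis_expansion[OF vspace vspace span comult_mem[OF cC]]) blast
    have "g b \<in> I" if b: "b \<in> F" for b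
    proof -
      obtain p where p: "p \<in> A" "\<And>b'. b' \<in> B \<Longrightarrow> p b' = (if b' = b then 1 else 0)"
        using dual_prescribe[OF vspace B(2,1), of "\<lambda>b'. if b' = b then 1 else 0"] by blast
      have "L p c = g b"
      proof (rule C_eqI)
        fix q assume q: "q \<in> A"
        have "q (L p c) = (\<Sum>b'\<in>F. q (g b') * p b')"
          using q p(1) cC
          by (simp add: L_eval conv_apply F(4) sum_fun_apply tens_apply A_mult_bilinear)
        also have "\<dots> = (\<Sum>b'\<in>F. if b' = b then q (g b') else 0)"
          using p(2) F(2) by (intro sum.cong) auto
        finally show "q (L p c) = q (g b)" using F(1) b by simp
      qed (use p(1) cC F(3) in simp_all)
      then show ?thesis using * p(1) c by metis
    qed
    then have "tens C C (g b) b \<in> {tens C C v w |v w. v \<in> I \<and> w \<in> vecs C}" if "b \<in> F" for b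
      using that F(2) B(1) by blast
    then show ?thesis
      unfolding F(4) tensor_span_def by (intro P.span_sum P.span_base)
  qed
  with * show "right_coideal C I" by (auto simp: right_coideal_def)
qed

text \<open>The orbit of \<open>c\<close> under all \<open>L p\<close> lies in the span of the
  finitely many left legs of \<open>comult C c\<close>. This is the local finiteness of
  comodules.\<close>

lemma cyclic_coideal:
  assumes c: "c \<in> vecs C"
  obtains I F where "right_coideal C I" "c \<in> I" "finite F" "I \<subseteq> VC.span F"
proof -
  define I where "I = (\<lambda>p. L p c) ` A"
  have "I \<subseteq> vecs C" using c by (auto simp: I_def)
  moreover have "VC.subspace I"
  proof (rule VC.subspaceI)
    have "L 0 c = 0" using c by (intro C_eqI) (simp_all add: L_eval conv_zero_right A_app(1))
    then show "0 \<in> I" unfolding I_def by (metis A_zero image_eqI)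
  next
    fix x y assume "x \<in> I" "y \<in> I"
    then obtain p q where pq: "p \<in> A" "q \<in> A" "x = L p c" "y = L q c" by (auto simp: I_def)
    have "L (p + q) c = x + y"
      using c pq by (intro C_eqI) (simp_all add: L_eval conv_add_right A_app(2))
    then show "x + y \<in> I" using pq unfolding I_def by (metis A_add image_eqI)
  next
    fix a x assume "x \<in> I"
    then obtain p where p: "p \<in> A" "x = L p c" by (auto simp: I_def)
    have "L (pscale a p) c = scal C a x"
      using c p by (intro C_eqI) (simp_all add: L_eval conv_pscale_right A_app(4) pscale_apply)
    then show "scal C a x \<in> I" using p unfolding I_def by (metis A_pscale image_eqI)
  qed
  moreover have "L q x \<in> I" if q: "q \<in> A" and x: "x \<in> I" for q x
  proof -
    obtain p where p: "p \<in> A" "x = L p c" using x by (auto simp: I_def)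
    have "L q x = L (q \<star> p) c" using q p c by (simp add: L_conv)
    then show ?thesis unfolding I_def by (simp only: conv_mem image_eqI)
  qed
  ultimately have "right_coideal C I" unfolding right_coideal_iff by blast
  moreover have "c \<in> I" using L_eps[OF c] unfolding I_def by (metis eps_mem image_eqI)
  moreover obtain F g where F: "finite F" "F \<subseteq> vecs C" "\<And>b. g b \<in> vecs C" "comult C c = (\<Sum>b\<in>F. tens C C (g b) b)"
    by (rule tensor_basis_expansion[OF vspace vspace VC.span_eq_iff[THEN iffD2, OF subspace_vecs]
        comult_mem[OF c]]) blast
  have "L p c = (\<Sum>b\<in>F. scal C (p b) (g b))" if p: "p \<in> A" for p
  proof (rule C_eqI)
    fix q assume q: "q \<in> A"
    have "q (L p c) = (\<Sum>b\<in>F. q (g b) * p b)"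
      using q p(1) c by (simp add: L_eval conv_apply F(4) sum_fun_apply tens_apply A_mult_bilinear)
    also have "\<dots> = q (\<Sum>b\<in>F. scal C (p b) (g b))"
      using q F(3) by (simp add: A_app(4,5) mult.commute)
    finally show "q (L p c) = q (\<Sum>b\<in>F. scal C (p b) (g b))" .
  qed (use p c F(3) in simp_all)
  then have "L p c \<in> VC.span (g ` F)" if "p \<in> A" for p
    using that by (auto intro!: VC.span_sum VC.span_scale intro: VC.span_base)
  then have "I \<subseteq> VC.span (g ` F)" by (auto simp: I_def)
  ultimately show thesis using that[of I "g ` F"] F(1) by blast
qed

text \<open>Kernels of \<open>R p\<close>, and likewise images of coideals under it, are coideals
  because \<open>R p\<close> commutes with every \<open>L q\<close>.\<close>

lemma right_coideal_kernel: assumes p: "p \<in> A" shows "right_coideal C {c \<in> vecs C. R p c = 0}"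
  unfolding right_coideal_iff
proof (intro conjI ballI)
  show "VC.subspace {c \<in> vecs C. R p c = 0}"
    using p by (auto intro!: VC.subspaceI simp: R_zero R_add R_scale)
  show "L q c \<in> {c \<in> vecs C. R p c = 0}" if "q \<in> A" "c \<in> {c \<in> vecs C. R p c = 0}" for q c
    using that p linear_map_basic(1)[OF vspace vspace L_linear] by (simp add: R_L_commute)
qed auto

lemma right_coideal_image:
  assumes p: "p \<in> A" and I: "right_coideal C I" shows "right_coideal C (R p ` I)"
  unfolding right_coideal_iff
proof (intro conjI ballI)
  have I': "VC.subspace I" "I \<subseteq> vecs C" "\<And>q c. q \<in> A \<Longrightarrow> c \<in> I \<Longrightarrow> L q c \<in> I"
    using I by (auto simp: right_coideal_iff)
  show "R p ` I \<subseteq> vecs C" using I'(2) p by auto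
  show "VC.subspace (R p ` I)"
  proof (rule VC.subspaceI)
    show "0 \<in> R p ` I" using R_zero[OF p] VC.subspace_0[OF I'(1)] by force
    show "x + y \<in> R p ` I" if "x \<in> R p ` I" "y \<in> R p ` I" for x y
      using that I'(2) VC.subspace_add[OF I'(1)] R_add[OF p]
      by (auto simp: image_iff) (metis subsetD)
    show "scal C a x \<in> R p ` I" if "x \<in> R p ` I" for a x
      using that I'(2) VC.subspace_scale[OF I'(1)] R_scale[OF p]
      by (auto simp: image_iff) (metis subsetD)
  qed
  show "L q c \<in> R p ` I" if "q \<in> A" "c \<in> R p ` I" for q c
    using that I'(2,3) R_L_commute[OF p] by (auto simp: image_iff) (metis subsetD)
qed

end

section \<open>Chain coalgebras\<close>

context coalg
begin

text \<open>Since (p \<star> q)(c) = q(R p c), dividing \<open>r\<close> by \<open>p\<close> on the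
  left amounts to factoring \<open>r\<close> through the surjection \<open>R p\<close>.\<close>

lemma conv_factor:
  assumes p: "p \<in> A" and surj: "R p ` vecs C = vecs C" and r: "r \<in> A"
    and ker: "\<And>c. c \<in> vecs C \<Longrightarrow> R p c = 0 \<Longrightarrow> r c = 0"
  obtains q where "q \<in> A" "p \<star> q = r"
proof -
  define i where "i = inv_into (vecs C) (R p)"
  have i: "i d \<in> vecs C" "R p (i d) = d" if "d \<in> vecs C" for d
    using that surj inv_into_into[of d "R p"] f_inv_into_f[of d "R p"] by (simp_all add: i_def)
  have ri: "r c = r c'" if "c \<in> vecs C" "c' \<in> vecs C" "R p c = R p c'" for c c'
    using ker[of "c - c'"] that p r by (simp add: R_diff A_app(3))
  define q where "q = (\<lambda>d. if d \<in> vecs C then r (i d) else 0)"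
  have "linear_map C ground (\<lambda>d. r (i d))"
    unfolding linear_form_iff
  proof (intro conjI ballI allI)
    fix d e assume de: "d \<in> vecs C" "e \<in> vecs C"
    have "r (i (d + e)) = r (i d + i e)"
      using de i p by (intro ri) (simp_all add: R_add)
    then show "r (i (d + e)) = r (i d) + r (i e)" using i de r by (simp add: A_app(2))
  next
    fix a d assume d: "d \<in> vecs C"
    have "r (i (scal C a d)) = r (scal C a (i d))"
      using d i p by (intro ri) (simp_all add: R_scale)
    then show "r (i (scal C a d)) = a * r (i d)" using i d r by (simp add: A_app(4))
  qed
  then have q: "q \<in> A" unfolding q_def by (rule A_restrict)
  have "p \<star> q = r"
  proof (rule A_eqI)
    fix c assume c: "c \<in> vecs C"
    have "(p \<star> q) c = q (R p c)" using p q c by (simp add: R_eval)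
    also have "\<dots> = r (i (R p c))" unfolding q_def using p c by simp
    also have "\<dots> = r c" using p c i by (intro ri) simp_all
    finally show "(p \<star> q) c = r c" .
  qed (use r in simp_all)
  with q show thesis by (rule that)
qed

end

locale chain_coalg = coalg C for C :: "('k::field, 'c::ab_group_add) coalgebra" +
  assumes chain: "right_coideal C I \<Longrightarrow> right_coideal C J \<Longrightarrow> I \<subseteq> J \<or> J \<subseteq> I"
    and infinite: "\<not> finite_dim C"
begin

definition small :: "'c set \<Rightarrow> bool" where
  "small S \<longleftrightarrow> (\<exists>F. finite F \<and> S \<subseteq> VC.span F)"

lemma small_mono: "S \<subseteq> T \<Longrightarrow> small T \<Longrightarrow> small S"
  by (auto simp: small_def)

lemma not_small: "\<not> small (vecs C)"
  using VC.finite_span_subspace[OF subspace_vecs] infinite by (metis finite_dim_def small_def)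

text \<open>A vector outside \<open>I\<close> generates a finite-dimensional coideal that is not
  contained in \<open>I\<close>; by the chain condition it contains \<open>I\<close>.\<close>

lemma proper_coideal_small:
  assumes I: "right_coideal C I" "I \<noteq> vecs C" shows "small I"
proof -
  obtain c where c: "c \<in> vecs C" "c \<notin> I" using I by (auto simp: right_coideal_iff)
  obtain J F where J: "right_coideal C J" "c \<in> J" "finite F" "J \<subseteq> VC.span F"
    using cyclic_coideal[OF c(1)] by blast
  then show ?thesis using chain[OF I(1) J(1)] c(2) by (auto simp: small_def)
qed

lemma coideal_dim_less:
  assumes "right_coideal C I" "right_coideal C J" "I \<subset> J" "small J"
  shows "VC.dim I < VC.dim J"
  using assms VC.dim_less[of I J] by (auto simp: right_coideal_iff small_def)

text \<open>In a chain, a coideal of minimal dimension with property \<open>P\<close> lies in every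
  other coideal with \<open>P\<close>, which would otherwise be strictly smaller.\<close>

lemma least_coideal:
  assumes P: "\<exists>I. right_coideal C I \<and> small I \<and> P I"
  obtains M where "right_coideal C M" "small M" "P M"
    "\<And>I. right_coideal C I \<Longrightarrow> P I \<Longrightarrow> M \<subseteq> I"
proof -
  obtain M where M: "right_coideal C M \<and> small M \<and> P M"
    and min: "\<And>I. right_coideal C I \<and> small I \<and> P I \<Longrightarrow> VC.dim M \<le> VC.dim I"
    using ex_has_least_nat[of "\<lambda>I. right_coideal C I \<and> small I \<and> P I" _ VC.dim] P by blast
  have "M \<subseteq> I" if I: "right_coideal C I" "P I" for I
  proof (rule ccontr)
    assume "\<not> M \<subseteq> I"
    then have IM: "I \<subset> M" using chain[OF I(1), of M] M by blast
    then have "small I" using M small_mono by blast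
    then show False using min[of I] I coideal_dim_less[OF I(1) _ IM] M by force
  qed
  then show thesis using that M by blast
qed

text \<open>A proper image is a finite-dimensional coideal. Together with a finite-dimensional
  kernel it would make \<open>C\<close> finite-dimensional.\<close>

lemma R_surj:
  assumes p: "p \<in> A" and ker: "small {c \<in> vecs C. R p c = 0}"
  shows "R p ` vecs C = vecs C"
proof (rule ccontr)
  assume ne: "R p ` vecs C \<noteq> vecs C"
  have "right_coideal C (vecs C)" by (auto simp: right_coideal_iff subspace_vecs)
  then have im: "right_coideal C (R p ` vecs C)" using right_coideal_image[OF p] by blast
  obtain G where G: "finite G" "R p ` vecs C \<subseteq> VC.span G"
    using proper_coideal_small[OF im ne] by (auto simp: small_def)
  obtain B where B: "finite B" "VC.span B = R p ` vecs C" "B \<subseteq> R p ` vecs C"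
    using VC.finite_span_subspace[OF _ G] im unfolding right_coideal_iff by metis
  obtain F where F: "finite F" "{c \<in> vecs C. R p c = 0} \<subseteq> VC.span F"
    using ker by (auto simp: small_def)
  define r where "r = inv_into (vecs C) (R p)"
  have r: "r b \<in> vecs C" "R p (r b) = b" if "b \<in> B" for b
  proof -
    have b: "b \<in> R p ` vecs C" using that B(3) by (rule subsetD[rotated])
    show "r b \<in> vecs C" "R p (r b) = b"
      unfolding r_def by (rule inv_into_into[OF b], rule f_inv_into_f[OF b])
  qed
  have "c \<in> VC.span (F \<union> r ` B)" if c: "c \<in> vecs C" for c
  proof -
    have "R p c \<in> VC.span B" using c B(2) by blast
    then obtain u where u: "R p c = (\<Sum>b\<in>B. scal C (u b) b)"
      using B(1) by (auto simp: VC.span_finite)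
    let ?s = "\<Sum>b\<in>B. scal C (u b) (r b)"
    have s: "?s \<in> vecs C" using r by simp
    have "R p ?s = (\<Sum>b\<in>B. R p (scal C (u b) (r b)))"
      using r by (simp add: linear_map_basic(3)[OF vspace vspace R_linear[OF p]])
    also have "\<dots> = R p c" using r p by (simp add: u R_scale)
    finally have "c - ?s \<in> VC.span F" using F(2) c s p by (auto simp: R_diff)
    then have "c - ?s \<in> VC.span (F \<union> r ` B)" using VC.span_mono[of F "F \<union> r ` B"] by blast
    moreover have "?s \<in> VC.span (F \<union> r ` B)"
      by (intro VC.span_sum VC.span_scale VC.span_base) auto
    ultimately show ?thesis using VC.span_add by fastforce
  qed
  then have "small (vecs C)" using F(1) B(1) unfolding small_def
    by (intro exI[of _ "F \<union> r ` B"]) auto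
  then show False using not_small by blast
qed

text \<open>The image is comparable with \<open>I\<close>, and since its dimension is at most that
  of \<open>I\<close>, it cannot contain \<open>I\<close> strictly.\<close>

lemma R_preserves_small:
  assumes p: "p \<in> A" and I: "right_coideal C I" "small I"
  shows "R p ` I \<subseteq> I"
proof (rule ccontr)
  assume n: "\<not> R p ` I \<subseteq> I"
  have im: "right_coideal C (R p ` I)" using right_coideal_image[OF p I(1)] .
  have sub: "I \<subset> R p ` I" using n chain[OF I(1) im] by blast
  have I': "VC.subspace I" "I \<subseteq> vecs C" using I(1) by (auto simp: right_coideal_iff)
  obtain B where B: "finite B" "VC.span B = I" "B \<subseteq> I" "card B = VC.dim I"
    using VC.finite_span_subspace[OF I'(1)] I(2) by (metis small_def)
  obtain g where g: "Vector_Spaces.linear (scal C) (scal C) g" "\<And>c. c \<in> vecs C \<Longrightarrow> g c = R p c"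
    using linear_map_extend[OF vspace vspace R_linear[OF p]] by blast
  interpret g: Vector_Spaces.linear "scal C" "scal C" g by (rule g)
  have "R p ` I = g ` VC.span B" using g(2) I'(2) B(2) by force
  then have eq: "R p ` I = VC.span (g ` B)" by (simp add: g.span_image)
  then have "small (R p ` I)" using B(1) unfolding small_def by blast
  then have "VC.dim I < VC.dim (R p ` I)" using coideal_dim_less[OF I(1) im sub] by blast
  also have "\<dots> \<le> card (g ` B)" using VC.dim_le_card[of "R p ` I" "g ` B"] eq B(1) by simp
  also have "\<dots> \<le> VC.dim I" using card_image_le[OF B(1)] B(4) by simp
  finally show False by simp
qed

end

text \<open>
  The situation of a complete discrete valuation ring, seen on the coalgebra: \<open>A\<close> is local, \<open>M\<close> is
  the annihilator of its maximal ideal \<open>x \<star> A\<close>, and every element of \<open>C\<close> is killed by a power of \<open>x\<close>.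
\<close>

locale uniformized = coalg C for C :: "('k::field, 'c::ab_group_add) coalgebra" +
  fixes M :: "'c set" and x :: "'c \<Rightarrow> 'k"
  assumes M_coideal: "right_coideal C M"
    and M_finite: "\<exists>F. finite F \<and> M \<subseteq> VC.span F"
    and M_nonzero: "\<exists>m\<in>M. m \<noteq> 0"
    and x_mem [simp]: "x \<in> A"
    and x_kernel: "c \<in> vecs C \<Longrightarrow> R x c = 0 \<longleftrightarrow> c \<in> M"
    and x_surj: "R x ` vecs C = vecs C"
    and x_nilpotent: "c \<in> vecs C \<Longrightarrow> \<exists>n. (R x ^^ n) c = 0"
    and unit: "p \<in> A \<Longrightarrow> m \<in> M \<Longrightarrow> p m \<noteq> 0 \<Longrightarrow> \<exists>q\<in>A. p \<star> q = eps \<and> q \<star> p = eps"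
    and R_preserves: "p \<in> A \<Longrightarrow> m \<in> M \<Longrightarrow> R p m \<in> M"

context chain_coalg
begin

theorem uniformizer_exists:
  obtains M x where "uniformized C M x"
proof -
  obtain c0 where c0: "c0 \<in> vecs C" "c0 \<noteq> 0"
  proof -
    have "small {0}" unfolding small_def by (intro exI[of _ "{}"]) simp
    then have "\<not> vecs C \<subseteq> {0}" using not_small small_mono by blast
    then show ?thesis using that by blast
  qed
  have "\<exists>I. right_coideal C I \<and> small I \<and> (\<exists>m\<in>I. m \<noteq> 0)"
    using cyclic_coideal[OF c0(1)] c0(2) unfolding small_def by metis
  then obtain M where M: "right_coideal C M" "small M" "\<exists>m\<in>M. m \<noteq> 0"
    and M_least: "\<And>I. right_coideal C I \<Longrightarrow> \<exists>m\<in>I. m \<noteq> 0 \<Longrightarrow> M \<subseteq> I"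
    using least_coideal[of "\<lambda>I. \<exists>m\<in>I. m \<noteq> 0"] by blast
  obtain m0 where m0: "m0 \<in> M" "m0 \<noteq> 0" using M(3) by blast
  have M': "VC.subspace M" "M \<subseteq> vecs C" "\<And>p c. p \<in> A \<Longrightarrow> c \<in> M \<Longrightarrow> L p c \<in> M"
    using M(1) by (auto simp: right_coideal_iff)
  obtain c1 where c1: "c1 \<in> vecs C" "c1 \<notin> M" using M(2) M'(2) not_small small_mono by blast
  have "\<exists>I. right_coideal C I \<and> small I \<and> \<not> I \<subseteq> M"
    using cyclic_coideal[OF c1(1)] c1(2) unfolding small_def by (metis subsetD)
  then obtain M2 where M2: "right_coideal C M2" "small M2" "\<not> M2 \<subseteq> M"
    and M2_least: "\<And>I. right_coideal C I \<Longrightarrow> \<not> I \<subseteq> M \<Longrightarrow> M2 \<subseteq> I"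
    using least_coideal[of "\<lambda>I. \<not> I \<subseteq> M"] by blast
  obtain y where y: "y \<in> M2" "y \<notin> M" using M2(3) by blast
  have yC: "y \<in> vecs C" using y(1) M2(1) by (auto simp: right_coideal_iff)
  obtain x where x: "x \<in> A" "x y = 1" "\<And>m. m \<in> M \<Longrightarrow> x m = 0"
    using dual_separate_subspace[OF vspace M'(1,2) yC y(2)] by blast
  \<comment> \<open>q(R x m) = x(L q m), and \<open>L q m\<close> stays in the coideal
    \<open>M\<close>, where \<open>x\<close> vanishes.\<close>
  have ker1: "R x m = 0" if m: "m \<in> M" for m
  proof (rule C_eqI)
    show "q (R x m) = q 0" if q: "q \<in> A" for q
      using x q m M'(3)[OF q m] M'(2) L_eval[OF x(1) q, of m] by (auto simp: R_eval A_app(1))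
  qed (use x(1) m M'(2) in auto)
  \<comment> \<open>The kernel of \<open>R x\<close> is a coideal. If it were not inside
    \<open>M\<close>, it would contain \<open>M2\<close> and with it \<open>y\<close>; but
    \<open>x y = 1\<close> forces \<open>R x y\<close> to be nonzero.\<close>
  have ker2: "c \<in> M" if c: "c \<in> vecs C" "R x c = 0" for c
  proof (rule ccontr)
    assume "c \<notin> M"
    then have "\<not> {c \<in> vecs C. R x c = 0} \<subseteq> M" using c by blast
    from M2_least[OF right_coideal_kernel[OF x(1)] this] have "R x y = 0" using y(1) by blast
    then show False using apply_via_eps[OF x(1) yC] x(2) A_app(1)[OF eps_mem] by simp
  qed
  have kerM: "{c \<in> vecs C. R x c = 0} = M" using ker1 ker2 M'(2) by blast
  have surj: "R x ` vecs C = vecs C" using R_surj[OF x(1)] kerM M(2) by simp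
  have RM: "R p m \<in> M" if "p \<in> A" "m \<in> M" for p m
    using R_preserves_small[OF that(1) M(1,2)] that(2) by blast
  \<comment> \<open>A nonzero kernel of \<open>R p\<close> would contain the least coideal
    \<open>M\<close>, whereas p m = eps(R p m) is nonzero. So \<open>R p\<close> is bijective, and
    \<open>eps\<close> can be divided by \<open>p\<close>.\<close>
  have right_inverse: "\<exists>q\<in>A. p \<star> q = eps" if p: "p \<in> A" and m: "m \<in> M" "p m \<noteq> 0" for p m
  proof -
    have ker: "{c \<in> vecs C. R p c = 0} = {0}"
    proof (rule ccontr)
      assume "{c \<in> vecs C. R p c = 0} \<noteq> {0}"
      then have "\<exists>c\<in>{c \<in> vecs C. R p c = 0}. c \<noteq> 0" using R_zero[OF p] by fastforce
      from M_least[OF right_coideal_kernel[OF p] this] have "R p m = 0" using m(1) by blast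
      then show False using apply_via_eps[OF p] m M'(2) A_app(1)[OF eps_mem] by auto
    qed
    have "small {0}" unfolding small_def by (intro exI[of _ "{}"]) simp
    then have "R p ` vecs C = vecs C" using R_surj[OF p] ker by simp
    moreover have "eps c = 0" if "c \<in> vecs C" "R p c = 0" for c
    proof -
      have "c \<in> {c \<in> vecs C. R p c = 0}" using that by blast
      then have "c = 0" unfolding ker by blast
      then show ?thesis using A_app(1)[OF eps_mem] by simp
    qed
    ultimately show ?thesis using conv_factor[OF p _ eps_mem] by metis
  qed
  have unit: "\<exists>q\<in>A. p \<star> q = eps \<and> q \<star> p = eps" if p: "p \<in> A" and m: "m \<in> M" "p m \<noteq> 0" for p m
  proof -
    obtain q where q: "q \<in> A" "p \<star> q = eps" using right_inverse[OF p m] by blast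
    \<comment> \<open>If \<open>q\<close> vanished on \<open>M\<close>, so would eps = p \<star> q,
      and the counit law would make \<open>M\<close> zero. Hence \<open>q\<close> has a right
      inverse too, which must be \<open>p\<close>.\<close>
    have "\<exists>m'\<in>M. q m' \<noteq> 0"
    proof (rule ccontr)
      assume "\<not> (\<exists>m'\<in>M. q m' \<noteq> 0)"
      then have e0: "eps m' = 0" if "m' \<in> M" for m'
        using R_eval[OF p q(1), of m'] RM[OF p that] that M'(2) q(2) by auto
      have "r m0 = r 0" if r: "r \<in> A" for r
        using L_eval[OF eps_mem r, of m0] conv_eps_left[OF r] e0[OF M'(3)[OF r m0(1)]] m0(1) M'(2)
          A_app(1)[OF r] by auto
      then have "m0 = 0" using m0(1) M'(2) by (intro C_eqI) auto
      then show False using m0(2) by simp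
    qed
    then obtain r where r: "r \<in> A" "q \<star> r = eps" using right_inverse[OF q(1)] by blast
    have "p = p \<star> (q \<star> r)" using p r by (simp add: conv_eps_right)
    also have "\<dots> = r" using conv_assoc[OF p q(1) r(1)] q(2) conv_eps_left[OF r(1)] by simp
    finally show ?thesis using q r by auto
  qed
  \<comment> \<open>The kernels of the powers of \<open>R x\<close> grow strictly, since
    \<open>R x\<close> is onto and kills the nonzero \<open>M\<close>. If no power killed
    \<open>c\<close>, the chain condition would place all of them in the finite-dimensional coideal
    generated by \<open>c\<close>.\<close>
  have nil: "\<exists>n. (R x ^^ n) c = 0" if c: "c \<in> vecs C" for c
  proof (rule ccontr)
    assume nz: "\<nexists>n. (R x ^^ n) c = 0"
    define X where "X n = ((\<star>) x ^^ n) eps" for n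
    have X: "X n \<in> A" for n by (cases n) (simp_all add: X_def)
    have RX: "R (X n) d = (R x ^^ n) d" if "d \<in> vecs C" for n d
      using that
    proof (induction n arbitrary: d)
      case (Suc n)
      have "R (X (Suc n)) d = R (X n) (R x d)"
        using R_conv[OF x(1) X Suc.prems, of n] by (simp add: X_def)
      also have "\<dots> = (R x ^^ n) (R x d)" using Suc x(1) by simp
      finally show ?case by (simp add: funpow_swap1)
    qed (simp add: X_def R_eps)
    define K where "K n = {d \<in> vecs C. R (X n) d = 0}" for n
    have K: "right_coideal C (K n)" for n unfolding K_def by (rule right_coideal_kernel[OF X])
    obtain I F where I: "right_coideal C I" "c \<in> I" "finite F" "I \<subseteq> VC.span F"
      using cyclic_coideal[OF c] by blast
    have smI: "small I" using I(3,4) by (auto simp: small_def)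
    have "c \<notin> K n" for n using nz c RX by (auto simp: K_def)
    then have KI: "K n \<subseteq> I" for n using chain[OF K I(1)] I(2) by blast
    have Rn: "(R x ^^ n) d \<in> vecs C" if "d \<in> vecs C" for n d
      using that x(1) by (induction n) simp_all
    have surjn: "\<exists>d\<in>vecs C. (R x ^^ n) d = e" if "e \<in> vecs C" for n e
      using that
    proof (induction n arbitrary: e)
      case (Suc n)
      obtain e' where "e' \<in> vecs C" "R x e' = e" using surj Suc.prems by (metis imageE)
      with Suc.IH show ?case by fastforce
    qed auto
    have "K n \<subset> K (Suc n)" for n
    proof
      show "K n \<subseteq> K (Suc n)" using R_zero[OF x(1)] by (auto simp: K_def RX)
      obtain d where d: "d \<in> vecs C" "(R x ^^ n) d = m0" using surjn m0(1) M'(2) by blast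
      then have "d \<in> K (Suc n)" "d \<notin> K n" using m0 ker1 by (auto simp: K_def RX)
      then show "K n \<noteq> K (Suc n)" by blast
    qed
    then have less: "VC.dim (K n) < VC.dim (K (Suc n))" for n
      using coideal_dim_less[OF K K] small_mono[OF KI smI] by blast
    have "n \<le> VC.dim (K n)" for n
      by (induction n) (use less in \<open>auto intro: le_less_trans Suc_leI\<close>)
    moreover have "VC.dim (K n) \<le> VC.dim I" for n
      using VC.dim_mono_finite[OF _ _ KI I(3,4)] K I(1) by (auto simp: right_coideal_iff)
    ultimately show False using order.trans not_less_eq_eq by blast
  qed
  have "uniformized C M x"
    using M x(1) kerM surj nil unit RM
    by unfold_locales (auto simp: small_def)
  then show thesis by (rule that)
qed

end

section \<open>Separability of division algebras over perfect fields\<close>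

text \<open>
  A list of pairs \<open>(u, v)\<close> stands for the tensor \<open>\<Sum> u \<otimes> v\<close>, which is tested against bilinear maps.
\<close>

fun tsum :: "('d \<Rightarrow> 'd \<Rightarrow> 'b::comm_monoid_add) \<Rightarrow> ('d \<times> 'd) list \<Rightarrow> 'b" where
  "tsum F [] = 0"
| "tsum F ((u, v) # E) = F u v + tsum F E"

lemma tsum_cong:
  "(\<And>u v. (u, v) \<in> set E \<Longrightarrow> F u v = G u v) \<Longrightarrow> tsum F E = tsum G E"
  by (induction E) auto

lemma tsum_zero: "tsum (\<lambda>u v. 0) E = 0"
  by (induction E) auto

lemma tsum_add: "tsum (\<lambda>u v. F u v + G u v) E = tsum F E + tsum G E"
  by (induction E) (auto simp: ac_simps)

lemma tsum_diff:
  fixes F :: "'d \<Rightarrow> 'd \<Rightarrow> 'b::ab_group_add"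
  shows "tsum (\<lambda>u v. F u v - G u v) E = tsum F E - tsum G E"
  by (induction E) auto

lemma tsum_append: "tsum F (E @ E') = tsum F E + tsum F E'"
  by (induction E) (auto simp: ac_simps)

lemma tsum_map: "tsum F (map (\<lambda>(u, v). (f u, g v)) E) = tsum (\<lambda>u v. F (f u) (g v)) E"
  by (induction E) auto

lemma tsum_concat: "tsum F (concat (map (\<lambda>(u, v). g u v) E)) = tsum (\<lambda>u v. tsum F (g u v)) E"
  by (induction E) (auto simp: tsum_append)

lemma tsum_swap:
  "tsum (\<lambda>u v. tsum (\<lambda>p q. F u v p q) E) L = tsum (\<lambda>p q. tsum (\<lambda>u v. F u v p q) L) E"
  by (induction L) (auto simp: tsum_zero tsum_add)

lemma tsum_hom:
  assumes "f 0 = 0" "\<And>a b. f (a + b) = f a + f b"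
  shows "f (tsum F E) = tsum (\<lambda>u v. f (F u v)) E"
  by (induction E) (auto simp: assms)

lemma tsum_apply: "tsum F E i = tsum (\<lambda>u v. F u v i) E"
  by (induction E) auto

lemma tsum_sum: "tsum (\<lambda>u v. \<Sum>i\<in>I. F i u v) E = (\<Sum>i\<in>I. tsum (F i) E)"
  by (induction E) (auto simp: sum.distrib)

text \<open>Forms are scalar-valued and live on whole function spaces; identities between
  vector-valued bilinear maps are obtained by testing each component.\<close>

definition bilin :: "(('i \<Rightarrow> 'k::field) \<Rightarrow> ('i \<Rightarrow> 'k) \<Rightarrow> 'k) \<Rightarrow> bool" where
  "bilin B \<longleftrightarrow>
     (\<forall>a b c. B (a + b) c = B a c + B b c) \<and> (\<forall>a b c. B a (b + c) = B a b + B a c) \<and>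
     (\<forall>r a b. B (pscale r a) b = r * B a b) \<and> (\<forall>r a b. B a (pscale r b) = r * B a b)"

lemma bilinD:
  assumes "bilin B"
  shows "B (a + b) c = B a c + B b c" "B a (b + c) = B a b + B a c"
    "B (pscale r a) b = r * B a b" "B a (pscale r b) = r * B a b"
    "B 0 b = 0" "B a 0 = 0"
    "B (\<Sum>i\<in>I. f i) b = (\<Sum>i\<in>I. B (f i) b)" "B a (\<Sum>i\<in>I. f i) = (\<Sum>i\<in>I. B a (f i))"
    "B (tsum F E) b = tsum (\<lambda>u v. B (F u v) b) E" "B a (tsum F E) = tsum (\<lambda>u v. B a (F u v)) E"
    "B (a - b) c = B a c - B b c" "B a (b - c) = B a b - B a c"
proof -
  show add: "B (a + b) c = B a c + B b c" "B a (b + c) = B a b + B a c" for a b c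
    using assms unfolding bilin_def by blast+
  show "B (pscale r a) b = r * B a b" "B a (pscale r b) = r * B a b"
    using assms unfolding bilin_def by blast+
  show z: "B 0 b = 0" "B a 0 = 0" for a b
    using add(1)[of 0 0 b] add(2)[of a 0 0] by (metis add_0 add_cancel_right_right)+
  show "B (\<Sum>i\<in>I. f i) b = (\<Sum>i\<in>I. B (f i) b)" "B a (\<Sum>i\<in>I. f i) = (\<Sum>i\<in>I. B a (f i))"
    by (induction I rule: infinite_finite_induct) (simp_all add: add z)
  show "B (tsum F E) b = tsum (\<lambda>u v. B (F u v) b) E" "B a (tsum F E) = tsum (\<lambda>u v. B a (F u v)) E"
    using tsum_hom[of "\<lambda>x. B x b" F E] tsum_hom[of "B a" F E] by (simp_all add: add z)
  show "B (a - b) c = B a c - B b c" "B a (b - c) = B a b - B a c"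
    using add(1)[of "a - b" b c] add(2)[of a "b - c" c] by simp_all
qed

lemma pscale_rules:
  "pscale 0 f = 0" "pscale 1 f = f" "pscale a 0 = 0" "pscale (a + b) f = pscale a f + pscale b f"
  "pscale a (f + g) = pscale a f + pscale a g" "pscale a (pscale b f) = pscale (a * b) f"
  "pscale (- a) f = - pscale a f"
  by (simp_all add: pscale_def fun_eq_iff algebra_simps)

definition unit_vec :: "nat \<Rightarrow> nat \<Rightarrow> 'k::field" where
  "unit_vec i = (\<lambda>j. if j = i then 1 else 0)"

definition coord_space :: "nat \<Rightarrow> (nat \<Rightarrow> 'k::field) set" where
  "coord_space n = {f. \<forall>i\<ge>n. f i = 0}"

lemma coord_space_expand:
  assumes "f \<in> coord_space n" shows "f = (\<Sum>i<n. pscale (f i) (unit_vec i))"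
proof
  fix j
  have "(\<Sum>i<n. pscale (f i) (unit_vec i)) j = (\<Sum>i<n. if i = j then f i else 0)"
    unfolding sum_fun_apply by (intro sum.cong) (auto simp: pscale_def unit_vec_def)
  then show "f j = (\<Sum>i<n. pscale (f i) (unit_vec i)) j"
    using assms by (simp add: coord_space_def)
qed

lemma unit_vec_mem: "i < n \<Longrightarrow> unit_vec i \<in> coord_space n"
  by (auto simp: unit_vec_def coord_space_def)

lemma is_vspace_coord: "is_vspace \<lparr>scal = pscale, vecs = coord_space n :: (nat \<Rightarrow> 'k::field) set\<rparr>"
proof -
  interpret P: vector_space "pscale :: 'k \<Rightarrow> (nat \<Rightarrow> 'k) \<Rightarrow> _" by (rule vector_space_pscale)
  show ?thesis
    by (auto simp: is_vspace_def P.vector_space_axioms coord_space_def pscale_def intro!: P.subspaceI)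
qed

lemma span_unit_vec: "module.span pscale (unit_vec ` {..<n}) = (coord_space n :: (nat \<Rightarrow> 'k::field) set)"
proof -
  interpret P: vector_space "pscale :: 'k \<Rightarrow> (nat \<Rightarrow> 'k) \<Rightarrow> _" by (rule vector_space_pscale)
  have "P.subspace (coord_space n :: (nat \<Rightarrow> 'k) set)"
    using is_vspace_coord[of n, where 'k = 'k] by (simp add: is_vspace_def)
  moreover have "f \<in> P.span (unit_vec ` {..<n})" if "f \<in> coord_space n" for f :: "nat \<Rightarrow> 'k"
    by (subst coord_space_expand[OF that]) (intro P.span_sum P.span_scale P.span_base, auto)
  ultimately show ?thesis
    using unit_vec_mem by (intro P.span_subspace) (auto simp: image_subset_iff)
qed

lemma finite_dim_coord: "finite_dim \<lparr>scal = pscale, vecs = coord_space n :: (nat \<Rightarrow> 'k::field) set\<rparr>"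
  unfolding finite_dim_def by (intro exI[of _ "unit_vec ` {..<n}"]) (simp add: span_unit_vec)

text \<open>
  A division algebra with underlying space \<open>k\<^sup>n\<close>, whose multiplication is bilinear and associative on
  all of \<open>nat \<Rightarrow> k\<close> (so that no membership conditions are needed for these laws).
\<close>

locale coord_division =
  fixes n :: nat and mult :: "(nat \<Rightarrow> 'k::field) \<Rightarrow> (nat \<Rightarrow> 'k) \<Rightarrow> nat \<Rightarrow> 'k" (infixl "\<odot>" 70)
    and e :: "nat \<Rightarrow> 'k"
  assumes m_add_left: "(a + b) \<odot> c = a \<odot> c + b \<odot> c"
    and m_add_right: "a \<odot> (b + c) = a \<odot> b + a \<odot> c"
    and m_scale_left: "pscale r a \<odot> b = pscale r (a \<odot> b)"
    and m_scale_right: "a \<odot> pscale r b = pscale r (a \<odot> b)"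
    and m_assoc: "(a \<odot> b) \<odot> c = a \<odot> (b \<odot> c)"
    and m_mem [simp]: "a \<odot> b \<in> coord_space n"
    and e_mem [simp]: "e \<in> coord_space n"
    and e_left [simp]: "a \<in> coord_space n \<Longrightarrow> e \<odot> a = a"
    and e_right [simp]: "a \<in> coord_space n \<Longrightarrow> a \<odot> e = a"
    and e_nonzero: "e \<noteq> 0"
    and m_inverse: "a \<in> coord_space n \<Longrightarrow> a \<noteq> 0 \<Longrightarrow> \<exists>b\<in>coord_space n. a \<odot> b = e \<and> b \<odot> a = e"
begin

abbreviation V where "V \<equiv> (coord_space n :: (nat \<Rightarrow> 'k) set)"

lemmas V_closed = vecs_closed[OF is_vspace_coord[of n, where 'k = 'k], simplified]

lemma m_zero_left [simp]: "0 \<odot> a = 0"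
  using m_add_left[of 0 0 a] by simp

lemma m_zero_right [simp]: "a \<odot> 0 = 0"
  using m_add_right[of a 0 0] by simp

lemma m_diff_right: "a \<odot> (b - c) = a \<odot> b - a \<odot> c"
  using m_add_right[of a "b - c" c] by simp

lemma m_sum_left: "(\<Sum>i\<in>I. f i) \<odot> a = (\<Sum>i\<in>I. f i \<odot> a)"
  by (rule additive.sum[of "\<lambda>x. x \<odot> a"]) (simp add: additive.intro m_add_left)

lemma m_sum_right: "a \<odot> (\<Sum>i\<in>I. f i) = (\<Sum>i\<in>I. a \<odot> f i)"
  by (rule additive.sum[of "\<lambda>x. a \<odot> x"]) (simp add: additive.intro m_add_right)

lemma m_tsum_left: "tsum F E \<odot> a = tsum (\<lambda>u v. F u v \<odot> a) E"
  by (rule tsum_hom[where f = "\<lambda>x. x \<odot> a"]) (simp_all add: m_add_left)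

lemma m_tsum_right: "a \<odot> tsum F E = tsum (\<lambda>u v. a \<odot> F u v) E"
  by (rule tsum_hom[where f = "\<lambda>x. a \<odot> x"]) (simp_all add: m_add_right)

lemma tsum_mem: "(\<And>u v. (u, v) \<in> set E \<Longrightarrow> F u v \<in> V) \<Longrightarrow> tsum F E \<in> V"
  by (induction E) (auto simp: V_closed)

lemma no_zero_divisors:
  assumes "a \<in> V" "b \<in> V" "a \<odot> b = 0" shows "a = 0 \<or> b = 0"
proof (rule disjCI)
  assume "b \<noteq> 0"
  then obtain c where "b \<odot> c = e" using m_inverse assms(2) by blast
  then show "a = 0" using assms m_assoc[of a b c] by simp
qed

lemma bilin_component: "bilin (\<lambda>u v. (f u \<odot> g v) i)"
  if "\<And>a b. f (a + b) = f a + f b" "\<And>r a. f (pscale r a) = pscale r (f a)"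
    "\<And>a b. g (a + b) = g a + g b" "\<And>r a. g (pscale r a) = pscale r (g a)" for f g
  by (simp add: bilin_def that m_add_left m_add_right m_scale_left m_scale_right pscale_apply)

lemma bilin_mult:
  assumes "bilin B" shows "bilin (\<lambda>u v. B (a \<odot> u) (v \<odot> b))"
  by (simp add: bilin_def m_add_left m_add_right m_scale_left m_scale_right bilinD[OF assms])

lemma bilin_mult_right:
  assumes "bilin B" shows "bilin (\<lambda>u v. B u (v \<odot> b))" "bilin (\<lambda>u v. B (u \<odot> a) (v \<odot> b))"
  by (simp_all add: bilin_def m_add_left m_add_right m_scale_left m_scale_right bilinD[OF assms])

text \<open>In D \<otimes> D this is the equation d E = E d for the outer bimodule structure;
  testing against bilinear forms replaces the tensor product.\<close>

definition casimir :: "((nat \<Rightarrow> 'k) \<times> (nat \<Rightarrow> 'k)) list \<Rightarrow> (nat \<Rightarrow> 'k) \<Rightarrow> bool" where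
  "casimir E d \<longleftrightarrow> (\<forall>B. bilin B \<longrightarrow> tsum (\<lambda>u v. B (d \<odot> u) v) E = tsum (\<lambda>u v. B u (v \<odot> d)) E)"

lemma casimirD: "casimir E d \<Longrightarrow> bilin B \<Longrightarrow> tsum (\<lambda>u v. B (d \<odot> u) v) E = tsum (\<lambda>u v. B u (v \<odot> d)) E"
  by (simp add: casimir_def)

lemma casimir_add: "casimir E c \<Longrightarrow> casimir E d \<Longrightarrow> casimir E (c + d)"
  by (simp add: casimir_def m_add_left m_add_right bilinD tsum_add)

lemma casimir_scale: "casimir E d \<Longrightarrow> casimir E (pscale r d)"
  unfolding casimir_def
proof (intro allI impI)
  fix B :: "(nat \<Rightarrow> 'k) \<Rightarrow> (nat \<Rightarrow> 'k) \<Rightarrow> 'k"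
  assume c: "\<forall>B. bilin B \<longrightarrow> tsum (\<lambda>u v. B (d \<odot> u) v) E = tsum (\<lambda>u v. B u (v \<odot> d)) E" and B: "bilin B"
  have "r * tsum F E = tsum (\<lambda>u v. r * F u v) E" for F :: "(nat \<Rightarrow> 'k) \<Rightarrow> (nat \<Rightarrow> 'k) \<Rightarrow> 'k"
    by (rule tsum_hom) (simp_all add: distrib_left)
  with c B show "tsum (\<lambda>u v. B (pscale r d \<odot> u) v) E = tsum (\<lambda>u v. B u (v \<odot> pscale r d)) E"
    by (simp add: m_scale_left m_scale_right bilinD flip: \<open>\<And>F. r * tsum F E = _ F\<close>)
qed

definition centre :: "(nat \<Rightarrow> 'k) set" where
  "centre = {z \<in> V. \<forall>d\<in>V. d \<odot> z = z \<odot> d}"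

lemma centreD: "z \<in> centre \<Longrightarrow> z \<in> V" "z \<in> centre \<Longrightarrow> d \<in> V \<Longrightarrow> d \<odot> z = z \<odot> d"
  by (auto simp: centre_def)

lemma centre_closed:
  "e \<in> centre" "0 \<in> centre" "a \<in> centre \<Longrightarrow> b \<in> centre \<Longrightarrow> a + b \<in> centre"
  "a \<in> centre \<Longrightarrow> pscale r a \<in> centre"
  by (auto simp: centre_def V_closed m_add_left m_add_right m_scale_left m_scale_right)

lemma centre_mult: assumes a: "a \<in> centre" and b: "b \<in> centre" shows "a \<odot> b \<in> centre"
proof -
  have "d \<odot> (a \<odot> b) = a \<odot> b \<odot> d" if d: "d \<in> V" for d
  proof -
    have "d \<odot> (a \<odot> b) = (d \<odot> a) \<odot> b" by (simp add: m_assoc)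
    also have "\<dots> = a \<odot> (d \<odot> b)" using centreD(2)[OF a d] by (simp add: m_assoc)
    also have "\<dots> = a \<odot> b \<odot> d" using centreD(2)[OF b d] by (simp add: m_assoc)
    finally show ?thesis .
  qed
  then show ?thesis by (simp add: centre_def)
qed

lemma centre_inverse:
  assumes a: "a \<in> centre" "a \<noteq> 0"
  obtains b where "b \<in> centre" "a \<odot> b = e" "b \<odot> a = e"
proof -
  obtain b where b: "b \<in> V" "a \<odot> b = e" "b \<odot> a = e" using m_inverse centreD(1) a by metis
  have "d \<odot> b = b \<odot> d" if d: "d \<in> V" for d
  proof -
    have "d \<odot> b = (b \<odot> a) \<odot> (d \<odot> b)" using b(3) by simp
    also have "\<dots> = b \<odot> (a \<odot> d) \<odot> b" by (simp add: m_assoc)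
    also have "\<dots> = b \<odot> (d \<odot> a) \<odot> b" using centreD(2)[OF a(1) d] by simp
    also have "\<dots> = b \<odot> d \<odot> (a \<odot> b)" by (simp add: m_assoc)
    finally show ?thesis using b(2) by simp
  qed
  then have "b \<in> centre" using b(1) by (simp add: centre_def)
  with b show thesis using that by blast
qed

subsection \<open>Simple extensions\<close>

text \<open>Horner's scheme for the homomorphism from k[X] to \<open>D\<close> that sends X to
  \<open>t\<close>. It is multiplicative although \<open>D\<close> is noncommutative, because
  coefficients are scalars.\<close>

definition ev :: "(nat \<Rightarrow> 'k) \<Rightarrow> 'k poly \<Rightarrow> nat \<Rightarrow> 'k" where
  "ev t p = fold_coeffs (\<lambda>a y. pscale a e + t \<odot> y) p 0"

lemma ev_zero [simp]: "ev t 0 = 0"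
  by (simp add: ev_def)

lemma ev_pCons [simp]: "ev t (pCons a p) = pscale a e + t \<odot> ev t p"
  by (cases "p = 0 \<and> a = 0") (auto simp: ev_def pscale_rules)

lemma ev_mem [simp]: "ev t p \<in> V"
proof (induction p)
  case 0
  show "ev t 0 \<in> V" using V_closed(1) by simp
next
  case (pCons a p)
  show "ev t (pCons a p) \<in> V" using V_closed(2,4) by simp
qed

lemma ev_add: "ev t (p + q) = ev t p + ev t q"
proof (induction p arbitrary: q)
  case 0
  show "ev t (0 + q) = ev t 0 + ev t q" by simp
next
  case (pCons a p)
  obtain b q' where q: "q = pCons b q'" by (cases q)
  have IH: "ev t (p + q') = ev t p + ev t q'" by (rule pCons.IH)
  show "ev t (pCons a p + q) = ev t (pCons a p) + ev t q"
    unfolding q by (simp add: IH m_add_right pscale_rules ac_simps)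
qed

lemma ev_smult: "ev t (smult a p) = pscale a (ev t p)"
proof (induction p)
  case 0
  show "ev t (smult a 0) = pscale a (ev t 0)" by (simp add: pscale_rules)
next
  case (pCons b p)
  show "ev t (smult a (pCons b p)) = pscale a (ev t (pCons b p))"
    by (simp add: pCons.IH m_scale_right pscale_rules)
qed

lemma ev_mult: "ev t (p * q) = ev t p \<odot> ev t q"
proof (induction p)
  case 0
  show "ev t (0 * q) = ev t 0 \<odot> ev t q" by simp
next
  case (pCons a p)
  show "ev t (pCons a p * q) = ev t (pCons a p) \<odot> ev t q"
    by (simp add: pCons.IH ev_add ev_smult m_add_left m_scale_left m_assoc pscale_rules)
qed

lemma ev_sum: "ev t (\<Sum>i\<in>I. f i) = (\<Sum>i\<in>I. ev t (f i))"
  by (rule additive.sum[of "ev t"]) (simp add: additive.intro ev_add)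

lemma ev_centre:
  assumes t: "t \<in> centre" shows "ev t p \<in> centre"
proof (induction p)
  case 0
  show "ev t 0 \<in> centre" using centre_closed(2) by simp
next
  case (pCons a p)
  show "ev t (pCons a p) \<in> centre"
    using pCons.IH t by (simp add: centre_closed centre_mult)
qed

text \<open>The tensor is \<open>(p(X) - p(Y)) / (X - Y)\<close>, evaluated at \<open>X = t \<otimes> 1\<close> and \<open>Y = 1 \<otimes> t\<close>.\<close>

lemma difference_quotient:
  assumes t: "t \<in> centre"
  shows "\<exists>E. set E \<subseteq> centre \<times> centre \<and> tsum (\<odot>) E = ev t (pderiv p) \<and>
    (\<forall>B. bilin B \<longrightarrow>
      tsum (\<lambda>u v. B (t \<odot> u) v) E - tsum (\<lambda>u v. B u (v \<odot> t)) E = B (ev t p) e - B e (ev t p))"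
proof (induction p)
  case 0
  have "tsum (\<lambda>u v. B (t \<odot> u) v) [] - tsum (\<lambda>u v. B u (v \<odot> t)) [] = B (ev t 0) e - B e (ev t 0)"
    if "bilin B" for B
    using bilinD(5,6)[OF that] by simp
  moreover have "tsum (\<odot>) [] = ev t (pderiv 0)" by simp
  ultimately show ?case by (intro exI[of _ "[]"] conjI allI impI) (assumption | simp)+
next
  case (pCons a p)
  then obtain E where E: "set E \<subseteq> centre \<times> centre" "tsum (\<odot>) E = ev t (pderiv p)"
    "\<And>B. bilin B \<Longrightarrow>
      tsum (\<lambda>u v. B (t \<odot> u) v) E - tsum (\<lambda>u v. B u (v \<odot> t)) E = B (ev t p) e - B e (ev t p)"
    by blast
  have tc: "ev t q \<odot> t = t \<odot> ev t q" for q using centreD(2)[OF t ev_mem] .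
  \<comment> \<open>X p(X) - Y p(Y) = (X - Y) p(X) + Y (p(X) - p(Y)) yields the quotient for a + X
    p; the constant \<open>a\<close> cancels.\<close>
  let ?E = "(ev t p, e) # map (\<lambda>(u, v). (u, v \<odot> t)) E"
  have "set ?E \<subseteq> centre \<times> centre"
    using E(1) t by (auto simp: ev_centre centre_closed centre_mult)
  moreover have "tsum (\<odot>) ?E = ev t (pderiv (pCons a p))"
    using E(2) tsum_map[of "(\<odot>)" "\<lambda>u. u" "\<lambda>v. v \<odot> t" E]
    by (simp add: pderiv_pCons ev_add m_tsum_left tc[symmetric] flip: m_assoc)
      (simp add: m_tsum_left[symmetric] E(2) pscale_rules)
  moreover have "tsum (\<lambda>u v. B (t \<odot> u) v) ?E - tsum (\<lambda>u v. B u (v \<odot> t)) ?E =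
      B (ev t (pCons a p)) e - B e (ev t (pCons a p))" if B: "bilin B" for B
  proof -
    have "tsum (\<lambda>u v. B (t \<odot> u) v) ?E - tsum (\<lambda>u v. B u (v \<odot> t)) ?E =
        B (t \<odot> ev t p) e - B (ev t p) (e \<odot> t) +
        (tsum (\<lambda>u v. B (t \<odot> u) (v \<odot> t)) E - tsum (\<lambda>u v. B u (v \<odot> t \<odot> t)) E)"
      using tsum_map[of "\<lambda>u v. B (t \<odot> u) v" "\<lambda>u. u" "\<lambda>v. v \<odot> t" E]
        tsum_map[of "\<lambda>u v. B u (v \<odot> t)" "\<lambda>u. u" "\<lambda>v. v \<odot> t" E] by simp
    also have "tsum (\<lambda>u v. B (t \<odot> u) (v \<odot> t)) E - tsum (\<lambda>u v. B u (v \<odot> t \<odot> t)) E =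
        B (ev t p) (e \<odot> t) - B e (ev t p \<odot> t)"
      using E(3)[OF bilin_mult_right(1)[OF B, of t]] .
    finally show ?thesis using tc by (simp add: bilinD[OF B])
  qed
  ultimately show ?case by blast
qed

lemma annihilating_polynomial:
  obtains p where "p \<noteq> 0" "ev t p = 0"
proof -
  interpret P: vector_space "pscale :: 'k \<Rightarrow> (nat \<Rightarrow> 'k) \<Rightarrow> _" by (rule vector_space_pscale)
  define f where "f i = ev t (monom 1 i)" for i
  show thesis
  \<comment> \<open>Among n + 1 powers of \<open>t\<close> in a space of dimension \<open>n\<close>,
    either two coincide or the set of powers is dependent. The cases are separate because dependence
    of a set does not see repetitions.\<close>
  proof (cases "inj_on f {..n}")
    case False
    then obtain i j where ij: "i \<noteq> j" "f i = f j" by (auto simp: inj_on_def)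
    have "ev t (monom 1 i + smult (-1) (monom 1 j)) = 0"
      using ij(2) by (simp add: ev_add ev_smult f_def pscale_def fun_eq_iff del: smult_minus_left)
    moreover have "coeff (monom 1 i + smult (-1) (monom 1 j)) i = (1::'k)" using ij(1) by simp
    ultimately show ?thesis using that by (metis coeff_0 zero_neq_one)
  next
    case True
    have "P.dependent (f ` {..n})"
    proof (rule ccontr)
      assume ind: "\<not> P.dependent (f ` {..n})"
      have "f ` {..n} \<subseteq> P.span (unit_vec ` {..<n})" by (auto simp: span_unit_vec f_def)
      from P.independent_span_bound[OF _ ind this]
      have "card (f ` {..n}) \<le> card (unit_vec ` {..<n} :: (nat \<Rightarrow> 'k) set)" by simp
      also have "\<dots> \<le> n" using card_image_le[of "{..<n}" "unit_vec :: nat \<Rightarrow> nat \<Rightarrow> 'k"] by simp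
      finally show False using card_image[OF True] by simp
    qed
    then obtain u where u: "\<exists>v\<in>f ` {..n}. u v \<noteq> 0" "(\<Sum>v\<in>f ` {..n}. pscale (u v) v) = 0"
      by (subst (asm) P.dependent_finite) auto
    obtain i where i: "i \<le> n" "u (f i) \<noteq> 0" using u(1) by auto
    let ?p = "\<Sum>i\<le>n. monom (u (f i)) i"
    have "ev t ?p = (\<Sum>i\<le>n. pscale (u (f i)) (f i))"
      by (simp add: ev_sum f_def flip: ev_smult) (simp add: smult_monom)
    also have "\<dots> = 0" using u(2) by (simp add: sum.reindex[OF True])
    finally have "ev t ?p = 0" .
    moreover have "coeff ?p i = u (f i)" using i(1) by (simp add: coeff_sum)
    ultimately show ?thesis using that i(2) by (metis coeff_0)
  qed
qed

text \<open>A nonzero polynomial of least degree vanishing at \<open>t\<close> is irreducible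
  because \<open>D\<close> has no zero divisors. Over a perfect field it is coprime to its
  derivative, which is therefore nonzero and, being of smaller degree, does not vanish at
  \<open>t\<close>.\<close>

lemma separable_polynomial:
  assumes perfect: "perfect_field TYPE('k)"
  obtains p where "ev t p = 0" "ev t (pderiv p) \<noteq> 0"
proof -
  obtain p where p: "p \<noteq> 0 \<and> ev t p = 0"
    and min: "\<And>q. q \<noteq> 0 \<and> ev t q = 0 \<Longrightarrow> degree p \<le> degree q"
    using ex_has_least_nat[of "\<lambda>p. p \<noteq> 0 \<and> ev t p = 0" _ degree] annihilating_polynomial[of t] by metis
  have deg: "degree p \<noteq> 0"
  proof
    assume "degree p = 0"
    then obtain a where a: "p = [:a:]" by (rule degree_eq_zeroE)
    then have "pscale a e = 0" using p by simp
    moreover obtain i where "e i \<noteq> 0" using e_nonzero by (auto simp: fun_eq_iff)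
    ultimately have "a = 0" by (auto simp: pscale_def fun_eq_iff)
    then show False using a p by simp
  qed
  have "irreducible p"
  proof (rule irreducibleI)
    show "p \<noteq> 0" "\<not> p dvd 1" using p deg by (auto simp: is_unit_iff_degree)
    fix a b assume ab: "p = a * b"
    have nz: "a \<noteq> 0" "b \<noteq> 0" using ab p by auto
    have "ev t a = 0 \<or> ev t b = 0"
      using no_zero_divisors[of "ev t a" "ev t b"] p by (simp add: ab ev_mult)
    moreover have "degree p = degree a + degree b" using nz by (simp add: ab degree_mult_eq)
    ultimately have "degree b = 0 \<or> degree a = 0" using min[of a] min[of b] nz by auto
    then show "a dvd 1 \<or> b dvd 1" using nz by (auto simp: is_unit_iff_degree)
  qed
  then have cop: "coprime p (pderiv p)" using perfect by (simp add: perfect_field_def)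
  have "pderiv p \<noteq> 0"
    using cop deg p by (auto simp: is_unit_iff_degree)
  moreover have "degree (pderiv p) < degree p"
  proof -
    have "degree (pderiv p) \<le> degree p - 1"
      by (rule degree_le) (use deg in \<open>auto simp: coeff_pderiv intro: coeff_eq_0\<close>)
    with deg show ?thesis by linarith
  qed
  ultimately have "ev t (pderiv p) \<noteq> 0" using min[of "pderiv p"] by auto
  with p show thesis using that by blast
qed

text \<open>If p(t) = 0, the difference quotient of \<open>p\<close> satisfies the Casimir equation
  for \<open>t\<close>. The product of its legs is p'(t), which is invertible for the separable
  \<open>p\<close>; dividing the second legs by it normalises the product to
  \<open>e\<close>.\<close>

lemma casimir_simple:
  assumes perfect: "perfect_field TYPE('k)" and t: "t \<in> centre"
  obtains E where "set E \<subseteq> centre \<times> centre" "tsum (\<odot>) E = e" "casimir E t"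
proof -
  obtain p where p: "ev t p = 0" "ev t (pderiv p) \<noteq> 0" using separable_polynomial[OF perfect] by blast
  obtain E where E: "set E \<subseteq> centre \<times> centre" "tsum (\<odot>) E = ev t (pderiv p)"
    "\<And>B. bilin B \<Longrightarrow>
      tsum (\<lambda>u v. B (t \<odot> u) v) E - tsum (\<lambda>u v. B u (v \<odot> t)) E = B (ev t p) e - B e (ev t p)"
    using difference_quotient[OF t, of p] by blast
  obtain w where w: "w \<in> centre" "ev t (pderiv p) \<odot> w = e"
    using centre_inverse[OF ev_centre[OF t] p(2)] by blast
  let ?E = "map (\<lambda>(u, v). (u, v \<odot> w)) E"
  have "set ?E \<subseteq> centre \<times> centre" using E(1) w(1) by (auto simp: centre_mult)
  moreover have "tsum (\<odot>) ?E = e"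
    using tsum_map[of "(\<odot>)" "\<lambda>u. u" "\<lambda>v. v \<odot> w" E] E(2) w(2)
    by (simp add: m_tsum_left[symmetric] flip: m_assoc)
  moreover have "casimir ?E t"
    unfolding casimir_def
  proof (intro allI impI)
    fix B :: "(nat \<Rightarrow> 'k) \<Rightarrow> (nat \<Rightarrow> 'k) \<Rightarrow> 'k" assume B: "bilin B"
    have "tsum (\<lambda>u v. B (t \<odot> u) (v \<odot> w)) E = tsum (\<lambda>u v. B u (v \<odot> t \<odot> w)) E"
      using E(3)[OF bilin_mult_right(1)[OF B, of w]] p(1) by (simp add: bilinD[OF B])
    moreover have "t \<odot> w = w \<odot> t" using centreD t w(1) by simp
    ultimately show "tsum (\<lambda>u v. B (t \<odot> u) v) ?E = tsum (\<lambda>u v. B u (v \<odot> t)) ?E"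
      using tsum_map[of "\<lambda>u v. B (t \<odot> u) v" "\<lambda>u. u" "\<lambda>v. v \<odot> w" E]
        tsum_map[of "\<lambda>u v. B u (v \<odot> t)" "\<lambda>u. u" "\<lambda>v. v \<odot> w" E] by (simp add: m_assoc)
  qed
  ultimately show thesis by (rule that)
qed

end

context coord_division
begin

subsection \<open>The centre\<close>

text \<open>Let K be the centre. The product in K \<otimes> K of Casimir elements for several
  generators is Casimir for all of them, since commutativity of K lets a generator pass the other
  factors.\<close>

lemma casimir_generators:
  assumes perfect: "perfect_field TYPE('k)" and ts: "set ts \<subseteq> centre"
  shows "\<exists>E. set E \<subseteq> centre \<times> centre \<and> tsum (\<odot>) E = e \<and> (\<forall>t\<in>set ts. casimir E t)"
  using ts
proof (induction ts)
  case Nil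
  have "set [(e, e)] \<subseteq> centre \<times> centre" "tsum (\<odot>) [(e, e)] = e" by (auto simp: centre_closed)
  then show ?case by (metis empty_iff list.set(1))
next
  case (Cons t ts)
  then obtain E where E: "set E \<subseteq> centre \<times> centre" "tsum (\<odot>) E = e" "\<forall>t\<in>set ts. casimir E t"
    by auto
  have t: "t \<in> centre" using Cons.prems by simp
  obtain E' where E': "set E' \<subseteq> centre \<times> centre" "tsum (\<odot>) E' = e" "casimir E' t"
    by (rule casimir_simple[OF perfect t])
  have c: "a \<odot> b = b \<odot> a" if "a \<in> centre" "b \<in> centre" for a b
    using centreD that by blast
  \<comment> \<open>\<open>E'\<close> is wrapped around \<open>E\<close>: x, y are the outer legs
    and u, v the inner ones.\<close>
  define EE where "EE = concat (map (\<lambda>(u, v). map (\<lambda>(x, y). (x \<odot> u, v \<odot> y)) E') E)"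
  have sum: "tsum F EE = tsum (\<lambda>u v. tsum (\<lambda>x y. F (x \<odot> u) (v \<odot> y)) E') E"
    for F :: "(nat \<Rightarrow> 'k) \<Rightarrow> (nat \<Rightarrow> 'k) \<Rightarrow> 'b::comm_monoid_add"
    unfolding EE_def by (simp add: tsum_concat tsum_map)
  have EE1: "set EE \<subseteq> centre \<times> centre" using E(1) E'(1) unfolding EE_def by (fastforce intro: centre_mult)
  have EE2: "tsum (\<odot>) EE = e"
  proof -
    have "tsum (\<odot>) EE = tsum (\<lambda>x y. tsum (\<lambda>u v. x \<odot> (u \<odot> v) \<odot> y) E) E'"
      unfolding sum by (subst tsum_swap) (simp add: m_assoc)
    also have "\<dots> = tsum (\<lambda>x y. x \<odot> e \<odot> y) E'"
      by (simp add: m_tsum_left[symmetric] m_tsum_right[symmetric] E(2))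
    also have "\<dots> = tsum (\<odot>) E'" 
    proof (rule tsum_cong)
      fix u v assume "(u, v) \<in> set E'"
      then have "u \<in> centre" using E'(1) by auto
      then show "u \<odot> e \<odot> v = u \<odot> v" using centreD(1) by simp
    qed
    finally show ?thesis using E'(2) by simp
  qed
  have EE3: "casimir EE s" if s: "s \<in> set ts" for s
    unfolding casimir_def
  proof (intro allI impI)
    fix B :: "(nat \<Rightarrow> 'k) \<Rightarrow> (nat \<Rightarrow> 'k) \<Rightarrow> 'k" assume B: "bilin B"
    have sc: "s \<in> centre" using s Cons.prems by auto
    have "tsum (\<lambda>u v. B (s \<odot> u) v) EE = tsum (\<lambda>x y. tsum (\<lambda>u v. B (s \<odot> (x \<odot> u)) (v \<odot> y)) E) E'"
      unfolding sum by (rule tsum_swap)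
    also have "\<dots> = tsum (\<lambda>x y. tsum (\<lambda>u v. B (x \<odot> (s \<odot> u)) (v \<odot> y)) E) E'"
      using E'(1) sc by (intro tsum_cong) (auto simp: c m_assoc[symmetric])
    also have "\<dots> = tsum (\<lambda>x y. tsum (\<lambda>u v. B (x \<odot> u) (v \<odot> s \<odot> y)) E) E'"
      using casimirD[OF _ bilin_mult[OF B]] E(3) s by (simp cong: tsum_cong)
    also have "\<dots> = tsum (\<lambda>x y. tsum (\<lambda>u v. B (x \<odot> u) (v \<odot> y \<odot> s)) E) E'"
      using E'(1) sc by (intro tsum_cong) (auto simp: c m_assoc)
    also have "\<dots> = tsum (\<lambda>u v. B u (v \<odot> s)) EE"
      unfolding sum by (rule tsum_swap)
    finally show "tsum (\<lambda>u v. B (s \<odot> u) v) EE = tsum (\<lambda>u v. B u (v \<odot> s)) EE" .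
  qed
  have EE4: "casimir EE t"
    unfolding casimir_def
  proof (intro allI impI)
    fix B :: "(nat \<Rightarrow> 'k) \<Rightarrow> (nat \<Rightarrow> 'k) \<Rightarrow> 'k" assume B: "bilin B"
    have bil: "bilin (\<lambda>x y. B (x \<odot> u) (v \<odot> y))" for u v
      by (simp add: bilin_def m_add_left m_add_right m_scale_left m_scale_right bilinD[OF B])
    have "tsum (\<lambda>u v. B (t \<odot> u) v) EE = tsum (\<lambda>u v. tsum (\<lambda>x y. B ((t \<odot> x) \<odot> u) (v \<odot> y)) E') E"
      unfolding sum by (simp add: m_assoc)
    also have "\<dots> = tsum (\<lambda>u v. tsum (\<lambda>x y. B (x \<odot> u) (v \<odot> (y \<odot> t))) E') E"
      using casimirD[OF E'(3) bil] by simp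
    also have "\<dots> = tsum (\<lambda>u v. B u (v \<odot> t)) EE"
      unfolding sum by (simp add: m_assoc)
    finally show "tsum (\<lambda>u v. B (t \<odot> u) v) EE = tsum (\<lambda>u v. B u (v \<odot> t)) EE" .
  qed
  have EE5: "\<forall>s\<in>set (t # ts). casimir EE s" using EE3 EE4 by simp
  show ?case by (rule exI[of _ EE]) (intro conjI EE1 EE2 EE5)
qed

text \<open>The condition \<open>casimir E d\<close> is linear in \<open>d\<close>, so a finite
  basis of the centre provides enough generators.\<close>

lemma casimir_centre:
  assumes perfect: "perfect_field TYPE('k)"
  obtains E where "set E \<subseteq> centre \<times> centre" "tsum (\<odot>) E = e" "\<And>d. d \<in> centre \<Longrightarrow> casimir E d"
proof -
  interpret P: vector_space "pscale :: 'k \<Rightarrow> (nat \<Rightarrow> 'k) \<Rightarrow> _" by (rule vector_space_pscale)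
  have sub: "P.subspace centre" by (rule P.subspaceI) (auto simp: centre_closed simp del: zero_fun_apply)
  have span: "centre \<subseteq> P.span (unit_vec ` {..<n})" unfolding span_unit_vec by (auto simp: centre_def)
  obtain T where T: "finite T" "P.independent T" "P.span T = centre" "T \<subseteq> centre" "card T = P.dim centre"
    by (rule P.finite_span_subspace[OF sub finite_imageI[OF finite_lessThan] span])
  obtain ts where ts: "set ts = T" using finite_list[OF T(1)] by blast
  obtain E where E: "set E \<subseteq> centre \<times> centre" "tsum (\<odot>) E = e" "\<forall>t\<in>set ts. casimir E t"
    using casimir_generators[OF perfect, of ts] ts T(4) by auto
  have zero: "casimir E 0"
    using casimir_scale[of E _ 0] by (simp add: casimir_def bilinD)
  have "casimir E d" if "d \<in> P.span T" for d
    using that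
  proof (induction rule: P.span_induct_alt)
    case base
    show "casimir E 0" by (rule zero)
  next
    case (step a t d)
    then show "casimir E (pscale a t + d)" using E(3) ts by (intro casimir_add casimir_scale) auto
  qed
  then show thesis using that[OF E(1,2)] unfolding T(3) by blast
qed

subsection \<open>Division algebras over their centre\<close>

text \<open>
  This says that \<open>D \<otimes>\<^bsub>K\<^esub> D \<rightarrow> End D\<close>, \<open>u \<otimes> v \<mapsto> (z \<mapsto> u z v)\<close> is injective for the centre \<open>K\<close> of \<open>D\<close>,
  where \<open>D \<otimes>\<^bsub>K\<^esub> D\<close> is embedded in \<open>D \<otimes> D\<close> by inserting the idempotent \<open>E\<close> of \<open>K \<otimes> K\<close>.  The
  induction shortens a relation \<open>\<Sum> u z v = 0\<close> by taking commutators of the normalised second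
  components.
\<close>

lemma two_sided_relation:
  assumes E: "set E \<subseteq> centre \<times> centre" "tsum (\<odot>) E = e" "\<And>d. d \<in> centre \<Longrightarrow> casimir E d"
    and L: "set L \<subseteq> V \<times> V" "\<And>z. z \<in> V \<Longrightarrow> tsum (\<lambda>u v. u \<odot> z \<odot> v) L = 0"
    and B: "bilin B"
  shows "tsum (\<lambda>u v. tsum (\<lambda>p q. B (u \<odot> p) (q \<odot> v)) E) L = 0"
  using L B
proof (induction "length L" arbitrary: L B rule: less_induct)
  case less
  show ?case
  proof (cases L)
    case Nil
    then show ?thesis by simp
  next
    case (Cons uv L')
    obtain u0 v0 where uv: "uv = (u0, v0)" by (cases uv)
    note L = Cons[unfolded uv]
    have mem: "u0 \<in> V" "v0 \<in> V" "set L' \<subseteq> V \<times> V" using less.prems(1) L by auto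
    show ?thesis
    proof (cases "v0 = 0")
      case True
      have "tsum (\<lambda>u v. tsum (\<lambda>p q. B (u \<odot> p) (q \<odot> v)) E) L' = 0"
        using less.hyps[of L' B] less.prems L mem True by simp
      then show ?thesis using L True bilinD(6)[OF less.prems(3)] by (simp add: tsum_zero)
    next
      case False
      obtain w where w: "w \<in> V" "v0 \<odot> w = e" "w \<odot> v0 = e" using m_inverse[OF mem(2) False] by blast
      \<comment> \<open>The value on the form \<open>B'\<close> of the relation \<open>L\<close>,
        with \<open>E\<close> inserted between its legs and \<open>g\<close> applied to its second
        components.\<close>
      define I where "I B' g = tsum (\<lambda>u v. tsum (\<lambda>p q. B' (u \<odot> p) (q \<odot> g v)) E) L"
        for B' :: "(nat \<Rightarrow> 'k) \<Rightarrow> (nat \<Rightarrow> 'k) \<Rightarrow> 'k" and g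
      \<comment> \<open>Replacing v by d v w - v w d keeps the relation and annihilates its first
        term, because v0 w = e; the induction hypothesis applies to the remaining terms.\<close>
      have comm: "I B' (\<lambda>v. d \<odot> (v \<odot> w)) = I B' (\<lambda>v. v \<odot> w \<odot> d)" if d: "d \<in> V" and B': "bilin B'" for d B'
      proof -
        let ?g = "\<lambda>v. d \<odot> (v \<odot> w) - v \<odot> w \<odot> d"
        have g0: "?g v0 = 0" using w(2) d by simp
        have gV: "?g v \<in> V" for v by (rule V_closed(3)) simp_all
        have rel: "tsum (\<lambda>u v. u \<odot> z \<odot> v) (map (\<lambda>(u, v). (u, ?g v)) L') = 0" if z: "z \<in> V" for z
        proof -
          have "tsum (\<lambda>u v. u \<odot> z \<odot> v) (map (\<lambda>(u, v). (u, ?g v)) L') = tsum (\<lambda>u v. u \<odot> z \<odot> ?g v) L"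
            using g0 by (simp add: tsum_map[where f = "\<lambda>u. u"] L)
          also have "\<dots> = tsum (\<lambda>u v. u \<odot> (z \<odot> d) \<odot> v) L \<odot> w - tsum (\<lambda>u v. u \<odot> z \<odot> v) L \<odot> w \<odot> d"
            by (simp add: m_tsum_left m_diff_right tsum_diff m_assoc)
          also have "\<dots> = 0" using less.prems(2) z by simp
          finally show ?thesis .
        qed
        have "tsum (\<lambda>u v. tsum (\<lambda>p q. B' (u \<odot> p) (q \<odot> v)) E) (map (\<lambda>(u, v). (u, ?g v)) L') = 0"
          using mem(3) gV by (intro less.hyps rel B') (auto simp: L)
        then have "tsum (\<lambda>u v. tsum (\<lambda>p q. B' (u \<odot> p) (q \<odot> ?g v)) E) L' = 0"
          by (simp add: tsum_map[where f = "\<lambda>u. u"])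
        then have "tsum (\<lambda>u v. tsum (\<lambda>p q. B' (u \<odot> p) (q \<odot> ?g v)) E) L = 0"
          using g0 by (simp add: L bilinD(6)[OF B'] tsum_zero)
        then show ?thesis
          by (simp add: I_def m_diff_right bilinD(12)[OF B'] tsum_diff)
      qed
      \<comment> \<open>When the left legs are written in coordinates, \<open>y j\<close> is the
        coefficient belonging to the j-th unit vector; \<open>comm\<close> makes it central.\<close>
      define y where "y j = tsum (\<lambda>u v. tsum (\<lambda>p q. pscale ((u \<odot> p) j) (q \<odot> (v \<odot> w))) E) L" for j
      have yV: "y j \<in> V" for j unfolding y_def by (intro tsum_mem V_closed(4)) simp
      have yc: "y j \<in> centre" for j
      proof -
        have "d \<odot> y j = y j \<odot> d" if d: "d \<in> V" for d
        proof
          fix i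
          have bil: "bilin (\<lambda>a b. a j * b i)" by (simp add: bilin_def pscale_def algebra_simps)
          have swap: "d \<odot> (q \<odot> c) = q \<odot> (d \<odot> c)" if "(p, q) \<in> set E" for p q c
          proof -
            have "q \<in> centre" using that E(1) by auto
            from centreD(2)[OF this d] show ?thesis by (simp flip: m_assoc)
          qed
          have "(d \<odot> y j) i = I (\<lambda>a b. a j * b i) (\<lambda>v. d \<odot> (v \<odot> w))"
            unfolding y_def I_def m_tsum_right tsum_apply
            by (intro tsum_cong) (simp add: m_scale_right pscale_apply swap)
          also have "\<dots> = (y j \<odot> d) i"
            unfolding comm[OF d bil] unfolding y_def I_def m_tsum_left tsum_apply
            by (intro tsum_cong) (simp add: m_scale_left pscale_apply m_assoc)
          finally show "(d \<odot> y j) i = (y j \<odot> d) i" .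
        qed
        with yV show ?thesis by (simp add: centre_def)
      qed
      define B0 where "B0 a b = B a (b \<odot> v0)" for a b
      have B0: "bilin B0" unfolding B0_def by (rule bilin_mult_right(1)[OF less.prems(3)])
      \<comment> \<open>The Casimir equation moves the leg q of one copy of \<open>E\<close> across
        the other copy, where it meets p and \<Sum> p q = e. So inserting \<open>E\<close> twice has
        the same effect as inserting it once.\<close>
      have idem: "tsum (\<lambda>p q. B0 (u \<odot> p) (q \<odot> c)) E =
          tsum (\<lambda>p q. tsum (\<lambda>p' q'. B0 (u \<odot> p \<odot> p') (q' \<odot> (q \<odot> c))) E) E" if u: "u \<in> V" for u c
      proof -
        have "tsum (\<lambda>p q. tsum (\<lambda>p' q'. B0 (u \<odot> p \<odot> p') (q' \<odot> (q \<odot> c))) E) E =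
            tsum (\<lambda>p q. tsum (\<lambda>p' q'. B0 (u \<odot> p \<odot> (q \<odot> p')) (q' \<odot> c)) E) E"
        proof (rule tsum_cong)
          fix p q assume "(p, q) \<in> set E"
          then have "casimir E q" using E(1,3) by auto
          from casimirD[OF this bilin_mult[OF B0, of "u \<odot> p" c]]
          show "tsum (\<lambda>p' q'. B0 (u \<odot> p \<odot> p') (q' \<odot> (q \<odot> c))) E =
              tsum (\<lambda>p' q'. B0 (u \<odot> p \<odot> (q \<odot> p')) (q' \<odot> c)) E"
            by (simp add: m_assoc)
        qed
        also have "\<dots> = tsum (\<lambda>p' q'. B0 (u \<odot> tsum (\<odot>) E \<odot> p') (q' \<odot> c)) E"
          by (subst tsum_swap) (simp add: m_tsum_left m_tsum_right bilinD(9)[OF B0] m_assoc)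
        finally show ?thesis using u E(2) by simp
      qed
      have ev: "v \<odot> w \<odot> v0 = v" if "v \<in> V" for v using that w(3) by (simp add: m_assoc)
      have LV: "u \<in> V" "v \<in> V" if "(u, v) \<in> set L" for u v using less.prems(1) that by auto
      have "tsum (\<lambda>u v. tsum (\<lambda>p q. B (u \<odot> p) (q \<odot> v)) E) L =
          tsum (\<lambda>u v. tsum (\<lambda>p q. B0 (u \<odot> p) (q \<odot> (v \<odot> w))) E) L"
        unfolding B0_def using ev LV by (intro tsum_cong) (simp add: m_assoc)
      also have "\<dots> = tsum (\<lambda>u v. tsum (\<lambda>p q. tsum (\<lambda>p' q'. B0 (u \<odot> p \<odot> p') (q' \<odot> (q \<odot> (v \<odot> w)))) E) E) L"
        by (intro tsum_cong idem LV)
      also have "\<dots> = tsum (\<lambda>u v. tsum (\<lambda>p' q'. tsum (\<lambda>p q. B0 (u \<odot> p \<odot> p') (q' \<odot> (q \<odot> (v \<odot> w)))) E) E) L"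
        by (intro tsum_cong tsum_swap)
      also have "\<dots> = tsum (\<lambda>p' q'. tsum (\<lambda>u v. tsum (\<lambda>p q. B0 (u \<odot> p \<odot> p') (q' \<odot> (q \<odot> (v \<odot> w)))) E) L) E"
        by (rule tsum_swap)
      also have "\<dots> = tsum (\<lambda>p' q'. \<Sum>j<n. B0 (unit_vec j \<odot> p') (q' \<odot> y j)) E"
      proof (rule tsum_cong)
        fix p' q'
        have "B0 (a \<odot> p') c = (\<Sum>j<n. B0 (unit_vec j \<odot> p') (pscale (a j) c))" if "a \<in> V" for a c
          by (subst coord_space_expand[OF that])
            (simp add: m_sum_left m_scale_left bilinD(3,4,7)[OF B0])
        then have "tsum (\<lambda>u v. tsum (\<lambda>p q. B0 (u \<odot> p \<odot> p') (q' \<odot> (q \<odot> (v \<odot> w)))) E) L =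
            tsum (\<lambda>u v. tsum (\<lambda>p q. \<Sum>j<n. B0 (unit_vec j \<odot> p') (pscale ((u \<odot> p) j) (q' \<odot> (q \<odot> (v \<odot> w))))) E) L"
          by simp
        also have "\<dots> = (\<Sum>j<n. B0 (unit_vec j \<odot> p') (q' \<odot> y j))"
          by (simp add: tsum_sum y_def m_tsum_right m_scale_right bilinD(10)[OF B0])
        finally show "tsum (\<lambda>u v. tsum (\<lambda>p q. B0 (u \<odot> p \<odot> p') (q' \<odot> (q \<odot> (v \<odot> w)))) E) L =
            (\<Sum>j<n. B0 (unit_vec j \<odot> p') (q' \<odot> y j))" .
      qed
      also have "\<dots> = (\<Sum>j<n. tsum (\<lambda>p' q'. B0 (unit_vec j \<odot> p') (q' \<odot> y j)) E)"
        by (rule tsum_sum)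
      \<comment> \<open>Being central, \<open>y j\<close> crosses \<open>E\<close> to the left leg.
        There the sum over j reassembles to \<Sum> u p q v w = \<Sum> u v w, which is the relation
        at z = e times w, hence 0.\<close>
      also have "\<dots> = (\<Sum>j<n. tsum (\<lambda>p' q'. B0 (unit_vec j \<odot> (y j \<odot> p')) q') E)"
      proof (rule sum.cong[OF refl])
        fix j
        have "bilin (\<lambda>a b. B0 (unit_vec j \<odot> a) b)"
          by (simp add: bilin_def m_add_right m_scale_right bilinD[OF B0])
        from casimirD[OF E(3)[OF yc] this]
        show "tsum (\<lambda>p' q'. B0 (unit_vec j \<odot> p') (q' \<odot> y j)) E =
            tsum (\<lambda>p' q'. B0 (unit_vec j \<odot> (y j \<odot> p')) q') E" by simp
      qed
      also have "\<dots> = tsum (\<lambda>p' q'. B0 ((\<Sum>j<n. unit_vec j \<odot> y j) \<odot> p') q') E"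
        by (simp add: tsum_sum[symmetric] m_sum_left bilinD(7)[OF B0] m_assoc)
      also have "(\<Sum>j<n. unit_vec j \<odot> y j) = tsum (\<lambda>u v. tsum (\<lambda>p q. u \<odot> p \<odot> (q \<odot> (v \<odot> w))) E) L"
      proof -
        have "(\<Sum>j<n. unit_vec j \<odot> y j) =
            tsum (\<lambda>u v. tsum (\<lambda>p q. (\<Sum>j<n. pscale ((u \<odot> p) j) (unit_vec j)) \<odot> (q \<odot> (v \<odot> w))) E) L"
          by (simp add: y_def m_tsum_right m_scale_right m_sum_left m_scale_left tsum_sum)
        then show ?thesis by (simp add: coord_space_expand[OF m_mem, symmetric])
      qed
      also have "\<dots> = tsum (\<lambda>u v. u \<odot> tsum (\<odot>) E \<odot> v) L \<odot> w"
        by (simp add: m_tsum_left m_tsum_right m_assoc)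
      also have "\<dots> = 0" using less.prems(2)[OF e_mem] E(2) by simp
      finally show ?thesis by (simp add: bilinD(5)[OF B0] tsum_zero del: zero_fun_apply)
    qed
  qed
qed

theorem separability:
  assumes perfect: "perfect_field TYPE('k)"
  obtains E where "set E \<subseteq> V \<times> V" "tsum (\<odot>) E = e" "\<And>d. d \<in> V \<Longrightarrow> casimir E d"
proof -
  \<comment> \<open>Any coordinate that is nonzero at \<open>e\<close> gives a Frobenius form (y, z)
    |-> (y z)(i0); it is nondegenerate because a nonzero y has an inverse.\<close>
  obtain i0 where i0: "e i0 \<noteq> 0" using e_nonzero by (auto simp: fun_eq_iff)
  then have i0n: "i0 < n" using e_mem by (auto simp: coord_space_def not_less intro: ccontr)
  define G where "G y = (\<lambda>j. if j < n then (y \<odot> unit_vec j) i0 else 0)" for y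
  have G_add: "G (a + b) = G a + G b" for a b by (auto simp: G_def m_add_left fun_eq_iff)
  have G_scale: "G (pscale r a) = pscale r (G a)" for r a
    by (auto simp: G_def m_scale_left pscale_apply fun_eq_iff)
  have G_eval: "(y \<odot> z) i0 = (\<Sum>j<n. z j * G y j)" if "z \<in> V" for y z
    by (subst coord_space_expand[OF that])
      (simp add: m_sum_right m_scale_right sum_fun_apply pscale_apply G_def)
  have G_inj: "y = 0" if y: "y \<in> V" "G y = 0" for y
  proof (rule ccontr)
    assume "y \<noteq> 0"
    then obtain z where "z \<in> V" "y \<odot> z = e" using m_inverse y(1) by blast
    then have "e i0 = 0" using G_eval[of z y] y(2) by simp
    then show False using i0 by simp
  qed
  have "G ` V = V"
    using finite_dim_inj_surj[OF is_vspace_coord finite_dim_coord, of n G] G_add G_scale G_inj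
    by (auto simp: linear_map_def G_def coord_space_def)
  then have "\<forall>i<n. \<exists>y\<in>V. G y = unit_vec i" by (metis imageE unit_vec_mem)
  \<comment> \<open>\<open>vs\<close> is the basis dual to the unit vectors with respect to the
    Frobenius form.\<close>
  then obtain vs where vs: "\<And>i. i < n \<Longrightarrow> vs i \<in> V" "\<And>i. i < n \<Longrightarrow> G (vs i) = unit_vec i" by metis
  have coord: "(vs i \<odot> z) i0 = z i" if "i < n" "z \<in> V" for i z
  proof -
    have "(vs i \<odot> z) i0 = (\<Sum>j<n. if j = i then z j else 0)"
      unfolding G_eval[OF that(2)] by (intro sum.cong) (auto simp: vs(2)[OF that(1)] unit_vec_def)
    then show ?thesis using that(1) by simp
  qed
  have expand: "y = (\<Sum>j<n. pscale ((y \<odot> unit_vec j) i0) (vs j))" if y: "y \<in> V" for y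
  proof -
    let ?s = "\<Sum>j<n. pscale ((y \<odot> unit_vec j) i0) (vs j)"
    have sV: "?s \<in> V" using vs(1) by (intro V_closed(4,5)) auto
    have G_sum: "G (\<Sum>j<n. f j) = (\<Sum>j<n. G (f j))" for f :: "nat \<Rightarrow> _"
      by (rule additive.sum[of G]) (simp add: additive.intro G_add)
    have "G ?s = (\<Sum>j<n. pscale (G y j) (unit_vec j))"
      unfolding G_sum by (intro sum.cong) (auto simp: G_scale vs(2), simp add: G_def)
    also have "\<dots> = G y" by (rule coord_space_expand[symmetric]) (simp add: G_def coord_space_def)
    finally have "G (y - ?s) = 0"
      using G_add[of "y - ?s" ?s] by simp
    then show ?thesis using G_inj[OF V_closed(3)[OF y sV]] by simp
  qed
  \<comment> \<open>Left multiplication by \<open>d\<close> on the unit vectors and right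
    multiplication by \<open>d\<close> on the dual basis have transposed matrices.\<close>
  have dual_bases: "(\<Sum>i<n. B (d \<odot> unit_vec i) (vs i)) = (\<Sum>i<n. B (unit_vec i) (vs i \<odot> d))"
    if d: "d \<in> V" and B: "bilin B" for d B
  proof -
    have "(\<Sum>i<n. B (d \<odot> unit_vec i) (vs i)) =
        (\<Sum>i<n. \<Sum>j<n. (d \<odot> unit_vec i) j * B (unit_vec j) (vs i))"
    proof (rule sum.cong[OF refl])
      fix i
      have "B (d \<odot> unit_vec i) (vs i) = B (\<Sum>j<n. pscale ((d \<odot> unit_vec i) j) (unit_vec j)) (vs i)"
        using coord_space_expand[OF m_mem, of d "unit_vec i"] by (rule arg_cong)
      then show "B (d \<odot> unit_vec i) (vs i) = (\<Sum>j<n. (d \<odot> unit_vec i) j * B (unit_vec j) (vs i))"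
        by (simp add: bilinD(3,7)[OF B])
    qed
    also have "\<dots> = (\<Sum>j<n. \<Sum>i<n. (d \<odot> unit_vec i) j * B (unit_vec j) (vs i))"
      by (rule sum.swap)
    also have "\<dots> = (\<Sum>i<n. B (unit_vec i) (vs i \<odot> d))"
    proof (rule sum.cong[OF refl])
      fix j assume j: "j \<in> {..<n}"
      have "vs j \<odot> d = (\<Sum>i<n. pscale ((vs j \<odot> d \<odot> unit_vec i) i0) (vs i))" by (rule expand) simp
      also have "\<dots> = (\<Sum>i<n. pscale ((d \<odot> unit_vec i) j) (vs i))"
        using j by (intro sum.cong) (simp_all add: m_assoc coord)
      finally have eq: "vs j \<odot> d = (\<Sum>i<n. pscale ((d \<odot> unit_vec i) j) (vs i))" .
      show "(\<Sum>i<n. (d \<odot> unit_vec i) j * B (unit_vec j) (vs i)) = B (unit_vec j) (vs j \<odot> d)"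
        unfolding eq by (simp add: bilinD(4,8)[OF B])
    qed
    finally show ?thesis .
  qed
  define L where "L = map (\<lambda>i. (unit_vec i :: nat \<Rightarrow> 'k, vs i)) [0..<n]"
  have LV: "set L \<subseteq> V \<times> V" using vs(1) by (auto simp: L_def unit_vec_mem)
  have tsum_L: "tsum F L = (\<Sum>i<n. F (unit_vec i) (vs i))" for F :: "_ \<Rightarrow> _ \<Rightarrow> 'b::comm_monoid_add"
  proof -
    have "tsum F (map (\<lambda>i. (unit_vec i, vs i)) is) = (\<Sum>i\<leftarrow>is. F (unit_vec i) (vs i))" for "is"
      by (induction "is") auto
    then show ?thesis by (simp add: L_def interv_sum_list_conv_sum_set_nat atLeast0LessThan)
  qed
  have casL: "casimir L d" if "d \<in> V" for d
    unfolding casimir_def tsum_L using dual_bases[OF that] by blast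
  define T where "T z = tsum (\<lambda>u v. u \<odot> z \<odot> v) L" for z
  \<comment> \<open>Were \<open>T\<close> identically 0, \<open>two_sided_relation\<close> would
    apply to the dual bases. With the form chosen below, its conclusion says that the coordinate
    \<open>i0\<close> of \<Sum> q p = e is 0, a contradiction.\<close>
  have "\<exists>z\<in>V. T z \<noteq> 0"
  proof (rule ccontr)
    assume "\<not> (\<exists>z\<in>V. T z \<noteq> 0)"
    then have T0: "\<And>z. z \<in> V \<Longrightarrow> tsum (\<lambda>u v. u \<odot> z \<odot> v) L = 0" by (simp add: T_def)
    obtain E where E: "set E \<subseteq> centre \<times> centre" "tsum (\<odot>) E = e" "\<And>d. d \<in> centre \<Longrightarrow> casimir E d"
      using casimir_centre[OF perfect] by metis
    have bil: "bilin (\<lambda>a b. a i0 * (b \<odot> e) i0)"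
      by (simp add: bilin_def m_add_left m_scale_left pscale_apply algebra_simps)
    have "0 = tsum (\<lambda>u v. tsum (\<lambda>p q. (u \<odot> p) i0 * (q \<odot> v \<odot> e) i0) E) L"
      using two_sided_relation[OF E LV T0 bil] by simp
    also have "\<dots> = tsum (\<lambda>p q. \<Sum>i<n. (unit_vec i \<odot> p) i0 * (q \<odot> vs i \<odot> e) i0) E"
      by (subst tsum_swap) (simp add: tsum_L)
    also have "\<dots> = tsum (\<lambda>p q. (q \<odot> p) i0) E"
    proof (rule tsum_cong)
      fix p q assume "(p, q) \<in> set E"
      then have pq: "p \<in> V" "q \<in> V" "q \<in> centre" using E(1) by (auto dest: centreD(1))
      have "(q \<odot> vs i \<odot> e) i0 = q i" if "i < n" for i
        using coord[OF that pq(2)] centreD(2)[OF pq(3) vs(1)[OF that]] by simp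
      then have "(\<Sum>i<n. (unit_vec i \<odot> p) i0 * (q \<odot> vs i \<odot> e) i0) = (\<Sum>i<n. q i * (unit_vec i \<odot> p) i0)"
        by (simp add: mult.commute)
      also have "\<dots> = ((\<Sum>i<n. pscale (q i) (unit_vec i)) \<odot> p) i0"
        by (simp add: m_sum_left m_scale_left sum_fun_apply pscale_apply)
      finally show "(\<Sum>i<n. (unit_vec i \<odot> p) i0 * (q \<odot> vs i \<odot> e) i0) = (q \<odot> p) i0"
        by (simp add: coord_space_expand[OF pq(2), symmetric])
    qed
    also have "\<dots> = tsum (\<odot>) E i0"
      unfolding tsum_apply using E(1) centreD by (intro tsum_cong) force
    finally show False using E(2) i0 by simp
  qed
  then obtain z where z: "z \<in> V" "T z \<noteq> 0" by blast
  have "d \<odot> T z = T z \<odot> d" if d: "d \<in> V" for d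
  proof
    fix i
    have bil: "bilin (\<lambda>a b. (a \<odot> z \<odot> b) i)"
      by (rule bilin_component) (simp_all add: m_add_left m_scale_left)
    show "(d \<odot> T z) i = (T z \<odot> d) i"
      using casimirD[OF casL[OF d] bil]
      by (simp add: T_def m_tsum_left m_tsum_right tsum_apply m_assoc)
  qed
  then have "T z \<in> centre" unfolding centre_def T_def using tsum_mem[of L "\<lambda>u v. u \<odot> z \<odot> v"] by simp
  then obtain c where c: "c \<in> centre" "T z \<odot> c = e" using centre_inverse z(2) by metis
  \<comment> \<open>Inserting \<open>z\<close> and dividing by the central element
    \<open>T z\<close> makes the product equal to \<open>e\<close> and keeps the Casimir
    property.\<close>
  let ?E = "map (\<lambda>(u, v). (u \<odot> z, v \<odot> c)) L"
  have "set ?E \<subseteq> V \<times> V" by auto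
  moreover have "tsum (\<odot>) ?E = e"
    using c(2) by (simp add: tsum_map T_def m_tsum_left m_assoc)
  moreover have "casimir ?E d" if d: "d \<in> V" for d
    unfolding casimir_def
  proof (intro allI impI)
    fix B :: "(nat \<Rightarrow> 'k) \<Rightarrow> (nat \<Rightarrow> 'k) \<Rightarrow> 'k" assume B: "bilin B"
    show "tsum (\<lambda>u v. B (d \<odot> u) v) ?E = tsum (\<lambda>u v. B u (v \<odot> d)) ?E"
      using casimirD[OF casL[OF d] bilin_mult_right(2)[OF B, of z c]] centreD(2)[OF c(1) d]
      by (simp add: tsum_map m_assoc)
  qed
  ultimately show thesis by (rule that)
qed

end

section \<open>The residue division algebra\<close>

context coalg
begin

definition cpow :: "('c \<Rightarrow> 'k) \<Rightarrow> nat \<Rightarrow> 'c \<Rightarrow> 'k" where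
  "cpow p n = ((\<star>) p ^^ n) eps"

lemma cpow_0 [simp]: "cpow p 0 = eps"
  by (simp add: cpow_def)

lemma cpow_Suc: "cpow p (Suc n) = p \<star> cpow p n"
  by (simp add: cpow_def)

lemma cpow_mem [simp]: "cpow p n \<in> A"
  by (cases n) (simp_all add: cpow_Suc)

lemma cpow_add: "p \<in> A \<Longrightarrow> cpow p (m + n) = cpow p m \<star> cpow p n"
  by (induction m) (simp_all add: cpow_Suc conv_eps_left conv_assoc)

lemma cpow_1: "p \<in> A \<Longrightarrow> cpow p (Suc 0) = p"
  by (simp add: cpow_Suc conv_eps_right)

lemma R_cpow:
  assumes p: "p \<in> A" and c: "c \<in> vecs C" shows "R (cpow p n) c = (R p ^^ n) c"
  using c
proof (induction n arbitrary: c)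
  case (Suc n)
  have "R (cpow p (Suc n)) c = R (cpow p n) (R p c)"
    using R_conv[OF p cpow_mem Suc.prems] by (simp add: cpow_Suc)
  also have "\<dots> = (R p ^^ n) (R p c)" using Suc p by simp
  finally show ?case by (simp add: funpow_swap1)
qed (simp add: R_eps)

lemma R_cpow_surj:
  assumes p: "p \<in> A" and surj: "R p ` vecs C = vecs C" shows "R (cpow p n) ` vecs C = vecs C"
proof (induction n)
  case 0
  show ?case using R_eps by force
next
  case (Suc n)
  have "R (cpow p (Suc n)) ` vecs C = R (cpow p n) ` (R p ` vecs C)"
    using p by (force simp: cpow_Suc R_conv)
  then show ?case using surj Suc by simp
qed

lemma tsum_mem_A: "(\<And>u v. (u, v) \<in> set E \<Longrightarrow> F u v \<in> A) \<Longrightarrow> tsum F E \<in> A"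
  by (induction E) (auto simp: A_add A_zero simp del: zero_fun_apply)

lemma conv_tsum_left:
  "(\<And>u v. F u v \<in> A) \<Longrightarrow> q \<in> A \<Longrightarrow> tsum F E \<star> q = tsum (\<lambda>u v. F u v \<star> q) E"
proof (induction E)
  case (Cons z E)
  obtain u v where "z = (u, v)" by (cases z)
  with Cons show "tsum F (z # E) \<star> q = tsum (\<lambda>u v. F u v \<star> q) (z # E)"
    by (simp add: conv_add_left tsum_mem_A)
qed (simp add: conv_zero_left del: zero_fun_apply)

lemma conv_tsum_right:
  "(\<And>u v. F u v \<in> A) \<Longrightarrow> q \<in> A \<Longrightarrow> q \<star> tsum F E = tsum (\<lambda>u v. q \<star> F u v) E"
proof (induction E)
  case (Cons z E)
  obtain u v where "z = (u, v)" by (cases z)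
  with Cons show "q \<star> tsum F (z # E) = tsum (\<lambda>u v. q \<star> F u v) (z # E)"
    by (simp add: conv_add_right tsum_mem_A)
qed (simp add: conv_zero_right del: zero_fun_apply)

end

context uniformized
begin

lemma M_sub: "VC.subspace M" "m \<in> M \<Longrightarrow> m \<in> vecs C" "p \<in> A \<Longrightarrow> m \<in> M \<Longrightarrow> L p m \<in> M"
  using M_coideal by (auto simp: right_coideal_iff)

definition basis :: "'c list" where
  "basis = (SOME bs. distinct bs \<and> VC.independent (set bs) \<and> VC.span (set bs) = M)"

abbreviation rank :: nat where "rank \<equiv> length basis"

lemma basis: "distinct basis" "VC.independent (set basis)" "VC.span (set basis) = M"
proof -
  obtain F where F: "finite F" "M \<subseteq> VC.span F" using M_finite by blast
  obtain B where B: "finite B" "VC.independent B" "VC.span B = M"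
    by (rule VC.finite_span_subspace[OF M_sub(1) F])
  obtain bs where "set bs = B" "distinct bs" using finite_distinct_list[OF B(1)] by blast
  with B have "\<exists>bs. distinct bs \<and> VC.independent (set bs) \<and> VC.span (set bs) = M" by blast
  from someI_ex[OF this]
  show "distinct basis" "VC.independent (set basis)" "VC.span (set basis) = M"
    unfolding basis_def by blast+
qed

lemma basis_mem: "i < rank \<Longrightarrow> basis ! i \<in> M"
  using VC.span_base[of "basis ! i" "set basis"] by (simp add: basis(3))

text \<open>Restriction of functionals to \<open>M\<close>, in coordinates: the residue map from
  \<open>A\<close> onto M^*. Coordinates give the residue algebra a type that does not depend on
  \<open>C\<close>.\<close>

definition coords :: "('c \<Rightarrow> 'k) \<Rightarrow> nat \<Rightarrow> 'k" where
  "coords p = (\<lambda>i. if i < rank then p (basis ! i) else 0)"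

definition dual_vec :: "nat \<Rightarrow> 'c \<Rightarrow> 'k" where
  "dual_vec j = (SOME p. p \<in> A \<and> (\<forall>i<rank. p (basis ! i) = (if i = j then 1 else 0)))"

definition sec :: "(nat \<Rightarrow> 'k) \<Rightarrow> 'c \<Rightarrow> 'k" where
  "sec f = (\<Sum>j<rank. pscale (f j) (dual_vec j))"

text \<open>The product of \<open>A\<close> modulo the functionals vanishing on \<open>M\<close>,
  transported through the linear section \<open>sec\<close>; \<open>coords_conv\<close> shows that
  it does not depend on the section.\<close>

definition dmult :: "(nat \<Rightarrow> 'k) \<Rightarrow> (nat \<Rightarrow> 'k) \<Rightarrow> nat \<Rightarrow> 'k" (infixl "\<odot>" 70) where
  "f \<odot> g = coords (sec f \<star> sec g)"

definition de :: "nat \<Rightarrow> 'k" where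
  "de = coords eps"

abbreviation V where "V \<equiv> (coord_space rank :: (nat \<Rightarrow> 'k) set)"

lemma dual_vec: "dual_vec j \<in> A" "i < rank \<Longrightarrow> dual_vec j (basis ! i) = (if i = j then 1 else 0)"
proof -
  have sub: "set basis \<subseteq> vecs C" using M_sub(2) VC.span_base basis(3) by blast
  obtain p where p: "p \<in> A" "\<And>b. b \<in> set basis \<Longrightarrow> p b = (if j < rank \<and> b = basis ! j then 1 else 0)"
    using dual_prescribe[OF vspace basis(2) sub, of "\<lambda>b. if j < rank \<and> b = basis ! j then 1 else 0"] by metis
  have "p (basis ! i) = (if i = j then 1 else 0)" if "i < rank" for i
    using p(2)[of "basis ! i"] that nth_eq_iff_index_eq[OF basis(1)] by auto
  with p(1) have "\<exists>p. p \<in> A \<and> (\<forall>i<rank. p (basis ! i) = (if i = j then 1 else 0))" by blast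
  from someI_ex[OF this]
  show "dual_vec j \<in> A" "i < rank \<Longrightarrow> dual_vec j (basis ! i) = (if i = j then 1 else 0)"
    unfolding dual_vec_def by blast+
qed

lemma sec_mem [simp]: "sec f \<in> A"
  unfolding sec_def by (intro A_sum A_pscale dual_vec)

lemma sec_add: "sec (f + g) = sec f + sec g"
  by (simp add: sec_def pscale_rules sum.distrib)

lemma sec_scale: "sec (pscale r f) = pscale r (sec f)"
  by (rule ext) (simp add: sec_def pscale_apply sum_fun_apply sum_distrib_left mult.assoc)

lemma coords_mem [simp]: "coords p \<in> V"
  by (simp add: coords_def coord_space_def)

lemma coords_add: "coords (p + q) = coords p + coords q"
  by (auto simp: coords_def fun_eq_iff)

lemma coords_diff: "coords (p - q) = coords p - coords q"
  by (auto simp: coords_def fun_eq_iff)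

lemma coords_scale: "coords (pscale r p) = pscale r (coords p)"
  by (auto simp: coords_def pscale_def fun_eq_iff)

lemma coords_sec: assumes f: "f \<in> V" shows "coords (sec f) = f"
proof
  fix i
  have "sec f (basis ! i) = (\<Sum>j<rank. if j = i then f j else 0)" if "i < rank"
    unfolding sec_def sum_fun_apply
    using that by (intro sum.cong) (auto simp: pscale_apply dual_vec(2))
  then show "coords (sec f) i = f i" using f by (auto simp: coords_def coord_space_def)
qed

lemma coords_eq_zero_iff: assumes p: "p \<in> A" shows "coords p = 0 \<longleftrightarrow> (\<forall>m\<in>M. p m = 0)"
proof
  assume "\<forall>m\<in>M. p m = 0"
  then show "coords p = 0" by (auto simp: coords_def fun_eq_iff basis_mem)
next
  assume 0: "coords p = 0"
  have pb: "p b = 0" if b: "b \<in> set basis" for b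
  proof -
    obtain i where "i < rank" "b = basis ! i" using b by (auto simp: in_set_conv_nth)
    then show ?thesis using fun_cong[OF 0, of i] by (simp add: coords_def)
  qed
  have "m \<in> vecs C \<and> p m = 0" if "m \<in> VC.span (set basis)" for m
    using that
  proof (induction rule: VC.span_induct_alt)
    case base
    show ?case using A_app(1)[OF p] by simp
  next
    case (step c b y)
    then have "b \<in> vecs C" using VC.span_base basis(3) M_sub(2) by blast
    then show ?case using step pb p by (simp add: A_app(2,4))
  qed
  then show "\<forall>m\<in>M. p m = 0" by (simp add: basis(3))
qed

text \<open>(q \<star> p)(m) = p(R q m), and \<open>R q\<close> preserves \<open>M\<close>. For
  \<open>ideal_right\<close> the operator is \<open>L q\<close>, which preserves \<open>M\<close>
  because \<open>M\<close> is a coideal. So the kernel of \<open>coords\<close> is a two-sided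
  ideal.\<close>

lemma ideal_left: "q \<in> A \<Longrightarrow> p \<in> A \<Longrightarrow> coords p = 0 \<Longrightarrow> coords (q \<star> p) = 0"
  using R_preserves R_eval M_sub(2) by (metis coords_eq_zero_iff conv_mem)

lemma ideal_right: "q \<in> A \<Longrightarrow> p \<in> A \<Longrightarrow> coords p = 0 \<Longrightarrow> coords (p \<star> q) = 0"
  using M_sub L_eval by (metis coords_eq_zero_iff conv_mem)

lemma coords_conv_cong:
  assumes mem: "p \<in> A" "p' \<in> A" "q \<in> A" "q' \<in> A" and eq: "coords p = coords p'" "coords q = coords q'"
  shows "coords (p \<star> q) = coords (p' \<star> q')"
proof -
  have "p \<star> q - p' \<star> q' = (p - p') \<star> q + p' \<star> (q - q')"
    using mem by (simp add: conv_diff_left conv_diff_right)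
  moreover have "coords ((p - p') \<star> q) = 0" "coords (p' \<star> (q - q')) = 0"
    using mem eq by (simp_all add: ideal_left ideal_right coords_diff)
  ultimately have "coords (p \<star> q - p' \<star> q') = 0" by (simp add: coords_add)
  then show ?thesis by (simp add: coords_diff)
qed

lemma coords_conv: "p \<in> A \<Longrightarrow> q \<in> A \<Longrightarrow> coords (p \<star> q) = coords p \<odot> coords q"
  unfolding dmult_def by (intro coords_conv_cong) (simp_all add: coords_sec)

lemma coords_unit:
  assumes p: "p \<in> A" "coords p \<noteq> 0"
  obtains q where "q \<in> A" "p \<star> q = eps" "q \<star> p = eps"
  using unit[OF p(1)] p coords_eq_zero_iff by metis

text \<open>Every functional r satisfies r(m) = eps(L r m), so a counit vanishing on
  \<open>M\<close> would make \<open>M\<close> zero.\<close>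

lemma eps_nonzero: "coords eps \<noteq> 0"
proof
  assume "coords eps = 0"
  then have 0: "eps m = 0" if "m \<in> M" for m using that by (simp add: coords_eq_zero_iff)
  obtain m where m: "m \<in> M" "m \<noteq> 0" using M_nonzero by blast
  have "r m = r 0" if r: "r \<in> A" for r
    using L_eval[OF eps_mem r, of m] conv_eps_left[OF r] 0[OF M_sub(3)[OF r m(1)]] m(1) M_sub(2)
      A_app(1)[OF r] by simp
  then have "m = 0" using m(1) M_sub(2) by (intro C_eqI) simp_all
  then show False using m(2) by simp
qed

text \<open>Inverses come from \<open>A\<close> itself: a functional with nonzero residue is a unit
  there, and the residue of its inverse is the inverse of its residue.\<close>

sublocale D: coord_division rank dmult de
proof
  fix a b c :: "nat \<Rightarrow> 'k" and r :: 'k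
  show "(a + b) \<odot> c = a \<odot> c + b \<odot> c" "a \<odot> (b + c) = a \<odot> b + a \<odot> c"
    "pscale r a \<odot> b = pscale r (a \<odot> b)" "a \<odot> pscale r b = pscale r (a \<odot> b)"
    by (simp_all add: dmult_def sec_add sec_scale conv_add_left conv_add_right conv_pscale_left
        conv_pscale_right coords_add coords_scale)
  show "(a \<odot> b) \<odot> c = a \<odot> (b \<odot> c)"
  proof -
    have "(a \<odot> b) \<odot> c = coords (sec a \<star> sec b \<star> sec c)"
      unfolding dmult_def[of "a \<odot> b"] by (intro coords_conv_cong) (simp_all add: dmult_def coords_sec)
    also have "\<dots> = coords (sec a \<star> (sec b \<star> sec c))" by (simp add: conv_assoc)
    also have "\<dots> = a \<odot> (b \<odot> c)"
      unfolding dmult_def[of a] by (intro coords_conv_cong) (simp_all add: dmult_def coords_sec)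
    finally show ?thesis .
  qed
  show "a \<odot> b \<in> V" "de \<in> V" "de \<noteq> 0" by (simp_all add: dmult_def de_def eps_nonzero)
  assume a: "a \<in> V"
  show "de \<odot> a = a" "a \<odot> de = a"
    using coords_conv[of eps "sec a"] coords_conv[of "sec a" eps]
    by (simp_all add: de_def coords_sec[OF a] conv_eps_left conv_eps_right)
  assume "a \<noteq> 0"
  then obtain q where q: "q \<in> A" "sec a \<star> q = eps" "q \<star> sec a = eps"
    using coords_unit[of "sec a"] coords_sec[OF a] by auto
  have "a \<odot> coords q = de" "coords q \<odot> a = de"
    using coords_conv[of "sec a" q] coords_conv[of q "sec a"] q by (simp_all add: de_def coords_sec[OF a])
  then show "\<exists>b\<in>V. a \<odot> b = de \<and> b \<odot> a = de" by (intro bexI[of _ "coords q"]) simp_all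
qed

section \<open>The powers of the maximal ideal\<close>

text \<open>This is the right ideal x^n A, described through the subspace of \<open>C\<close> that
  it annihilates; a vanishing condition is convenient for limits and intersections.\<close>

definition I :: "nat \<Rightarrow> ('c \<Rightarrow> 'k) set" where
  "I n = {p \<in> A. \<forall>c\<in>vecs C. R (cpow x n) c = 0 \<longrightarrow> p c = 0}"

lemma I_A: "p \<in> I n \<Longrightarrow> p \<in> A"
  by (simp add: I_def)

lemma I_factor: assumes "p \<in> I n" obtains q where "q \<in> A" "p = cpow x n \<star> q"
proof -
  have p: "p \<in> A" "\<And>c. c \<in> vecs C \<Longrightarrow> R (cpow x n) c = 0 \<Longrightarrow> p c = 0" using assms by (auto simp: I_def)
  show thesis
    by (rule conv_factor[OF cpow_mem R_cpow_surj[OF x_mem x_surj] p(1), of n]) (use p(2) that in auto)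
qed

lemma I_intro: "q \<in> A \<Longrightarrow> cpow x n \<star> q \<in> I n"
  using R_eval[OF cpow_mem] A_app(1) by (auto simp: I_def simp flip: R_eval)

lemma I_closed:
  "0 \<in> I n" "p \<in> I n \<Longrightarrow> q \<in> I n \<Longrightarrow> p + q \<in> I n" "p \<in> I n \<Longrightarrow> q \<in> I n \<Longrightarrow> p - q \<in> I n"
  by (simp_all add: I_def)

lemma I_tsum: "(\<And>u v. (u, v) \<in> set E \<Longrightarrow> F u v \<in> I n) \<Longrightarrow> tsum F E \<in> I n"
  by (induction E) (auto simp: I_closed simp del: zero_fun_apply)

lemma I_right: "p \<in> I n \<Longrightarrow> q \<in> A \<Longrightarrow> p \<star> q \<in> I n"
  by (erule I_factor) (simp add: conv_assoc I_intro)

lemma I_1_iff: "p \<in> I (Suc 0) \<longleftrightarrow> p \<in> A \<and> coords p = 0"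
  using coords_eq_zero_iff M_sub(2) by (auto simp: I_def cpow_1 x_kernel)

section \<open>Conjugation by the uniformizer\<close>

lemma x_coords: "coords x = 0"
proof -
  have "x m = 0" if "m \<in> M" for m
    using apply_via_eps[OF x_mem, of m] x_kernel that M_sub(2) A_app(1)[OF eps_mem] by metis
  then show ?thesis by (simp add: coords_eq_zero_iff)
qed

lemma ideal_factor: "p \<in> A \<Longrightarrow> coords p = 0 \<Longrightarrow> \<exists>q\<in>A. p = x \<star> q"
  using I_factor[of p "Suc 0"] by (auto simp: I_1_iff cpow_1)

text \<open>a x lies in the two-sided ideal x A, and x can be cancelled on the left, so the choice
  is unique and \<open>twist\<close> is a unital ring endomorphism of \<open>A\<close>.\<close>

definition twist :: "('c \<Rightarrow> 'k) \<Rightarrow> 'c \<Rightarrow> 'k" where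
  "twist a = (SOME b. b \<in> A \<and> a \<star> x = x \<star> b)"

lemma twist: assumes a: "a \<in> A" shows "twist a \<in> A" "a \<star> x = x \<star> twist a"
proof -
  have "\<exists>b. b \<in> A \<and> a \<star> x = x \<star> b"
    using ideal_factor[of "a \<star> x"] ideal_left[OF a x_mem x_coords] by auto
  from someI_ex[OF this] show "twist a \<in> A" "a \<star> x = x \<star> twist a" unfolding twist_def by blast+
qed

text \<open>(x \<star> p)(d) = p(R x d), and \<open>R x\<close> is onto.\<close>

lemma x_cancel: assumes "p \<in> A" "q \<in> A" "x \<star> p = x \<star> q" shows "p = q"
proof (rule A_eqI[OF assms(1,2)])
  fix c assume "c \<in> vecs C"
  then obtain d where d: "d \<in> vecs C" "c = R x d" using x_surj by blast
  then show "p c = q c" using assms by (simp add: R_eval)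
qed

lemma twist_add: "a \<in> A \<Longrightarrow> b \<in> A \<Longrightarrow> twist (a + b) = twist a + twist b"
  by (rule x_cancel) (use twist[of a] twist[of b] twist[of "a + b"] in \<open>simp_all add: conv_add_left conv_add_right\<close>)

lemma twist_scale: "a \<in> A \<Longrightarrow> twist (pscale r a) = pscale r (twist a)"
  by (rule x_cancel) (use twist[of a] twist[of "pscale r a"] in \<open>simp_all add: conv_pscale_left conv_pscale_right\<close>)

lemma twist_eps: "twist eps = eps"
  by (rule x_cancel) (use twist[of eps] in \<open>simp_all add: conv_eps_left conv_eps_right\<close>)

lemma twist_conv: assumes a: "a \<in> A" and b: "b \<in> A" shows "twist (a \<star> b) = twist a \<star> twist b"
proof (rule x_cancel)
  have "x \<star> twist (a \<star> b) = a \<star> (b \<star> x)" using a b twist(2)[of "a \<star> b"] by (simp add: conv_assoc)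
  also have "\<dots> = a \<star> x \<star> twist b" using a twist[OF b] by (simp add: conv_assoc)
  finally show "x \<star> twist (a \<star> b) = x \<star> (twist a \<star> twist b)"
    using twist[OF a] twist[OF b] by (simp add: conv_assoc)
qed (use twist a b in simp_all)

text \<open>The twist of x \<star> q is q \<star> x, which again has residue 0. So
  \<open>twist\<close> descends to the residue algebra, where it is \<open>beta\<close>.\<close>

lemma twist_ideal: assumes a: "a \<in> A" "coords a = 0" shows "coords (twist a) = 0"
proof -
  obtain q where q: "q \<in> A" "a = x \<star> q" using ideal_factor[OF a] by blast
  have "twist a = q \<star> x"
    by (rule x_cancel) (use q twist[OF a(1)] in \<open>simp_all add: conv_assoc\<close>)
  then show ?thesis using ideal_left[OF q(1) x_mem x_coords] by simp
qed

definition beta :: "(nat \<Rightarrow> 'k) \<Rightarrow> nat \<Rightarrow> 'k" where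
  "beta f = coords (twist (sec f))"

lemma coords_twist: assumes a: "a \<in> A" shows "coords (twist a) = beta (coords a)"
proof -
  let ?b = "sec (coords a)"
  have "coords (twist (a - ?b)) = 0" using a by (intro twist_ideal) (simp_all add: coords_diff coords_sec)
  moreover have "twist a = twist (a - ?b) + twist ?b"
    using twist_add[of "a - ?b" ?b] a by simp
  ultimately show ?thesis by (simp add: beta_def coords_add)
qed

lemma beta_add: "beta (f + g) = beta f + beta g"
  by (simp add: beta_def sec_add twist_add coords_add)

lemma beta_scale: "beta (pscale r f) = pscale r (beta f)"
  by (simp add: beta_def sec_scale twist_scale coords_scale)

lemma beta_mem [simp]: "beta f \<in> V"
  by (simp add: beta_def)

lemma beta_mult: "beta (f \<odot> g) = beta f \<odot> beta g"
proof -
  have "beta (f \<odot> g) = coords (twist (sec f \<star> sec g))" by (simp add: coords_twist dmult_def)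
  then show ?thesis by (simp add: twist_conv coords_conv twist beta_def)
qed

lemma beta_one: "beta de = de"
  using coords_twist[of eps] by (simp add: twist_eps de_def)

text \<open>A unital endomorphism of a division algebra is injective, and finite dimension makes it
  bijective.\<close>

lemma beta_bij: "bij_betw beta V V"
proof -
  have inj0: "f = 0" if f: "f \<in> V" "beta f = 0" for f
  proof (rule ccontr)
    assume "f \<noteq> 0"
    then obtain g where "f \<odot> g = de" using D.m_inverse f(1) by blast
    then have "de = beta f \<odot> beta g" using beta_mult[of f g] beta_one by simp
    then show False using f(2) D.e_nonzero by simp
  qed
  have lin: "linear_map \<lparr>scal = pscale, vecs = V\<rparr> \<lparr>scal = pscale, vecs = V\<rparr> beta"
    by (simp add: linear_map_def beta_add beta_scale)
  have "beta ` V = V"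
    using finite_dim_inj_surj[OF is_vspace_coord finite_dim_coord lin, unfolded vspace.simps, OF inj0] .
  moreover have "inj_on beta V"
  proof (rule inj_onI)
    fix f g assume fg: "f \<in> V" "g \<in> V" "beta f = beta g"
    then have "beta (f - g) = 0" using beta_add[of "f - g" g] by simp
    then show "f = g" using inj0[OF D.V_closed(3)] fg by simp
  qed
  ultimately show ?thesis by (simp add: bij_betw_def)
qed

text \<open>The induction produces \<open>twist\<close> applied \<open>n\<close> times to
  \<open>a\<close>; this is what makes the ideals \<open>I n\<close> two-sided.\<close>

lemma cpow_commute: "a \<in> A \<Longrightarrow> \<exists>b\<in>A. a \<star> cpow x n = cpow x n \<star> b"
proof (induction n arbitrary: a)
  case 0
  then show ?case by (auto simp: conv_eps_left conv_eps_right)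
next
  case (Suc n)
  obtain b where b: "b \<in> A" "twist a \<star> cpow x n = cpow x n \<star> b" using Suc twist by blast
  have "a \<star> cpow x (Suc n) = x \<star> (twist a \<star> cpow x n)"
    using Suc.prems twist[OF Suc.prems] by (simp add: cpow_Suc flip: conv_assoc)
  then show ?case using b by (auto simp: cpow_Suc conv_assoc)
qed

lemma I_left: assumes p: "p \<in> I n" and a: "a \<in> A" shows "a \<star> p \<in> I n"
proof -
  obtain q where q: "q \<in> A" "p = cpow x n \<star> q" by (rule I_factor[OF p])
  obtain b where b: "b \<in> A" "a \<star> cpow x n = cpow x n \<star> b" using cpow_commute[OF a] by blast
  have "a \<star> p = cpow x n \<star> (b \<star> q)" using q a b by (simp flip: conv_assoc)
  then show ?thesis by (simp add: I_intro)
qed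

lemma I_mult: assumes p: "p \<in> I m" and q: "q \<in> I n" shows "p \<star> q \<in> I (m + n)"
proof -
  obtain r where r: "r \<in> A" "p = cpow x m \<star> r" by (rule I_factor[OF p])
  obtain s where s: "s \<in> A" "r \<star> q = cpow x n \<star> s" using I_factor[OF I_left[OF q r(1)]] by blast
  have "p \<star> q = cpow x (m + n) \<star> s" using r s I_A[OF q] by (simp add: conv_assoc cpow_add)
  then show ?thesis using s(1) by (simp add: I_intro)
qed

lemma I_mono: assumes "m \<le> n" shows "I n \<subseteq> I m"
proof
  fix p assume "p \<in> I n"
  then obtain q where q: "q \<in> A" "p = cpow x n \<star> q" by (rule I_factor)
  have "p = cpow x m \<star> (cpow x (n - m) \<star> q)" 
    using q assms cpow_add[OF x_mem, of m "n - m"] by (simp flip: conv_assoc)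
  then show "p \<in> I m" by (simp add: I_intro)
qed

text \<open>A functional in every \<open>I n\<close> vanishes at each \<open>c\<close>, because some
  power of \<open>R x\<close> kills \<open>c\<close>.\<close>

lemma I_Inter: assumes "\<And>n. p \<in> I n" shows "p = 0"
proof (rule A_eqI)
  fix c assume c: "c \<in> vecs C"
  obtain n where "(R x ^^ n) c = 0" using x_nilpotent[OF c] by blast
  then show "p c = 0 c" using assms[of n] c by (simp add: I_def R_cpow)
qed (use assms I_A in auto)

end

section \<open>Lifting the residue division algebra\<close>

context uniformized
begin

text \<open>A linear section of the residue map that is multiplicative modulo the m-th power of the
  ideal. Linearity is demanded on all functions, so that sums need no membership conditions.\<close>

definition approx_hom :: "nat \<Rightarrow> ((nat \<Rightarrow> 'k) \<Rightarrow> 'c \<Rightarrow> 'k) \<Rightarrow> bool" where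
  "approx_hom m s \<longleftrightarrow>
     (\<forall>f g. s (f + g) = s f + s g) \<and> (\<forall>r f. s (pscale r f) = pscale r (s f)) \<and> (\<forall>f. s f \<in> A) \<and>
     (\<forall>f\<in>V. coords (s f) = f) \<and> (\<forall>f\<in>V. \<forall>g\<in>V. s (f \<odot> g) - s f \<star> s g \<in> I m)"

lemma approx_homD:
  assumes "approx_hom m s"
  shows "s (f + g) = s f + s g" "s (pscale r f) = pscale r (s f)" "s f \<in> A"
    "f \<in> V \<Longrightarrow> coords (s f) = f" "f \<in> V \<Longrightarrow> g \<in> V \<Longrightarrow> s (f \<odot> g) - s f \<star> s g \<in> I m"
  using assms unfolding approx_hom_def by blast+

lemma approx_hom_sec: "approx_hom (Suc 0) sec"
proof -
  have "sec (f \<odot> g) - sec f \<star> sec g \<in> I (Suc 0)" for f g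
    by (simp add: I_1_iff coords_diff coords_sec dmult_def)
  then show ?thesis by (simp add: approx_hom_def sec_add sec_scale coords_sec)
qed

text \<open>
  The defect \<open>F\<close> of \<open>s\<close> is a 2-cocycle modulo higher powers of the ideal, and the Casimir element of
  the residue algebra makes it a coboundary.
\<close>

lemma approx_hom_step:
  assumes perfect: "perfect_field TYPE('k)" and s: "approx_hom m s" and m: "m \<ge> 1"
  shows "\<exists>s'. approx_hom (Suc m) s' \<and> (\<forall>f\<in>V. s' f - s f \<in> I m)"
proof -
  note sD = approx_homD[OF s]
  note [simp] = sD(3)
  obtain E where E: "set E \<subseteq> V \<times> V" "tsum (\<odot>) E = de" "\<And>d. d \<in> V \<Longrightarrow> D.casimir E d"
    using D.separability[OF perfect] by metis
  have EV: "u \<in> V" "v \<in> V" if "(u, v) \<in> set E" for u v using that E(1) by auto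
  define F where "F a b = s (a \<odot> b) - s a \<star> s b" for a b
  have FA [simp]: "F a b \<in> A" for a b by (simp add: F_def)
  have FI: "F a b \<in> I m" if "a \<in> V" "b \<in> V" for a b using sD(5)[OF that] by (simp add: F_def)
  have F_add: "F (a + b) c = F a c + F b c" "F a (b + c) = F a b + F a c" for a b c
    by (simp_all add: F_def D.m_add_left D.m_add_right sD(1) conv_add_left conv_add_right)
  have F_scale: "F (pscale r a) b = pscale r (F a b)" "F a (pscale r b) = pscale r (F a b)" for r a b
    by (simp_all add: F_def D.m_scale_left D.m_scale_right sD(2) conv_pscale_left conv_pscale_right)
      (simp_all add: pscale_def fun_eq_iff algebra_simps)
  have s0: "s 0 = 0" using sD(1)[of 0 0] by simp
  have s_tsum: "s (tsum G L) = tsum (\<lambda>u v. s (G u v)) L" for G L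
    by (rule tsum_hom[of s]) (simp_all add: s0 sD(1))
  \<comment> \<open>By associativity of both products this identity holds exactly, not only modulo a
    power of the ideal.\<close>
  have cocycle: "F (a \<odot> b) c + F a b \<star> s c = F a (b \<odot> c) + s a \<star> F b c" for a b c
    by (simp add: F_def conv_diff_left conv_diff_right D.m_assoc conv_assoc)
  \<comment> \<open>The contracting homotopy of Hochschild cohomology that \<open>E\<close>
    provides; \<open>g\<close> below is the lifted product of the legs of \<open>E\<close> and
    agrees with \<open>eps\<close> modulo \<open>I m\<close>.\<close>
  define h where "h a = tsum (\<lambda>u v. s u \<star> F v a) E" for a
  define g where "g = tsum (\<lambda>u v. s u \<star> s v) E"
  define s' where "s' a = s a + h a" for a
  have hA [simp]: "h a \<in> A" and gA [simp]: "g \<in> A" for a by (simp_all add: h_def g_def tsum_mem_A)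
  have hI: "h a \<in> I m" if "a \<in> V" for a
    unfolding h_def using that EV by (intro I_tsum I_left FI) auto
  have casimir: "tsum (\<lambda>u v. s (a \<odot> u) \<star> F v b) E = tsum (\<lambda>u v. s u \<star> F (v \<odot> a) b) E"
    if "a \<in> V" for a b
  proof
    fix c
    have "bilin (\<lambda>u v. (s u \<star> F v b) c)"
      by (simp add: bilin_def sD(1,2) F_add F_scale conv_add_left conv_add_right conv_pscale_left
          conv_pscale_right pscale_apply)
    from D.casimirD[OF E(3)[OF that] this]
    show "tsum (\<lambda>u v. s (a \<odot> u) \<star> F v b) E c = tsum (\<lambda>u v. s u \<star> F (v \<odot> a) b) E c"
      by (simp add: tsum_apply)
  qed
  \<comment> \<open>The coboundary of \<open>h\<close> is the defect \<open>F\<close> up to two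
    errors: \<open>g\<close> replaces \<open>eps\<close>, and a sum of products of two defects
    appears because \<open>s\<close> is not multiplicative in s a \<star> s u.\<close>
  have key: "s a \<star> h b + h a \<star> s b = h (a \<odot> b) + g \<star> F a b - tsum (\<lambda>u v. F a u \<star> F v b) E"
    if a: "a \<in> V" for a b
  proof -
    have "s a \<star> h b = tsum (\<lambda>u v. s (a \<odot> u) \<star> F v b - F a u \<star> F v b) E"
      unfolding h_def
      by (subst conv_tsum_right) (simp_all add: F_def[of a] conv_diff_left conv_assoc)
    also have "\<dots> = tsum (\<lambda>u v. s u \<star> F (v \<odot> a) b) E - tsum (\<lambda>u v. F a u \<star> F v b) E"
      by (simp add: tsum_diff casimir[OF a])
    finally have 1: "s a \<star> h b = tsum (\<lambda>u v. s u \<star> F (v \<odot> a) b) E - tsum (\<lambda>u v. F a u \<star> F v b) E" .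
    have 2: "h a \<star> s b = tsum (\<lambda>u v. s u \<star> (F v a \<star> s b)) E"
      unfolding h_def by (subst conv_tsum_left) (simp_all add: conv_assoc)
    have 3: "tsum (\<lambda>u v. s u \<star> F (v \<odot> a) b) E + tsum (\<lambda>u v. s u \<star> (F v a \<star> s b)) E =
        h (a \<odot> b) + g \<star> F a b"
    proof -
      have "tsum (\<lambda>u v. s u \<star> F (v \<odot> a) b) E + tsum (\<lambda>u v. s u \<star> (F v a \<star> s b)) E =
          tsum (\<lambda>u v. s u \<star> (F (v \<odot> a) b + F v a \<star> s b)) E"
        by (simp add: tsum_add conv_add_right)
      also have "\<dots> = tsum (\<lambda>u v. s u \<star> F v (a \<odot> b)) E + tsum (\<lambda>u v. s u \<star> s v \<star> F a b) E"
        by (simp add: cocycle conv_add_right tsum_add conv_assoc)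
      also have "tsum (\<lambda>u v. s u \<star> s v \<star> F a b) E = g \<star> F a b"
        unfolding g_def by (subst conv_tsum_left) simp_all
      finally show ?thesis unfolding h_def .
    qed
    show ?thesis unfolding 1 2 diff_add_eq 3 by (rule refl)
  qed
  \<comment> \<open>\<open>s de\<close> is idempotent modulo \<open>I m\<close>, and it is a unit
    because its residue is nonzero.\<close>
  have "eps - s de \<in> I m"
  proof -
    have "coords (s de) \<noteq> 0" using sD(4)[of de] D.e_nonzero by simp
    then obtain q where q: "q \<in> A" "q \<star> s de = eps" using coords_unit[OF sD(3)] by metis
    have "s de \<star> (eps - s de) = F de de" by (simp add: F_def conv_diff_right conv_eps_right)
    then have "q \<star> (s de \<star> (eps - s de)) \<in> I m" using I_left[OF FI q(1), of de de] by simp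
    then show ?thesis using q by (simp add: conv_eps_left flip: conv_assoc)
  qed
  moreover have "eps - g = (eps - s de) + tsum F E"
  proof -
    have "tsum F E = tsum (\<lambda>u v. s (u \<odot> v) - s u \<star> s v) E" by (rule tsum_cong) (simp add: F_def)
    also have "\<dots> = s de - g" using s_tsum[of "(\<odot>)" E] by (simp add: tsum_diff g_def E(2))
    finally have "tsum F E = s de - g" .
    then show ?thesis by simp
  qed
  moreover have "tsum F E \<in> I m" using EV by (intro I_tsum FI)
  ultimately have gI: "eps - g \<in> I m" using I_closed(2)[of "eps - s de" m "tsum F E"] by (simp only:)
  have "s' (a \<odot> b) - s' a \<star> s' b \<in> I (Suc m)" if ab: "a \<in> V" "b \<in> V" for a b
  proof -
    have "s' (a \<odot> b) - s' a \<star> s' b =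
        F a b + h (a \<odot> b) - (s a \<star> h b + h a \<star> s b) - h a \<star> h b"
      by (simp add: s'_def F_def conv_add_left conv_add_right algebra_simps)
    also have "\<dots> = (eps - g) \<star> F a b + tsum (\<lambda>u v. F a u \<star> F v b) E - h a \<star> h b"
      unfolding key[OF ab(1)] by (simp add: conv_diff_left conv_eps_left algebra_simps)
    \<comment> \<open>All remaining terms are products of two elements of \<open>I m\<close>, so the
      precision doubles; \<open>Suc m \<le> m + m\<close> is what the induction uses.\<close>
    also have "\<dots> \<in> I (m + m)"
      using ab EV
      by (intro I_closed(3)[OF I_closed(2)[OF I_mult[OF gI FI] I_tsum] I_mult[OF hI hI]] I_mult FI) auto
    finally show ?thesis using I_mono[of "Suc m" "m + m"] m by auto
  qed
  moreover have "coords (s' f) = f" if "f \<in> V" for f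
    using sD(4)[OF that] hI[OF that] I_mono[of "Suc 0" m] m
    by (auto simp: s'_def coords_add I_1_iff simp del: zero_fun_apply)
  moreover have "s' (a + b) = s' a + s' b" for a b
    by (simp add: s'_def h_def sD(1) F_add conv_add_right tsum_add algebra_simps)
  moreover have "s' (pscale r a) = pscale r (s' a)" for r a
  proof -
    have "h (pscale r a) = pscale r (h a)"
      using tsum_hom[of "pscale r" "\<lambda>u v. s u \<star> F v a" E]
      by (simp add: h_def F_scale conv_pscale_right pscale_rules)
    then show ?thesis by (simp add: s'_def sD(2) pscale_rules)
  qed
  ultimately have "approx_hom (Suc m) s'" by (simp add: approx_hom_def s'_def)
  moreover have "s' f - s f \<in> I m" if "f \<in> V" for f using hI[OF that] by (simp add: s'_def)
  ultimately show ?thesis by blast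
qed

text \<open>The limit is taken pointwise: at each \<open>c\<close> the approximations become
  constant, because a power of \<open>x\<close> kills \<open>c\<close>.\<close>

theorem residue_lift:
  assumes perfect: "perfect_field TYPE('k)"
  obtains s where "\<And>f g. s (f + g) = s f + s g" "\<And>r f. s (pscale r f) = pscale r (s f)"
    "\<And>f. s f \<in> A" "\<And>f. f \<in> V \<Longrightarrow> coords (s f) = f"
    "\<And>f g. f \<in> V \<Longrightarrow> g \<in> V \<Longrightarrow> s (f \<odot> g) = s f \<star> s g" "s de = eps"
proof -
  have "\<exists>S. \<forall>m. approx_hom (Suc m) (S m) \<and> (\<forall>f\<in>V. S (Suc m) f - S m f \<in> I (Suc m))"
  proof (rule dependent_nat_choice)
    show "\<exists>s. approx_hom (Suc 0) s" using approx_hom_sec by blast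
    show "\<exists>s'. approx_hom (Suc (Suc m)) s' \<and> (\<forall>f\<in>V. s' f - s f \<in> I (Suc m))"
      if "approx_hom (Suc m) s" for s m
      by (rule approx_hom_step[OF perfect that]) simp
  qed
  then obtain S where S: "\<And>m. approx_hom (Suc m) (S m)"
    and S_step: "\<And>m f. f \<in> V \<Longrightarrow> S (Suc m) f - S m f \<in> I (Suc m)" by blast
  note SD = approx_homD[OF S]
  note [simp] = SD(3)
  have S_diff: "S k f - S m f \<in> I (Suc m)" if "f \<in> V" "m \<le> k" for f m k
    using that(2)
  proof (induction rule: dec_induct)
    case base
    show "S m f - S m f \<in> I (Suc m)" by (simp add: I_closed del: zero_fun_apply)
  next
    case (step k)
    have "S (Suc k) f - S k f \<in> I (Suc m)"
      using S_step[OF that(1), of k] I_mono[of "Suc m" "Suc k"] step(1) by auto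
    moreover have "S k f - S m f \<in> I (Suc m)" by (rule step.IH)
    ultimately have "(S (Suc k) f - S k f) + (S k f - S m f) \<in> I (Suc m)" by (rule I_closed(2))
    then show "S (Suc k) f - S m f \<in> I (Suc m)" by simp
  qed
  define N where "N c = (LEAST k. (R x ^^ k) c = 0)" for c
  have N: "(R x ^^ k) c = 0" if c: "c \<in> vecs C" "N c \<le> k" for c k
  proof -
    have "(R x ^^ N c) c = 0" unfolding N_def by (rule LeastI_ex[OF x_nilpotent[OF c(1)]])
    moreover have "(R x ^^ k) c = (R x ^^ (k - N c)) ((R x ^^ N c) c)"
      using c(2) by (simp flip: funpow_add[THEN fun_cong, unfolded comp_def])
    moreover have "(R x ^^ j) 0 = 0" for j by (induction j) (simp_all add: R_zero)
    ultimately show ?thesis by simp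
  qed
  \<comment> \<open>Successive approximations are only close to each other on \<open>V\<close>.
    Truncating the argument first makes the limit additive and homogeneous on all functions.\<close>
  define trunc where "trunc f = (\<lambda>i. if i < rank then f i else 0)" for f :: "nat \<Rightarrow> 'k"
  have truncV [simp]: "trunc f \<in> V" for f by (simp add: trunc_def coord_space_def)
  have trunc_id: "trunc f = f" if "f \<in> V" for f using that by (auto simp: trunc_def coord_space_def fun_eq_iff)
  have trunc_add: "trunc (f + g) = trunc f + trunc g" for f g by (auto simp: trunc_def fun_eq_iff)
  have trunc_scale: "trunc (pscale r f) = pscale r (trunc f)" for r f
    by (auto simp: trunc_def fun_eq_iff pscale_def)
  have stable: "S k (trunc f) c = S (N c) (trunc f) c" if c: "c \<in> vecs C" "N c \<le> k" for k f c
  proof -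
    have "S k (trunc f) - S (N c) (trunc f) \<in> I (Suc (N c))" using S_diff[OF truncV c(2)] .
    then have "(S k (trunc f) - S (N c) (trunc f)) c = 0"
      using N[of c "Suc (N c)"] c(1) unfolding I_def by (simp add: R_cpow)
    then show ?thesis by simp
  qed
  define s where "s f = (\<lambda>c. if c \<in> vecs C then S (N c) (trunc f) c else 0)" for f
  have s_eval: "s f c = S k (trunc f) c" if "c \<in> vecs C" "N c \<le> k" for f c k
    using stable[OF that] that(1) by (simp add: s_def)
  have sA: "s f \<in> A" for f
    unfolding vecs_dual linear_form_iff
  proof (intro conjI ballI allI impI)
    fix c d assume cd: "c \<in> vecs C" "d \<in> vecs C"
    let ?k = "max (N (c + d)) (max (N c) (N d))"
    show "s f (c + d) = s f c + s f d"
      using cd s_eval[of "c + d" ?k f] s_eval[of c ?k f] s_eval[of d ?k f] by (simp add: A_app(2))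
  next
    fix r c assume c: "c \<in> vecs C"
    let ?k = "max (N (scal C r c)) (N c)"
    show "s f (scal C r c) = r * s f c"
      using c s_eval[of "scal C r c" ?k f] s_eval[of c ?k f] by (simp add: A_app(4))
  qed (simp add: s_def)
  have s_close: "s f - S m f \<in> I (Suc m)" if f: "f \<in> V" for f m
    unfolding I_def
  proof (intro CollectI conjI ballI impI)
    show "s f - S m f \<in> A" using sA by simp
    fix c assume c: "c \<in> vecs C" "R (cpow x (Suc m)) c = 0"
    let ?k = "max m (N c)"
    have "(S ?k f - S m f) c = 0" using S_diff[OF f, of m ?k] c unfolding I_def by auto
    then show "(s f - S m f) c = 0" using s_eval[OF c(1), of ?k f] by (simp add: trunc_id[OF f])
  qed
  have s_mult: "s (f \<odot> g) = s f \<star> s g" if f: "f \<in> V" and g: "g \<in> V" for f g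
  proof -
    have "s (f \<odot> g) - s f \<star> s g \<in> I m" for m
    proof -
      have "s (f \<odot> g) - s f \<star> s g = (s (f \<odot> g) - S m (f \<odot> g)) + (S m (f \<odot> g) - S m f \<star> S m g) -
          ((s f - S m f) \<star> s g + S m f \<star> (s g - S m g))"
        using sA by (simp add: conv_diff_left conv_diff_right)
      also have "\<dots> \<in> I (Suc m)"
        using f g sA
        by (intro I_closed(3)[OF I_closed(2) I_closed(2)] I_right I_left s_close SD(5)) simp_all
      finally show ?thesis using I_mono[of m "Suc m"] by auto
    qed
    then have "s (f \<odot> g) - s f \<star> s g = 0" by (rule I_Inter)
    then show ?thesis by simp
  qed
  have s_coords: "coords (s f) = f" if f: "f \<in> V" for f
  proof -
    have "coords (s f - S 0 f) = 0" using s_close[OF f, of 0] by (simp add: I_1_iff)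
    then show ?thesis using SD(4)[OF f, of 0] by (simp add: coords_diff)
  qed
  \<comment> \<open>\<open>s de\<close> is an idempotent with nonzero residue, hence an idempotent
    unit.\<close>
  have "s de = eps"
  proof -
    have "coords (s de) \<noteq> 0" using s_coords[of de] D.e_nonzero by simp
    then obtain q where q: "q \<in> A" "q \<star> s de = eps" using coords_unit[OF sA] by metis
    have "s de = q \<star> s de \<star> s de" using q sA by (simp add: conv_eps_left)
    also have "\<dots> = q \<star> s (de \<odot> de)"
      using conv_assoc[OF q(1) sA sA, of de de] s_mult[OF D.e_mem D.e_mem] by (simp only:)
    also have "\<dots> = eps" using q by simp
    finally show ?thesis .
  qed
  moreover have "s (f + g) = s f + s g" "s (pscale r f) = pscale r (s f)" for f g r
    by (auto simp: s_def fun_eq_iff trunc_add trunc_scale SD(1,2) pscale_apply)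
  ultimately show thesis using that[of s] sA s_coords s_mult by blast
qed

text \<open>
  The elements \<open>\<theta> a i = a \<star> x\<^sup>i\<close> (for a suitable uniformizer \<open>x\<close> with \<open>x \<star> a = \<alpha> a \<star> x\<close>) exhibit \<open>A\<close> as a
  completion of the skew polynomial ring \<open>D[x; \<alpha>]\<close>.
\<close>

theorem skew_power_series:
  assumes perfect: "perfect_field TYPE('k)"
  obtains \<alpha> \<theta> where
    "linear_map \<lparr>scal = pscale, vecs = V\<rparr> \<lparr>scal = pscale, vecs = V\<rparr> \<alpha>"
    "bij_betw \<alpha> V V" "\<alpha> de = de"
    "\<And>a b. a \<in> V \<Longrightarrow> b \<in> V \<Longrightarrow> \<alpha> (a \<odot> b) = \<alpha> a \<odot> \<alpha> b"
    "\<And>a i. \<theta> a i \<in> A" "\<And>a b i. \<theta> (a + b) i = \<theta> a i + \<theta> b i"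
    "\<And>r a i. \<theta> (pscale r a) i = pscale r (\<theta> a i)"
    "\<And>a b i j. a \<in> V \<Longrightarrow> b \<in> V \<Longrightarrow> \<theta> a i \<star> \<theta> b j = \<theta> (a \<odot> (\<alpha> ^^ i) b) (i + j)"
    "\<theta> de 0 = eps"
    "\<And>c. c \<in> vecs C \<Longrightarrow> \<exists>N. \<forall>i\<ge>N. \<forall>a\<in>V. \<theta> a i c = 0"
    "\<And>c. c \<in> vecs C \<Longrightarrow> (\<And>a i. a \<in> V \<Longrightarrow> \<theta> a i c = 0) \<Longrightarrow> c = 0"
    "\<And>\<psi> N. (\<And>i. linear_map \<lparr>scal = pscale, vecs = V\<rparr> ground (\<psi> i)) \<Longrightarrow>
      (\<And>i a. i \<ge> N \<Longrightarrow> a \<in> V \<Longrightarrow> \<psi> i a = 0) \<Longrightarrow> \<exists>c\<in>vecs C. \<forall>a\<in>V. \<forall>i. \<theta> a i c = \<psi> i a"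
proof -
  obtain s where s_add: "\<And>f g. s (f + g) = s f + s g"
    and s_scale: "\<And>r f. s (pscale r f) = pscale r (s f)"
    and sA [simp]: "\<And>f. s f \<in> A" and s_coords: "\<And>f. f \<in> V \<Longrightarrow> coords (s f) = f"
    and s_mult: "\<And>f g. f \<in> V \<Longrightarrow> g \<in> V \<Longrightarrow> s (f \<odot> g) = s f \<star> s g" and s_one: "s de = eps"
    using residue_lift[OF perfect] by metis
  obtain E where E: "set E \<subseteq> V \<times> V" "tsum (\<odot>) E = de" "\<And>d. d \<in> V \<Longrightarrow> D.casimir E d"
    using D.separability[OF perfect] by metis
  have EV: "u \<in> V" "v \<in> V" if "(u, v) \<in> set E" for u v using that E(1) by auto
  \<comment> \<open>Averaging over the Casimir element turns x into an X with s d \<star> X = X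
    \<star> s (beta d). For x itself this rule holds only modulo \<open>I 2\<close>.\<close>
  define X where "X = tsum (\<lambda>u v. s u \<star> x \<star> s (beta v)) E"
  have XA [simp]: "X \<in> A" by (simp add: X_def tsum_mem_A)
  have X_comm: "s d \<star> X = X \<star> s (beta d)" if d: "d \<in> V" for d
  proof -
    have "s d \<star> X = tsum (\<lambda>u v. s (d \<odot> u) \<star> x \<star> s (beta v)) E"
      unfolding X_def using EV(1) d
      by (subst conv_tsum_right) (auto intro!: tsum_cong simp: s_mult conv_assoc)
    also have "\<dots> = tsum (\<lambda>u v. s u \<star> x \<star> s (beta (v \<odot> d))) E"
    proof
      fix c
      have "bilin (\<lambda>u v. (s u \<star> x \<star> s (beta v)) c)"
        by (simp add: bilin_def s_add s_scale beta_add beta_scale conv_add_left conv_add_right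
            conv_pscale_left conv_pscale_right pscale_apply)
      from D.casimirD[OF E(3)[OF d] this]
      show "tsum (\<lambda>u v. s (d \<odot> u) \<star> x \<star> s (beta v)) E c = tsum (\<lambda>u v. s u \<star> x \<star> s (beta (v \<odot> d))) E c"
        by (simp add: tsum_apply)
    qed
    also have "\<dots> = X \<star> s (beta d)"
      unfolding X_def by (subst conv_tsum_left) (simp_all add: beta_mult s_mult conv_assoc)
    finally show ?thesis .
  qed
  \<comment> \<open>X = x \<star> y, and the residue of \<open>y\<close> is \<open>beta\<close>
    applied to \<Sum> u v = 1. So \<open>y\<close> is a unit, and X acts on \<open>C\<close> as a
    uniformizer again.\<close>
  define y where "y = tsum (\<lambda>u v. twist (s u) \<star> s (beta v)) E"
  have yA: "y \<in> A" by (simp add: y_def tsum_mem_A)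
  have X_y: "X = x \<star> y"
    unfolding X_def y_def by (subst conv_tsum_right) (simp_all add: twist flip: conv_assoc)
  have "coords y = tsum (\<lambda>u v. beta u \<odot> beta v) E"
  proof -
    have "coords y = tsum (\<lambda>u v. coords (twist (s u) \<star> s (beta v))) E"
      unfolding y_def
      by (rule tsum_hom[of coords]) (simp_all add: coords_add coords_eq_zero_iff del: zero_fun_apply, simp)
    also have "\<dots> = tsum (\<lambda>u v. beta u \<odot> beta v) E"
      using EV by (intro tsum_cong) (simp add: coords_conv twist coords_twist s_coords)
    finally show ?thesis .
  qed
  also have "\<dots> = beta (tsum (\<odot>) E)"
  proof -
    have "beta 0 = 0" using beta_add[of 0 0] by simp
    then show ?thesis by (subst tsum_hom[of beta]) (simp_all add: beta_add beta_mult)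
  qed
  finally have "coords y \<noteq> 0" using D.e_nonzero by (simp add: E(2) beta_one)
  then obtain z where z: "z \<in> A" "y \<star> z = eps" "z \<star> y = eps" using coords_unit[OF yA] by blast
  have X_kernel: "R X c = 0 \<longleftrightarrow> c \<in> M" if c: "c \<in> vecs C" for c
  proof -
    have "R X c = R y (R x c)" using yA c by (simp add: X_y R_conv)
    moreover have "R z (R y (R x c)) = R x c" using R_conv[OF yA z(1), of "R x c"] z(2) c by (simp add: R_eps)
    ultimately show ?thesis using x_kernel[OF c] R_zero[OF z(1)] R_zero[OF yA] by metis
  qed
  have X_surj: "R X ` vecs C = vecs C"
  proof -
    have "\<exists>d\<in>vecs C. R X d = c" if c: "c \<in> vecs C" for c
    proof -
      have "R z c \<in> R x ` vecs C" using z(1) c by (simp add: x_surj)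
      then obtain d where d: "d \<in> vecs C" "R x d = R z c" by (metis imageE)
      then have "R X d = c" using R_conv[OF z(1) yA c] z(3) yA by (simp add: X_y R_conv R_eps c)
      with d show ?thesis by blast
    qed
    then show ?thesis by auto
  qed
  have X_nil: "\<exists>n. (R X ^^ n) c = 0" if c: "c \<in> vecs C" for c
  proof -
    have XI: "cpow X n \<in> I n" for n
    proof (induction n)
      case 0
      show ?case by (simp add: I_def R_eps A_app(1)[OF eps_mem])
    next
      case (Suc n)
      have "X \<in> I (Suc 0)" using I_intro[OF yA, of "Suc 0"] by (simp add: X_y cpow_1)
      from I_mult[OF this Suc] show ?case by (simp add: cpow_Suc)
    qed
    obtain n where n: "(R x ^^ n) c = 0" using x_nilpotent[OF c] by blast
    obtain q where q: "q \<in> A" "cpow X n = cpow x n \<star> q" by (rule I_factor[OF XI])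
    have "R (cpow X n) c = 0" using q n c by (simp add: R_conv R_cpow R_zero)
    then show ?thesis using c by (auto simp: R_cpow)
  qed
  \<comment> \<open>The commutation rule moves scalars to the right of X through
    \<open>beta\<close>; writing them on the left requires the inverse of
    \<open>beta\<close>.\<close>
  define \<alpha> where "\<alpha> = inv_into V beta"
  have \<alpha>: "\<alpha> a \<in> V" "beta (\<alpha> a) = a" if "a \<in> V" for a
    using beta_bij that bij_betw_inv_into[OF beta_bij] bij_betw_inv_into_right[OF beta_bij]
    by (auto simp: \<alpha>_def bij_betw_def)
  have \<alpha>_beta: "\<alpha> (beta a) = a" if "a \<in> V" for a
    using bij_betw_inv_into_left[OF beta_bij that] by (simp add: \<alpha>_def)
  have \<alpha>_eq: "\<alpha> a = b" if "a = beta b" "b \<in> V" for a b using \<alpha>_beta that by simp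
  have \<alpha>_linear: "linear_map \<lparr>scal = pscale, vecs = V\<rparr> \<lparr>scal = pscale, vecs = V\<rparr> \<alpha>"
    using \<alpha> by (auto simp: linear_map_def beta_add beta_scale intro!: \<alpha>_eq D.V_closed)
  have \<alpha>_mult: "\<alpha> (a \<odot> b) = \<alpha> a \<odot> \<alpha> b" if "a \<in> V" "b \<in> V" for a b
    using \<alpha> that by (intro \<alpha>_eq) (simp_all add: beta_mult)
  have \<alpha>_pow: "(\<alpha> ^^ i) a \<in> V" if "a \<in> V" for i a
    using that by (induction i) (auto intro: \<alpha>)
  have X_comm': "X \<star> s a = s (\<alpha> a) \<star> X" if "a \<in> V" for a
    using X_comm[OF \<alpha>(1)[OF that]] \<alpha>(2)[OF that] by simp
  have X_pow: "cpow X i \<star> s a = s ((\<alpha> ^^ i) a) \<star> cpow X i" if "a \<in> V" for i a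
    using that
  proof (induction i)
    case (Suc i)
    have "cpow X (Suc i) \<star> s a = X \<star> s ((\<alpha> ^^ i) a) \<star> cpow X i"
      using Suc by (simp add: cpow_Suc conv_assoc)
    then show ?case using X_comm'[OF \<alpha>_pow[OF Suc.prems]] by (simp add: cpow_Suc conv_assoc)
  qed (simp add: conv_eps_left conv_eps_right)
  define \<theta> where "\<theta> a i = s a \<star> cpow X i" for a i
  have \<theta>A [simp]: "\<theta> a i \<in> A" for a i by (simp add: \<theta>_def)
  have \<theta>_add: "\<theta> (a + b) i = \<theta> a i + \<theta> b i" for a b i by (simp add: \<theta>_def s_add conv_add_left)
  have \<theta>_scale: "\<theta> (pscale r a) i = pscale r (\<theta> a i)" for r a i
    by (simp add: \<theta>_def s_scale conv_pscale_left)
  have \<theta>_mult: "\<theta> a i \<star> \<theta> b j = \<theta> (a \<odot> (\<alpha> ^^ i) b) (i + j)" if "a \<in> V" "b \<in> V" for a b i j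
  proof -
    have "\<theta> a i \<star> \<theta> b j = s a \<star> (cpow X i \<star> s b) \<star> cpow X j" by (simp add: \<theta>_def conv_assoc)
    also have "\<dots> = s a \<star> s ((\<alpha> ^^ i) b) \<star> (cpow X i \<star> cpow X j)"
      by (simp add: X_pow that conv_assoc)
    finally show ?thesis using that \<alpha>_pow by (simp add: \<theta>_def s_mult cpow_add)
  qed
  have \<theta>_0: "\<theta> a 0 = s a" for a by (simp add: \<theta>_def conv_eps_right)
  \<comment> \<open>Pairing a X^(i+1) with \<open>c\<close> is pairing beta(a) X^i with
    \<open>R X c\<close>. This shift drives the inductions for \<open>fin\<close>,
    \<open>sep\<close> and \<open>surj\<close>.\<close>
  have \<theta>_Suc: "\<theta> a (Suc i) c = \<theta> (beta a) i (R X c)" if "a \<in> V" "c \<in> vecs C" for a i c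
  proof -
    have "\<theta> a (Suc i) = X \<star> \<theta> (beta a) i"
      using X_comm[OF that(1)] by (simp add: \<theta>_def cpow_Suc flip: conv_assoc)
    then show ?thesis using that(2) by (simp add: R_eval)
  qed
  have fin: "\<exists>N. \<forall>i\<ge>N. \<forall>a\<in>V. \<theta> a i c = 0" if c: "c \<in> vecs C" for c
  proof -
    have "\<forall>i\<ge>n. \<forall>a\<in>V. \<theta> a i c = 0" if "(R X ^^ n) c = 0" for n
      using that c
    proof (induction n arbitrary: c)
      case 0
      then show ?case by (simp add: A_app(1)[OF \<theta>A])
    next
      case (Suc n)
      have IH: "\<forall>i\<ge>n. \<forall>a\<in>V. \<theta> a i (R X c) = 0" using Suc by (simp add: funpow_swap1)
      show ?case
      proof (intro allI impI ballI)
        fix i a assume "Suc n \<le> i" "a \<in> V"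
        then show "\<theta> a i c = 0" using IH \<theta>_Suc[of a c "i - 1"] Suc.prems(2) by simp
      qed
    qed
    with X_nil[OF c] show ?thesis by blast
  qed
  have sep: "c = 0" if c: "c \<in> vecs C" and 0: "\<And>a i. a \<in> V \<Longrightarrow> \<theta> a i c = 0" for c
  proof -
    \<comment> \<open>Every \<open>p\<close> has the form s(coords p) + X \<star> q. The first part
      vanishes at \<open>c\<close> by assumption, and the second has the value q(R X c), where a
      smaller power of \<open>R X\<close> suffices.\<close>
    have *: "p c = 0" if "(R X ^^ n) c = 0" "c \<in> vecs C" "\<forall>a\<in>V. \<forall>i. \<theta> a i c = 0" "p \<in> A" for n p c
      using that
    proof (induction n arbitrary: c p)
      case 0
      then show ?case using A_app(1)[OF \<open>p \<in> A\<close>] by simp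
    next
      case (Suc n)
      let ?r = "p - s (coords p)"
      have rA: "?r \<in> A" using Suc.prems(4) by simp
      have "coords ?r = 0" by (simp add: coords_diff s_coords)
      then have "?r d = 0" if "d \<in> vecs C" "R X d = 0" for d
        using coords_eq_zero_iff[OF rA] X_kernel that by blast
      then obtain q where q: "q \<in> A" "X \<star> q = ?r"
        using conv_factor[OF XA X_surj rA] by metis
      have "\<theta> b i (R X c) = 0" if "b \<in> V" for b i
        using \<theta>_Suc[OF \<alpha>(1)[OF that] Suc.prems(2), of i] Suc.prems(3) \<alpha>[OF that] by simp
      then have "q (R X c) = 0"
        using Suc.prems q(1) by (intro Suc.IH) (simp_all add: funpow_swap1)
      then have "?r c = 0" using q R_eval[OF XA q(1) Suc.prems(2)] by simp
      moreover have "s (coords p) c = 0" using Suc.prems(3) \<theta>_0 by (metis coords_mem)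
      ultimately show ?case by simp
    qed
    obtain n where n: "(R X ^^ n) c = 0" using X_nil[OF c] by blast
    show ?thesis
    proof (rule dual_separates[OF vspace c])
      fix p assume "p \<in> A"
      then show "p c = 0" using *[OF n c _] 0 by blast
    qed
  qed
  \<comment> \<open>The family shifted down by one degree is realised by induction and lifted along
    \<open>R X\<close>. The lift is then corrected in degree 0 by an element of \<open>M\<close>,
    the kernel of \<open>R X\<close>.\<close>
  have surj: "\<exists>c\<in>vecs C. \<forall>a\<in>V. \<forall>i. \<theta> a i c = \<psi> i a"
    if "\<And>i. linear_map \<lparr>scal = pscale, vecs = V\<rparr> ground (\<psi> i)" "\<And>i a. i \<ge> N \<Longrightarrow> a \<in> V \<Longrightarrow> \<psi> i a = 0"
    for \<psi> N
    using that
  proof (induction N arbitrary: \<psi>)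
    case 0
    then show ?case by (intro bexI[of _ 0]) (simp_all add: A_app(1)[OF \<theta>A])
  next
    case (Suc N)
    have lin: "\<psi> i (a + b) = \<psi> i a + \<psi> i b" "\<psi> i (pscale r a) = r * \<psi> i a"
      if "a \<in> V" "b \<in> V" for i r a b
      using Suc.prems(1)[of i] that by (simp_all add: linear_form_iff)
    have "linear_map \<lparr>scal = pscale, vecs = V\<rparr> ground (\<lambda>a. \<psi> (Suc i) (\<alpha> a))" for i
      using \<alpha>_linear \<alpha>(1) by (simp add: linear_form_iff lin) (simp add: linear_map_def lin)
    then have "\<exists>c\<in>vecs C. \<forall>a\<in>V. \<forall>i. \<theta> a i c = \<psi> (Suc i) (\<alpha> a)"
      by (rule Suc.IH) (use Suc.prems(2) \<alpha>(1) in auto)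
    then obtain c' where c': "c' \<in> vecs C" "\<And>a i. a \<in> V \<Longrightarrow> \<theta> a i c' = \<psi> (Suc i) (\<alpha> a)" by blast
    obtain c0 where c0: "c0 \<in> vecs C" "R X c0 = c'" using c'(1) X_surj by (metis imageE)
    \<comment> \<open>The coordinates of the correction are the errors in degree 0 on unit vectors;
      \<open>s a\<close> acts on the basis of \<open>M\<close> by the coordinates of
      \<open>a\<close>.\<close>
    define r where "r i = \<psi> 0 (unit_vec i) - s (unit_vec i) c0" for i
    define m where "m = (\<Sum>i<rank. scal C (r i) (basis ! i))"
    have bC: "basis ! i \<in> vecs C" if "i < rank" for i using basis_mem[OF that] M_sub(2) by blast
    have mM: "m \<in> M" unfolding m_def
      by (intro VC.subspace_sum[OF M_sub(1)] VC.subspace_scale[OF M_sub(1)] basis_mem) simp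
    then have mC: "m \<in> vecs C" by (rule M_sub(2))
    have sm: "s a m = \<psi> 0 a - s a c0" if a: "a \<in> V" for a
    proof -
      have "s a m = (\<Sum>i<rank. r i * coords (s a) i)"
      proof -
        have "s a m = (\<Sum>i<rank. s a (scal C (r i) (basis ! i)))"
          unfolding m_def using bC by (intro A_app(5)[OF sA]) simp
        then show ?thesis using bC by (simp add: A_app(4)[OF sA] coords_def)
      qed
      also have "\<dots> = (\<Sum>i<rank. a i * \<psi> 0 (unit_vec i)) - (\<Sum>i<rank. a i * s (unit_vec i) c0)"
        by (simp add: s_coords[OF a] r_def algebra_simps sum_subtractf)
      also have "(\<Sum>i<rank. a i * \<psi> 0 (unit_vec i)) = \<psi> 0 a"
      proof -
        have "\<psi> 0 a = \<psi> 0 (\<Sum>i<rank. pscale (a i) (unit_vec i))"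
          using coord_space_expand[OF a] by (rule arg_cong)
        also have "\<dots> = (\<Sum>i<rank. \<psi> 0 (pscale (a i) (unit_vec i)))"
          using unit_vec_mem D.V_closed(4)
          by (intro linear_form_basic(5)[OF is_vspace_coord Suc.prems(1)]) auto
        also have "\<dots> = (\<Sum>i<rank. a i * \<psi> 0 (unit_vec i))"
          by (intro sum.cong) (auto simp: lin(2)[OF _ D.e_mem] unit_vec_mem)
        finally show ?thesis by simp
      qed
      also have "(\<Sum>i<rank. a i * s (unit_vec i) c0) = s a c0"
      proof -
        have "s a = s (\<Sum>i<rank. pscale (a i) (unit_vec i))" using coord_space_expand[OF a] by (rule arg_cong)
        also have "\<dots> = (\<Sum>i<rank. s (pscale (a i) (unit_vec i)))"
          by (rule additive.sum[of s]) (simp add: additive.intro s_add)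
        finally have "s a c0 = (\<Sum>i<rank. s (pscale (a i) (unit_vec i))) c0" by simp
        then show ?thesis by (simp add: sum_fun_apply s_scale pscale_apply)
      qed
      finally show ?thesis .
    qed
    have RXm: "R X (c0 + m) = c'" using c0 mM mC X_kernel[OF mC] by (simp add: R_add)
    have "\<theta> a i (c0 + m) = \<psi> i a" if a: "a \<in> V" for a i
    proof (cases i)
      case 0
      then show ?thesis using sm[OF a] c0(1) mC by (simp add: \<theta>_0 A_app(2)[OF sA])
    next
      case (Suc j)
      then show ?thesis using \<theta>_Suc[OF a, of "c0 + m" j] c0(1) mC c'(2)[of "beta a"] \<alpha>_beta[OF a]
        by (simp add: RXm)
    qed
    moreover have "c0 + m \<in> vecs C" using c0(1) mC by simp
    ultimately show ?case by blast
  qed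
  show thesis
  proof (rule that[of \<alpha> \<theta>])
    show "bij_betw \<alpha> V V" unfolding \<alpha>_def by (rule bij_betw_inv_into[OF beta_bij])
    show "\<alpha> de = de" by (rule \<alpha>_eq) (simp_all add: beta_one)
    show "\<theta> de 0 = eps" by (simp add: \<theta>_0 s_one)
  qed (fact \<alpha>_linear \<alpha>_mult \<theta>A \<theta>_add \<theta>_scale \<theta>_mult fin sep surj)+
qed

end

section \<open>Calculus of tensor powers\<close>

lemma linear_map_compose:
  "linear_map V W f \<Longrightarrow> linear_map W U g \<Longrightarrow> linear_map V U (\<lambda>x. g (f x))"
  by (simp add: linear_map_def)

lemma linear_map_cong:
  assumes V: "is_vspace V" and eq: "\<And>x. x \<in> vecs V \<Longrightarrow> f x = g x"
  shows "linear_map V W f \<longleftrightarrow> linear_map V W g"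
  using eq vecs_closed[OF V] by (simp add: linear_map_def)

lemma bilinear_left: "bilinear_map V W ground B \<Longrightarrow> w \<in> vecs W \<Longrightarrow> linear_map V ground (\<lambda>v. B v w)"
  by (simp add: bilinear_form_iff)

lemma bilinear_right: "bilinear_map V W ground B \<Longrightarrow> v \<in> vecs V \<Longrightarrow> linear_map W ground (B v)"
  by (simp add: bilinear_form_iff)

lemma set_list_update: "set ms \<subseteq> S \<Longrightarrow> x \<in> S \<Longrightarrow> set (ms[i := x]) \<subseteq> S"
  using set_update_subset_insert[of ms i x] by auto

lemma multilinear_formI:
  "(\<And>ms i. length ms = n \<Longrightarrow> set ms \<subseteq> vecs N \<Longrightarrow> i < n \<Longrightarrow> linear_map N ground (\<lambda>x. F (ms[i := x]))) \<Longrightarrow>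
   multilinear_form N n F"
  by (simp add: multilinear_form_def)

lemma multilinear_formD:
  "multilinear_form N n F \<Longrightarrow> length ms = n \<Longrightarrow> set ms \<subseteq> vecs N \<Longrightarrow> i < n \<Longrightarrow>
   linear_map N ground (\<lambda>x. F (ms[i := x]))"
  by (simp add: multilinear_form_def)

lemma multilinear_form_cong:
  assumes N: "is_vspace N"
    and eq: "\<And>ms. length ms = n \<Longrightarrow> set ms \<subseteq> vecs N \<Longrightarrow> F ms = G ms"
  shows "multilinear_form N n F \<longleftrightarrow> multilinear_form N n G"
proof -
  have "linear_map N ground (\<lambda>x. F (ms[i := x])) \<longleftrightarrow> linear_map N ground (\<lambda>x. G (ms[i := x]))"
    if "length ms = n" "set ms \<subseteq> vecs N" for ms i
    by (rule linear_map_cong[OF N], rule eq) (use that in \<open>simp, intro set_list_update\<close>)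
  then show ?thesis by (simp add: multilinear_form_def)
qed

lemma multilinear_form_zero: "multilinear_form N n (\<lambda>ms. 0)"
  by (simp add: multilinear_form_def linear_form_iff)

lemma multilinear_form_add:
  "multilinear_form N n F \<Longrightarrow> multilinear_form N n G \<Longrightarrow> multilinear_form N n (\<lambda>ms. F ms + G ms)"
  by (simp add: multilinear_form_def linear_form_iff algebra_simps)

lemma multilinear_form_scale:
  "multilinear_form N n F \<Longrightarrow> multilinear_form N n (\<lambda>ms. a * F ms)"
  by (simp add: multilinear_form_def linear_form_iff algebra_simps)

lemma multilinear_form_Suc:
  assumes N: "is_vspace N"
  shows "multilinear_form N (Suc n) F \<longleftrightarrow>
    (\<forall>ms. length ms = n \<and> set ms \<subseteq> vecs N \<longrightarrow> linear_map N ground (\<lambda>x. F (x # ms))) \<and>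
    (\<forall>x\<in>vecs N. multilinear_form N n (\<lambda>ms. F (x # ms)))"
proof (intro iffI conjI allI ballI impI)
  assume F: "multilinear_form N (Suc n) F"
  show "linear_map N ground (\<lambda>x. F (x # ms))" if "length ms = n \<and> set ms \<subseteq> vecs N" for ms
    using multilinear_formD[OF F, of "0 # ms" 0] that vecs_closed(1)[OF N] by simp
  show "multilinear_form N n (\<lambda>ms. F (x # ms))" if "x \<in> vecs N" for x
  proof (rule multilinear_formI)
    fix ms i assume "length ms = n" "set ms \<subseteq> vecs N" "i < n"
    then show "linear_map N ground (\<lambda>y. F (x # ms[i := y]))"
      using multilinear_formD[OF F, of "x # ms" "Suc i"] that by simp
  qed
next
  assume F: "(\<forall>ms. length ms = n \<and> set ms \<subseteq> vecs N \<longrightarrow> linear_map N ground (\<lambda>x. F (x # ms))) \<and>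
    (\<forall>x\<in>vecs N. multilinear_form N n (\<lambda>ms. F (x # ms)))"
  show "multilinear_form N (Suc n) F"
  proof (rule multilinear_formI)
    fix ms i assume ms: "length ms = Suc n" "set ms \<subseteq> vecs N" "i < Suc n"
    then obtain y ys where "ms = y # ys" by (cases ms) auto
    then show "linear_map N ground (\<lambda>x. F (ms[i := x]))"
      using F ms multilinear_formD[of N n "\<lambda>ms. F (y # ms)" ys "i - 1"] by (cases i) auto
  qed
qed

lemma word_apply: "multilinear_form N n F \<Longrightarrow> word N n ms F = F ms"
  by (simp add: word_def)

lemma multilinear_word: "multilinear_form N n (\<lambda>ms. word N n ms F)"
  by (cases "multilinear_form N n F") (simp_all add: word_def multilinear_form_zero)

lemma scal_tpow [simp]: "scal (tpow N n) = pscale"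
  by (simp add: tpow_def)

lemma is_vspace_tpow: "is_vspace (tpow N n :: ('k::field, ('v::ab_group_add list \<Rightarrow> 'k) \<Rightarrow> 'k) vspace)"
proof -
  interpret P: vector_space "pscale :: 'k \<Rightarrow> (('v list \<Rightarrow> 'k) \<Rightarrow> 'k) \<Rightarrow> _" by (rule vector_space_pscale)
  show ?thesis by (simp add: is_vspace_def tpow_def P.vector_space_axioms P.subspace_span)
qed

lemma word_mem: "length ms = n \<Longrightarrow> set ms \<subseteq> vecs N \<Longrightarrow> word N n ms \<in> vecs (tpow N n)"
  for N :: "('k::field, 'v::ab_group_add, 'm) vspace_scheme"
proof -
  interpret P: vector_space "pscale :: 'k \<Rightarrow> (('v list \<Rightarrow> 'k) \<Rightarrow> 'k) \<Rightarrow> _" by (rule vector_space_pscale)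
  assume "length ms = n" "set ms \<subseteq> vecs N"
  then show ?thesis by (auto simp: tpow_def intro!: P.span_base)
qed

lemma tpow_induct [consumes 1, case_names zero step]:
  fixes N :: "('k::field, 'v::ab_group_add, 'm) vspace_scheme"
  assumes t: "t \<in> vecs (tpow N n)"
    and z: "P 0"
    and st: "\<And>c ms t. length ms = n \<Longrightarrow> set ms \<subseteq> vecs N \<Longrightarrow> t \<in> vecs (tpow N n) \<Longrightarrow> P t \<Longrightarrow>
               P (pscale c (word N n ms) + t)"
  shows "P t"
proof -
  interpret P: vector_space "pscale :: 'k \<Rightarrow> (('v list \<Rightarrow> 'k) \<Rightarrow> 'k) \<Rightarrow> _" by (rule vector_space_pscale)
  have "t \<in> P.span {word N n ms |ms. length ms = n \<and> set ms \<subseteq> vecs N}" using t by (simp add: tpow_def)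
  then have "t \<in> vecs (tpow N n) \<and> P t"
  proof (induction rule: P.span_induct_alt)
    case base
    show "0 \<in> vecs (tpow N n) \<and> P 0" using z vecs_closed(1)[OF is_vspace_tpow] by blast
  next
    case (step c w t)
    then show "pscale c w + t \<in> vecs (tpow N n) \<and> P (pscale c w + t)"
      using st[of _ t c] vecs_closed(2,4)[OF is_vspace_tpow, of _ N n] word_mem[of _ n N] by auto
  qed
  then show ?thesis ..
qed

lemma tpow_cong:
  assumes N: "is_vspace N" and t: "t \<in> vecs (tpow N n)"
    and eq: "\<And>ms. length ms = n \<Longrightarrow> set ms \<subseteq> vecs N \<Longrightarrow> F ms = G ms"
  shows "t F = t G"
  using t
proof (induction rule: tpow_induct)
  case (step c ms t)
  have "multilinear_form N n F = multilinear_form N n G" by (rule multilinear_form_cong[OF N eq])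
  then show ?case using step eq by (simp add: word_def pscale_apply)
qed simp

lemma tpow_not_multilinear: "t \<in> vecs (tpow N n) \<Longrightarrow> \<not> multilinear_form N n F \<Longrightarrow> t F = 0"
  by (induction rule: tpow_induct) (simp_all add: word_def pscale_apply)

lemma tpow_form_add:
  "t \<in> vecs (tpow N n) \<Longrightarrow> multilinear_form N n F \<Longrightarrow> multilinear_form N n G \<Longrightarrow>
   t (\<lambda>ms. F ms + G ms) = t F + t G"
  by (induction rule: tpow_induct)
    (simp_all add: word_apply multilinear_form_add pscale_apply algebra_simps)

lemma tpow_form_scale:
  "t \<in> vecs (tpow N n) \<Longrightarrow> multilinear_form N n F \<Longrightarrow> t (\<lambda>ms. a * F ms) = a * t F"
  by (induction rule: tpow_induct)
    (simp_all add: word_apply multilinear_form_scale pscale_apply algebra_simps)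

lemma tpow_form_sum:
  assumes t: "t \<in> vecs (tpow N n)" and F: "\<And>i. i \<in> J \<Longrightarrow> multilinear_form N n (F i)"
  shows "t (\<lambda>ms. \<Sum>i\<in>J. F i ms) = (\<Sum>i\<in>J. t (F i))"
proof -
  have ml: "multilinear_form N n (\<lambda>ms. \<Sum>i\<in>J. F i ms)"
    using F by (induction J rule: infinite_finite_induct) (simp_all add: multilinear_form_zero multilinear_form_add)
  show ?thesis using t
    by (induction rule: tpow_induct)
      (simp_all add: word_apply ml F pscale_apply sum.distrib sum_distrib_left)
qed

lemma linear_word:
  assumes "length ms = n" "set ms \<subseteq> vecs N" "i < n"
  shows "linear_map N (tpow N n) (\<lambda>x. word N n (ms[i := x]))"
  unfolding linear_map_def
proof (intro conjI ballI allI)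
  show "word N n (ms[i := x]) \<in> vecs (tpow N n)" if "x \<in> vecs N" for x
    using assms that by (intro word_mem set_list_update) auto
  have lin: "linear_map N ground (\<lambda>x. word N n (ms[i := x]) F)" for F
    using multilinear_formD[OF multilinear_word assms] .
  show "word N n (ms[i := x + y]) = word N n (ms[i := x]) + word N n (ms[i := y])"
    if "x \<in> vecs N" "y \<in> vecs N" for x y
    using lin that by (intro ext) (simp add: linear_form_iff)
  show "word N n (ms[i := scal N a x]) = scal (tpow N n) a (word N n (ms[i := x]))"
    if "x \<in> vecs N" for a x
    using lin that by (intro ext) (simp add: linear_form_iff pscale_apply)
qed

lemma linear_word_Cons:
  assumes "length ms = n" "set ms \<subseteq> vecs N" "is_vspace N"
  shows "linear_map N (tpow N (Suc n)) (\<lambda>x. word N (Suc n) (x # ms))"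
  using linear_word[of "0 # ms" "Suc n" N 0] assms vecs_closed(1)[OF assms(3)] by simp

lemma wlift_zero: "wlift h 0 = 0"
  by (simp add: wlift_def fun_eq_iff)

lemma wlift_add: "wlift h (t + t') = wlift h t + wlift h t'"
  by (simp add: wlift_def fun_eq_iff)

lemma wlift_pscale: "wlift h (pscale c t) = pscale c (wlift h t)"
  by (simp add: wlift_def pscale_def fun_eq_iff)

lemma wlift_mem:
  fixes U :: "('k::field, 'b \<Rightarrow> 'k, 'm) vspace_scheme"
  assumes U: "is_vspace U" "scal U = pscale" and t: "t \<in> vecs (tpow N n)"
    and h: "\<And>B. multilinear_form N n (\<lambda>ms. h ms B)"
    and mem: "\<And>ms. length ms = n \<Longrightarrow> set ms \<subseteq> vecs N \<Longrightarrow> h ms \<in> vecs U"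
  shows "wlift h t \<in> vecs U"
  using t
proof (induction rule: tpow_induct)
  case zero
  show "wlift h 0 \<in> vecs U" using vecs_closed(1)[OF U(1)] by (simp add: wlift_zero)
next
  case (step c ms t)
  have "wlift h (word N n ms) = h ms" by (simp add: wlift_def word_apply[OF h])
  then show "wlift h (pscale c (word N n ms) + t) \<in> vecs U"
    using step mem vecs_closed[OF U(1)] U(2) by (simp add: wlift_add wlift_pscale)
qed

lemma wlift_apply: "wlift h t B = t (\<lambda>ms. h ms B)"
  by (simp add: wlift_def)

lemma linear_map_wlift:
  fixes U :: "('k::field, 'b \<Rightarrow> 'k, 'm) vspace_scheme"
  assumes "scal U = pscale" "\<And>t. t \<in> vecs (tpow N n) \<Longrightarrow> wlift h t \<in> vecs U"
  shows "linear_map (tpow N n) U (wlift h)"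
  using assms by (simp add: linear_map_def wlift_add wlift_pscale)

text \<open>The elementary multilinear form with one functional per slot; \<open>hd\<close> and
  \<open>tl\<close> allow it to be applied to lists of any length.\<close>

fun pev :: "('a \<Rightarrow> 'v \<Rightarrow> 'k::comm_monoid_mult) \<Rightarrow> 'a list \<Rightarrow> 'v list \<Rightarrow> 'k" where
  "pev \<phi> [] ms = 1"
| "pev \<phi> (d # ds) ms = \<phi> d (hd ms) * pev \<phi> ds (tl ms)"

lemma multilinear_pev:
  assumes N: "is_vspace N" and \<phi>: "\<And>d. d \<in> set ds \<Longrightarrow> linear_map N ground (\<phi> d)"
  shows "multilinear_form N (length ds) (pev \<phi> ds)"
  using \<phi>
proof (induction ds)
  case Nil
  show ?case by (rule multilinear_formI) simp
next
  case (Cons d ds)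
  have "multilinear_form N (Suc (length ds)) (pev \<phi> (d # ds))"
    unfolding multilinear_form_Suc[OF N]
    using Cons by (auto simp: linear_form_iff algebra_simps intro!: multilinear_form_scale)
  then show ?case by (simp only: list.size add_Suc_right add_0_right)
qed

lemma pev_append:
  "length ds \<le> length ms \<Longrightarrow>
   pev \<phi> (ds @ ds') ms = pev \<phi> ds (take (length ds) ms) * pev \<phi> ds' (drop (length ds) ms)"
proof (induction ds arbitrary: ms)
  case (Cons d ds)
  then show ?case by (cases ms) (simp_all add: mult.assoc)
qed simp

lemma pev_snoc:
  assumes "length ms = Suc (length ds)"
  shows "pev \<phi> (ds @ [d]) ms = pev \<phi> ds (butlast ms) * \<phi> d (last ms)"
  using assms
proof (induction ds arbitrary: ms)
  case Nil
  then show ?case by (cases ms) auto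
next
  case (Cons d' ds)
  then obtain m ms' where "ms = m # ms'" "length ms' = Suc (length ds)" by (cases ms) auto
  moreover then have "ms' \<noteq> []" by auto
  ultimately show ?case using Cons.IH[of ms'] by (simp add: mult.assoc)
qed

text \<open>Each slot is expanded in the spanning family \<open>b\<close> with coefficient
  functionals \<open>\<phi>\<close>; the lists \<open>js\<close> name the resulting words.\<close>

lemma multilinear_expansion:
  assumes N: "is_vspace N" and b: "\<And>j. j < m \<Longrightarrow> b j \<in> vecs N"
    and exp: "\<And>v. v \<in> vecs N \<Longrightarrow> v = (\<Sum>j<m. scal N (\<phi> j v) (b j))"
    and F: "multilinear_form N n F" and ms: "length ms = n" "set ms \<subseteq> vecs N"
  shows "F ms = (\<Sum>js\<in>{js. set js \<subseteq> {..<m} \<and> length js = n}. pev \<phi> js ms * F (map b js))"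
  using F ms
proof (induction n arbitrary: F ms)
  case 0
  have "{js. set js \<subseteq> {..<m} \<and> length js = 0} = {[]}" by auto
  then show ?case using 0 by simp
next
  case (Suc n)
  let ?J = "\<lambda>n. {js. set js \<subseteq> {..<m} \<and> length js = n}"
  obtain v vs where ms: "ms = v # vs" "length vs = n" using Suc.prems(2) by (cases ms) auto
  have v: "v \<in> vecs N" "set vs \<subseteq> vecs N" using Suc.prems(3) ms by auto
  have F0: "linear_map N ground (\<lambda>x. F (x # vs))" and F1: "\<And>x. x \<in> vecs N \<Longrightarrow> multilinear_form N n (\<lambda>ms. F (x # ms))"
    using Suc.prems(1) ms(2) v(2) unfolding multilinear_form_Suc[OF N] by blast+
  have "F (v # vs) = F ((\<Sum>j<m. scal N (\<phi> j v) (b j)) # vs)" using exp[OF v(1)] by simp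
  also have "\<dots> = (\<Sum>j<m. F (scal N (\<phi> j v) (b j) # vs))"
    using b vecs_closed(4)[OF N] by (intro linear_form_basic(5)[OF N F0]) auto
  also have "\<dots> = (\<Sum>j<m. \<phi> j v * F (b j # vs))"
    using b by (intro sum.cong) (auto simp: linear_form_basic(4)[OF N F0])
  also have "\<dots> = (\<Sum>j<m. \<Sum>js\<in>?J n. pev \<phi> (j # js) (v # vs) * F (map b (j # js)))"
  proof (rule sum.cong[OF refl])
    fix j assume "j \<in> {..<m}"
    then have "F (b j # vs) = (\<Sum>js\<in>?J n. pev \<phi> js vs * F (b j # map b js))"
      using Suc.IH[OF F1 ms(2) v(2)] b by simp
    then show "\<phi> j v * F (b j # vs) = (\<Sum>js\<in>?J n. pev \<phi> (j # js) (v # vs) * F (map b (j # js)))"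
      by (simp add: sum_distrib_left mult.assoc)
  qed
  also have "\<dots> = (\<Sum>(j, js)\<in>{..<m} \<times> ?J n. pev \<phi> (j # js) (v # vs) * F (map b (j # js)))"
    by (simp add: sum.cartesian_product)
  also have "\<dots> = (\<Sum>js\<in>(\<lambda>(j, js). j # js) ` ({..<m} \<times> ?J n). pev \<phi> js (v # vs) * F (map b js))"
    by (subst sum.reindex) (auto simp: inj_on_def case_prod_beta)
  also have "(\<lambda>(j, js). j # js) ` ({..<m} \<times> ?J n) = ?J (Suc n)"
    by (auto simp: image_iff length_Suc_conv)
  finally show ?case by (simp add: ms)
qed

text \<open>Evaluation at a fixed tensor is additive only on bilinear forms, so linearity in a
  parameter has to be derived from bilinearity of each form and from linearity of its values in the
  parameter.\<close>

lemma tensor_parameter_linear: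
  assumes V: "is_vspace V" and W: "is_vspace W" and Y: "is_vspace Y" and t: "t \<in> vecs (tensor V W)"
    and bil: "\<And>y. y \<in> vecs Y \<Longrightarrow> bilinear_map V W ground (\<Phi> y)"
    and lin: "\<And>v w. v \<in> vecs V \<Longrightarrow> w \<in> vecs W \<Longrightarrow> linear_map Y ground (\<lambda>y. \<Phi> y v w)"
  shows "linear_map Y ground (\<lambda>y. t (\<Phi> y))"
  unfolding linear_form_iff
proof (intro conjI ballI allI)
  fix y z assume yz: "y \<in> vecs Y" "z \<in> vecs Y"
  have "t (\<Phi> (y + z)) = t (\<lambda>v w. \<Phi> y v w + \<Phi> z v w)"
    by (rule tensor_cong[OF V W t]) (use lin yz in \<open>simp add: linear_form_iff\<close>)
  then show "t (\<Phi> (y + z)) = t (\<Phi> y) + t (\<Phi> z)"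
    using tensor_form_add[OF t bil bil] yz by simp
next
  fix a y assume y: "y \<in> vecs Y"
  have "t (\<Phi> (scal Y a y)) = t (\<lambda>v w. a * \<Phi> y v w)"
    by (rule tensor_cong[OF V W t]) (use lin y in \<open>simp add: linear_form_iff\<close>)
  then show "t (\<Phi> (scal Y a y)) = a * t (\<Phi> y)"
    using tensor_form_scale[OF t bil] y by simp
qed

text \<open>\<open>wlift\<close> takes prescribed values on words only if these are multilinear. A
  slot lies either among the first \<open>i\<close> letters or among the others, and only one of the
  two factors varies with it.\<close>

lemma multilinear_tsplit:
  assumes N: "is_vspace N" and i: "i \<le> n"
  shows "multilinear_form N n
    (\<lambda>ms. tens (tpow N i) (tpow N (n - i)) (word N i (take i ms)) (word N (n - i) (drop i ms)) B)"
proof (cases "bilinear_map (tpow N i) (tpow N (n - i)) ground B")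
  case B: True
  show ?thesis
    unfolding tens_apply[OF B]
  proof (rule multilinear_formI)
    fix ms j assume ms: "length ms = n" "set ms \<subseteq> vecs N" "j < n"
    have tk: "length (take i ms) = i" "set (take i ms) \<subseteq> vecs N"
      and dr: "length (drop i ms) = n - i" "set (drop i ms) \<subseteq> vecs N"
      using ms i by (auto dest: in_set_takeD in_set_dropD)
    show "linear_map N ground (\<lambda>x. B (word N i (take i (ms[j := x]))) (word N (n - i) (drop i (ms[j := x]))))"
    proof (cases "j < i")
      case True
      have "linear_map N ground (\<lambda>x. B (word N i ((take i ms)[j := x])) (word N (n - i) (drop i ms)))"
        by (rule linear_map_compose[OF linear_word[OF tk True] bilinear_left[OF B word_mem[OF dr]]])
      then show ?thesis using True by (simp add: take_update_swap)
    next
      case False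
      then have ji: "j - i < n - i" using ms(3) by simp
      have "linear_map N ground (\<lambda>x. B (word N i (take i ms)) (word N (n - i) ((drop i ms)[j - i := x])))"
        by (rule linear_map_compose[OF linear_word[OF dr ji] bilinear_right[OF B word_mem[OF tk]]])
      then show ?thesis using False by (simp add: drop_update_swap)
    qed
  qed
next
  case False
  then show ?thesis by (simp add: tens_def multilinear_form_zero)
qed

lemma tsplit_mem:
  assumes N: "is_vspace N" and i: "i \<le> n" and t: "t \<in> vecs (tpow N n)"
  shows "tsplit N n i t \<in> vecs (tensor (tpow N i) (tpow N (n - i)))"
  unfolding tsplit_def
proof (rule wlift_mem[OF is_vspace_tensor _ t multilinear_tsplit[OF N i]])
  fix ms assume "length ms = n" "set ms \<subseteq> vecs N"
  then show "tens (tpow N i) (tpow N (n - i)) (word N i (take i ms)) (word N (n - i) (drop i ms))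
      \<in> vecs (tensor (tpow N i) (tpow N (n - i)))"
    using i by (intro tens_in_tensor word_mem) (auto dest: in_set_takeD in_set_dropD)
qed simp

lemma linear_eval: "scal V = pscale \<Longrightarrow> linear_map V ground (\<lambda>u. u F)"
  by (simp add: linear_form_iff pscale_apply)

lemma tsplit_eval:
  assumes N: "is_vspace N" and \<phi>: "\<And>d. linear_map N ground (\<phi> d)"
    and t: "t \<in> vecs (tpow N n)" and ds: "length ds + length ds' = n"
  shows "tsplit N n (length ds) t (\<lambda>u w. u (pev \<phi> ds) * w (pev \<phi> ds')) = t (pev \<phi> (ds @ ds'))"
proof -
  have B: "bilinear_map (tpow N (length ds)) (tpow N (n - length ds)) ground
      (\<lambda>u w. u (pev \<phi> ds) * w (pev \<phi> ds'))"
    by (intro bilinear_form_mult linear_eval) simp_all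
  have len: "n - length ds = length ds'" using ds by simp
  show ?thesis
    unfolding tsplit_def wlift_apply tens_apply[OF B]
  proof (rule tpow_cong[OF N t])
    fix ms :: "'b list" assume "length ms = n"
    then show "word N (length ds) (take (length ds) ms) (pev \<phi> ds) *
        word N (n - length ds) (drop (length ds) ms) (pev \<phi> ds') = pev \<phi> (ds @ ds') ms"
      using ds by (simp add: len word_apply multilinear_pev[OF N] \<phi> pev_append)
  qed
qed

lemma lcoact_bilinear:
  assumes C: "is_vspace C" and N: "is_vspace N" and ms: "length ms = n" "set ms \<subseteq> vecs N"
  shows "bilinear_map C N ground (\<lambda>c x. tens C (tpow N (Suc n)) c (word N (Suc n) (x # ms)) B)"
  by (rule tens_bilinear_in[where f = "\<lambda>x. x" and V' = C])
    (simp_all add: linear_word_Cons[OF ms N], simp add: linear_map_def)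

text \<open>The first slot enters through \<open>lcoact\<close>. For any other slot the tensor
  \<open>lcoact N x\<close> stays fixed and the form to which it is applied varies linearly.\<close>

lemma multilinear_lcoact:
  assumes C: "is_vspace C" and N: "is_vspace N" and l: "linear_map N (tensor C N) (lcoact N)"
  shows "multilinear_form N (Suc n) (\<lambda>ms.
    tlift (\<lambda>c x. tens C (tpow N (Suc n)) c (word N (Suc n) (x # tl ms))) (lcoact N (hd ms)) B)"
  unfolding multilinear_form_Suc[OF N] list.sel tlift_def
proof (intro conjI allI ballI impI)
  fix ms assume "length ms = n \<and> set ms \<subseteq> vecs N"
  show "linear_map N ground
      (\<lambda>x. lcoact N x (\<lambda>v w. tens C (tpow N (Suc n)) v (word N (Suc n) (w # ms)) B))"
    by (rule linear_map_compose[OF l linear_eval]) simp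
next
  fix x assume x: "x \<in> vecs N"
  have t: "lcoact N x \<in> vecs (tensor C N)" using l x by (simp add: linear_map_def)
  show "multilinear_form N n
      (\<lambda>ms. lcoact N x (\<lambda>v w. tens C (tpow N (Suc n)) v (word N (Suc n) (w # ms)) B))"
  proof (rule multilinear_formI)
    fix ms i assume ms: "length ms = n" "set ms \<subseteq> vecs N" "i < n"
    show "linear_map N ground
        (\<lambda>y. lcoact N x (\<lambda>v w. tens C (tpow N (Suc n)) v (word N (Suc n) (w # ms[i := y])) B))"
    proof (rule tensor_parameter_linear[OF C N N t])
      show "bilinear_map C N ground
          (\<lambda>v w. tens C (tpow N (Suc n)) v (word N (Suc n) (w # ms[i := y])) B)" if "y \<in> vecs N" for y
        using ms that by (intro lcoact_bilinear[OF C N] set_list_update) simp_all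
      fix v w assume vw: "v \<in> vecs C" "w \<in> vecs N"
      have "linear_map N (tpow N (Suc n)) (\<lambda>y. word N (Suc n) ((w # ms)[Suc i := y]))"
        using ms vw by (intro linear_word) auto
      from linear_map_compose[OF linear_map_compose[OF this linear_tens_right[OF vw(1)]] linear_eval]
      show "linear_map N ground (\<lambda>y. tens C (tpow N (Suc n)) v (word N (Suc n) (w # ms[i := y])) B)"
        by simp
    qed
  qed
qed

lemma lcoact_pow_mem:
  assumes C: "is_vspace C" and N: "is_vspace N" and l: "linear_map N (tensor C N) (lcoact N)"
    and n: "n \<ge> 1" and t: "t \<in> vecs (tpow N n)"
  shows "lcoact_pow C N n t \<in> vecs (tensor C (tpow N n))"
proof -
  obtain m where m: "n = Suc m" using n by (cases n) auto
  show ?thesis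
    unfolding lcoact_pow_def m
  proof (rule wlift_mem[OF is_vspace_tensor _ _ multilinear_lcoact[OF C N l]])
    show "t \<in> vecs (tpow N (Suc m))" using t m by simp
    fix ms assume ms: "length ms = Suc m" "set ms \<subseteq> vecs N"
    then obtain y ys where y: "ms = y # ys" "y \<in> vecs N" "set ys \<subseteq> vecs N" "length ys = m"
      by (cases ms) auto
    have "lcoact N y \<in> vecs (tensor C N)" using l y(2) by (simp add: linear_map_def)
    then have "tlift (\<lambda>c x. tens C (tpow N (Suc m)) c (word N (Suc m) (x # ys))) (lcoact N y)
        \<in> vecs (tensor C (tpow N (Suc m)))"
      using y by (intro tlift_mem[OF is_vspace_tensor _ _ lcoact_bilinear[OF C N]] tens_in_tensor word_mem) auto
    then show "tlift (\<lambda>c x. tens C (tpow N (Suc m)) c (word N (Suc m) (x # tl ms))) (lcoact N (hd ms))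
        \<in> vecs (tensor C (tpow N (Suc m)))" by (simp add: y(1))
  qed simp
qed

lemma linear_word_snoc:
  assumes "length ms = n" "set ms \<subseteq> vecs N" "is_vspace N"
  shows "linear_map N (tpow N (Suc n)) (\<lambda>x. word N (Suc n) (ms @ [x]))"
  using linear_word[of "ms @ [0]" "Suc n" N n] assms vecs_closed(1)[OF assms(3)] by (simp add: list_update_append)

lemma rcoact_bilinear:
  assumes C: "is_vspace C" and N: "is_vspace N" and ms: "length ms = n" "set ms \<subseteq> vecs N"
  shows "bilinear_map N C ground (\<lambda>x c. tens (tpow N (Suc n)) C (word N (Suc n) (ms @ [x])) c B)"
  by (rule tens_bilinear_in[where g = "\<lambda>x. x" and W' = C])
    (simp_all add: linear_word_snoc[OF ms N], simp add: linear_map_def)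

lemma multilinear_rcoact:
  assumes C: "is_vspace C" and N: "is_vspace N" and r: "linear_map N (tensor N C) (rcoact N)"
  shows "multilinear_form N (Suc n) (\<lambda>ms.
    tlift (\<lambda>x c. tens (tpow N (Suc n)) C (word N (Suc n) (butlast ms @ [x])) c) (rcoact N (last ms)) B)"
  unfolding tlift_def
proof (rule multilinear_formI)
  fix ms i assume ms: "length ms = Suc n" "set ms \<subseteq> vecs N" "i < Suc n"
  then have ne: "ms \<noteq> []" by auto
  have bl: "length (butlast ms) = n" "set (butlast ms) \<subseteq> vecs N" "last ms \<in> vecs N"
    using ms last_in_set[OF ne] by (auto dest: in_set_butlastD)
  show "linear_map N ground (\<lambda>y. rcoact N (last (ms[i := y]))
      (\<lambda>v w. tens (tpow N (Suc n)) C (word N (Suc n) (butlast (ms[i := y]) @ [v])) w B))"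
  proof (cases "i = n")
    case True
    have "linear_map N ground (\<lambda>y. rcoact N y
        (\<lambda>v w. tens (tpow N (Suc n)) C (word N (Suc n) (butlast ms @ [v])) w B))"
      by (rule linear_map_compose[OF r linear_eval]) simp
    then show ?thesis using True ms ne by (simp add: last_list_update butlast_list_update)
  next
    case False
    then have i: "i < n" using ms by simp
    have t: "rcoact N (last ms) \<in> vecs (tensor N C)" using r bl(3) by (simp add: linear_map_def)
    have "linear_map N ground (\<lambda>y. rcoact N (last ms)
        (\<lambda>v w. tens (tpow N (Suc n)) C (word N (Suc n) ((butlast ms)[i := y] @ [v])) w B))"
    proof (rule tensor_parameter_linear[OF N C N t])
      show "bilinear_map N C ground
          (\<lambda>v w. tens (tpow N (Suc n)) C (word N (Suc n) ((butlast ms)[i := y] @ [v])) w B)"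
        if "y \<in> vecs N" for y
        using bl that by (intro rcoact_bilinear[OF C N] set_list_update) simp_all
      fix v w assume vw: "v \<in> vecs N" "w \<in> vecs C"
      have "linear_map N (tpow N (Suc n)) (\<lambda>y. word N (Suc n) ((butlast ms @ [v])[i := y]))"
        using bl vw i by (intro linear_word) auto
      from linear_map_compose[OF linear_map_compose[OF this linear_tens_left[OF vw(2)]] linear_eval]
      show "linear_map N ground
          (\<lambda>y. tens (tpow N (Suc n)) C (word N (Suc n) ((butlast ms)[i := y] @ [v])) w B)"
        using i bl(1) by (simp add: list_update_append)
    qed
    then show ?thesis using False ms ne by (simp add: last_list_update butlast_list_update)
  qed
qed

lemma rcoact_pow_mem:
  assumes C: "is_vspace C" and N: "is_vspace N" and r: "linear_map N (tensor N C) (rcoact N)"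
    and n: "n \<ge> 1" and t: "t \<in> vecs (tpow N n)"
  shows "rcoact_pow C N n t \<in> vecs (tensor (tpow N n) C)"
proof -
  obtain m where m: "n = Suc m" using n by (cases n) auto
  show ?thesis
    unfolding rcoact_pow_def m
  proof (rule wlift_mem[OF is_vspace_tensor _ _ multilinear_rcoact[OF C N r]])
    show "t \<in> vecs (tpow N (Suc m))" using t m by simp
    fix ms assume ms: "length ms = Suc m" "set ms \<subseteq> vecs N"
    then have ne: "ms \<noteq> []" by auto
    have bl: "length (butlast ms) = m" "set (butlast ms) \<subseteq> vecs N" "last ms \<in> vecs N"
      using ms last_in_set[OF ne] by (auto dest: in_set_butlastD)
    have "rcoact N (last ms) \<in> vecs (tensor N C)" using r bl(3) by (simp add: linear_map_def)
    then show "tlift (\<lambda>x c. tens (tpow N (Suc m)) C (word N (Suc m) (butlast ms @ [x])) c) (rcoact N (last ms))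
        \<in> vecs (tensor (tpow N (Suc m)) C)"
      using bl by (intro tlift_mem[OF is_vspace_tensor _ _ rcoact_bilinear[OF C N]] tens_in_tensor word_mem) auto
  qed simp
qed

lemma linear_lcoact_pow:
  assumes "is_vspace C" "is_vspace N" "linear_map N (tensor C N) (lcoact N)" "n \<ge> 1"
  shows "linear_map (tpow N n) (tensor C (tpow N n)) (lcoact_pow C N n)"
  unfolding lcoact_pow_def
  by (rule linear_map_wlift) (use lcoact_pow_mem[OF assms] in \<open>simp_all add: lcoact_pow_def\<close>)

lemma linear_rcoact_pow:
  assumes "is_vspace C" "is_vspace N" "linear_map N (tensor N C) (rcoact N)" "n \<ge> 1"
  shows "linear_map (tpow N n) (tensor (tpow N n) C) (rcoact_pow C N n)"
  unfolding rcoact_pow_def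
  by (rule linear_map_wlift) (use rcoact_pow_mem[OF assms] in \<open>simp_all add: rcoact_pow_def\<close>)

section \<open>The cotensor coalgebra of a twisted division algebra\<close>

text \<open>The dual coalgebra, the dual bicomodule and the plain dual space are different records.
  Tensors depend on \<open>scal\<close> and \<open>vecs\<close> only, so the plain dual space can
  replace the other two.\<close>

lemma tens_cong_spaces:
  assumes "scal V = scal V'" "vecs V = vecs V'" "scal W = scal W'" "vecs W = vecs W'"
  shows "tens V W = tens V' W'"
  by (simp add: fun_eq_iff tens_def bilinear_form_iff linear_form_iff assms)

lemma tensor_cong_spaces:
  assumes "scal V = scal V'" "vecs V = vecs V'" "scal W = scal W'" "vecs W = vecs W'"
  shows "tensor V W = tensor V' W'"
  unfolding tensor_def tensor_span_def tens_cong_spaces[OF assms] assms(2,4) ..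

lemma dual_cong_spaces: "scal V = scal W \<Longrightarrow> vecs V = vecs W \<Longrightarrow> dual V = dual W"
  by (simp add: dual_def linear_form_iff)

lemma dual_map_cong_spaces:
  assumes "scal V = scal V'" "vecs V = vecs V'" "scal W = scal W'" "vecs W = vecs W'"
  shows "dual_map V W m = dual_map V' W' m"
  unfolding dual_map_def dual_cong_spaces[OF assms(1,2)] dual_cong_spaces[OF assms(3,4)] assms(2,4) ..

lemma is_vspace_cong: "scal V = scal W \<Longrightarrow> vecs V = vecs W \<Longrightarrow> is_vspace V \<longleftrightarrow> is_vspace W"
  by (simp add: is_vspace_def)

lemma pev_map: "pev \<phi> (map h ds) ms = pev (\<lambda>d. \<phi> (h d)) ds ms"
  by (induction ds arbitrary: ms) simp_all

locale twisted_division = coord_division +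
  fixes \<alpha> :: "(nat \<Rightarrow> 'a::field) \<Rightarrow> nat \<Rightarrow> 'a"
  assumes \<alpha>_linear: "linear_map \<lparr>scal = pscale, vecs = V\<rparr> \<lparr>scal = pscale, vecs = V\<rparr> \<alpha>"
    and \<alpha>_bij: "bij_betw \<alpha> V V"
    and \<alpha>_one: "\<alpha> e = e"
    and \<alpha>_mult: "a \<in> V \<Longrightarrow> b \<in> V \<Longrightarrow> \<alpha> (a \<odot> b) = \<alpha> a \<odot> \<alpha> b"
begin

abbreviation VS :: "('a, nat \<Rightarrow> 'a) vspace" where "VS \<equiv> \<lparr>scal = pscale, vecs = V\<rparr>"

abbreviation N0 :: "('a, (nat \<Rightarrow> 'a) \<Rightarrow> 'a) vspace" where "N0 \<equiv> dual VS"

definition Dalg :: "('a, nat \<Rightarrow> 'a) algebra" where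
  "Dalg = \<lparr>scal = pscale, vecs = V, amult = (\<odot>), aone = e\<rparr>"

definition CC :: "('a, (nat \<Rightarrow> 'a) \<Rightarrow> 'a) coalgebra" where
  "CC = dual_coalgebra Dalg"

definition NN :: "('a, (nat \<Rightarrow> 'a) \<Rightarrow> 'a, (nat \<Rightarrow> 'a) \<Rightarrow> 'a) bicomodule" where
  "NN = dual_bicomodule Dalg (twisted_bimodule Dalg \<alpha>)"

lemma vs_VS: "is_vspace VS" by (rule is_vspace_coord)

lemma vs_N0: "is_vspace N0" by (rule is_vspace_dual[OF vs_VS])

lemma dual_Dalg: "dual Dalg = N0"
  by (rule dual_cong_spaces) (simp_all add: Dalg_def)

lemma dual_twisted: "dual (twisted_bimodule Dalg \<alpha>) = N0"
  by (rule dual_cong_spaces) (simp_all add: Dalg_def twisted_bimodule_def)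

lemma dual_map_simps:
  "dual_map Dalg Dalg m = dual_map VS VS m"
  "dual_map Dalg (twisted_bimodule Dalg \<alpha>) m = dual_map VS VS m"
  "dual_map (twisted_bimodule Dalg \<alpha>) Dalg m = dual_map VS VS m"
  by (rule dual_map_cong_spaces; simp add: Dalg_def twisted_bimodule_def)+

lemma CC_simps: "scal CC = pscale" "vecs CC = vecs N0" "comult CC = dual_map VS VS (\<odot>)"
    "counit CC g = g e"
  unfolding CC_def dual_coalgebra_def dual_Dalg dual_map_simps by (simp_all add: Dalg_def)

lemma NN_simps: "scal NN = pscale" "vecs NN = vecs N0" "lcoact NN = dual_map VS VS (\<odot>)"
    "rcoact NN = dual_map VS VS (\<lambda>x b. x \<odot> \<alpha> b)"
  unfolding NN_def dual_bicomodule_def dual_twisted bicomodule.simps vspace.simps dual_map_simps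
  by (simp_all add: Dalg_def twisted_bimodule_def)

lemma vs_CC: "is_vspace CC" and vs_NN: "is_vspace NN"
  using vs_N0 is_vspace_cong[of CC N0] is_vspace_cong[of NN N0] by (simp_all add: CC_simps NN_simps)

lemma tensor_simps: "tensor CC NN = tensor N0 N0" "tensor NN CC = tensor N0 N0" "tensor CC CC = tensor N0 N0"
  by (rule tensor_cong_spaces; simp add: CC_simps NN_simps)+

lemma N0_linear: "g \<in> vecs N0 \<Longrightarrow> linear_map VS ground g"
  by (simp add: vecs_dual)

lemma N0_outside: "g \<in> vecs N0 \<Longrightarrow> a \<notin> V \<Longrightarrow> g a = 0"
  by (simp add: vecs_dual)

lemmas N0_app = linear_form_basic[OF vs_VS N0_linear, simplified]

lemma N0_eqI: "g \<in> vecs N0 \<Longrightarrow> h \<in> vecs N0 \<Longrightarrow> (\<And>a. a \<in> V \<Longrightarrow> g a = h a) \<Longrightarrow> g = h"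
  by (rule ext) (metis N0_outside)

lemma N0_restrict: "linear_map VS ground g \<Longrightarrow> (\<lambda>a. if a \<in> V then g a else 0) \<in> vecs N0"
  by (simp add: vecs_dual linear_form_iff V_closed)

lemma linear_eval_at: "scal W = pscale \<Longrightarrow> linear_map W ground (\<lambda>g. g d)"
  by (rule linear_eval)

section \<open>Dual bases and dual maps\<close>

definition dual_unit :: "nat \<Rightarrow> (nat \<Rightarrow> 'a) \<Rightarrow> 'a" where
  "dual_unit j = (\<lambda>f. if f \<in> V then f j else 0)"

lemma dual_unit_mem: "dual_unit j \<in> vecs N0"
  unfolding dual_unit_def by (rule N0_restrict) (simp add: linear_form_iff pscale_apply)

lemma coord_form_expand:
  assumes g: "linear_map VS ground g" and a: "a \<in> V"
  shows "g a = (\<Sum>j<n. a j * g (unit_vec j))"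
proof -
  have "g a = g (\<Sum>j<n. pscale (a j) (unit_vec j))" using coord_space_expand[OF a] by (rule arg_cong)
  also have "\<dots> = (\<Sum>j<n. g (pscale (a j) (unit_vec j)))"
    using unit_vec_mem V_closed(4) by (intro linear_form_basic(5)[OF vs_VS g]) auto
  also have "\<dots> = (\<Sum>j<n. a j * g (unit_vec j))"
    using linear_form_basic(4)[OF vs_VS g] by (intro sum.cong) (auto simp: unit_vec_mem)
  finally show ?thesis .
qed

lemma dual_unit_expand:
  assumes g: "g \<in> vecs N0" shows "g = (\<Sum>j<n. pscale (g (unit_vec j)) (dual_unit j))"
proof (rule N0_eqI[OF g])
  show "(\<Sum>j<n. pscale (g (unit_vec j)) (dual_unit j)) \<in> vecs N0"
    using vecs_closed(4)[OF vs_N0 dual_unit_mem] by (intro vecs_closed(5)[OF vs_N0]) simp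
  show "g a = (\<Sum>j<n. pscale (g (unit_vec j)) (dual_unit j)) a" if "a \<in> V" for a
    using coord_form_expand[OF N0_linear[OF g] that] that
    by (simp add: sum_fun_apply pscale_apply dual_unit_def mult.commute)
qed

text \<open>Evaluations at points of \<open>V\<close> separate functionals on \<open>V\<close>, so
  pairs of points separate the tensors.\<close>

lemma tensor_N0_eqI:
  assumes "t \<in> vecs (tensor N0 N0)" "t' \<in> vecs (tensor N0 N0)"
    and "\<And>a b. a \<in> V \<Longrightarrow> b \<in> V \<Longrightarrow> t (\<lambda>g h. g a * h b) = t' (\<lambda>g h. g a * h b)"
  shows "t = t'"
proof (rule tensor_eqI[OF vs_N0 vs_N0 _ _ _ _ assms(1,2),
      where P = "(\<lambda>a g. g a) ` V" and Q = "(\<lambda>a g. g a) ` V"])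
  show "g = 0" if "g \<in> vecs N0" "\<And>p. p \<in> (\<lambda>a g. g a) ` V \<Longrightarrow> p g = 0" for g
    using that vecs_closed(1)[OF vs_N0] by (intro N0_eqI) auto
  then show "g = 0" if "g \<in> vecs N0" "\<And>p. p \<in> (\<lambda>a g. g a) ` V \<Longrightarrow> p g = 0" for g
    using that .
qed (auto intro: linear_eval_at assms(3))

text \<open>This justifies the definite description: the tensor with coefficients f(m u_i u_j) in
  the dual basis has the required values, and such values determine a tensor.\<close>

lemma dual_map_spec:
  assumes f: "bilinear_map VS VS ground (\<lambda>v w. f (m v w))"
  shows "dual_map VS VS m f \<in> vecs (tensor N0 N0)"
    and "a \<in> V \<Longrightarrow> b \<in> V \<Longrightarrow> dual_map VS VS m f (\<lambda>g h. g a * h b) = f (m a b)"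
proof -
  let ?P = "\<lambda>t. t \<in> vecs (tensor N0 N0) \<and> (\<forall>v\<in>vecs VS. \<forall>w\<in>vecs VS. t (\<lambda>g h. g v * h w) = f (m v w))"
  define t where "t = (\<Sum>i<n. \<Sum>j<n. pscale (f (m (unit_vec i) (unit_vec j))) (tens N0 N0 (dual_unit i) (dual_unit j)))"
  have "pscale c (tens N0 N0 (dual_unit i) (dual_unit j)) \<in> vecs (tensor N0 N0)" for c i j
    using vecs_closed(4)[OF is_vspace_tensor, of _ N0 N0 c] tens_in_tensor[OF dual_unit_mem dual_unit_mem]
    by simp
  then have t: "t \<in> vecs (tensor N0 N0)"
    unfolding t_def by (intro vecs_closed(5)[OF is_vspace_tensor])
  moreover have "t (\<lambda>g h. g v * h w) = f (m v w)" if v: "v \<in> V" and w: "w \<in> V" for v w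
  proof -
    have B: "bilinear_map N0 N0 ground (\<lambda>g h. g v * h w)"
      by (intro bilinear_form_mult linear_eval_at) simp_all
    have "t (\<lambda>g h. g v * h w) = (\<Sum>i<n. \<Sum>j<n. v i * (w j * f (m (unit_vec i) (unit_vec j))))"
      using v w by (simp add: t_def sum_fun_apply pscale_apply tens_apply[OF B] dual_unit_def algebra_simps)
    also have "\<dots> = (\<Sum>i<n. v i * f (m (unit_vec i) w))"
    proof (rule sum.cong[OF refl])
      fix i assume "i \<in> {..<n}"
      then have "linear_map VS ground (\<lambda>w. f (m (unit_vec i) w))"
        using bilinear_right[OF f, of "unit_vec i"] by (simp add: unit_vec_mem)
      from coord_form_expand[OF this w]
      show "(\<Sum>j<n. v i * (w j * f (m (unit_vec i) (unit_vec j)))) = v i * f (m (unit_vec i) w)"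
        by (simp add: sum_distrib_left)
    qed
    also have "\<dots> = f (m v w)"
      using coord_form_expand[OF bilinear_left[OF f] v, of w] w by simp
    finally show ?thesis .
  qed
  ultimately have "?P t" by simp
  moreover have "t' = t" if "?P t'" for t'
    using that \<open>?P t\<close> by (intro tensor_N0_eqI) simp_all
  ultimately have "?P (dual_map VS VS m f)"
    unfolding dual_map_def by (rule theI[of ?P])
  then show "dual_map VS VS m f \<in> vecs (tensor N0 N0)"
    and "a \<in> V \<Longrightarrow> b \<in> V \<Longrightarrow> dual_map VS VS m f (\<lambda>g h. g a * h b) = f (m a b)" by simp_all
qed

lemma dual_map_linear:
  assumes "\<And>g. g \<in> vecs N0 \<Longrightarrow> bilinear_map VS VS ground (\<lambda>v w. g (m v w))"
  shows "linear_map N0 (tensor N0 N0) (dual_map VS VS m)"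
  unfolding linear_map_def
proof (intro conjI ballI allI)
  have spec: "dual_map VS VS m g \<in> vecs (tensor N0 N0)"
    "\<And>a b. a \<in> V \<Longrightarrow> b \<in> V \<Longrightarrow> dual_map VS VS m g (\<lambda>u w. u a * w b) = g (m a b)"
    if "g \<in> vecs N0" for g
    using dual_map_spec[of g m, OF assms[OF that]] by blast+
  show "dual_map VS VS m g \<in> vecs (tensor N0 N0)" if "g \<in> vecs N0" for g
    using spec(1)[OF that] .
  show "dual_map VS VS m (g + h) = dual_map VS VS m g + dual_map VS VS m h"
    if "g \<in> vecs N0" "h \<in> vecs N0" for g h
    using that spec
    by (intro tensor_N0_eqI) (simp_all add: vecs_closed(2)[OF vs_N0] vecs_closed(2)[OF is_vspace_tensor])
  show "dual_map VS VS m (scal N0 a g) = scal (tensor N0 N0) a (dual_map VS VS m g)"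
    if "g \<in> vecs N0" for a g
    using that spec vecs_closed(4)[OF vs_N0, of g a] vecs_closed(4)[OF is_vspace_tensor spec(1)[OF that], of a]
    by (intro tensor_N0_eqI) (simp_all add: pscale_apply)
qed

lemma \<alpha>_mem [simp]: "a \<in> V \<Longrightarrow> \<alpha> a \<in> V"
  using \<alpha>_linear by (simp add: linear_map_def)

lemma \<alpha>_add: "a \<in> V \<Longrightarrow> b \<in> V \<Longrightarrow> \<alpha> (a + b) = \<alpha> a + \<alpha> b"
  using \<alpha>_linear by (simp add: linear_map_def)

lemma \<alpha>_scale: "a \<in> V \<Longrightarrow> \<alpha> (pscale r a) = pscale r (\<alpha> a)"
  using \<alpha>_linear by (simp add: linear_map_def)

lemma N0_mult_bilinear:
  assumes g: "g \<in> vecs N0"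
  shows "bilinear_map VS VS ground (\<lambda>v w. g (v \<odot> w))"
    and "bilinear_map VS VS ground (\<lambda>v w. g (v \<odot> \<alpha> w))"
  by (simp_all add: bilinear_form_iff linear_form_iff m_add_left m_add_right m_scale_left m_scale_right
      \<alpha>_add \<alpha>_scale N0_app[OF g])

lemma mult_spec:
  assumes "g \<in> vecs N0"
  shows "dual_map VS VS (\<odot>) g \<in> vecs (tensor N0 N0)"
    and "a \<in> V \<Longrightarrow> b \<in> V \<Longrightarrow> dual_map VS VS (\<odot>) g (\<lambda>u w. u a * w b) = g (a \<odot> b)"
  using dual_map_spec[of g "(\<odot>)", OF N0_mult_bilinear(1)[OF assms]] by blast+

lemma twist_spec:
  assumes "g \<in> vecs N0"
  shows "dual_map VS VS (\<lambda>x b. x \<odot> \<alpha> b) g \<in> vecs (tensor N0 N0)"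
    and "a \<in> V \<Longrightarrow> b \<in> V \<Longrightarrow> dual_map VS VS (\<lambda>x b. x \<odot> \<alpha> b) g (\<lambda>u w. u a * w b) = g (a \<odot> \<alpha> b)"
  using dual_map_spec[of g "\<lambda>x b. x \<odot> \<alpha> b", OF N0_mult_bilinear(2)[OF assms]] by blast+

lemma lcoact_linear: "linear_map NN (tensor CC NN) (lcoact NN)"
  using dual_map_linear[OF N0_mult_bilinear(1)]
  unfolding tensor_simps NN_simps by (simp add: linear_map_def NN_simps)

lemma rcoact_linear: "linear_map NN (tensor NN CC) (rcoact NN)"
  using dual_map_linear[OF N0_mult_bilinear(2)]
  unfolding tensor_simps NN_simps by (simp add: linear_map_def NN_simps)

section \<open>Testing tensor powers on words\<close>

abbreviation pf :: "(nat \<Rightarrow> 'a) list \<Rightarrow> ((nat \<Rightarrow> 'a) \<Rightarrow> 'a) list \<Rightarrow> 'a" where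
  "pf \<equiv> pev (\<lambda>d g. g d)"

lemma eval_NN: "linear_map NN ground (\<lambda>g. g d)"
  by (rule linear_eval_at) (simp add: NN_simps)

lemma multilinear_pf: "multilinear_form NN (length ds) (pf ds)"
  by (rule multilinear_pev[OF vs_NN eval_NN])

text \<open>Expanding a multilinear form in dual bases reduces it to forms \<open>pf\<close> on
  words of unit vectors; at arguments that are not multilinear, \<open>t\<close> is 0 by
  construction.\<close>

lemma tpow_separated:
  assumes t: "t \<in> vecs (tpow NN k)" and 0: "\<And>ds. length ds = k \<Longrightarrow> set ds \<subseteq> V \<Longrightarrow> t (pf ds) = 0"
  shows "t = 0"
proof
  fix F
  let ?J = "{js. set js \<subseteq> {..<n} \<and> length js = k}"
  show "t F = 0 F"
  proof (cases "multilinear_form NN k F")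
    case True
    have "t F = t (\<lambda>ms. \<Sum>js\<in>?J. F (map dual_unit js) * pf (map unit_vec js) ms)"
    proof (rule tpow_cong[OF vs_NN t])
      fix ms assume ms: "length ms = k" "set ms \<subseteq> vecs NN"
      have "F ms = (\<Sum>js\<in>?J. pev (\<lambda>j g. g (unit_vec j)) js ms * F (map dual_unit js))"
        by (rule multilinear_expansion[OF vs_NN _ _ True ms])
          (simp_all add: NN_simps dual_unit_mem flip: dual_unit_expand)
      then show "F ms = (\<Sum>js\<in>?J. F (map dual_unit js) * pf (map unit_vec js) ms)"
        by (simp add: pev_map mult.commute)
    qed
    also have "\<dots> = (\<Sum>js\<in>?J. t (\<lambda>ms. F (map dual_unit js) * pf (map unit_vec js) ms))"
      using multilinear_pf[of "map unit_vec _"]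
      by (intro tpow_form_sum[OF t] multilinear_form_scale) auto
    also have "\<dots> = (\<Sum>js\<in>?J. F (map dual_unit js) * t (pf (map unit_vec js)))"
    proof (rule sum.cong[OF refl])
      fix js assume "js \<in> ?J"
      then have "multilinear_form NN k (pf (map unit_vec js))" using multilinear_pf[of "map unit_vec js"] by simp
      then show "t (\<lambda>ms. F (map dual_unit js) * pf (map unit_vec js) ms) = F (map dual_unit js) * t (pf (map unit_vec js))"
        by (rule tpow_form_scale[OF t])
    qed
    also have "\<dots> = 0"
      by (intro sum.neutral ballI) (auto simp: subset_iff unit_vec_mem intro!: 0)
    finally show ?thesis by simp
  qed (simp add: tpow_not_multilinear[OF t])
qed

text \<open>The coefficient of x^k in (d_1 x) ... (d_k x), where x d = \<alpha>(d) x.\<close>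

fun dprod :: "(nat \<Rightarrow> 'a) list \<Rightarrow> nat \<Rightarrow> 'a" where
  "dprod [] = e"
| "dprod (d # ds) = d \<odot> \<alpha> (dprod ds)"

lemma dprod_mem [simp]: "dprod ds \<in> V"
  by (cases ds) simp_all

lemma multilinear_dprod:
  "linear_map VS ground \<psi> \<Longrightarrow> multilinear_form VS k (\<lambda>ds. \<psi> (dprod ds))"
proof (induction k arbitrary: \<psi>)
  case 0
  show ?case by (rule multilinear_formI) simp
next
  case (Suc k)
  have "linear_map VS ground (\<lambda>x. \<psi> (x \<odot> \<alpha> y))" for y
    using Suc.prems by (simp add: linear_form_iff m_add_left m_scale_left)
  moreover have "linear_map VS ground (\<lambda>y. \<psi> (x \<odot> \<alpha> y))" for x
    using Suc.prems by (simp add: linear_form_iff m_add_right m_scale_right \<alpha>_add \<alpha>_scale)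
  ultimately show ?case
    unfolding multilinear_form_Suc[OF vs_VS] using Suc.IH[of "\<lambda>y. \<psi> (_ \<odot> \<alpha> y)"] by simp
qed

text \<open>The element of the tensor power that represents the multilinear form ds |-> \<psi>(dprod
  ds), written in the dual basis.\<close>

definition tau :: "nat \<Rightarrow> ((nat \<Rightarrow> 'a) \<Rightarrow> 'a) \<Rightarrow> (((nat \<Rightarrow> 'a) \<Rightarrow> 'a) list \<Rightarrow> 'a) \<Rightarrow> 'a" where
  "tau k \<psi> = (\<Sum>js\<in>{js. set js \<subseteq> {..<n} \<and> length js = k}.
     pscale (\<psi> (dprod (map unit_vec js))) (word NN k (map dual_unit js)))"

lemma tau_mem: "tau k \<psi> \<in> vecs (tpow NN k)"
proof -
  have "pscale c (word NN k (map dual_unit js)) \<in> vecs (tpow NN k)" if "length js = k" for c js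
    using vecs_closed(4)[OF is_vspace_tpow word_mem[of "map dual_unit js" k NN], of c] that dual_unit_mem
    by (auto simp: NN_simps)
  then show ?thesis unfolding tau_def by (intro vecs_closed(5)[OF is_vspace_tpow]) auto
qed

lemma tau_eval:
  assumes \<psi>: "linear_map VS ground \<psi>" and ds: "length ds = k" "set ds \<subseteq> V"
  shows "tau k \<psi> (pf ds) = \<psi> (dprod ds)"
proof -
  let ?J = "{js. set js \<subseteq> {..<n} \<and> length js = k}"
  have pf_sym: "pf es (map dual_unit js) = pev (\<lambda>j v. v j) js es"
    if "length es = length js" "set es \<subseteq> V" for es js
    using that by (induction es js rule: list_induct2) (auto simp: dual_unit_def)
  have "tau k \<psi> (pf ds) = (\<Sum>js\<in>?J. pev (\<lambda>j v. v j) js ds * \<psi> (dprod (map unit_vec js)))"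
    using ds multilinear_pf[of ds]
    by (auto simp: tau_def sum_fun_apply pscale_apply word_apply pf_sym mult.commute intro!: sum.cong)
  also have "\<dots> = \<psi> (dprod ds)"
    by (rule multilinear_expansion[OF vs_VS _ _ multilinear_dprod[OF \<psi>], symmetric])
      (use ds in \<open>simp_all add: unit_vec_mem flip: coord_space_expand\<close>)
  finally show ?thesis .
qed

lemma \<alpha>_pow_mem [simp]: "a \<in> V \<Longrightarrow> (\<alpha> ^^ i) a \<in> V"
  by (induction i) simp_all

lemma \<alpha>_pow_mult: "a \<in> V \<Longrightarrow> b \<in> V \<Longrightarrow> (\<alpha> ^^ i) (a \<odot> b) = (\<alpha> ^^ i) a \<odot> (\<alpha> ^^ i) b"
  by (induction i) (simp_all add: \<alpha>_mult)

lemma dprod_append: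
  "dprod (ds @ ds') = dprod ds \<odot> (\<alpha> ^^ length ds) (dprod ds')"
  by (induction ds) (simp_all add: \<alpha>_mult m_assoc)

lemma dprod_replicate: "dprod (replicate k e) = e"
  by (induction k) (simp_all add: \<alpha>_one)

section \<open>Coactions and the cotensor condition on words\<close>

lemma lcoact_pow_eval:
  assumes t: "t \<in> vecs (tpow NN k)" and k: "k = Suc (length ds)" and ad: "a \<in> V" "d \<in> V"
  shows "lcoact_pow CC NN k t (\<lambda>c u. c a * u (pf (d # ds))) = t (pf ((a \<odot> d) # ds))"
proof -
  have B: "bilinear_map CC (tpow NN k) ground (\<lambda>c u. c a * u (pf (d # ds)))"
    by (intro bilinear_form_mult linear_eval) (simp_all add: CC_simps)
  have ml: "multilinear_form NN k (pf (d # ds))" using multilinear_pf[of "d # ds"] k by simp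
  show ?thesis
    unfolding lcoact_pow_def wlift_apply tlift_def tens_apply[OF B]
  proof (rule tpow_cong[OF vs_NN t])
    fix ms assume ms: "length ms = k" "set ms \<subseteq> vecs NN"
    then obtain y ys where y: "ms = y # ys" "y \<in> vecs N0" using k by (cases ms) (auto simp: NN_simps)
    have mem: "lcoact NN y \<in> vecs (tensor N0 N0)" using mult_spec(1)[OF y(2)] by (simp add: NN_simps)
    have B': "bilinear_map N0 N0 ground (\<lambda>c x. c a * x d)"
      by (intro bilinear_form_mult linear_eval) simp_all
    have "lcoact NN y (\<lambda>c x. pf ds ys * (c a * x d)) = pf ds ys * y (a \<odot> d)"
      using tensor_form_scale[OF mem B', of "pf ds ys"] mult_spec(2)[OF y(2) ad] by (simp add: NN_simps)
    then show "lcoact NN (hd ms) (\<lambda>c x. c a * word NN k (x # tl ms) (pf (d # ds))) = pf ((a \<odot> d) # ds) ms"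
      by (simp add: y(1) word_apply[OF ml] mult.assoc mult.commute mult.left_commute)
  qed
qed

lemma rcoact_pow_eval:
  assumes t: "t \<in> vecs (tpow NN k)" and k: "k = Suc (length ds)" and ad: "a \<in> V" "d \<in> V"
  shows "rcoact_pow CC NN k t (\<lambda>u c. u (pf (ds @ [d])) * c a) = t (pf (ds @ [d \<odot> \<alpha> a]))"
proof -
  have B: "bilinear_map (tpow NN k) CC ground (\<lambda>u c. u (pf (ds @ [d])) * c a)"
    by (intro bilinear_form_mult linear_eval) (simp_all add: CC_simps)
  have ml: "multilinear_form NN k (pf (ds @ [d]))" using multilinear_pf[of "ds @ [d]"] k by simp
  show ?thesis
    unfolding rcoact_pow_def wlift_apply tlift_def tens_apply[OF B]
  proof (rule tpow_cong[OF vs_NN t])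
    fix ms assume ms: "length ms = k" "set ms \<subseteq> vecs NN"
    then have "ms \<noteq> []" using k by auto
    then have y: "last ms \<in> vecs N0" using ms(2) last_in_set[of ms] by (auto simp: NN_simps)
    have mem: "rcoact NN (last ms) \<in> vecs (tensor N0 N0)" using twist_spec(1)[OF y] by (simp add: NN_simps)
    have B': "bilinear_map N0 N0 ground (\<lambda>x c. x d * c a)"
      by (intro bilinear_form_mult linear_eval) simp_all
    have "rcoact NN (last ms) (\<lambda>x c. pf ds (butlast ms) * (x d * c a)) = pf ds (butlast ms) * (last ms) (d \<odot> \<alpha> a)"
      using tensor_form_scale[OF mem B', of "pf ds (butlast ms)"] twist_spec(2)[OF y ad(2,1)]
      by (simp add: NN_simps)
    then show "rcoact NN (last ms) (\<lambda>x c. word NN k (butlast ms @ [x]) (pf (ds @ [d])) * c a) = pf (ds @ [d \<odot> \<alpha> a]) ms"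
      using ms k by (simp add: word_apply[OF ml[unfolded k]] pev_snoc mult.assoc mult.left_commute)
  qed
qed

lemma tsplit_pf:
  "t \<in> vecs (tpow NN k) \<Longrightarrow> i = length ds \<Longrightarrow> i + length ds' = k \<Longrightarrow>
   tsplit NN k i t (\<lambda>u w. u (pf ds) * w (pf ds')) = t (pf (ds @ ds'))"
  using tsplit_eval[OF vs_NN eval_NN] by simp

text \<open>Dually to the coactions, the kernel condition between neighbouring slots says that
  \<open>t\<close> is balanced: a scalar \<open>a\<close> acting through \<alpha> on the right of
  one letter may be moved to the left of the next.\<close>

lemma cotensor_pow_iff:
  assumes t: "t \<in> vecs (tpow NN k)"
  shows "t \<in> vecs (cotensor_pow CC NN k) \<longleftrightarrow>
    (\<forall>es d a b fs. length es + length fs + 2 = k \<and> set es \<subseteq> V \<and> set fs \<subseteq> V \<and> d \<in> V \<and> a \<in> V \<and> b \<in> V \<longrightarrow>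
      t (pf (es @ (d \<odot> \<alpha> a) # b # fs)) = t (pf (es @ d # (a \<odot> b) # fs)))"
proof -
  define LL where "LL i = tassoc (tpow NN i) CC (tpow NN (k - i))
      (tmap (tensor (tpow NN i) CC) (tpow NN (k - i)) (rcoact_pow CC NN i) id (tsplit NN k i t))" for i
  define RR where "RR i = tmap (tpow NN i) (tensor CC (tpow NN (k - i))) id (lcoact_pow CC NN (k - i)) (tsplit NN k i t)" for i
  \<comment> \<open>A test form on triple tensors: the left part is evaluated on the word
    \<open>ds\<close>, the middle factor at \<open>a\<close> and the right part on
    \<open>ds'\<close>. Equality on all of these forces equality of the tensors.\<close>
  define \<Phi> where "\<Phi> ds a ds' = (\<lambda>(u :: (((nat \<Rightarrow> 'a) \<Rightarrow> 'a) list \<Rightarrow> 'a) \<Rightarrow> 'a) s :: (((nat \<Rightarrow> 'a) \<Rightarrow> 'a) \<Rightarrow> ((((nat \<Rightarrow> 'a) \<Rightarrow> 'a) list \<Rightarrow> 'a) \<Rightarrow> 'a) \<Rightarrow> 'a) \<Rightarrow> 'a.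
      u (pf ds) * s (\<lambda>c w. c a * w (pf ds')))" for ds a ds'
  have \<Phi>: "bilinear_map (tpow NN i) (tensor CC (tpow NN j)) ground (\<Phi> ds a ds')" for i j ds a ds'
    unfolding \<Phi>_def by (intro bilinear_form_mult linear_eval) simp_all
  have split_mem: "tsplit NN k i t \<in> vecs (tensor (tpow NN i) (tpow NN (k - i)))" if "i < k" for i
    using tsplit_mem[OF vs_NN _ t] that by simp
  have lin_id: "linear_map W W id" for W :: "('a, 'w::ab_group_add) vspace" by (simp add: linear_map_def)
  have mapL: "tmap (tensor (tpow NN i) CC) (tpow NN (k - i)) (rcoact_pow CC NN i) id (tsplit NN k i t)
      \<in> vecs (tensor (tensor (tpow NN i) CC) (tpow NN (k - i)))" if "0 < i" "i < k" for i
    using that by (intro tmap_mem[OF linear_rcoact_pow[OF vs_CC vs_NN rcoact_linear] lin_id split_mem]) auto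
  have LL_mem: "LL i \<in> vecs (tensor (tpow NN i) (tensor CC (tpow NN (k - i))))" if "0 < i" "i < k" for i
    unfolding LL_def by (rule tassoc_mem[OF is_vspace_tpow mapL[OF that]])
  have RR_mem: "RR i \<in> vecs (tensor (tpow NN i) (tensor CC (tpow NN (k - i))))" if "0 < i" "i < k" for i
    unfolding RR_def
    using that by (intro tmap_mem[OF lin_id linear_lcoact_pow[OF vs_CC vs_NN lcoact_linear] split_mem]) auto
  have LL_eval: "LL i (\<Phi> (es @ [d]) a (b # fs)) = t (pf (es @ (d \<odot> \<alpha> a) # b # fs))"
    if i: "i = Suc (length es)" "i + Suc (length fs) = k" and V: "d \<in> V" "a \<in> V" for i es d a b fs
  proof -
    have ik: "0 < i" "i < k" using i by auto
    have B1: "bilinear_map CC (tpow NN (k - i)) ground (\<lambda>c w. c a * w (pf (b # fs)))"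
      by (intro bilinear_form_mult linear_eval) (simp_all add: CC_simps)
    have B2: "bilinear_map (tpow NN i) CC ground (\<lambda>v c. v (pf (es @ [d])) * c a)"
      by (intro bilinear_form_mult linear_eval) (simp_all add: CC_simps)
    have B3: "bilinear_map (tensor (tpow NN i) CC) (tpow NN (k - i)) ground
        (\<lambda>s u. s (\<lambda>v c. v (pf (es @ [d])) * c a) * u (pf (b # fs)))"
      by (intro bilinear_form_mult linear_eval) simp_all
    have "LL i (\<Phi> (es @ [d]) a (b # fs)) =
        tmap (tensor (tpow NN i) CC) (tpow NN (k - i)) (rcoact_pow CC NN i) id (tsplit NN k i t)
          (\<lambda>s u. s (\<lambda>v c. v (pf (es @ [d])) * c a) * u (pf (b # fs)))"
      unfolding LL_def tassoc_apply[OF \<Phi>]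
    proof (rule tensor_cong[OF is_vspace_tensor is_vspace_tpow mapL[OF ik]])
      fix s u assume s: "s \<in> vecs (tensor (tpow NN i) CC)"
      have "s (\<lambda>v w. \<Phi> (es @ [d]) a (b # fs) v (tens CC (tpow NN (k - i)) w u)) =
          s (\<lambda>v w. u (pf (b # fs)) * (v (pf (es @ [d])) * w a))"
        by (simp add: \<Phi>_def tens_apply[OF B1] mult.commute mult.left_commute)
      then show "s (\<lambda>v w. \<Phi> (es @ [d]) a (b # fs) v (tens CC (tpow NN (k - i)) w u)) =
          s (\<lambda>v c. v (pf (es @ [d])) * c a) * u (pf (b # fs))"
        using tensor_form_scale[OF s B2] by (simp add: mult.commute)
    qed
    also have "\<dots> = tsplit NN k i t (\<lambda>u w. u (pf (es @ [d \<odot> \<alpha> a])) * w (pf (b # fs)))"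
      unfolding tmap_apply[OF B3]
      by (rule tensor_cong[OF is_vspace_tpow is_vspace_tpow split_mem[OF ik(2)]])
        (use rcoact_pow_eval[OF _ i(1) V(2,1)] in simp)
    also have "\<dots> = t (pf ((es @ [d \<odot> \<alpha> a]) @ b # fs))" using i by (intro tsplit_pf[OF t]) auto
    finally show ?thesis by simp
  qed
  have RR_eval: "RR i (\<Phi> (es @ [d]) a (b # fs)) = t (pf (es @ d # (a \<odot> b) # fs))"
    if i: "i = Suc (length es)" "i + Suc (length fs) = k" and V: "a \<in> V" "b \<in> V" for i es d a b fs
  proof -
    have ik: "0 < i" "i < k" "k - i = Suc (length fs)" using i by auto
    have "RR i (\<Phi> (es @ [d]) a (b # fs)) = tsplit NN k i t (\<lambda>u w. u (pf (es @ [d])) * w (pf ((a \<odot> b) # fs)))"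
      unfolding RR_def tmap_apply[OF \<Phi>]
      by (rule tensor_cong[OF is_vspace_tpow is_vspace_tpow split_mem[OF ik(2)]])
        (use lcoact_pow_eval[OF _ ik(3) V] in \<open>simp add: \<Phi>_def\<close>)
    also have "\<dots> = t (pf ((es @ [d]) @ (a \<odot> b) # fs))" using i by (intro tsplit_pf[OF t]) auto
    finally show ?thesis by simp
  qed
  have cond: "t \<in> vecs (cotensor_pow CC NN k) \<longleftrightarrow> (\<forall>i. 0 < i \<and> i < k \<longrightarrow> LL i = RR i)"
    using t by (simp add: cotensor_pow_def LL_def RR_def)
  show ?thesis
    unfolding cond
  proof (intro iffI allI impI)
    fix es d a b fs
    assume eq: "\<forall>i. 0 < i \<and> i < k \<longrightarrow> LL i = RR i"
      and V: "length es + length fs + 2 = k \<and> set es \<subseteq> V \<and> set fs \<subseteq> V \<and> d \<in> V \<and> a \<in> V \<and> b \<in> V"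
    let ?i = "Suc (length es)"
    have i: "?i + Suc (length fs) = k" "0 < ?i \<and> ?i < k" using V by auto
    have "LL ?i (\<Phi> (es @ [d]) a (b # fs)) = RR ?i (\<Phi> (es @ [d]) a (b # fs))" using eq i(2) by simp
    then show "t (pf (es @ (d \<odot> \<alpha> a) # b # fs)) = t (pf (es @ d # (a \<odot> b) # fs))"
      using LL_eval[OF refl i(1), of d a b] RR_eval[OF refl i(1), of a b d] V by simp
  next
    fix i
    assume eq: "\<forall>es d a b fs. length es + length fs + 2 = k \<and> set es \<subseteq> V \<and> set fs \<subseteq> V \<and> d \<in> V \<and> a \<in> V \<and> b \<in> V \<longrightarrow>
      t (pf (es @ (d \<odot> \<alpha> a) # b # fs)) = t (pf (es @ d # (a \<odot> b) # fs))"
      and i: "0 < i \<and> i < k"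
    let ?P = "{\<lambda>u. u (pf ds) | ds. length ds = i \<and> set ds \<subseteq> V}"
    let ?Q = "{\<lambda>s. s (\<lambda>c w. c a * w (pf ds')) | a ds'. a \<in> V \<and> length ds' = k - i \<and> set ds' \<subseteq> V}"
    show "LL i = RR i"
    proof (rule tensor_eqI[OF is_vspace_tpow is_vspace_tensor, where P = ?P and Q = ?Q])
      show "LL i \<in> vecs (tensor (tpow NN i) (tensor CC (tpow NN (k - i))))"
        "RR i \<in> vecs (tensor (tpow NN i) (tensor CC (tpow NN (k - i))))"
        using LL_mem RR_mem i by blast+
      show "linear_map (tpow NN i) ground p" if "p \<in> ?P" for p
        using that linear_eval[of "tpow NN i"] by auto
      show "linear_map (tensor CC (tpow NN (k - i))) ground q" if "q \<in> ?Q" for q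
        using that linear_eval[of "tensor CC (tpow NN (k - i))"] by auto
      show "v = 0" if "v \<in> vecs (tpow NN i)" "\<And>p. p \<in> ?P \<Longrightarrow> p v = 0" for v
        using that(2) by (intro tpow_separated[OF that(1)]) blast
      show "s = 0" if s: "s \<in> vecs (tensor CC (tpow NN (k - i)))" "\<And>q. q \<in> ?Q \<Longrightarrow> q s = 0" for s
      proof (rule tensor_separated[OF vs_CC is_vspace_tpow _ _ _ _ s(1),
            where P = "(\<lambda>a g. g a) ` V" and Q = "{\<lambda>u. u (pf ds) | ds. length ds = k - i \<and> set ds \<subseteq> V}"])
        show "g = 0" if "g \<in> vecs CC" "\<And>p. p \<in> (\<lambda>a g. g a) ` V \<Longrightarrow> p g = 0" for g
          using that vecs_closed(1)[OF vs_N0] by (intro N0_eqI) (auto simp: CC_simps)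
        show "w = 0" if "w \<in> vecs (tpow NN (k - i))"
          "\<And>q. q \<in> {\<lambda>u. u (pf ds) | ds. length ds = k - i \<and> set ds \<subseteq> V} \<Longrightarrow> q w = 0" for w
          using that(2) by (intro tpow_separated[OF that(1)]) blast
        show "s (\<lambda>v w. p v * q w) = 0"
          if "p \<in> (\<lambda>a g. g a) ` V" "q \<in> {\<lambda>u. u (pf ds) | ds. length ds = k - i \<and> set ds \<subseteq> V}" for p q
          using s(2) that by blast
      qed (auto intro!: linear_eval simp: CC_simps)
      show "LL i (\<lambda>v w. p v * q w) = RR i (\<lambda>v w. p v * q w)" if pq: "p \<in> ?P" "q \<in> ?Q" for p q
      proof -
        obtain ds a ds' where ds: "length ds = i" "set ds \<subseteq> V" "a \<in> V" "length ds' = k - i" "set ds' \<subseteq> V"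
          and p: "p = (\<lambda>u. u (pf ds))" and q: "q = (\<lambda>s. s (\<lambda>c w. c a * w (pf ds')))" using pq by blast
        obtain es d where es: "ds = es @ [d]" using ds(1) i by (cases ds rule: rev_cases) auto
        obtain b fs where fs: "ds' = b # fs" using ds(4) i by (cases ds') auto
        have "LL i (\<Phi> ds a ds') = RR i (\<Phi> ds a ds')"
        proof -
          have mem: "set es \<subseteq> V" "d \<in> V" "b \<in> V" "set fs \<subseteq> V" using ds(2,5) by (auto simp: es fs)
          have len: "i = Suc (length es)" "i + Suc (length fs) = k" using ds(1,4) i by (auto simp: es fs)
          have "t (pf (es @ (d \<odot> \<alpha> a) # b # fs)) = t (pf (es @ d # (a \<odot> b) # fs))"
            using eq mem ds(3) len by auto
          then show ?thesis
            using LL_eval[OF len mem(2) ds(3)] RR_eval[OF len ds(3) mem(3)] by (simp only: es fs)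
        qed
        then show ?thesis by (simp add: p q \<Phi>_def)
      qed
    qed
  qed
qed

end

section \<open>The graded total space and the isomorphism onto the cotensor part\<close>

context twisted_division
begin

abbreviation TS where "TS \<equiv> tensor_sum CC NN"
abbreviation CS where "CS \<equiv> cotensor_sum CC NN"

lemma scal_TS: "scal TS = (\<lambda>a (c, t). (pscale a c, \<lambda>k. pscale a (t k)))"
  by (simp add: tensor_sum_def graded_sum_def CC_simps)

lemma scal_CS: "scal CS = scal TS"
  by (simp add: cotensor_sum_def tensor_sum_def graded_sum_def cotensor_pow_def)

lemma vecs_TS: "(c, t) \<in> vecs TS \<longleftrightarrow>
    c \<in> vecs N0 \<and> t 0 = 0 \<and> (\<forall>k\<ge>1. t k \<in> vecs (tpow NN k)) \<and> finite {k. t k \<noteq> 0}"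
  by (simp add: tensor_sum_def graded_sum_def CC_simps)

lemma vecs_CS: "(c, t) \<in> vecs CS \<longleftrightarrow>
    c \<in> vecs N0 \<and> t 0 = 0 \<and> (\<forall>k\<ge>1. t k \<in> vecs (cotensor_pow CC NN k)) \<and> finite {k. t k \<noteq> 0}"
  by (simp add: cotensor_sum_def graded_sum_def CC_simps)

lemma cotensor_pow_subset: "vecs (cotensor_pow CC NN k) \<subseteq> vecs (tpow NN k)"
  by (auto simp: cotensor_pow_def)

lemma cotensor_pow_closed:
  "0 \<in> vecs (cotensor_pow CC NN k)"
  "s \<in> vecs (cotensor_pow CC NN k) \<Longrightarrow> t \<in> vecs (cotensor_pow CC NN k) \<Longrightarrow> s + t \<in> vecs (cotensor_pow CC NN k)"
  "t \<in> vecs (cotensor_pow CC NN k) \<Longrightarrow> pscale r t \<in> vecs (cotensor_pow CC NN k)"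
proof -
  note c = vecs_closed[OF is_vspace_tpow[of NN k], simplified]
  show "0 \<in> vecs (cotensor_pow CC NN k)"
    by (simp add: cotensor_pow_iff[OF c(1)])
  assume t: "t \<in> vecs (cotensor_pow CC NN k)"
  then have t': "t \<in> vecs (tpow NN k)" using cotensor_pow_subset by blast
  show "pscale r t \<in> vecs (cotensor_pow CC NN k)"
    using t by (simp add: cotensor_pow_iff[OF c(4)[OF t']] cotensor_pow_iff[OF t'] pscale_apply)
  assume s: "s \<in> vecs (cotensor_pow CC NN k)"
  then have s': "s \<in> vecs (tpow NN k)" using cotensor_pow_subset by blast
  show "s + t \<in> vecs (cotensor_pow CC NN k)"
    using s t by (simp add: cotensor_pow_iff[OF c(2)[OF s' t']] cotensor_pow_iff[OF t'] cotensor_pow_iff[OF s'])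
qed

lemma CS_subset: "vecs CS \<subseteq> vecs TS"
  using cotensor_pow_subset by (force simp: vecs_CS vecs_TS)

lemma vector_space_TS: "vector_space (scal TS)"
  unfolding scal_TS
  by unfold_locales (auto simp: pscale_def fun_eq_iff algebra_simps)

lemma support_closed:
  fixes t u :: "nat \<Rightarrow> 'x \<Rightarrow> 'k::field"
  assumes "finite {k. t k \<noteq> 0}"
  shows "finite {k. u k \<noteq> 0} \<Longrightarrow> finite {k. t k + u k \<noteq> 0}"
    and "finite {k. pscale r (t k) \<noteq> 0}"
proof -
  show "finite {k. pscale r (t k) \<noteq> 0}"
    by (rule finite_subset[OF _ assms]) (auto simp: pscale_rules simp del: zero_fun_apply)
  assume "finite {k. u k \<noteq> 0}"
  then have "finite ({k. t k \<noteq> 0} \<union> {k. u k \<noteq> 0})" using assms by simp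
  then show "finite {k. t k + u k \<noteq> 0}" by (rule finite_subset[rotated]) auto
qed

lemma vs_TS: "is_vspace TS"
proof -
  interpret vector_space "scal TS" by (rule vector_space_TS)
  note c = vecs_closed[OF vs_N0, simplified] and d = vecs_closed[OF is_vspace_tpow, simplified]
  have "subspace (vecs TS)"
  proof (rule subspaceI)
    show "0 \<in> vecs TS" by (simp add: zero_prod_def vecs_TS c d del: zero_fun_apply) (simp add: d)
    show "x + y \<in> vecs TS" if "x \<in> vecs TS" "y \<in> vecs TS" for x y
      using that by (cases x; cases y) (simp add: vecs_TS c d support_closed)
    show "scal TS r x \<in> vecs TS" if "x \<in> vecs TS" for r x
      using that by (cases x) (simp add: scal_TS vecs_TS c d support_closed pscale_rules)
  qed
  then show ?thesis by (simp add: is_vspace_def vector_space_TS)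
qed

lemma vs_CS: "is_vspace CS"
proof -
  interpret vector_space "scal TS" by (rule vector_space_TS)
  note c = vecs_closed[OF vs_N0, simplified]
  have "subspace (vecs CS)"
  proof (rule subspaceI)
    show "0 \<in> vecs CS" by (simp add: zero_prod_def vecs_CS c cotensor_pow_closed del: zero_fun_apply) (simp add: cotensor_pow_closed)
    show "x + y \<in> vecs CS" if "x \<in> vecs CS" "y \<in> vecs CS" for x y
      using that by (cases x; cases y) (simp add: vecs_CS c cotensor_pow_closed support_closed)
    show "scal TS r x \<in> vecs CS" if "x \<in> vecs CS" for r x
      using that by (cases x) (simp add: scal_TS vecs_CS c cotensor_pow_closed support_closed pscale_rules)
  qed
  then show ?thesis by (simp add: is_vspace_def vector_space_TS scal_CS)
qed

type_synonym ('b) total = "((nat \<Rightarrow> 'b) \<Rightarrow> 'b) \<times> (nat \<Rightarrow> (((nat \<Rightarrow> 'b) \<Rightarrow> 'b) list \<Rightarrow> 'b) \<Rightarrow> 'b)"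

definition pr0 :: "(nat \<Rightarrow> 'a) \<Rightarrow> 'a total \<Rightarrow> 'a" where
  "pr0 a x = fst x a"

definition prn :: "(nat \<Rightarrow> 'a) list \<Rightarrow> 'a total \<Rightarrow> 'a" where
  "prn ds x = snd x (length ds) (pf ds)"

text \<open>Degree 0 has its own component in the pair, so only nonempty words occur besides the
  evaluations \<open>pr0\<close>.\<close>

definition functionals :: "('a total \<Rightarrow> 'a) set" where
  "functionals = pr0 ` V \<union> prn ` {ds. ds \<noteq> [] \<and> set ds \<subseteq> V}"

lemma functionals_linear: "p \<in> functionals \<Longrightarrow> linear_map TS ground p"
  by (auto simp: functionals_def linear_form_iff scal_TS pr0_def prn_def pscale_apply)

lemma functionals_linear_CS: "p \<in> functionals \<Longrightarrow> linear_map CS ground p"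
  using functionals_linear[of p] CS_subset unfolding linear_form_iff scal_CS by blast

lemma functionals_separate:
  assumes x: "x \<in> vecs TS" and 0: "\<And>p. p \<in> functionals \<Longrightarrow> p x = 0" shows "x = 0"
proof -
  obtain c t where ct: "x = (c, t)" by (cases x)
  note xv = x[unfolded ct vecs_TS]
  have "c a = 0" if "a \<in> V" for a using 0[of "pr0 a"] that by (simp add: functionals_def pr0_def ct)
  then have "c = 0" using xv vecs_closed(1)[OF vs_N0] by (intro N0_eqI) auto
  moreover have t0: "t k = 0" for k
  proof (cases "k = 0")
    case False
    have "t k (pf ds) = 0" if "length ds = k" "set ds \<subseteq> V" for ds
      using 0[of "prn ds"] that False by (auto simp: functionals_def prn_def ct)
    then show ?thesis using xv False tpow_separated[of "t k" k] by auto
  qed (use xv in simp)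
  moreover have "t = 0" by (rule ext) (simp only: t0 zero_fun_apply)
  ultimately show ?thesis by (simp only: ct zero_prod_def)
qed

lemma TS_eqI:
  assumes "x \<in> vecs TS" "y \<in> vecs TS" "\<And>p. p \<in> functionals \<Longrightarrow> p x = p y" shows "x = y"
proof -
  have "x - y = 0"
    by (rule functionals_separate[OF vecs_closed(3)[OF vs_TS assms(1,2)]])
      (simp add: linear_form_basic(3)[OF vs_TS functionals_linear assms(1,2)] assms(3))
  then show ?thesis by simp
qed

lemma tensor_TS_eqI:
  assumes "t \<in> vecs (tensor TS TS)" "t' \<in> vecs (tensor TS TS)"
    "\<And>p q. p \<in> functionals \<Longrightarrow> q \<in> functionals \<Longrightarrow> t (\<lambda>x y. p x * q y) = t' (\<lambda>x y. p x * q y)"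
  shows "t = t'"
  by (rule tensor_eqI[OF vs_TS vs_TS functionals_linear functionals_linear functionals_separate
        functionals_separate assms(1,2), of functionals functionals]) (use assms(3) in auto)

text \<open>Restricted to the cotensor part the functionals still separate. This gives uniqueness in
  the definite description of the comultiplication.\<close>

lemma tensor_CS_eqI:
  assumes "t \<in> vecs (tensor CS CS)" "t' \<in> vecs (tensor CS CS)"
    "\<And>p q. p \<in> functionals \<Longrightarrow> q \<in> functionals \<Longrightarrow> t (\<lambda>x y. p x * q y) = t' (\<lambda>x y. p x * q y)"
  shows "t = t'"
proof -
  have sep: "x = 0" if "x \<in> vecs CS" "\<And>p. p \<in> functionals \<Longrightarrow> p x = 0" for x
    using functionals_separate[of x] that CS_subset by blast
  show ?thesis
    by (rule tensor_eqI[OF vs_CS vs_CS functionals_linear_CS functionals_linear_CS sep sep assms(1,2),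
          of functionals functionals]) (use assms(3) in auto)
qed

lemma in_deg_simps:
  "pr0 a (in_deg0 c) = c a" "k \<ge> 1 \<Longrightarrow> pr0 a (in_deg k u) = 0" "prn ds (in_deg0 c) = 0"
  "prn ds (in_deg k u) = (if k = length ds then u (pf ds) else 0)"
  by (auto simp: pr0_def prn_def in_deg0_def in_deg_def)

lemma in_deg0_linear: "linear_map CC TS in_deg0"
  using vecs_closed(1)[OF is_vspace_tpow, of NN]
  by (auto simp: linear_map_def in_deg0_def vecs_TS CC_simps scal_TS pscale_rules zero_fun_def[symmetric] fun_eq_iff
      pscale_apply)

lemma in_deg_linear: "k \<ge> 1 \<Longrightarrow> linear_map (tpow NN k) TS (in_deg k)"
  using vecs_closed(1)[OF is_vspace_tpow, of NN] vecs_closed(1)[OF vs_N0]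
  by (auto simp: linear_map_def in_deg_def vecs_TS scal_TS pscale_rules fun_eq_iff pscale_apply)

lemma ambient_mem:
  assumes x: "x \<in> vecs TS" shows "ambient_comult CC NN x \<in> vecs (tensor TS TS)"
proof -
  obtain c t where ct: "x = (c, t)" by (cases x)
  note xv = x[unfolded ct vecs_TS]
  have cm: "comult CC c \<in> vecs (tensor CC CC)"
    using xv mult_spec(1)[of c] by (simp add: CC_simps(3) tensor_simps)
  have tm: "k \<ge> 1 \<and> t k \<in> vecs (tpow NN k)" if "t k \<noteq> 0" for k
    using that xv by (cases k) auto
  note add = vecs_closed(2)[OF is_vspace_tensor]
  show ?thesis
    unfolding ambient_comult_def ct case_prod_conv
  proof (intro add vecs_closed(5)[OF is_vspace_tensor] tmap_mem[OF in_deg0_linear in_deg0_linear cm])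
    fix k assume "k \<in> {k. t k \<noteq> 0}"
    then have k: "k \<ge> 1" "t k \<in> vecs (tpow NN k)" using tm by auto
    show "tmap TS TS in_deg0 (in_deg k) (lcoact_pow CC NN k (t k)) \<in> vecs (tensor TS TS)"
      by (rule tmap_mem[OF in_deg0_linear in_deg_linear[OF k(1)]
            lcoact_pow_mem[OF vs_CC vs_NN lcoact_linear k]])
    show "tmap TS TS (in_deg k) in_deg0 (rcoact_pow CC NN k (t k)) \<in> vecs (tensor TS TS)"
      by (rule tmap_mem[OF in_deg_linear[OF k(1)] in_deg0_linear
            rcoact_pow_mem[OF vs_CC vs_NN rcoact_linear k]])
    show "tmap TS TS (in_deg i) (in_deg (k - i)) (tsplit NN k i (t k)) \<in> vecs (tensor TS TS)"
      if "i \<in> {1..<k}" for i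
      by (rule tmap_mem[OF in_deg_linear in_deg_linear tsplit_mem[OF vs_NN _ k(2)]]) (use that in auto)
  qed
qed

lemma ambient_eval:
  assumes p: "p \<in> functionals" and q: "q \<in> functionals"
  shows "ambient_comult CC NN (c, t) (\<lambda>x y. p x * q y) =
    comult CC c (\<lambda>g h. p (in_deg0 g) * q (in_deg0 h)) +
    (\<Sum>k\<in>{k. t k \<noteq> 0}.
       lcoact_pow CC NN k (t k) (\<lambda>g u. p (in_deg0 g) * q (in_deg k u)) +
       (\<Sum>i\<in>{1..<k}. tsplit NN k i (t k) (\<lambda>u w. p (in_deg i u) * q (in_deg (k - i) w))) +
       rcoact_pow CC NN k (t k) (\<lambda>u g. p (in_deg k u) * q (in_deg0 g)))"
proof -
  have B: "bilinear_map TS TS ground (\<lambda>x y. p x * q y)"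
    by (intro bilinear_form_mult functionals_linear p q)
  show ?thesis
    by (simp add: ambient_comult_def tmap_apply[OF B] sum_fun_apply)
qed

text \<open>Only degree \<open>l\<close> contributes; if \<open>l\<close> lies outside the support,
  both sides are 0.\<close>

lemma sum_support:
  fixes t :: "nat \<Rightarrow> 'x \<Rightarrow> 'a"
  assumes "finite {k. t k \<noteq> 0}" "\<And>k. t k \<noteq> 0 \<Longrightarrow> F k = (if k = l then t l z else 0)"
  shows "(\<Sum>k\<in>{k. t k \<noteq> 0}. F k) = t l z"
proof -
  have "(\<Sum>k\<in>{k. t k \<noteq> 0}. F k) = (\<Sum>k\<in>{k. t k \<noteq> 0}. if k = l then t l z else 0)"
    using assms(2) by (intro sum.cong) auto
  also have "\<dots> = t l z" using assms(1) by (auto simp: sum.delta)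
  finally show ?thesis .
qed

text \<open>Each pair of test functionals sees one kind of summand: the coproduct of D^*, a coaction
  or one splitting. Dually, scalars multiply the outer letters of a word, on the right through
  \<alpha>, and words are concatenated.\<close>

lemma ambient_values:
  assumes x: "x \<in> vecs TS"
  shows "a \<in> V \<Longrightarrow> b \<in> V \<Longrightarrow> ambient_comult CC NN x (\<lambda>x y. pr0 a x * pr0 b y) = pr0 (a \<odot> b) x"
    and "a \<in> V \<Longrightarrow> d \<in> V \<Longrightarrow> set ds \<subseteq> V \<Longrightarrow>
      ambient_comult CC NN x (\<lambda>x y. pr0 a x * prn (d # ds) y) = prn ((a \<odot> d) # ds) x"
    and "b \<in> V \<Longrightarrow> d \<in> V \<Longrightarrow> set ds \<subseteq> V \<Longrightarrow>
      ambient_comult CC NN x (\<lambda>x y. prn (ds @ [d]) x * pr0 b y) = prn (ds @ [d \<odot> \<alpha> b]) x"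
    and "ds \<noteq> [] \<Longrightarrow> ds' \<noteq> [] \<Longrightarrow> set ds \<subseteq> V \<Longrightarrow> set ds' \<subseteq> V \<Longrightarrow>
      ambient_comult CC NN x (\<lambda>x y. prn ds x * prn ds' y) = prn (ds @ ds') x"
proof -
  obtain c t where ct: "x = (c, t)" by (cases x)
  note xv = x[unfolded ct vecs_TS]
  have cm: "comult CC c \<in> vecs (tensor CC CC)"
    using xv mult_spec(1)[of c] by (simp add: CC_simps(3) tensor_simps)
  have tm: "k \<ge> 1" "t k \<in> vecs (tpow NN k)" if "t k \<noteq> 0" for k
    using that xv by (cases k; auto)+
  have l0: "lcoact_pow CC NN k (t k) (\<lambda>g u. 0) = 0"
    and r0: "rcoact_pow CC NN k (t k) (\<lambda>g u. 0) = 0" if "t k \<noteq> 0" for k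
    using tensor_form_zero[OF lcoact_pow_mem[OF vs_CC vs_NN lcoact_linear tm[OF that]]]
      tensor_form_zero[OF rcoact_pow_mem[OF vs_CC vs_NN rcoact_linear tm[OF that]]] by simp_all
  have s0: "tsplit NN k i (t k) (\<lambda>g u. 0) = 0" if "t k \<noteq> 0" "i \<in> {1..<k}" for k i
    using tensor_form_zero[OF tsplit_mem[OF vs_NN _ tm(2)[OF that(1)], of i]] that by simp
  have c0: "comult CC c (\<lambda>g h. 0) = 0" by (rule tensor_form_zero[OF cm])
  show "ambient_comult CC NN x (\<lambda>x y. pr0 a x * pr0 b y) = pr0 (a \<odot> b) x" if "a \<in> V" "b \<in> V"
  proof -
    have pq: "pr0 a \<in> functionals" "pr0 b \<in> functionals" using that by (auto simp: functionals_def)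
    have "ambient_comult CC NN x (\<lambda>x y. pr0 a x * pr0 b y) = comult CC c (\<lambda>g h. g a * h b) + 0"
      unfolding ct ambient_eval[OF pq]
    proof (intro arg_cong2[where f = "(+)"] sum.neutral ballI)
      show "comult CC c (\<lambda>g h. pr0 a (in_deg0 g) * pr0 b (in_deg0 h)) = comult CC c (\<lambda>g h. g a * h b)"
        by (simp add: in_deg_simps)
      fix k assume "k \<in> {k. t k \<noteq> 0}"
      then have k: "t k \<noteq> 0" by simp
      show "lcoact_pow CC NN k (t k) (\<lambda>g u. pr0 a (in_deg0 g) * pr0 b (in_deg k u)) +
          (\<Sum>i\<in>{1..<k}. tsplit NN k i (t k) (\<lambda>u w. pr0 a (in_deg i u) * pr0 b (in_deg (k - i) w))) +
          rcoact_pow CC NN k (t k) (\<lambda>u g. pr0 a (in_deg k u) * pr0 b (in_deg0 g)) = 0"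
        using tm(1)[OF k] by (auto simp: in_deg_simps l0[OF k] r0[OF k] s0[OF k] intro!: sum.neutral)
    qed
    then show ?thesis using mult_spec(2)[of c a b] xv that by (simp add: CC_simps(3) pr0_def ct)
  qed
  show "ambient_comult CC NN x (\<lambda>x y. pr0 a x * prn (d # ds) y) = prn ((a \<odot> d) # ds) x"
    if V: "a \<in> V" "d \<in> V" "set ds \<subseteq> V"
  proof -
    have pq: "pr0 a \<in> functionals" "prn (d # ds) \<in> functionals" using V by (auto simp: functionals_def)
    let ?l = "Suc (length ds)"
    have "ambient_comult CC NN x (\<lambda>x y. pr0 a x * prn (d # ds) y) = 0 + t ?l (pf ((a \<odot> d) # ds))"
      unfolding ct ambient_eval[OF pq]
    proof (intro arg_cong2[where f = "(+)"] sum_support)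
      show "comult CC c (\<lambda>g h. pr0 a (in_deg0 g) * prn (d # ds) (in_deg0 h)) = 0"
        by (simp add: in_deg_simps c0)
      fix k assume k: "t k \<noteq> 0"
      have sz: "(\<Sum>i\<in>{1..<k}. tsplit NN k i (t k) (\<lambda>u w. pr0 a (in_deg i u) * prn (d # ds) (in_deg (k - i) w))) = 0"
        by (rule sum.neutral) (auto simp: in_deg_simps s0[OF k])
      show "lcoact_pow CC NN k (t k) (\<lambda>g u. pr0 a (in_deg0 g) * prn (d # ds) (in_deg k u)) +
          (\<Sum>i\<in>{1..<k}. tsplit NN k i (t k) (\<lambda>u w. pr0 a (in_deg i u) * prn (d # ds) (in_deg (k - i) w))) +
          rcoact_pow CC NN k (t k) (\<lambda>u g. pr0 a (in_deg k u) * prn (d # ds) (in_deg0 g)) =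
          (if k = ?l then t ?l (pf ((a \<odot> d) # ds)) else 0)"
        unfolding sz using lcoact_pow_eval[OF tm(2)[OF k] _ V(1,2)] tm(1)[OF k]
        by (auto simp: in_deg_simps l0[OF k] r0[OF k] simp del: pev.simps)
    qed (use xv in auto)
    then show ?thesis by (simp add: prn_def ct del: pev.simps)
  qed
  show "ambient_comult CC NN x (\<lambda>x y. prn (ds @ [d]) x * pr0 b y) = prn (ds @ [d \<odot> \<alpha> b]) x"
    if V: "b \<in> V" "d \<in> V" "set ds \<subseteq> V"
  proof -
    have pq: "prn (ds @ [d]) \<in> functionals" "pr0 b \<in> functionals" using V by (auto simp: functionals_def)
    let ?l = "Suc (length ds)"
    have "ambient_comult CC NN x (\<lambda>x y. prn (ds @ [d]) x * pr0 b y) = 0 + t ?l (pf (ds @ [d \<odot> \<alpha> b]))"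
      unfolding ct ambient_eval[OF pq]
    proof (intro arg_cong2[where f = "(+)"] sum_support)
      show "comult CC c (\<lambda>g h. prn (ds @ [d]) (in_deg0 g) * pr0 b (in_deg0 h)) = 0"
        by (simp add: in_deg_simps c0)
      fix k assume k: "t k \<noteq> 0"
      have sz: "(\<Sum>i\<in>{1..<k}. tsplit NN k i (t k) (\<lambda>u w. prn (ds @ [d]) (in_deg i u) * pr0 b (in_deg (k - i) w))) = 0"
        by (rule sum.neutral) (auto simp: in_deg_simps s0[OF k])
      show "lcoact_pow CC NN k (t k) (\<lambda>g u. prn (ds @ [d]) (in_deg0 g) * pr0 b (in_deg k u)) +
          (\<Sum>i\<in>{1..<k}. tsplit NN k i (t k) (\<lambda>u w. prn (ds @ [d]) (in_deg i u) * pr0 b (in_deg (k - i) w))) +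
          rcoact_pow CC NN k (t k) (\<lambda>u g. prn (ds @ [d]) (in_deg k u) * pr0 b (in_deg0 g)) =
          (if k = ?l then t ?l (pf (ds @ [d \<odot> \<alpha> b])) else 0)"
        unfolding sz using rcoact_pow_eval[OF tm(2)[OF k] _ V(1,2)] tm(1)[OF k]
        by (auto simp: in_deg_simps l0[OF k] r0[OF k])
    qed (use xv in auto)
    then show ?thesis by (simp add: prn_def ct)
  qed
  show "ambient_comult CC NN x (\<lambda>x y. prn ds x * prn ds' y) = prn (ds @ ds') x"
    if V: "ds \<noteq> []" "ds' \<noteq> []" "set ds \<subseteq> V" "set ds' \<subseteq> V"
  proof -
    have pq: "prn ds \<in> functionals" "prn ds' \<in> functionals" using V by (auto simp: functionals_def)
    let ?l = "length ds + length ds'"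
    have "ambient_comult CC NN x (\<lambda>x y. prn ds x * prn ds' y) = 0 + t ?l (pf (ds @ ds'))"
      unfolding ct ambient_eval[OF pq]
    proof (intro arg_cong2[where f = "(+)"] sum_support)
      show "comult CC c (\<lambda>g h. prn ds (in_deg0 g) * prn ds' (in_deg0 h)) = 0"
        by (simp add: in_deg_simps c0)
      fix k assume k: "t k \<noteq> 0"
      have "(\<Sum>i\<in>{1..<k}. tsplit NN k i (t k) (\<lambda>u w. prn ds (in_deg i u) * prn ds' (in_deg (k - i) w))) =
          (\<Sum>i\<in>{1..<k}. if i = length ds then (if k = ?l then t ?l (pf (ds @ ds')) else 0) else 0)"
      proof (rule sum.cong[OF refl])
        fix i assume i: "i \<in> {1..<k}"
        have "(k - i = length ds') = (k = i + length ds')" using i by auto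
        then show "tsplit NN k i (t k) (\<lambda>u w. prn ds (in_deg i u) * prn ds' (in_deg (k - i) w)) =
          (if i = length ds then (if k = ?l then t ?l (pf (ds @ ds')) else 0) else 0)"
          using tsplit_pf[OF tm(2)[OF k], of i ds ds'] s0[OF k i]
          by (cases "i = length ds"; cases "k = ?l") (simp_all add: in_deg_simps)
      qed
      also have "\<dots> = (if k = ?l then t ?l (pf (ds @ ds')) else 0)"
        using V(1,2) by (auto simp: Suc_le_eq)
      finally show "lcoact_pow CC NN k (t k) (\<lambda>g u. prn ds (in_deg0 g) * prn ds' (in_deg k u)) +
          (\<Sum>i\<in>{1..<k}. tsplit NN k i (t k) (\<lambda>u w. prn ds (in_deg i u) * prn ds' (in_deg (k - i) w))) +
          rcoact_pow CC NN k (t k) (\<lambda>u g. prn ds (in_deg k u) * prn ds' (in_deg0 g)) =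
          (if k = ?l then t ?l (pf (ds @ ds')) else 0)"
        by (simp add: in_deg_simps l0[OF k] r0[OF k])
    qed (use xv in auto)
    then show ?thesis by (simp add: prn_def ct)
  qed
qed

text \<open>Balancing from the right end collects all letters in one place, so \<open>t\<close> is
  determined by words whose letters after the first are \<open>e\<close>. The prefix
  \<open>pre\<close> serves the induction, which works on suffixes.\<close>

lemma cotensor_reduce:
  assumes t: "t \<in> vecs (cotensor_pow CC NN k)"
    and "length pre + length ds + 1 = k" "set pre \<subseteq> V" "set ds \<subseteq> V" "d \<in> V"
  shows "t (pf (pre @ d # ds)) = t (pf (pre @ (d \<odot> \<alpha> (dprod ds)) # replicate (length ds) e))"
  using assms(2-)
proof (induction ds arbitrary: pre d)
  case Nil
  then show ?case by (simp add: \<alpha>_one)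
next
  case (Cons b ds)
  have t': "t \<in> vecs (tpow NN k)" using t cotensor_pow_subset by blast
  have V: "b \<in> V" "set ds \<subseteq> V" using Cons.prems by auto
  have "t (pf (pre @ d # b # ds)) = t (pf ((pre @ [d]) @ b # ds))" by simp
  also have "\<dots> = t (pf ((pre @ [d]) @ (b \<odot> \<alpha> (dprod ds)) # replicate (length ds) e))"
    using Cons.prems V by (intro Cons.IH) auto
  also have "\<dots> = t (pf (pre @ d # ((b \<odot> \<alpha> (dprod ds)) \<odot> e) # replicate (length ds) e))"
    by simp
  \<comment> \<open>An instance of balancing in which the second letter is \<open>e\<close>: the
    whole collected factor moves into the letter on its left.\<close>
  also have "\<dots> = t (pf (pre @ (d \<odot> \<alpha> (b \<odot> \<alpha> (dprod ds))) # e # replicate (length ds) e))"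
    using t[unfolded cotensor_pow_iff[OF t'], rule_format, of pre "replicate (length ds) e" d "b \<odot> \<alpha> (dprod ds)" e]
      Cons.prems by (auto simp: set_replicate_conv_if simp del: pev.simps)
  finally show ?case by simp
qed

text \<open>By multiplicativity of \<alpha>, \<open>dprod\<close> does not change when a scalar
  passes between neighbouring letters.\<close>

lemma tau_cotensor:
  assumes \<psi>: "linear_map VS ground \<psi>" shows "tau k \<psi> \<in> vecs (cotensor_pow CC NN k)"
  unfolding cotensor_pow_iff[OF tau_mem]
proof (intro allI impI)
  fix es d a b fs
  assume *: "length es + length fs + 2 = k \<and> set es \<subseteq> V \<and> set fs \<subseteq> V \<and> d \<in> V \<and> a \<in> V \<and> b \<in> V"
  have "dprod (es @ (d \<odot> \<alpha> a) # b # fs) = dprod (es @ d # (a \<odot> b) # fs)"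
    using * by (simp add: dprod_append \<alpha>_mult m_assoc)
  then show "tau k \<psi> (pf (es @ (d \<odot> \<alpha> a) # b # fs)) = tau k \<psi> (pf (es @ d # (a \<odot> b) # fs))"
    using * by (simp add: tau_eval[OF \<psi>] del: dprod.simps)
qed

lemma slot_linear:
  assumes t: "t \<in> vecs (tpow NN (Suc (length ds)))"
  shows "linear_map VS ground (\<lambda>a. t (pf (a # ds)))"
  unfolding linear_form_iff
proof (intro conjI ballI allI)
  have ml: "multilinear_form NN (Suc (length ds)) (pf (a # ds))" for a
    using multilinear_pf[of "a # ds"] by simp
  have hd0: "hd ms \<in> vecs N0" if "length ms = Suc (length ds)" "set ms \<subseteq> vecs NN" for ms
    using that by (cases ms) (auto simp: NN_simps)
  fix a assume a: "a \<in> vecs VS"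
  show "t (pf ((a + b) # ds)) = t (pf (a # ds)) + t (pf (b # ds))" if b: "b \<in> vecs VS" for b
  proof -
    have "t (pf ((a + b) # ds)) = t (\<lambda>ms. pf (a # ds) ms + pf (b # ds) ms)"
      by (rule tpow_cong[OF vs_NN t]) (use a b hd0 in \<open>simp add: N0_app distrib_right\<close>)
    then show ?thesis using tpow_form_add[OF t ml ml] by simp
  qed
  show "t (pf (scal VS r a # ds)) = r * t (pf (a # ds))" for r
  proof -
    have "t (pf (scal VS r a # ds)) = t (\<lambda>ms. r * pf (a # ds) ms)"
      by (rule tpow_cong[OF vs_NN t]) (use a hd0 in \<open>simp add: N0_app\<close>)
    then show ?thesis using tpow_form_scale[OF t ml] by simp
  qed
qed

text \<open>The family \<theta> exhibits \<open>C\<close> as the graded dual of the skew polynomial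
  ring: \<open>c\<close> is sent to the functionals a |-> \<theta> a i c, one for each degree i.
  Products of the \<open>\<theta> a i\<close> dualise to the comultiplication, and the last three
  hypotheses give finite support, injectivity and surjectivity.\<close>

theorem skew_dual_isomorphic:
  fixes C :: "('a, 'c::ab_group_add) coalgebra"
  assumes C: "is_coalgebra C"
    and \<theta>A: "\<And>a i. \<theta> a i \<in> vecs (dual C)"
    and \<theta>_add: "\<And>a b i. \<theta> (a + b) i = \<theta> a i + \<theta> b i"
    and \<theta>_scale: "\<And>r a i. \<theta> (pscale r a) i = pscale r (\<theta> a i)"
    and \<theta>_mult: "\<And>a b i j. a \<in> V \<Longrightarrow> b \<in> V \<Longrightarrow>
      coalg.conv C (\<theta> a i) (\<theta> b j) = \<theta> (a \<odot> (\<alpha> ^^ i) b) (i + j)"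
    and \<theta>_one: "\<theta> e 0 = coalg.eps C"
    and \<theta>_fin: "\<And>c. c \<in> vecs C \<Longrightarrow> \<exists>N. \<forall>i\<ge>N. \<forall>a\<in>V. \<theta> a i c = 0"
    and \<theta>_sep: "\<And>c. c \<in> vecs C \<Longrightarrow> (\<And>a i. a \<in> V \<Longrightarrow> \<theta> a i c = 0) \<Longrightarrow> c = 0"
    and \<theta>_surj: "\<And>\<psi> N. (\<And>i. linear_map VS ground (\<psi> i)) \<Longrightarrow>
      (\<And>i a. i \<ge> N \<Longrightarrow> a \<in> V \<Longrightarrow> \<psi> i a = 0) \<Longrightarrow> \<exists>c\<in>vecs C. \<forall>a\<in>V. \<forall>i. \<theta> a i c = \<psi> i a"
  shows "coalgebra_isomorphic C (DC Dalg \<alpha>)"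
proof -
  interpret K: coalg C by unfold_locales (rule C)
  have \<psi>: "linear_map VS ground (\<lambda>a. \<theta> a i c)" for i c
    by (simp add: linear_form_iff \<theta>_add \<theta>_scale pscale_apply)
  define f where "f c = ((\<lambda>a. if a \<in> V then \<theta> a 0 c else 0), (\<lambda>k. if k = 0 then 0 else tau k (\<lambda>a. \<theta> a k c)))" for c
  have f0: "pr0 a (f c) = \<theta> a 0 c" if "a \<in> V" for a c using that by (simp add: f_def pr0_def)
  have fn: "prn ds (f c) = \<theta> (dprod ds) (length ds) c" if "ds \<noteq> []" "set ds \<subseteq> V" for ds c
    using that by (simp add: f_def prn_def tau_eval[OF \<psi>])
  have f_CS: "f c \<in> vecs CS" if c: "c \<in> vecs C" for c
  proof -
    obtain N where N: "\<And>i a. i \<ge> N \<Longrightarrow> a \<in> V \<Longrightarrow> \<theta> a i c = 0" using \<theta>_fin[OF c] by blast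
    have "tau k (\<lambda>a. \<theta> a k c) = 0" if "k \<ge> N" for k
      unfolding tau_def by (rule sum.neutral) (simp add: N[OF that] pscale_rules)
    then have "k < N" if "(if k = 0 then 0 else tau k (\<lambda>a. \<theta> a k c)) \<noteq> 0" for k
      using that by (metis not_less)
    then have "{k. (if k = 0 then 0 else tau k (\<lambda>a. \<theta> a k c)) \<noteq> 0} \<subseteq> {..<N}" by blast
    then have "finite {k. (if k = 0 then 0 else tau k (\<lambda>a. \<theta> a k c)) \<noteq> 0}"
      by (rule finite_subset) simp
    then show ?thesis
      unfolding f_def vecs_CS using N0_restrict[OF \<psi>] tau_cotensor[OF \<psi>] by auto
  qed
  have f_TS: "f c \<in> vecs TS" if "c \<in> vecs C" for c using f_CS[OF that] CS_subset by blast
  \<comment> \<open>On the image of \<open>f\<close> every test functional is one of the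
    \<open>\<theta> a i\<close>, so the properties of \<open>f\<close> can be read off in the dual
    algebra.\<close>
  have f_values: "\<exists>a\<in>V. \<exists>i. \<forall>c\<in>vecs C. p (f c) = \<theta> a i c" if "p \<in> functionals" for p
    using that f0 fn dprod_mem unfolding functionals_def by (elim UnE imageE) (blast, auto)
  have f_linear: "linear_map C CS f"
    unfolding linear_map_def
  proof (intro conjI ballI allI)
    show "f c \<in> vecs CS" if "c \<in> vecs C" for c using f_CS[OF that] .
    show "f (c + d) = f c + f d" if cd: "c \<in> vecs C" "d \<in> vecs C" for c d
    proof (rule TS_eqI)
      fix p assume p: "p \<in> functionals"
      from f_values[OF p] obtain a i where "\<forall>c\<in>vecs C. p (f c) = \<theta> a i c" by blast
      then show "p (f (c + d)) = p (f c + f d)"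
        using cd by (simp add: linear_form_basic(2)[OF vs_TS functionals_linear[OF p]] f_TS K.A_app(2)[OF \<theta>A])
    qed (use cd f_TS vecs_closed(2)[OF vs_TS] in auto)
    show "f (scal C r c) = scal CS r (f c)" if c: "c \<in> vecs C" for r c
    proof (rule TS_eqI)
      fix p assume p: "p \<in> functionals"
      from f_values[OF p] obtain a i where "\<forall>c\<in>vecs C. p (f c) = \<theta> a i c" by blast
      then show "p (f (scal C r c)) = p (scal CS r (f c))"
        using c by (simp add: scal_CS linear_form_basic(4)[OF vs_TS functionals_linear[OF p]] f_TS K.A_app(4)[OF \<theta>A])
    qed (use c f_TS vecs_closed(4)[OF vs_TS] in \<open>auto simp: scal_CS\<close>)
  qed
  have dprod1: "dprod (a # replicate k e) = a" if "a \<in> V" for a k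
    using that by (simp add: dprod_replicate \<alpha>_one)
  have inj: "inj_on f (vecs C)"
  proof (rule inj_onI)
    fix c d assume cd: "c \<in> vecs C" "d \<in> vecs C" "f c = f d"
    have "\<theta> a i c = \<theta> a i d" if a: "a \<in> V" for a i
    proof (cases i)
      case 0
      then show ?thesis using f0[OF a] cd(3) by metis
    next
      case (Suc k)
      have "prn (a # replicate k e) (f c) = prn (a # replicate k e) (f d)" using cd(3) by simp
      moreover have "set (a # replicate k e) \<subseteq> V" using a by auto
      ultimately show ?thesis using fn[of "a # replicate k e"] Suc dprod1[OF a, of k] by (simp del: dprod.simps)
    qed
    then have "\<theta> a i (c - d) = 0" if "a \<in> V" for a i
      using that cd by (simp add: K.A_app(3)[OF \<theta>A])
    then have "c - d = 0" using cd by (intro \<theta>_sep) auto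
    then show "c = d" by simp
  qed
  have surj: "\<exists>c\<in>vecs C. f c = x" if x: "x \<in> vecs CS" for x
  proof -
    obtain g t where gt: "x = (g, t)" by (cases x)
    note xv = x[unfolded gt vecs_CS]
    have xT: "x \<in> vecs TS" using x CS_subset by blast
    note xv' = xT[unfolded gt vecs_TS]
    \<comment> \<open>By \<open>cotensor_reduce\<close> the component of degree i is determined by
      its values on the words a, e, ..., e with i - 1 letters \<open>e\<close>; these values form a
      functional of a.\<close>
    define \<psi>' where "\<psi>' i a = (if i = 0 then g a else t i (pf (a # replicate (i - 1) e)))" for i a
    have lin: "linear_map VS ground (\<psi>' i)" for i
    proof (cases i)
      case 0
      then have "\<psi>' i = g" by (simp add: \<psi>'_def fun_eq_iff)
      then show ?thesis using xv N0_linear[of g] by simp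
    next
      case (Suc k)
      then have "t i \<in> vecs (tpow NN (Suc (length (replicate k e))))" using xv' by auto
      from slot_linear[OF this] show ?thesis using Suc by (simp add: \<psi>'_def[abs_def] del: pev.simps)
    qed
    obtain N where N: "\<And>k. t k \<noteq> 0 \<Longrightarrow> k < N" using xv finite_nat_set_iff_bounded by auto
    have "\<psi>' i a = 0" if "i \<ge> Suc N" "a \<in> V" for i a
    proof -
      have "t i = 0" using N[of i] that(1) by auto
      then show ?thesis using that(1) by (simp add: \<psi>'_def del: pev.simps)
    qed
    then obtain c where c: "c \<in> vecs C" "\<And>a i. a \<in> V \<Longrightarrow> \<theta> a i c = \<psi>' i a"
      using \<theta>_surj[of \<psi>' "Suc N", OF lin] by blast
    have "f c = x"
    proof (rule TS_eqI[OF f_TS[OF c(1)] xT])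
      fix p assume "p \<in> functionals"
      then consider a where "a \<in> V" "p = pr0 a" | ds where "ds \<noteq> []" "set ds \<subseteq> V" "p = prn ds"
        by (auto simp: functionals_def)
      then show "p (f c) = p x"
      proof cases
        case 1
        then show ?thesis using c(2)[of a 0] f0 by (simp add: \<psi>'_def pr0_def gt)
      next
        case 2
        obtain d es where ds: "ds = d # es" using 2(1) by (cases ds) auto
        have V: "d \<in> V" "set es \<subseteq> V" using 2(2) ds by auto
        have "t (length ds) \<in> vecs (cotensor_pow CC NN (length ds))" using xv 2(1) by (cases ds) auto
        from cotensor_reduce[OF this, of "[]" es d] V
        have "t (length ds) (pf ds) = t (length ds) (pf (dprod ds # replicate (length es) e))"
          by (simp add: ds del: pev.simps)
        then show ?thesis
          using c(2)[of "dprod ds" "length ds"] fn[OF 2(1,2)] 2(3)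
          by (simp add: \<psi>'_def prn_def gt ds del: pev.simps dprod.simps) 
      qed
    qed
    with c(1) show ?thesis by blast
  qed
  have bij: "bij_betw f (vecs C) (vecs CS)"
    using inj surj f_CS unfolding bij_betw_def by blast
  \<comment> \<open>The left side is a product of two elements of the family \<theta> at
    \<open>c\<close>, and the right side is computed by \<open>ambient_values\<close>. They agree
    because concatenation of words corresponds under \<open>dprod\<close> to the multiplication rule
    \<open>\<theta>_mult\<close>.\<close>
  have f_comult: "comult C c (\<lambda>x y. p (f x) * q (f y)) = ambient_comult CC NN (f c) (\<lambda>x y. p x * q y)"
    if c: "c \<in> vecs C" and pq: "p \<in> functionals" "q \<in> functionals" for c p q
  proof -
    have cm: "comult C c (\<lambda>x y. p (f x) * q (f y)) = \<theta> (a \<odot> (\<alpha> ^^ i) b) (i + j) c"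
      if "a \<in> V" "b \<in> V" "\<forall>c. p (f c) = \<theta> a i c" "\<forall>c. q (f c) = \<theta> b j c" for a b i j
      using K.conv_apply[OF c, of "\<theta> a i" "\<theta> b j"] \<theta>_mult[OF that(1,2)] that(3,4) by simp
    consider a b where "a \<in> V" "b \<in> V" "p = pr0 a" "q = pr0 b"
      | a d ds where "a \<in> V" "d \<in> V" "set ds \<subseteq> V" "p = pr0 a" "q = prn (d # ds)"
      | b d ds where "b \<in> V" "d \<in> V" "set ds \<subseteq> V" "p = prn (ds @ [d])" "q = pr0 b"
      | ds ds' where "ds \<noteq> []" "ds' \<noteq> []" "set ds \<subseteq> V" "set ds' \<subseteq> V" "p = prn ds" "q = prn ds'"
    proof -
      have ne1: "\<exists>d es. ds = d # es \<and> d \<in> V \<and> set es \<subseteq> V" if "ds \<noteq> []" "set ds \<subseteq> V" for ds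
        using that by (cases ds) auto
      have ne2: "\<exists>d es. ds = es @ [d] \<and> d \<in> V \<and> set es \<subseteq> V" if "ds \<noteq> []" "set ds \<subseteq> V" for ds
        using that by (cases ds rule: rev_cases) auto
      have cases: "(\<exists>a\<in>V. r = pr0 a) \<or> (\<exists>ds. ds \<noteq> [] \<and> set ds \<subseteq> V \<and> r = prn ds)" if "r \<in> functionals" for r
        using that by (auto simp: functionals_def)
      show thesis
        using cases[OF pq(1)] cases[OF pq(2)]
      proof (elim disjE bexE exE conjE)
        fix a b assume "a \<in> V" "b \<in> V" "p = pr0 a" "q = pr0 b"
        then show thesis by (rule that(1))
      next
        fix a ds assume *: "a \<in> V" "p = pr0 a" "ds \<noteq> []" "set ds \<subseteq> V" "q = prn ds"
        then show thesis using ne1[of ds] that(2)[of a] by auto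
      next
        fix b ds assume *: "b \<in> V" "q = pr0 b" "ds \<noteq> []" "set ds \<subseteq> V" "p = prn ds"
        then show thesis using ne2[of ds] that(3)[of b] by auto
      next
        fix ds ds' assume "ds \<noteq> []" "set ds \<subseteq> V" "p = prn ds" "ds' \<noteq> []" "set ds' \<subseteq> V" "q = prn ds'"
        then show thesis using that(4) by blast
      qed
    qed
    then show ?thesis
    proof cases
      case 1
      then show ?thesis
        using cm[of a b 0 0] ambient_values(1)[OF f_TS[OF c], of a b] f0 by simp
    next
      case 2
      have "dprod ((a \<odot> d) # ds) = a \<odot> dprod (d # ds)" by (simp add: m_assoc)
      then show ?thesis
        using 2 cm[of a "dprod (d # ds)" 0 "length (d # ds)"] ambient_values(2)[OF f_TS[OF c], of a d ds]
          f0 fn[of "d # ds"] fn[of "(a \<odot> d) # ds"] by (simp del: dprod.simps)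
    next
      case 3
      have "dprod (ds @ [d \<odot> \<alpha> b]) = dprod (ds @ [d]) \<odot> (\<alpha> ^^ length (ds @ [d])) b"
        using 3 by (simp add: dprod_append \<alpha>_one \<alpha>_pow_mult m_assoc funpow_swap1)
      then show ?thesis
        using 3 cm[of "dprod (ds @ [d])" b "length (ds @ [d])" 0] ambient_values(3)[OF f_TS[OF c], of b d ds]
          f0 fn[of "ds @ [d]"] fn[of "ds @ [d \<odot> \<alpha> b]"] by (simp del: dprod.simps)
    next
      case 4
      then show ?thesis
        using cm[of "dprod ds" "dprod ds'" "length ds" "length ds'"] fn[of ds] fn[of ds'] fn[of "ds @ ds'"]
          ambient_values(4)[OF f_TS[OF c], of ds ds'] dprod_append[of ds ds'] by simp
    qed
  qed
  have id_linear: "linear_map CS TS id"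
    using CS_subset by (auto simp: linear_map_def scal_CS)
  have comult: "comult (DC Dalg \<alpha>) (f c) = tmap CS CS f f (comult C c)" if c: "c \<in> vecs C" for c
  proof -
    let ?T = "tmap CS CS f f (comult C c)"
    have T: "?T \<in> vecs (tensor CS CS)" by (rule tmap_mem[OF f_linear f_linear K.comult_mem[OF c]])
    have bilT: "bilinear_map TS TS ground (\<lambda>x y. p x * q y)" "bilinear_map CS CS ground (\<lambda>x y. p x * q y)"
      if "p \<in> functionals" "q \<in> functionals" for p q
      using that by (intro bilinear_form_mult functionals_linear functionals_linear_CS; simp)+
    have "tmap TS TS id id ?T = ambient_comult CC NN (f c)"
    proof (rule tensor_TS_eqI)
      show "tmap TS TS id id ?T \<in> vecs (tensor TS TS)" by (rule tmap_mem[OF id_linear id_linear T])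
      show "ambient_comult CC NN (f c) \<in> vecs (tensor TS TS)" by (rule ambient_mem[OF f_TS[OF c]])
      show "tmap TS TS id id ?T (\<lambda>x y. p x * q y) = ambient_comult CC NN (f c) (\<lambda>x y. p x * q y)"
        if "p \<in> functionals" "q \<in> functionals" for p q
        using f_comult[OF c that] by (simp add: tmap_apply bilT[OF that])
    qed
    moreover have "u = ?T" if u: "u \<in> vecs (tensor CS CS)" "tmap TS TS id id u = ambient_comult CC NN (f c)" for u
    proof (rule tensor_CS_eqI[OF u(1) T])
      fix p q assume pq: "p \<in> functionals" "q \<in> functionals"
      have "tmap TS TS id id u (\<lambda>x y. p x * q y) = tmap TS TS id id ?T (\<lambda>x y. p x * q y)"
        using u(2) calculation by simp
      then show "u (\<lambda>x y. p x * q y) = ?T (\<lambda>x y. p x * q y)"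
        by (simp add: tmap_apply[OF bilT(1)[OF pq]])
    qed
    ultimately have "(THE u. u \<in> vecs (tensor CS CS) \<and> tmap TS TS id id u = ambient_comult CC NN (f c)) = ?T"
      using T by (intro the_equality) blast+
    then show ?thesis by (simp add: DC_def cotensor_coalgebra_def flip: CC_def NN_def)
  qed
  have DC_simps: "scal (DC Dalg \<alpha>) = scal CS" "vecs (DC Dalg \<alpha>) = vecs CS"
    "counit (DC Dalg \<alpha>) = (\<lambda>(c, t). counit CC c)"
    by (simp_all add: DC_def cotensor_coalgebra_def flip: CC_def NN_def)
  have "coalgebra_iso C (DC Dalg \<alpha>) f"
    unfolding coalgebra_iso_def
  proof (intro conjI ballI)
    show "linear_map C (DC Dalg \<alpha>) f" using f_linear by (simp add: linear_map_def DC_simps)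
    show "bij_betw f (vecs C) (vecs (DC Dalg \<alpha>))" using bij by (simp add: DC_simps)
    fix c assume c: "c \<in> vecs C"
    have "tmap (DC Dalg \<alpha>) (DC Dalg \<alpha>) f f = tmap CS CS f f"
      unfolding tmap_def by (subst tens_cong_spaces[of _ CS _ CS]) (simp_all add: DC_simps)
    then show "comult (DC Dalg \<alpha>) (f c) = tmap (DC Dalg \<alpha>) (DC Dalg \<alpha>) f f (comult C c)"
      using comult[OF c] by simp
    show "counit (DC Dalg \<alpha>) (f c) = counit C c"
      using c by (simp add: DC_simps f_def CC_simps \<theta>_one K.eps_def)
  qed
  then show ?thesis by (auto simp: coalgebra_isomorphic_def)
qed

lemma Dalg_division: "division_algebra Dalg" "finite_dim Dalg" "\<alpha> \<in> algebra_aut Dalg"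
proof -
  have "is_vspace Dalg" using vs_VS is_vspace_cong[of Dalg VS] by (simp add: Dalg_def)
  then show "division_algebra Dalg"
    using m_inverse e_nonzero
    by (auto simp: division_algebra_def is_algebra_def Dalg_def bilinear_map_def linear_map_def
        m_add_left m_add_right m_scale_left m_scale_right m_assoc)
  show "finite_dim Dalg" using finite_dim_coord[of n, where 'k = 'a] by (simp add: finite_dim_def Dalg_def)
  show "\<alpha> \<in> algebra_aut Dalg"
    using \<alpha>_linear \<alpha>_bij \<alpha>_one \<alpha>_mult by (simp add: algebra_aut_def Dalg_def linear_map_def)
qed

end

text \<open>The dimension of \<open>D\<close> depends on \<open>C\<close>, so the algebra is placed
  on the first \<open>rank\<close> coordinates of functions on the naturals, where
  \<open>rank\<close> is the dimension of \<open>M\<close>.\<close>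

theorem corollary5p7:
  fixes C :: "('k::field, 'c::ab_group_add) coalgebra"
  assumes "perfect_field TYPE('k)"
    and "chain_coalgebra C"
    and "\<not> finite_dim C"
  shows "\<exists>(D :: ('k, nat \<Rightarrow> 'k) algebra) \<alpha>.
           division_algebra D \<and> finite_dim D \<and> \<alpha> \<in> algebra_aut D \<and>
           coalgebra_isomorphic C (DC D \<alpha>)"
proof -
  interpret chain_coalg C
    using assms(2,3) by unfold_locales (auto simp: chain_coalgebra_def)
  obtain M x where "uniformized C M x" by (rule uniformizer_exists)
  then interpret U: uniformized C M x .
  obtain \<alpha> \<theta> where
    \<alpha>: "linear_map \<lparr>scal = pscale, vecs = U.V\<rparr> \<lparr>scal = pscale, vecs = U.V\<rparr> \<alpha>"
    "bij_betw \<alpha> U.V U.V" "\<alpha> U.de = U.de"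
    "\<And>a b. a \<in> U.V \<Longrightarrow> b \<in> U.V \<Longrightarrow> \<alpha> (U.dmult a b) = U.dmult (\<alpha> a) (\<alpha> b)"
    and \<theta>: "\<And>a i. \<theta> a i \<in> A" "\<And>a b i. \<theta> (a + b) i = \<theta> a i + \<theta> b i"
    "\<And>r a i. \<theta> (pscale r a) i = pscale r (\<theta> a i)"
    "\<And>a b i j. a \<in> U.V \<Longrightarrow> b \<in> U.V \<Longrightarrow> conv (\<theta> a i) (\<theta> b j) = \<theta> (U.dmult a ((\<alpha> ^^ i) b)) (i + j)"
    "\<theta> U.de 0 = eps"
    "\<And>c. c \<in> vecs C \<Longrightarrow> \<exists>N. \<forall>i\<ge>N. \<forall>a\<in>U.V. \<theta> a i c = 0"
    "\<And>c. c \<in> vecs C \<Longrightarrow> (\<And>a i. a \<in> U.V \<Longrightarrow> \<theta> a i c = 0) \<Longrightarrow> c = 0"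
    "\<And>\<psi> N. (\<And>i. linear_map \<lparr>scal = pscale, vecs = U.V\<rparr> ground (\<psi> i)) \<Longrightarrow>
      (\<And>i a. i \<ge> N \<Longrightarrow> a \<in> U.V \<Longrightarrow> \<psi> i a = 0) \<Longrightarrow> \<exists>c\<in>vecs C. \<forall>a\<in>U.V. \<forall>i. \<theta> a i c = \<psi> i a"
    apply (rule U.skew_power_series[OF assms(1)])
    subgoal premises prems for \<alpha> \<theta> by (rule that[of \<alpha> \<theta>]) (fact prems)+
    done
  interpret T: twisted_division U.rank U.dmult U.de \<alpha>
    by unfold_locales (fact \<alpha>)+
  have "coalgebra_isomorphic C (DC T.Dalg \<alpha>)"
    by (rule T.skew_dual_isomorphic[OF coalgebra, of \<theta>]) (fact \<theta>)+
  then show ?thesis using T.Dalg_division by blast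
qed

end
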